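(* Let $q=p^r$ be a power of a prime $p$ with $r\ge 1$, let $n\ge 1$, let $V=\mathbb F_q^n$ be the natural $GL_n(q)$-module, and let $\mathrm{St}$ be the Steinberg module of $GL_n(q)$ over $\mathbb F_q$. (1) The bi-graded multiplicity of $\mathrm{St}$ in $S^\bullet(V)\otimes\wedge^\bullet(V)$ is $$H_{\mathrm{St}}\big(S^\bullet(V)\otimes\wedge^\bullet(V);t,s\big)=t^{-n}\cdot\frac{(st^{q^n-1}+t^{q^{n-1}})\prod_{i=0}^{n-2}(s+t^{q^i})}{\prod_{i=1}^n(1-t^{q^i-1})}.$$ (2) For every integer $k$ with $1\le k\le q-2$, the bi-graded multiplicity of $\mathrm{St}$ in $S^\bullet(V)\otimes\wedge^\bullet(V)\otimes\mathrm{Det}^k$ is $$H_{\mathrm{St}}\big(S^\bullet(V)\otimes\wedge^\bullet(V)\otimes\mathrm{Det}^k;t,s\big)=t^{-n+(q-1-k)\frac{q^n-1}{q-1}}\cdot\frac{\prod_{i=0}^{n-1}(s+t^{q^i})}{\prod_{i=1}^n(1-t^{q^i-1})}.$$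
   Context: $GL_n(q)$ acts naturally on the symmetric algebra $S^\bullet(V)$ and the exterior algebra $\wedge^\bullet(V)$ of $V$ (over $\mathbb F_q$), and diagonally on tensor products. $\mathrm{Det}$ is the one-dimensional $GL_n(q)$-module over $\mathbb F_q$ on which $g$ acts by $\det(g)$. The Steinberg module $\mathrm{St}$ of $GL_n(q)$ over $\mathbb F_q$ (defining characteristic) is the projective, absolutely irreducible $\mathbb F_q[GL_n(q)]$-module of dimension $q^{n(n-1)/2}$ realized as the left ideal of $\mathbb F_q[GL_n(q)]$ generated by $\big(\sum_{w\in S_n}\mathrm{sgn}(w)\,w\big)\big(\sum_{b\in B}b\big)$, where $S_n\subseteq GL_n(q)$ is the group of permutation matrices and $B$ is the group of invertible upper triangular matrices. For a bi-graded $GL_n(q)$-module $N^\bullet=\bigoplus_{i,j}N^{i,j}$, the bi-graded multiplicity of $\mathrm{St}$ is $H_{\mathrm{St}}(N^\bullet;t,s)=\sum_{i,j}t^is^j\dim_{\mathbb F_q}\mathrm{Hom}_{GL_n(q)}(\mathrm{St},N^{i,j})$ (this counts composition multiplicities, since $\mathrm{St}$ is projective and absolutely irreducible). Here the $(i,j)$ component of $S^\bullet(V)\otimes\wedge^\bullet(V)\otimes\mathrm{Det}^k$ is $S^i(V)\otimes\wedge^j(V)\otimes\mathrm{Det}^k$. An empty product equals $1$. *)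

theory Defs
  imports
    "Jordan_Normal_Form.Determinant"
    "HOL-Library.Cardinality"
    "HOL-Library.Poly_Mapping"
    "HOL-Library.Function_Algebras"
    "HOL-Computational_Algebra.Formal_Laurent_Series"
begin

section \<open>Vector spaces with a chosen basis\<close>

text \<open>
  The type \<open>'b \<Rightarrow>\<^sub>0 'k\<close> of finitely supported functions is the free \<open>'k\<close>-vector space
  on the basis \<open>single b 1\<close>, for \<open>b :: 'b\<close>.
\<close>

definition pm_scale :: "'k::field \<Rightarrow> ('b \<Rightarrow>\<^sub>0 'k) \<Rightarrow> ('b \<Rightarrow>\<^sub>0 'k)" where
  "pm_scale c x = Poly_Mapping.map ((*) c) x"

lemma lookup_pm_scale: "Poly_Mapping.lookup (pm_scale c x) b = c * Poly_Mapping.lookup x b"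
  by (simp add: pm_scale_def Poly_Mapping.map.rep_eq when_def)

lemma vector_space_pm_scale: "vector_space (pm_scale :: 'k::field \<Rightarrow> ('b \<Rightarrow>\<^sub>0 'k) \<Rightarrow> _)"
  by standard (auto intro!: poly_mapping_eqI simp: lookup_pm_scale lookup_add algebra_simps)

definition fun_scale :: "'k::field \<Rightarrow> ('x \<Rightarrow> ('b \<Rightarrow>\<^sub>0 'k)) \<Rightarrow> ('x \<Rightarrow> ('b \<Rightarrow>\<^sub>0 'k))" where
  "fun_scale c \<phi> = (\<lambda>x. pm_scale c (\<phi> x))"

lemma vector_space_fun_scale:
  "vector_space (fun_scale :: 'k::field \<Rightarrow> ('x \<Rightarrow> ('b \<Rightarrow>\<^sub>0 'k)) \<Rightarrow> _)"
  by standard (auto intro!: ext poly_mapping_eqI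
      simp: fun_scale_def lookup_pm_scale lookup_add algebra_simps)

text \<open>The linear map with prescribed values on the basis.\<close>

definition lin_ext :: "('b \<Rightarrow> ('c \<Rightarrow>\<^sub>0 'k::field)) \<Rightarrow> ('b \<Rightarrow>\<^sub>0 'k) \<Rightarrow> ('c \<Rightarrow>\<^sub>0 'k)" where
  "lin_ext f x = (\<Sum>b\<in>Poly_Mapping.keys x. pm_scale (Poly_Mapping.lookup x b) (f b))"

section \<open>The general linear group and its Steinberg module\<close>

definition GL :: "nat \<Rightarrow> 'k::field mat set" where
  "GL n = {g \<in> carrier_mat n n. invertible_mat g}"

definition Borel :: "nat \<Rightarrow> 'k::field mat set" where
  "Borel n = {b \<in> GL n. upper_triangular b}"

text \<open>The matrix sending the \<open>j\<close>-th basis vector to the \<open>w j\<close>-th one.\<close>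

definition perm_mat :: "nat \<Rightarrow> (nat \<Rightarrow> nat) \<Rightarrow> 'k::field mat" where
  "perm_mat n w = mat n n (\<lambda>(i, j). if i = w j then 1 else 0)"

text \<open>
  The group algebra of \<open>GL n\<close> consists of the \<open>x :: 'k mat \<Rightarrow>\<^sub>0 'k\<close> supported on \<open>GL n\<close>.
  Its multiplication is spelled out because \<open>'k mat\<close>, which contains matrices of all sizes,
  is not a monoid.
\<close>

definition group_algebra :: "nat \<Rightarrow> ('k::field mat \<Rightarrow>\<^sub>0 'k) set" where
  "group_algebra n = {x. Poly_Mapping.keys x \<subseteq> GL n}"

definition galg_mult ::
    "('k::field mat \<Rightarrow>\<^sub>0 'k) \<Rightarrow> ('k mat \<Rightarrow>\<^sub>0 'k) \<Rightarrow> ('k mat \<Rightarrow>\<^sub>0 'k)" where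
  "galg_mult x y = lin_ext (\<lambda>g. lin_ext (\<lambda>h. Poly_Mapping.single (g * h) 1) y) x"

definition steinberg_gen :: "nat \<Rightarrow> ('k::{field,finite} mat \<Rightarrow>\<^sub>0 'k)" where
  "steinberg_gen n =
     galg_mult (\<Sum>w | w permutes {..<n}. Poly_Mapping.single (perm_mat n w) (of_int (sign w)))
               (\<Sum>b\<in>Borel n. Poly_Mapping.single b 1)"

definition steinberg :: "nat \<Rightarrow> ('k::{field,finite} mat \<Rightarrow>\<^sub>0 'k) set" where
  "steinberg n = {galg_mult x (steinberg_gen n) | x. x \<in> group_algebra n}"

definition left_act :: "'k::field mat \<Rightarrow> ('k mat \<Rightarrow>\<^sub>0 'k) \<Rightarrow> ('k mat \<Rightarrow>\<^sub>0 'k)" where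
  "left_act g x = galg_mult (Poly_Mapping.single g 1) x"

section \<open>Symmetric and exterior powers, determinant, tensor products\<close>

text \<open>
  The symmetric algebra of \<open>V = 'k\<^sup>n\<close> is the polynomial ring in the basis vectors of \<open>V\<close>,
  regarded as variables with indices \<open>0, \<dots>, n - 1\<close>; a monomial is an exponent vector
  \<open>nat \<Rightarrow>\<^sub>0 nat\<close>. The ring structure on \<open>(nat \<Rightarrow>\<^sub>0 nat) \<Rightarrow>\<^sub>0 'k\<close> is the library's
  convolution product.
\<close>

definition sym_power :: "nat \<Rightarrow> nat \<Rightarrow> ((nat \<Rightarrow>\<^sub>0 nat) \<Rightarrow>\<^sub>0 'k::field) set" where
  "sym_power n i =
     {p. \<forall>m\<in>Poly_Mapping.keys p. Poly_Mapping.keys m \<subseteq> {..<n} \<and>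
        (\<Sum>l\<in>Poly_Mapping.keys m. Poly_Mapping.lookup m l) = i}"

definition sym_col :: "'k::field mat \<Rightarrow> nat \<Rightarrow> ((nat \<Rightarrow>\<^sub>0 nat) \<Rightarrow>\<^sub>0 'k)" where
  "sym_col g i = (\<Sum>l<dim_row g. Poly_Mapping.single (Poly_Mapping.single l 1) (g $$ (l, i)))"

definition sym_act ::
    "'k::field mat \<Rightarrow> ((nat \<Rightarrow>\<^sub>0 nat) \<Rightarrow>\<^sub>0 'k) \<Rightarrow> ((nat \<Rightarrow>\<^sub>0 nat) \<Rightarrow>\<^sub>0 'k)" where
  "sym_act g = lin_ext (\<lambda>m. \<Prod>i\<in>Poly_Mapping.keys m. sym_col g i ^ Poly_Mapping.lookup m i)"

text \<open>
  The exterior algebra has the basis \<open>e\<^sub>J = e\<^bsub>j1\<^esub> \<and> \<dots> \<and> e\<^bsub>jr\<^esub>\<close> for \<open>J = {j1 < \<dots> < jr}\<close>,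
  with \<open>e\<^sub>I \<and> e\<^sub>J = 0\<close> if \<open>I\<close> and \<open>J\<close> meet, and otherwise \<open>e\<^sub>I \<and> e\<^sub>J = \<plusminus> e\<^bsub>I \<union> J\<^esub>\<close>, the sign
  counting the transpositions needed to sort the concatenation of \<open>I\<close> and \<open>J\<close>.
\<close>

definition wedge_sign :: "nat set \<Rightarrow> nat set \<Rightarrow> 'k::field" where
  "wedge_sign I J =
     (if I \<inter> J = {} then (- 1) ^ card {(i, j). i \<in> I \<and> j \<in> J \<and> j < i} else 0)"

definition wedge :: "(nat set \<Rightarrow>\<^sub>0 'k::field) \<Rightarrow> (nat set \<Rightarrow>\<^sub>0 'k) \<Rightarrow> (nat set \<Rightarrow>\<^sub>0 'k)" where
  "wedge x y = lin_ext (\<lambda>I. lin_ext (\<lambda>J. Poly_Mapping.single (I \<union> J) (wedge_sign I J)) y) x"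

definition ext_power :: "nat \<Rightarrow> nat \<Rightarrow> (nat set \<Rightarrow>\<^sub>0 'k::field) set" where
  "ext_power n j = {x. \<forall>J\<in>Poly_Mapping.keys x. J \<subseteq> {..<n} \<and> card J = j}"

definition ext_col :: "'k::field mat \<Rightarrow> nat \<Rightarrow> (nat set \<Rightarrow>\<^sub>0 'k)" where
  "ext_col g j = (\<Sum>l<dim_row g. Poly_Mapping.single {l} (g $$ (l, j)))"

definition ext_act :: "'k::field mat \<Rightarrow> (nat set \<Rightarrow>\<^sub>0 'k) \<Rightarrow> (nat set \<Rightarrow>\<^sub>0 'k)" where
  "ext_act g =
     lin_ext (\<lambda>J. foldr wedge (map (ext_col g) (sorted_list_of_set J)) (Poly_Mapping.single {} 1))"

text \<open>The one-dimensional space underlying the powers of the determinant is \<open>unit \<Rightarrow>\<^sub>0 'k\<close>.\<close>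

definition det_space :: "(unit \<Rightarrow>\<^sub>0 'k::field) set" where
  "det_space = UNIV"

definition det_act :: "nat \<Rightarrow> 'k::field mat \<Rightarrow> (unit \<Rightarrow>\<^sub>0 'k) \<Rightarrow> (unit \<Rightarrow>\<^sub>0 'k)" where
  "det_act k g = pm_scale (det g ^ k)"

text \<open>
  The tensor product of free vector spaces is free on the product of the bases. The tensor
  product of two subspaces is the span of the pure tensors in it.
\<close>

definition pm_tensor :: "('b \<Rightarrow>\<^sub>0 'k::field) \<Rightarrow> ('c \<Rightarrow>\<^sub>0 'k) \<Rightarrow> ('b \<times> 'c \<Rightarrow>\<^sub>0 'k)" where
  "pm_tensor x y = lin_ext (\<lambda>b. lin_ext (\<lambda>c. Poly_Mapping.single (b, c) 1) y) x"

definition tensor_space ::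
    "('b \<Rightarrow>\<^sub>0 'k::field) set \<Rightarrow> ('c \<Rightarrow>\<^sub>0 'k) set \<Rightarrow> ('b \<times> 'c \<Rightarrow>\<^sub>0 'k) set" where
  "tensor_space A B = module.span pm_scale {pm_tensor x y | x y. x \<in> A \<and> y \<in> B}"

definition tensor_act ::
    "('g \<Rightarrow> ('b \<Rightarrow>\<^sub>0 'k::field) \<Rightarrow> ('b \<Rightarrow>\<^sub>0 'k)) \<Rightarrow> ('g \<Rightarrow> ('c \<Rightarrow>\<^sub>0 'k) \<Rightarrow> ('c \<Rightarrow>\<^sub>0 'k)) \<Rightarrow>
     'g \<Rightarrow> ('b \<times> 'c \<Rightarrow>\<^sub>0 'k) \<Rightarrow> ('b \<times> 'c \<Rightarrow>\<^sub>0 'k)" where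
  "tensor_act \<rho> \<sigma> g =
     lin_ext (\<lambda>(b, c). pm_tensor (\<rho> g (Poly_Mapping.single b 1))
                               (\<sigma> g (Poly_Mapping.single c 1)))"

section \<open>Bigraded multiplicity of the Steinberg module\<close>

text \<open>
  Equivariant linear maps \<open>M \<rightarrow> N\<close>; they are normalised to vanish outside \<open>M\<close>, so that each
  map on \<open>M\<close> is counted once.
\<close>

definition Hom_set ::
    "'g set \<Rightarrow> ('b \<Rightarrow>\<^sub>0 'k::field) set \<Rightarrow> ('g \<Rightarrow> ('b \<Rightarrow>\<^sub>0 'k) \<Rightarrow> ('b \<Rightarrow>\<^sub>0 'k)) \<Rightarrow>
     ('c \<Rightarrow>\<^sub>0 'k) set \<Rightarrow> ('g \<Rightarrow> ('c \<Rightarrow>\<^sub>0 'k) \<Rightarrow> ('c \<Rightarrow>\<^sub>0 'k)) \<Rightarrow>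
     (('b \<Rightarrow>\<^sub>0 'k) \<Rightarrow> ('c \<Rightarrow>\<^sub>0 'k)) set" where
  "Hom_set G M \<rho> N \<sigma> =
     {\<phi>. (\<forall>x\<in>M. \<phi> x \<in> N) \<and> (\<forall>x. x \<notin> M \<longrightarrow> \<phi> x = 0) \<and>
         (\<forall>x\<in>M. \<forall>y\<in>M. \<phi> (x + y) = \<phi> x + \<phi> y) \<and>
         (\<forall>c. \<forall>x\<in>M. \<phi> (pm_scale c x) = pm_scale c (\<phi> x)) \<and>
         (\<forall>g\<in>G. \<forall>x\<in>M. \<phi> (\<rho> g x) = \<sigma> g (\<phi> x))}"

definition steinberg_mult ::
    "nat \<Rightarrow> ('c \<Rightarrow>\<^sub>0 'k::{field,finite}) set \<Rightarrow>
     ('k mat \<Rightarrow> ('c \<Rightarrow>\<^sub>0 'k) \<Rightarrow> ('c \<Rightarrow>\<^sub>0 'k)) \<Rightarrow> nat" where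
  "steinberg_mult n N \<sigma> =
     vector_space.dim fun_scale (Hom_set (GL n) (steinberg n) left_act N \<sigma>)"

text \<open>
  Multiplicity series live in the ring of power series in \<open>s\<close> over the field of
  Laurent series in \<open>t\<close>, so that negative powers of \<open>t\<close> make sense.
\<close>

abbreviation tvar :: "rat fls fps" where "tvar \<equiv> fps_const fls_X"
abbreviation svar :: "rat fls fps" where "svar \<equiv> fps_X"

definition H_St ::
    "nat \<Rightarrow> (nat \<Rightarrow> nat \<Rightarrow> ('c \<Rightarrow>\<^sub>0 'k::{field,finite}) set) \<Rightarrow>
     ('k mat \<Rightarrow> ('c \<Rightarrow>\<^sub>0 'k) \<Rightarrow> ('c \<Rightarrow>\<^sub>0 'k)) \<Rightarrow> rat fls fps" where
  "H_St n N \<sigma> =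
     Abs_fps (\<lambda>j. fps_to_fls (Abs_fps (\<lambda>i. of_nat (steinberg_mult n (N i j) \<sigma>))))"

definition sym_ext_space :: "nat \<Rightarrow> nat \<Rightarrow> nat \<Rightarrow> ((nat \<Rightarrow>\<^sub>0 nat) \<times> nat set \<Rightarrow>\<^sub>0 'k::field) set" where
  "sym_ext_space n i j = tensor_space (sym_power n i) (ext_power n j)"

definition sym_ext_act ::
    "'k::field mat \<Rightarrow> ((nat \<Rightarrow>\<^sub>0 nat) \<times> nat set \<Rightarrow>\<^sub>0 'k) \<Rightarrow> ((nat \<Rightarrow>\<^sub>0 nat) \<times> nat set \<Rightarrow>\<^sub>0 'k)" where
  "sym_ext_act = tensor_act sym_act ext_act"

end

theory Submission
  imports Defs
begin

text \<open>
  Since St is generated by the signed sum over \<open>S\<^sub>n\<close> times the sum over \<open>B\<close>, the space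
  \<open>Hom(St, N)\<close> is isomorphic to the space \<open>K(N)\<close> of all \<open>B\<close>-invariant \<open>v\<close> with \<open>\<tau>\<^sub>i v = - v\<close> for the
  operators \<open>\<tau>\<^sub>i = \<Sum>\<^sub>c x\<^sub>i(c) s\<^sub>i\<close>; its dimension is read off from its cardinality.

  Elements of \<open>S \<otimes> \<Lambda>\<close> are forms with polynomial coefficients. Contraction with the covectors
  \<open>(x\<^sub>l^(q^m))\<^sub>l\<close>, \<open>m < n\<close>, is equivariant, and the iterated contractions \<open>D\<^sub>J\<close> with \<open>J \<subseteq> {0..n-1}\<close>,
  \<open>|J| = j\<close>, are jointly injective on forms of degree \<open>j\<close>, because the Moore determinant \<open>L\<close> of these covectors
  is nonzero. Here \<open>g L = det g L\<close>, and \<open>L\<close> is the product of all lines \<open>x\<^sub>i + \<Sum>\<^bsub>l<i\<^esub> u\<^sub>l x\<^sub>l\<close>, so a form in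
  \<open>K\<close> that is divisible by \<open>x\<^bsub>n-1\<^esub>\<close> is divisible by \<open>L\<close>, with quotient in the \<open>K\<close> of the next power of
  Det. It follows that \<open>D\<close> maps \<open>K\<close> of the forms bijectively, up to a triangular change, onto the product over \<open>J\<close>
  of the polynomial spaces \<open>K\<close> if \<open>n - 1 \<notin> J\<close>, and of their subspaces of multiples of \<open>x\<^bsub>n-1\<^esub>\<close>
  if \<open>n - 1 \<in> J\<close>.

  For polynomials, twisting by \<open>Det^k\<close> with \<open>1 \<le> k \<le> q - 2\<close> forces divisibility by \<open>x\<^bsub>n-1\<^esub>\<close> (by the
  diagonal torus), while for \<open>k = 0\<close> restriction to \<open>x\<^bsub>n-1\<^esub> = 0\<close> leads to the multiples of
  \<open>x\<^bsub>n-2\<^esub>\<close> in \<open>n - 1\<close> variables. This determines the Hilbert series by induction on \<open>n\<close>.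
\<close>

section \<open>Linear algebra on free vector spaces\<close>

text \<open>For n >= 2 the characteristic divides the order of \<open>Borel n\<close>, so averaging
  is impossible. The space \<open>K\<close> is cut out by equations instead, and its link with
  Hom(St, N) rests on the Borel sum and the signed permutation sum composing to a sign on
  \<open>K\<close>. Counting over a finite field has a further benefit: the bijection onto the
  product over J may use preimages picked by choice, which need not depend linearly on the data. The
  natural inverse of the contractions is h * beta J / L. The obstacle is that the Moore matrix is
  singular where the last variable vanishes: there its last row is a combination of the earlier
  rows, with Dickson invariants of n - 1 variables as coefficients. These are invariant under n - 1
  variables only, so multiplying by them need not preserve \<open>K\<close>, and an element of
  \<open>K\<close> with the same restriction has to be lifted. The exponents arise as follows. D_J
  raises degrees by the sum of q^m over J, which produces the factors s + t^(q^i). L has degree (q^n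
  - 1)/(q - 1) and character det, so in the untwisted \<open>K\<close> the multiples of the last
  variable are L^(q-1) times \<open>K\<close>, a shift by q^n - 1.\<close>

interpretation pm: vector_space "pm_scale :: 'k::field \<Rightarrow> ('b \<Rightarrow>\<^sub>0 'k) \<Rightarrow> _"
  by (rule vector_space_pm_scale)

interpretation fs: vector_space "fun_scale :: 'k::field \<Rightarrow> ('x \<Rightarrow> ('b \<Rightarrow>\<^sub>0 'k)) \<Rightarrow> _"
  by (rule vector_space_fun_scale)

text \<open>Coordinates in a basis identify the subspace with the functions on that basis.\<close>

lemma (in vector_space) card_subspace:
  assumes V: "subspace V" "finite V" and fin: "finite (UNIV :: 'a set)"
  shows "card V = CARD('a) ^ dim V"
proof -
  obtain B where B: "B \<subseteq> V" "independent B" "V \<subseteq> span B" "card B = dim V"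
    using basis_exists by blast
  have fB: "finite B" using B(1) V(2) finite_subset by blast
  have sp: "span B = V" using B V(1) span_minimal by blast
  define f where "f = (\<lambda>u. \<Sum>b\<in>B. scale (u b) b)"
  have im: "f ` (B \<rightarrow>\<^sub>E UNIV) = V"
  proof -
    have "f u \<in> f ` (B \<rightarrow>\<^sub>E UNIV)" for u
    proof -
      have "f u = f (restrict u B)" unfolding f_def by (intro sum.cong) auto
      then show ?thesis by auto
    qed
    then have "range f \<subseteq> f ` (B \<rightarrow>\<^sub>E UNIV)" by auto
    moreover have "range f = V" using span_finite[OF fB] sp unfolding f_def by simp
    ultimately show ?thesis by auto
  qed
  have inj: "inj_on f (B \<rightarrow>\<^sub>E UNIV)"
  proof (rule inj_onI)
    fix u v assume u: "u \<in> B \<rightarrow>\<^sub>E UNIV" and v: "v \<in> B \<rightarrow>\<^sub>E UNIV" and eq: "f u = f v"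
    have 0: "(\<Sum>b\<in>B. scale (u b - v b) b) = 0"
      using eq unfolding f_def scale_left_diff_distrib sum_subtractf by simp
    have uv: "u b = v b" if "b \<in> B" for b
      using independentD[OF B(2) fB order_refl 0 that] by simp
    show "u = v"
    proof
      fix b show "u b = v b"
        using uv PiE_arb[OF u] PiE_arb[OF v] by (cases "b \<in> B") simp_all
    qed
  qed
  have "card V = card (B \<rightarrow>\<^sub>E (UNIV :: 'a set))" using card_image[OF inj] im by simp
  also have "\<dots> = CARD('a) ^ card B" using fB by (simp add: card_PiE)
  finally show ?thesis using B(4) by simp
qed

text \<open>Translation by 1 permutes the field, so the sum of all elements absorbs q copies of 1.
  Consequently q equal vectors add up to 0, the source of many cancellations below.\<close>

lemma of_nat_card_field: "of_nat (CARD('k)) = (0 :: 'k::{field,finite})"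
proof -
  have "(\<Sum>x\<in>UNIV. x) = (\<Sum>x\<in>UNIV. x + (1::'k))"
    by (rule sum.reindex_bij_witness[of _ "\<lambda>x. x + 1" "\<lambda>x. x - 1"]) auto
  also have "\<dots> = (\<Sum>x\<in>UNIV. x) + of_nat (CARD('k))" by (simp add: sum.distrib)
  finally show ?thesis by simp
qed

lemma of_nat_card_field_minus_1: "of_nat (CARD('k) - 1) = (-1 :: 'k::{field,finite})"
proof -
  have "CARD('k) \<ge> 1" by (simp add: Suc_leI)
  then show ?thesis using of_nat_card_field[where 'k='k] by (simp add: of_nat_diff)
qed

text \<open>Two-element orbits cancel. In characteristic 2 antisymmetry says nothing at a fixed
  point, hence the separate last assumption.\<close>

lemma sum_antisym_involution:
  fixes f :: "'a \<Rightarrow> 'b::ab_group_add"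
  assumes "finite S" and "\<And>x. x \<in> S \<Longrightarrow> \<sigma> x \<in> S" and "\<And>x. x \<in> S \<Longrightarrow> \<sigma> (\<sigma> x) = x"
    and "\<And>x. x \<in> S \<Longrightarrow> f (\<sigma> x) = - f x" and "\<And>x. x \<in> S \<Longrightarrow> \<sigma> x = x \<Longrightarrow> f x = 0"
  shows "sum f S = 0"
  using assms
proof (induction "card S" arbitrary: S rule: less_induct)
  case less
  show ?case
  proof (cases "S = {}")
    case False
    then obtain x where x: "x \<in> S" by auto
    let ?S = "S - {x, \<sigma> x}"
    have lt: "card ?S < card S" using x less.prems(1) by (intro psubset_card_mono) auto
    have "sum f ?S = 0"
    proof (rule less.hyps[OF lt])
      fix y assume y: "y \<in> ?S"
      then show "\<sigma> y \<in> ?S" using less.prems(2,3) x by (metis Diff_iff insert_iff singletonD)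
    qed (use less.prems in auto)
    moreover have "sum f S = sum f ?S + sum f {x, \<sigma> x}"
      using less.prems(1,2) x by (metis add.commute empty_subsetI insert_subset sum.subset_diff)
    moreover have "sum f {x, \<sigma> x} = 0"
      using less.prems(4,5) x by (cases "\<sigma> x = x") (auto)
    ultimately show ?thesis by simp
  qed simp
qed

text \<open>Every module below turns out to be such a coordinate subspace, so that closure and
  equality of linear maps can be tested on basis elements.\<close>

definition basis_space :: "'b set \<Rightarrow> ('b \<Rightarrow>\<^sub>0 'k::field) set" where
  "basis_space A = {x. Poly_Mapping.keys x \<subseteq> A}"

lemma basis_space_iff: "x \<in> basis_space A \<longleftrightarrow> (\<forall>b. b \<notin> A \<longrightarrow> Poly_Mapping.lookup x b = 0)"
  by (auto simp: basis_space_def in_keys_iff)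

lemma basis_space_0[simp]: "0 \<in> basis_space A"
  by (simp add: basis_space_iff)

lemma basis_space_add: "x \<in> basis_space A \<Longrightarrow> y \<in> basis_space A \<Longrightarrow> x + y \<in> basis_space A"
  by (simp add: basis_space_iff lookup_add)

lemma basis_space_uminus: "x \<in> basis_space A \<Longrightarrow> - x \<in> basis_space A"
  by (simp add: basis_space_iff)

lemma basis_space_scale: "x \<in> basis_space A \<Longrightarrow> pm_scale c x \<in> basis_space A"
  by (simp add: basis_space_iff lookup_pm_scale)

lemma basis_space_sum: "(\<And>i. i \<in> I \<Longrightarrow> f i \<in> basis_space A) \<Longrightarrow> sum f I \<in> basis_space A"
  by (induction I rule: infinite_finite_induct) (auto intro: basis_space_add)

lemma basis_space_single: "b \<in> A \<Longrightarrow> Poly_Mapping.single b c \<in> basis_space A"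
  by (auto simp: basis_space_def)

lemma finite_basis_space:
  assumes "finite A" shows "finite (basis_space A :: ('b \<Rightarrow>\<^sub>0 'k::{field,finite}) set)"
proof -
  have inj: "inj_on (\<lambda>x. restrict (Poly_Mapping.lookup x) A) (basis_space A :: ('b \<Rightarrow>\<^sub>0 'k) set)"
  proof (rule inj_onI)
    fix x y :: "'b \<Rightarrow>\<^sub>0 'k"
    assume "x \<in> basis_space A" "y \<in> basis_space A"
      and eq: "restrict (Poly_Mapping.lookup x) A = restrict (Poly_Mapping.lookup y) A"
    then show "x = y"
      by (intro poly_mapping_eqI) (metis basis_space_iff restrict_apply')
  qed
  have "(\<lambda>x. restrict (Poly_Mapping.lookup x) A) ` (basis_space A :: ('b \<Rightarrow>\<^sub>0 'k) set) \<subseteq> A \<rightarrow>\<^sub>E UNIV"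
    by auto
  moreover have "finite (A \<rightarrow>\<^sub>E (UNIV :: 'k set))" using assms by (simp add: finite_PiE)
  ultimately show ?thesis using finite_imageD[OF _ inj] finite_subset by blast
qed

lemma pm_scale_single: "pm_scale c (Poly_Mapping.single b d) = Poly_Mapping.single b (c * d)"
  by (auto intro!: poly_mapping_eqI simp: lookup_pm_scale lookup_single when_def)

lemma pm_expand:
  assumes "finite S" "Poly_Mapping.keys x \<subseteq> S"
  shows "x = (\<Sum>b\<in>S. pm_scale (Poly_Mapping.lookup x b) (Poly_Mapping.single b 1))"
proof (rule poly_mapping_eqI)
  fix k
  have "(\<Sum>b\<in>S. Poly_Mapping.lookup x b when b = k) = Poly_Mapping.lookup x k"
    using assms by (auto simp: when_def sum.delta' in_keys_iff)
  then show "Poly_Mapping.lookup x k =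
      Poly_Mapping.lookup (\<Sum>b\<in>S. pm_scale (Poly_Mapping.lookup x b) (Poly_Mapping.single b 1)) k"
    by (simp add: lookup_sum pm_scale_single lookup_single)
qed

lemma lin_ext_superset:
  assumes "finite S" "Poly_Mapping.keys x \<subseteq> S"
  shows "lin_ext f x = (\<Sum>b\<in>S. pm_scale (Poly_Mapping.lookup x b) (f b))"
  unfolding lin_ext_def using assms
  by (intro sum.mono_neutral_left) (auto simp: in_keys_iff)

definition pm_linear :: "(('b \<Rightarrow>\<^sub>0 'k::field) \<Rightarrow> ('c \<Rightarrow>\<^sub>0 'k)) \<Rightarrow> bool" where
  "pm_linear T \<longleftrightarrow> (\<forall>x y. T (x + y) = T x + T y) \<and> (\<forall>c x. T (pm_scale c x) = pm_scale c (T x))"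

lemma pm_linear_add: "pm_linear T \<Longrightarrow> T (x + y) = T x + T y"
  and pm_linear_scale: "pm_linear T \<Longrightarrow> T (pm_scale c x) = pm_scale c (T x)"
  by (auto simp: pm_linear_def)

lemma pm_linear_0: "pm_linear T \<Longrightarrow> T 0 = 0"
  using pm_linear_scale[of T 0 0] by simp

lemma pm_linear_uminus: "pm_linear T \<Longrightarrow> T (- x) = - T x"
  using pm_linear_scale[of T "-1" x] by simp

lemma pm_linear_sum: "pm_linear T \<Longrightarrow> T (sum f I) = (\<Sum>i\<in>I. T (f i))"
  by (induction I rule: infinite_finite_induct) (auto simp: pm_linear_0 pm_linear_add)

lemma pm_linear_lin_ext: "pm_linear (lin_ext f)"
  unfolding pm_linear_def
proof (intro conjI allI)
  fix x y :: "'a \<Rightarrow>\<^sub>0 'b" and c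
  let ?S = "Poly_Mapping.keys x \<union> Poly_Mapping.keys y"
  have k: "Poly_Mapping.keys (x + y) \<subseteq> ?S" by (rule keys_add)
  show "lin_ext f (x + y) = lin_ext f x + lin_ext f y"
    by (subst (1 2 3) lin_ext_superset[of ?S]) (auto simp: k[simplified] lookup_add pm.scale_left_distrib sum.distrib
        dest: subsetD[OF k])
  have "Poly_Mapping.keys (pm_scale c x) \<subseteq> Poly_Mapping.keys x"
    by (auto simp: in_keys_iff lookup_pm_scale)
  then show "lin_ext f (pm_scale c x) = pm_scale c (lin_ext f x)"
    by (subst (1 2) lin_ext_superset[of "Poly_Mapping.keys x"])
      (auto simp: lookup_pm_scale pm.scale_sum_right)
qed

lemma lin_ext_single: "lin_ext f (Poly_Mapping.single b c) = pm_scale c (f b)"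
  by (subst lin_ext_superset[of "{b}"]) auto

lemma lin_ext_basis [simp]: "lin_ext f (Poly_Mapping.single b 1) = f b"
  by (simp add: lin_ext_single)

lemma pm_linear_eqI:
  assumes S: "pm_linear S" and T: "pm_linear T"
    and eq: "\<And>b. b \<in> A \<Longrightarrow> S (Poly_Mapping.single b 1) = T (Poly_Mapping.single b 1)"
    and x: "x \<in> basis_space A"
  shows "S x = T x"
proof -
  have k: "Poly_Mapping.keys x \<subseteq> A" using x by (simp add: basis_space_def)
  let ?e = "\<lambda>b. pm_scale (Poly_Mapping.lookup x b) (Poly_Mapping.single b 1)"
  have x: "x = (\<Sum>b\<in>Poly_Mapping.keys x. ?e b)" by (rule pm_expand) auto
  have "S x = (\<Sum>b\<in>Poly_Mapping.keys x. S (?e b))" by (subst (1) x) (rule pm_linear_sum[OF S])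
  also have "\<dots> = (\<Sum>b\<in>Poly_Mapping.keys x. T (?e b))"
    using k eq by (intro sum.cong) (auto simp: pm_linear_scale[OF S] pm_linear_scale[OF T])
  also have "\<dots> = T x" by (subst (3) x) (rule pm_linear_sum[OF T, symmetric])
  finally show ?thesis .
qed

lemma pm_linear_comp: "pm_linear S \<Longrightarrow> pm_linear T \<Longrightarrow> pm_linear (\<lambda>x. S (T x))"
  by (auto simp: pm_linear_def)

lemma pm_linear_closed:
  assumes T: "pm_linear T" and cl: "\<And>b. b \<in> A \<Longrightarrow> T (Poly_Mapping.single b 1) \<in> basis_space C"
    and x: "x \<in> basis_space A"
  shows "T x \<in> basis_space C"
proof -
  have k: "Poly_Mapping.keys x \<subseteq> A" using x by (simp add: basis_space_def)
  have "T x = (\<Sum>b\<in>Poly_Mapping.keys x. pm_scale (Poly_Mapping.lookup x b) (T (Poly_Mapping.single b 1)))"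
    by (subst pm_expand[of "Poly_Mapping.keys x" x]) (auto simp: pm_linear_sum[OF T] pm_linear_scale[OF T])
  also have "\<dots> \<in> basis_space C" using k cl by (intro basis_space_sum basis_space_scale) auto
  finally show ?thesis .
qed

section \<open>Entrywise calculations with GL, the Borel subgroup, elementary and permutation
  matrices\<close>

lemma sum_if_two:
  fixes f :: "'a \<Rightarrow> 'b::comm_ring_1"
  assumes "finite S" "i \<in> S" "j \<in> S" "i \<noteq> j"
  shows "(\<Sum>k\<in>S. (if k = i then x else if k = j then y else 0) * f k) = x * f i + y * f j"
proof -
  have "(\<Sum>k\<in>S. (if k = i then x else if k = j then y else 0) * f k) =
      (\<Sum>k\<in>S. (if k = i then x * f k else 0) + (if k = j then y * f k else 0))"
    using assms(4) by (intro sum.cong) auto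
  then show ?thesis using assms by (simp add: sum.distrib)
qed

lemma mult_mat_entry:
  assumes "A \<in> carrier_mat n n" "B \<in> carrier_mat n n" "a < n" "b < n"
  shows "(A * B) $$ (a, b) = (\<Sum>k<n. A $$ (a, k) * B $$ (k, b))"
  using assms by (auto simp: scalar_prod_def lessThan_atLeast0)

lemma mem_GL: "g \<in> GL n \<longleftrightarrow> g \<in> carrier_mat n n \<and> det g \<noteq> 0" for g :: "'k::field mat"
proof (cases "g \<in> carrier_mat n n")
  case True
  have "invertible_mat g \<longleftrightarrow> det g \<noteq> 0"
  proof
    assume "invertible_mat g"
    then obtain B where B: "inverts_mat g B" "inverts_mat B g" by (auto simp: invertible_mat_def)
    have gB: "g * B = 1\<^sub>m n" using B(1) True by (auto simp: inverts_mat_def)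
    \<comment> \<open>The shape of \<open>B\<close> is not given; the two products with
      \<open>g\<close> force it to be n by n.\<close>
    have "dim_col (B * g) = dim_row B" using B(2) by (simp add: inverts_mat_def del: index_mult_mat)
    moreover have "dim_col (g * B) = n" using gB by (simp del: index_mult_mat)
    ultimately have Bc: "B \<in> carrier_mat n n" using True by (intro carrier_matI) auto
    have "det g * det B = 1" using gB det_mult[OF True Bc] by simp
    then show "det g \<noteq> 0" by auto
  next
    assume d: "det g \<noteq> 0"
    let ?B = "inverse (det g) \<cdot>\<^sub>m adj_mat g"
    have "g * ?B = 1\<^sub>m n" "?B * g = 1\<^sub>m n"
      unfolding mult_smult_distrib[OF True adj_mat(1)[OF True]]
        mult_smult_assoc_mat[OF adj_mat(1)[OF True] True] adj_mat(2,3)[OF True]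
      using d by (auto intro!: eq_matI)
    moreover have "dim_row ?B = n" using adj_mat(1)[OF True] by simp
    ultimately show "invertible_mat g" using True
      unfolding invertible_mat_def inverts_mat_def by (intro conjI exI[of _ ?B]) auto
  qed
  then show ?thesis using True by (simp add: GL_def)
qed (auto simp: GL_def)

lemma GL_carrier: "g \<in> GL n \<Longrightarrow> g \<in> carrier_mat n n"
  by (simp add: GL_def)

lemma GL_mult: "g \<in> GL n \<Longrightarrow> h \<in> GL n \<Longrightarrow> g * h \<in> GL n" for g :: "'k::field mat"
  by (auto simp: mem_GL det_mult[of _ n])

lemma GL_one: "1\<^sub>m n \<in> (GL n :: 'k::field mat set)"
  by (simp add: mem_GL)

lemma GL_cancel_left:
  fixes g :: "'k::field mat"
  assumes g: "g \<in> GL n" and x: "x \<in> carrier_mat n n" and y: "y \<in> carrier_mat n n" and eq: "g * x = g * y"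
  shows "x = y"
proof -
  have gc: "g \<in> carrier_mat n n" and d: "det g \<noteq> 0" using g by (auto simp: mem_GL)
  let ?B = "inverse (det g) \<cdot>\<^sub>m adj_mat g"
  have B: "?B \<in> carrier_mat n n" using adj_mat(1)[OF gc] by simp
  have 1: "?B * g = 1\<^sub>m n"
    unfolding mult_smult_assoc_mat[OF adj_mat(1)[OF gc] gc] adj_mat(3)[OF gc]
    using d by (auto intro!: eq_matI)
  have "x = ?B * (g * x)" using assoc_mult_mat[OF B gc x] 1 x by simp
  also have "\<dots> = ?B * (g * y)" by (simp add: eq)
  also have "\<dots> = y" using assoc_mult_mat[OF B gc y] 1 y by simp
  finally show ?thesis .
qed

lemma finite_carrier_mat: "finite (carrier_mat n m :: 'k::finite mat set)"
proof -
  have "carrier_mat n m \<subseteq> (\<lambda>f. mat n m f) ` (({..<n} \<times> {..<m}) \<rightarrow>\<^sub>E (UNIV :: 'k set))"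
  proof
    fix A :: "'k mat" assume A: "A \<in> carrier_mat n m"
    have "A = mat n m (restrict (\<lambda>ij. A $$ ij) ({..<n} \<times> {..<m}))"
      using A by (intro eq_matI) auto
    then show "A \<in> (\<lambda>f. mat n m f) ` (({..<n} \<times> {..<m}) \<rightarrow>\<^sub>E UNIV)"
      by (intro image_eqI[where x = "restrict (\<lambda>ij. A $$ ij) ({..<n} \<times> {..<m})"]) auto
  qed
  then show ?thesis by (rule finite_subset) (simp add: finite_PiE)
qed

lemma finite_GL: "finite (GL n :: 'k::{field,finite} mat set)"
  by (rule finite_subset[OF _ finite_carrier_mat[of n n]]) (auto simp: GL_def)

lemma mem_Borel: "b \<in> Borel n \<longleftrightarrow> b \<in> carrier_mat n n \<and> (\<forall>i<n. \<forall>j<i. b $$ (i, j) = 0) \<and> (\<forall>i<n. b $$ (i, i) \<noteq> 0)"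
  for b :: "'k::field mat"
proof (cases "b \<in> carrier_mat n n \<and> upper_triangular b")
  case True
  then have "det b \<noteq> 0 \<longleftrightarrow> (\<forall>i<n. b $$ (i, i) \<noteq> 0)"
    using upper_triangular_imp_det_eq_0_iff[of b n] by (auto simp: diag_mat_def)
  then show ?thesis using True by (auto simp: Borel_def mem_GL upper_triangular_def)
qed (auto simp: Borel_def mem_GL upper_triangular_def)

lemma Borel_GL: "b \<in> Borel n \<Longrightarrow> b \<in> GL n"
  by (simp add: Borel_def)

lemma finite_Borel: "finite (Borel n :: 'k::{field,finite} mat set)"
  by (rule finite_subset[OF _ finite_GL[of n]]) (auto simp: Borel_def)

lemma Borel_mult:
  fixes b :: "'k::field mat"
  assumes b: "b \<in> Borel n" and c: "c \<in> Borel n" shows "b * c \<in> Borel n"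
proof -
  have "(b * c) $$ (i, j) = 0" if "i < n" "j < i" for i j
  proof -
    have "b $$ (i, k) * c $$ (k, j) = 0" if "k < n" for k
      using b c that \<open>i < n\<close> \<open>j < i\<close> by (cases "k < i") (auto simp: mem_Borel)
    then show ?thesis using b c that
      by (subst mult_mat_entry[of _ n]) (auto simp: mem_Borel simp del: mult_eq_0_iff)
  qed
  moreover have "b * c \<in> GL n" using b c by (simp add: Borel_def GL_mult)
  ultimately show ?thesis by (auto simp: Borel_def GL_def upper_triangular_def)
qed

text \<open>
  The matrix of \<open>x\<^sub>i(c) s\<^sub>i\<close>: the block \<open>((c, 1), (1, 0))\<close> in rows and columns \<open>i, i + 1\<close>.
\<close>

definition tm :: "nat \<Rightarrow> nat \<Rightarrow> 'k::field \<Rightarrow> 'k mat" where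
  "tm n i c = mat n n (\<lambda>(a, b). if a = i then (if b = i then c else if b = Suc i then 1 else 0)
     else if a = Suc i then (if b = i then 1 else 0) else if a = b then 1 else 0)"

definition em :: "nat \<Rightarrow> nat \<Rightarrow> nat \<Rightarrow> 'k::field \<Rightarrow> 'k mat" where
  "em n k l c = mat n n (\<lambda>(a, b). if a = b then 1 else if a = k \<and> b = l then c else 0)"

lemma tm_carrier [simp]: "tm n i c \<in> carrier_mat n n"
  and em_carrier [simp]: "em n k l c \<in> carrier_mat n n"
  and perm_mat_carrier [simp]: "perm_mat n w \<in> carrier_mat n n"
  by (auto simp: tm_def em_def perm_mat_def)

lemma tm_mult:
  assumes A: "A \<in> carrier_mat n n" and i: "Suc i < n" and ab: "a < n" "b < n"
  shows "(tm n i c * A) $$ (a, b) =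
    (if a = i then c * A $$ (i, b) + A $$ (Suc i, b) else if a = Suc i then A $$ (i, b) else A $$ (a, b))"
proof -
  have e: "(tm n i c * A) $$ (a, b) = (\<Sum>k<n. tm n i c $$ (a, k) * A $$ (k, b))"
    using A ab by (intro mult_mat_entry) auto
  show ?thesis
  proof (cases "a = i")
    case True
    have "(\<Sum>k<n. tm n i c $$ (a, k) * A $$ (k, b)) =
        (\<Sum>k<n. (if k = i then c else if k = Suc i then 1 else 0) * A $$ (k, b))"
      using ab True by (intro sum.cong) (auto simp: tm_def)
    then show ?thesis using e True i by (simp add: sum_if_two)
  next
    case False
    have "(\<Sum>k<n. tm n i c $$ (a, k) * A $$ (k, b)) =
        (\<Sum>k<n. if k = (if a = Suc i then i else a) then A $$ (k, b) else 0)"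
      using ab False by (intro sum.cong) (auto simp: tm_def)
    then show ?thesis using e False i ab by auto
  qed
qed

lemma mult_tm:
  assumes A: "A \<in> carrier_mat n n" and i: "Suc i < n" and ab: "a < n" "b < n"
  shows "(A * tm n i c) $$ (a, b) =
    (if b = i then c * A $$ (a, i) + A $$ (a, Suc i) else if b = Suc i then A $$ (a, i) else A $$ (a, b))"
proof -
  have e: "(A * tm n i c) $$ (a, b) = (\<Sum>k<n. A $$ (a, k) * tm n i c $$ (k, b))"
    using A ab by (intro mult_mat_entry) auto
  show ?thesis
  proof (cases "b = i")
    case True
    have "(\<Sum>k<n. A $$ (a, k) * tm n i c $$ (k, b)) =
        (\<Sum>k<n. (if k = i then c else if k = Suc i then 1 else 0) * A $$ (a, k))"
      using ab True by (intro sum.cong) (auto simp: tm_def)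
    then show ?thesis using e True i by (simp add: sum_if_two)
  next
    case False
    have "(\<Sum>k<n. A $$ (a, k) * tm n i c $$ (k, b)) =
        (\<Sum>k<n. if k = (if b = Suc i then i else b) then A $$ (a, k) else 0)"
      using ab False by (intro sum.cong) (auto simp: tm_def)
    then show ?thesis using e False i ab by auto
  qed
qed

lemma mult_em:
  assumes A: "A \<in> carrier_mat n n" and kl: "k < n" "l < n" "k \<noteq> l" and ab: "a < n" "b < n"
  shows "(A * em n k l c) $$ (a, b) = A $$ (a, b) + (if b = l then c * A $$ (a, k) else 0)"
proof -
  have e: "(A * em n k l c) $$ (a, b) = (\<Sum>j<n. A $$ (a, j) * em n k l c $$ (j, b))"
    using A ab by (intro mult_mat_entry) auto
  show ?thesis
  proof (cases "b = l")
    case True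
    have "(\<Sum>j<n. A $$ (a, j) * em n k l c $$ (j, b)) =
        (\<Sum>j<n. (if j = l then 1 else if j = k then c else 0) * A $$ (a, j))"
      using ab True by (intro sum.cong) (auto simp: em_def)
    then show ?thesis using e True kl by (simp add: sum_if_two)
  next
    case False
    have "(\<Sum>j<n. A $$ (a, j) * em n k l c $$ (j, b)) = (\<Sum>j<n. if j = b then A $$ (a, j) else 0)"
      using ab False by (intro sum.cong) (auto simp: em_def)
    then show ?thesis using e False ab by auto
  qed
qed

lemma mult_perm_mat:
  assumes A: "A \<in> carrier_mat n n" and w: "w permutes {..<n}" and ab: "a < n" "b < n"
  shows "(A * perm_mat n w) $$ (a, b) = A $$ (a, w b)"
proof -
  have wb: "w b < n" using permutes_in_image[OF w, of b] ab by simp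
  have "(A * perm_mat n w) $$ (a, b) = (\<Sum>j<n. A $$ (a, j) * perm_mat n w $$ (j, b))"
    using A ab by (intro mult_mat_entry) auto
  also have "\<dots> = (\<Sum>j<n. if j = w b then A $$ (a, j) else 0)"
    using ab by (intro sum.cong) (auto simp: perm_mat_def)
  finally show ?thesis using wb by simp
qed

lemma perm_mat_mult_entry:
  assumes A: "A \<in> carrier_mat n n" and w: "w permutes {..<n}" and ab: "a < n" "b < n"
  shows "(perm_mat n w * A) $$ (a, b) = A $$ (Hilbert_Choice.inv w a, b)"
proof -
  have wa: "Hilbert_Choice.inv w a < n" using permutes_in_image[OF permutes_inv[OF w], of a] ab by simp
  have "(perm_mat n w * A) $$ (a, b) = (\<Sum>j<n. perm_mat n w $$ (a, j) * A $$ (j, b))"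
    using A ab by (intro mult_mat_entry) auto
  also have "\<dots> = (\<Sum>j<n. if j = Hilbert_Choice.inv w a then A $$ (j, b) else 0)"
    using ab permutes_inverses[OF w] by (intro sum.cong) (auto simp: perm_mat_def)
  finally show ?thesis using wa by simp
qed

lemma perm_mat_comp:
  assumes "w permutes {..<n}" "v permutes {..<n}"
  shows "perm_mat n w * perm_mat n v = (perm_mat n (w \<circ> v) :: 'k::field mat)"
proof (rule eq_matI)
  fix a b assume "a < dim_row (perm_mat n (w \<circ> v) :: 'k mat)" "b < dim_col (perm_mat n (w \<circ> v) :: 'k mat)"
  then have ab: "a < n" "b < n" by (auto simp: perm_mat_def)
  have vb: "v b < n" using permutes_in_image[OF assms(2), of b] ab by simp
  show "(perm_mat n w * perm_mat n v) $$ (a, b) = (perm_mat n (w \<circ> v) :: 'k mat) $$ (a, b)"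
    using ab vb by (subst mult_perm_mat[OF _ assms(2)]) (auto simp: perm_mat_def)
qed (auto simp: perm_mat_def)

lemma perm_mat_id: "perm_mat n id = 1\<^sub>m n"
  by (intro eq_matI) (auto simp: perm_mat_def)

lemma perm_mat_GL:
  assumes "w permutes {..<n}" shows "perm_mat n w \<in> (GL n :: 'k::field mat set)"
proof -
  have "perm_mat n w * perm_mat n (Hilbert_Choice.inv w) = (1\<^sub>m n :: 'k mat)"
    using perm_mat_comp[OF assms permutes_inv[OF assms]] permutes_inv_o(1)[OF assms] by (simp add: perm_mat_id)
  then have "det (perm_mat n w :: 'k mat) * det (perm_mat n (Hilbert_Choice.inv w) :: 'k mat) = 1"
    by (metis det_mult det_one perm_mat_carrier)
  then show ?thesis by (auto simp: mem_GL)
qed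

lemma perm_mat_transpose:
  assumes "Suc i < n"
  shows "perm_mat n (Transposition.transpose i (Suc i)) = tm n i 0"
  using assms by (intro eq_matI) (auto simp: perm_mat_def tm_def Transposition.transpose_def)

lemma perm_mat_em:
  assumes w: "w permutes {..<n}" and jm: "j < n" "m < n" "j \<noteq> m"
  shows "perm_mat n w * em n j m c = em n (w j) (w m) c * perm_mat n w"
proof (rule eq_matI)
  fix a b assume "a < dim_row (em n (w j) (w m) c * perm_mat n w)" "b < dim_col (em n (w j) (w m) c * perm_mat n w)"
  then have ab: "a < n" "b < n" by (auto simp: perm_mat_def em_def)
  have b: "w b < n" "Hilbert_Choice.inv w a < n"
    using permutes_in_image[OF w, of b] permutes_in_image[OF permutes_inv[OF w], of a] ab by auto
  have eq: "Hilbert_Choice.inv w a = x \<longleftrightarrow> a = w x" for x using permutes_inv_eq[OF w] by metis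
  have inj: "w x = w y \<longleftrightarrow> x = y" for x y using permutes_inj[OF w] by (auto simp: inj_def)
  show "(perm_mat n w * em n j m c) $$ (a, b) = (em n (w j) (w m) c * perm_mat n w) $$ (a, b)"
    using ab b by (subst perm_mat_mult_entry[OF _ w], simp_all, subst mult_perm_mat[OF _ w])
      (auto simp: em_def eq inj)
qed (auto simp: perm_mat_def em_def)

lemma det_tm:
  assumes "Suc i < n" shows "det (tm n i c :: 'k::field mat) = - 1"
proof -
  have "tm n i c = addrow c i (Suc i) (swaprows i (Suc i) (1\<^sub>m n :: 'k mat))"
    using assms by (intro eq_matI) (auto simp: tm_def)
  moreover have "det (addrow c i (Suc i) (swaprows i (Suc i) (1\<^sub>m n :: 'k mat))) = - 1"
    using assms by (subst det_addrow[where n = n], simp_all, subst det_swaprows[where n = n]) auto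
  ultimately show ?thesis by simp
qed

lemma tm_GL: "Suc i < n \<Longrightarrow> tm n i c \<in> GL n"
  by (simp add: mem_GL det_tm)

lemma em_Borel: "k < l \<Longrightarrow> l < n \<Longrightarrow> em n k l c \<in> Borel n"
  by (auto simp: mem_Borel em_def)

text \<open>The cosets of the Borel subgroup B in B s_i B are represented by the
  \<open>tm n i c\<close>, and left multiplication by \<open>b\<close> permutes them by an affine
  substitution in \<open>c\<close> of nonzero slope.\<close>

lemma Borel_tm:
  fixes b :: "'k::field mat"
  assumes b: "b \<in> Borel n" and i: "Suc i < n"
  obtains b' where "b' \<in> Borel n"
    "b * tm n i c = tm n i ((b $$ (i, Suc i) + b $$ (i, i) * c) / b $$ (Suc i, Suc i)) * b'"
proof -
  have bc: "b \<in> carrier_mat n n" and up: "\<And>a l. a < n \<Longrightarrow> l < a \<Longrightarrow> b $$ (a, l) = 0"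
    and dg: "\<And>a. a < n \<Longrightarrow> b $$ (a, a) \<noteq> 0" using b by (auto simp: mem_Borel)
  define c' where "c' = (b $$ (i, Suc i) + b $$ (i, i) * c) / b $$ (Suc i, Suc i)"
  have c': "c' * b $$ (Suc i, Suc i) = b $$ (i, Suc i) + b $$ (i, i) * c"
    using dg[OF i] by (simp add: c'_def)
  define D where "D = b * tm n i c"
  have Dc: "D \<in> carrier_mat n n" using bc by (simp add: D_def)
  have D: "D $$ (a, l) = (if l = i then c * b $$ (a, i) + b $$ (a, Suc i) else if l = Suc i then b $$ (a, i) else b $$ (a, l))"
    if "a < n" "l < n" for a l unfolding D_def by (rule mult_tm[OF bc i that])
  \<comment> \<open>This is the inverse of \<open>tm n i c'\<close> times \<open>D\<close>: rows i
    and i + 1 are exchanged and c' times the new row i is subtracted.\<close>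
  define b' where "b' = mat n n (\<lambda>(a, l). if a = i then D $$ (Suc i, l)
     else if a = Suc i then D $$ (i, l) - c' * D $$ (Suc i, l) else D $$ (a, l))"
  have b'c: "b' \<in> carrier_mat n n" by (simp add: b'_def)
  have "tm n i c' * b' = D"
  proof (rule eq_matI)
    fix a l assume "a < dim_row D" "l < dim_col D"
    then have al: "a < n" "l < n" using Dc by auto
    show "(tm n i c' * b') $$ (a, l) = D $$ (a, l)"
      using i al by (subst tm_mult[OF b'c i al]) (auto simp: b'_def)
  qed (use Dc b'c in \<open>auto simp: tm_def\<close>)
  moreover have "b' \<in> Borel n"
    unfolding mem_Borel
  proof (intro conjI allI impI b'c)
    fix a l assume al: "a < n" "l < a"
    show "b' $$ (a, l) = 0"
      using al i up c' by (auto simp: b'_def D algebra_simps)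
  next
    fix a assume a: "a < n"
    show "b' $$ (a, a) \<noteq> 0" using a i up dg by (auto simp: b'_def D)
  qed
  ultimately show thesis using that unfolding D_def c'_def by metis
qed

text \<open>The 2 by 2 identity ((c, 1), (1, 0)) = ((0, 1), (1, 0)) ((1/c, 1), (1, 0)) ((c, 1), (0,
  -1/c)). It pairs the parameters c and 1/c up to the simple reflection.\<close>

lemma tm_Bruhat:
  fixes c :: "'k::field"
  assumes c: "c \<noteq> 0" and i: "Suc i < n"
  obtains b' where "b' \<in> Borel n" "tm n i c = tm n i 0 * (tm n i (1 / c) * b')"
proof -
  define b' where "b' = mat n n (\<lambda>(a, l). if a = i then (if l = i then c else if l = Suc i then 1 else 0)
     else if a = Suc i then (if l = Suc i then - (1 / c) else 0) else if a = l then 1 else (0::'k))"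
  have b'c: "b' \<in> carrier_mat n n" by (simp add: b'_def)
  have dc: "tm n i (1 / c) * b' \<in> carrier_mat n n"
    by (rule mult_carrier_mat[OF tm_carrier b'c])
  have "tm n i c = tm n i 0 * (tm n i (1 / c) * b')"
  proof (rule eq_matI)
    fix a l assume "a < dim_row (tm n i 0 * (tm n i (1 / c) * b'))" "l < dim_col (tm n i 0 * (tm n i (1 / c) * b'))"
    then have al: "a < n" "l < n" using b'c by (auto simp: tm_def)
    show "tm n i c $$ (a, l) = (tm n i 0 * (tm n i (1 / c) * b')) $$ (a, l)"
      using i al c by (subst tm_mult[OF dc i al])
        (simp add: tm_mult[OF b'c i] del: index_mult_mat, auto simp: tm_def b'_def)
  qed (use b'c in \<open>auto simp: tm_def\<close>)
  moreover have "b' \<in> Borel n" using c i by (auto simp: mem_Borel b'_def)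
  ultimately show thesis using that by blast
qed

lemma pm_linear_sum_fun: "(\<And>i. i \<in> I \<Longrightarrow> pm_linear (T i)) \<Longrightarrow> pm_linear (\<lambda>x. \<Sum>i\<in>I. T i x)"
  by (auto simp: pm_linear_def sum.distrib pm.scale_sum_right intro!: sum.cong)

lemma pm_linear_scale_fun: "pm_linear T \<Longrightarrow> pm_linear (\<lambda>x. pm_scale c (T x))"
  by (auto simp: pm_linear_def pm.scale_right_distrib mult.commute)

lemma pm_sum_const: "(\<Sum>c\<in>I. v) = pm_scale (of_nat (card I)) v"
proof -
  have "(\<Sum>c\<in>I. v) = (\<Sum>c\<in>I. pm_scale 1 v)" by simp
  also have "\<dots> = pm_scale (\<Sum>c\<in>I. 1) v" by (rule pm.scale_sum_left[symmetric])
  finally show ?thesis by simp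
qed

text \<open>
  The permutations \<open>sig k d\<close>, \<open>k + d < n\<close>, represent the cosets of the permutations of
  \<open>{k+1..<n}\<close> in those of \<open>{k..<n}\<close>.
\<close>

fun sig :: "nat \<Rightarrow> nat \<Rightarrow> nat \<Rightarrow> nat" where
  "sig k 0 = id"
| "sig k (Suc d) = sig k d \<circ> Transposition.transpose (k + d) (Suc (k + d))"

lemma sig_permutes: "k + d < n \<Longrightarrow> sig k d permutes {k..<n}"
  by (induction d) (auto intro!: permutes_compose permutes_swap_id permutes_id simp: id_def[symmetric])

lemma sig_fix: "l > k + d \<Longrightarrow> sig k d l = l"
  by (induction d) (auto simp: Transposition.transpose_def)

lemma sig_top: "sig k d (k + d) = k"
  by (induction d) auto

lemma permutation_sig: "permutation (sig k d)"
  using sig_permutes[of k d "Suc (k + d)"] by (auto simp: permutation_permutes)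

lemma sign_sig: "sign (sig k d) = (- 1) ^ d"
proof (induction d)
  case (Suc d)
  then show ?case
    by (simp only: sig.simps sign_compose[OF permutation_sig permutation_swap_id] sign_swap_id) auto
qed simp

text \<open>
  \<open>Borel_from n 0\<close> is the Borel subgroup, and \<open>Borel_from n k = Borel_from n (k + 1) * row_group n k (n - 1)\<close>;
  \<open>row_group n k m\<close> consists of the matrices that differ from the identity only in row \<open>k\<close>, between columns \<open>k\<close> and \<open>m\<close>.
\<close>

definition Borel_from :: "nat \<Rightarrow> nat \<Rightarrow> 'k::field mat set" where
  "Borel_from n k = {b \<in> Borel n. \<forall>a<k. \<forall>l<n. b $$ (a, l) = (if a = l then 1 else 0)}"

definition row_group :: "nat \<Rightarrow> nat \<Rightarrow> nat \<Rightarrow> 'k::field mat set" where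
  "row_group n k m = {h \<in> carrier_mat n n. h $$ (k, k) \<noteq> 0 \<and> (\<forall>l<k. h $$ (k, l) = 0) \<and>
     (\<forall>l<n. l > m \<longrightarrow> h $$ (k, l) = 0) \<and> (\<forall>a<n. \<forall>l<n. a \<noteq> k \<longrightarrow> h $$ (a, l) = (if a = l then 1 else 0))}"

lemma row_group_Borel: "h \<in> row_group n k m \<Longrightarrow> k < n \<Longrightarrow> h \<in> Borel n"
  unfolding mem_Borel
proof (intro conjI allI impI)
  fix i j assume "h \<in> row_group n k m" "k < n" "i < n" "j < i"
  then show "h $$ (i, j) = 0" by (cases "i = k") (auto simp: row_group_def)
next
  fix i assume "h \<in> row_group n k m" "k < n" "i < n"
  then show "h $$ (i, i) \<noteq> 0" by (cases "i = k") (auto simp: row_group_def)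
qed (auto simp: row_group_def)

text \<open>Column k of \<open>b\<close> is a unit vector: rows up to k are those of the identity,
  and entries below the diagonal vanish. Multiplication by \<open>h\<close> therefore only fills in
  row k, so the two factors can be read off from the product.\<close>

lemma Borel_from_row_group_entry:
  fixes b h :: "'k::field mat"
  assumes b: "b \<in> Borel_from n (Suc k)" and h: "h \<in> row_group n k m" and k: "k < n" and al: "a < n" "l < n"
  shows "(b * h) $$ (a, l) = (if a = k then h $$ (k, l) else b $$ (a, l))"
proof -
  have bc: "b \<in> carrier_mat n n" and hc: "h \<in> carrier_mat n n"
    using b h by (auto simp: Borel_from_def row_group_def mem_Borel)
  have bk: "b $$ (a, k) = (if a = k then 1 else 0)"
    using b k al by (cases "a \<le> k") (auto simp: Borel_from_def mem_Borel)
  have e: "(b * h) $$ (a, l) = (\<Sum>j<n. b $$ (a, j) * h $$ (j, l))"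
    by (rule mult_mat_entry[OF bc hc al])
  show ?thesis
  proof (cases "a = k")
    case True
    have "(\<Sum>j<n. b $$ (a, j) * h $$ (j, l)) = (\<Sum>j<n. if j = k then h $$ (j, l) else 0)"
      using b True k by (intro sum.cong) (auto simp: Borel_from_def)
    then show ?thesis using e True k by simp
  next
    case False
    have "(\<Sum>j<n. b $$ (a, j) * h $$ (j, l)) = (\<Sum>j<n. if j = l then b $$ (a, j) else 0)"
    proof (rule sum.cong)
      fix j assume j: "j \<in> {..<n}"
      show "b $$ (a, j) * h $$ (j, l) = (if j = l then b $$ (a, j) else 0)"
        using h al bk False j by (cases "j = k") (auto simp: row_group_def)
    qed simp
    then show ?thesis using e False al by simp
  qed
qed

section \<open>Homomorphisms from the Steinberg module\<close>

text \<open>The group laws are demanded only on \<open>GL n\<close> and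
  \<open>basis_space A\<close>, because actions such as \<open>sym_act\<close> are defined on larger
  spaces where the identity matrix does not act trivially.\<close>

locale glrep =
  fixes n :: nat and A :: "'c set" and \<rho> :: "'k::{field,finite} mat \<Rightarrow> ('c \<Rightarrow>\<^sub>0 'k) \<Rightarrow> ('c \<Rightarrow>\<^sub>0 'k)"
  assumes lin: "pm_linear (\<rho> g)"
    and closed: "g \<in> GL n \<Longrightarrow> x \<in> basis_space A \<Longrightarrow> \<rho> g x \<in> basis_space A"
    and mult: "g \<in> GL n \<Longrightarrow> h \<in> GL n \<Longrightarrow> x \<in> basis_space A \<Longrightarrow> \<rho> (g * h) x = \<rho> g (\<rho> h x)"
    and one: "x \<in> basis_space A \<Longrightarrow> \<rho> (1\<^sub>m n) x = x"
begin

text \<open>On B-invariant vectors this is the Hecke operator of the double coset B s_i B.\<close>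

definition tau where "tau i v = (\<Sum>c\<in>UNIV. \<rho> (tm n i c) v)"
definition binv where "binv v \<longleftrightarrow> v \<in> basis_space A \<and> (\<forall>b\<in>Borel n. \<rho> b v = v)"
text \<open>The bound \<open>k\<close> here and the set \<open>S\<close> in \<open>Bs\<close> are
  parameters so that permutations and Borel matrices can be peeled off one row at a time.\<close>

definition Sg where "Sg k y = (\<Sum>w | w permutes {k..<n}. pm_scale (of_int (sign w)) (\<rho> (perm_mat n w) y))"
definition Bs where "Bs S y = (\<Sum>b\<in>S. \<rho> b y)"

lemma lin_tau: "pm_linear (tau i)"
  and lin_Sg: "pm_linear (Sg k)"
  and lin_Bs: "pm_linear (Bs S)"
  unfolding tau_def[abs_def] Sg_def[abs_def] Bs_def[abs_def]
  by (intro pm_linear_sum_fun pm_linear_scale_fun lin)+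

lemma closed_tau: "Suc i < n \<Longrightarrow> v \<in> basis_space A \<Longrightarrow> tau i v \<in> basis_space A"
  unfolding tau_def by (intro basis_space_sum closed tm_GL)

lemma permutes_GL: "w permutes {k..<n} \<Longrightarrow> perm_mat n w \<in> GL n"
  by (rule perm_mat_GL, rule permutes_subset) auto

lemma permutes_lessThan: "w permutes {k..<n} \<Longrightarrow> w permutes {..<n}"
  by (rule permutes_subset) auto

lemma closed_Sg: "v \<in> basis_space A \<Longrightarrow> Sg k v \<in> basis_space A"
  unfolding Sg_def by (intro basis_space_sum basis_space_scale closed) (auto intro: permutes_GL)

lemma closed_Bs: "v \<in> basis_space A \<Longrightarrow> S \<subseteq> GL n \<Longrightarrow> Bs S v \<in> basis_space A"
  unfolding Bs_def by (intro basis_space_sum closed) auto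

text \<open>An element of B permutes the coset representatives \<open>tm n i c\<close> by the affine
  bijection \<open>?f\<close> of the parameter, by \<open>Borel_tm\<close>, and the error b' fixes
  \<open>v\<close>.\<close>

lemma binv_tau:
  assumes v: "binv v" and i: "Suc i < n"
  shows "binv (tau i v)"
  unfolding binv_def
proof (intro conjI ballI)
  have vA: "v \<in> basis_space A" using v by (simp add: binv_def)
  show "tau i v \<in> basis_space A" by (rule closed_tau[OF i vA])
  fix b :: "'k mat" assume b: "b \<in> Borel n"
  let ?f = "\<lambda>c. (b $$ (i, Suc i) + b $$ (i, i) * c) / b $$ (Suc i, Suc i)"
  have nz: "b $$ (i, i) \<noteq> 0" "b $$ (Suc i, Suc i) \<noteq> 0" using b i by (auto simp: mem_Borel)
  have "\<rho> b (\<rho> (tm n i c) v) = \<rho> (tm n i (?f c)) v" for c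
  proof -
    obtain b' where b': "b' \<in> Borel n" "b * tm n i c = tm n i (?f c) * b'" by (rule Borel_tm[OF b i])
    have "\<rho> b (\<rho> (tm n i c) v) = \<rho> (tm n i (?f c)) (\<rho> b' v)"
      using mult[OF Borel_GL[OF b] tm_GL[OF i] vA, of c] mult[OF tm_GL[OF i] Borel_GL[OF b'(1)] vA, of "?f c"] b'(2)
      by simp
    then show ?thesis using b'(1) v by (simp add: binv_def)
  qed
  then have "\<rho> b (tau i v) = (\<Sum>c\<in>UNIV. \<rho> (tm n i (?f c)) v)"
    unfolding tau_def by (simp add: pm_linear_sum[OF lin])
  also have "\<dots> = tau i v" unfolding tau_def using nz
    by (intro sum.reindex_bij_witness[of _ "\<lambda>d. (d * b $$ (Suc i, Suc i) - b $$ (i, Suc i)) / b $$ (i, i)" ?f])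
      (auto simp: field_simps)
  finally show "\<rho> b (tau i v) = tau i v" .
qed

lemma Sg_perm:
  assumes s: "s permutes {k..<n}" and y: "y \<in> basis_space A"
  shows "Sg k (\<rho> (perm_mat n s) y) = pm_scale (of_int (sign s)) (Sg k y)"
proof -
  have "Sg k y = (\<Sum>w | w permutes {k..<n}. pm_scale (of_int (sign (w \<circ> s))) (\<rho> (perm_mat n (w \<circ> s)) y))"
    unfolding Sg_def by (rule sum_permutations_compose_right[OF s])
  also have "\<dots> = (\<Sum>w | w permutes {k..<n}. pm_scale (of_int (sign s)) (pm_scale (of_int (sign w)) (\<rho> (perm_mat n w) (\<rho> (perm_mat n s) y))))"
  proof (rule sum.cong)
    fix w assume "w \<in> {w. w permutes {k..<n}}"
    then have w: "w permutes {k..<n}" by simp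
    have "sign (w \<circ> s) = sign w * sign s"
      using w s by (intro sign_compose) (auto simp: permutation_permutes)
    moreover have "\<rho> (perm_mat n (w \<circ> s)) y = \<rho> (perm_mat n w) (\<rho> (perm_mat n s) y)"
      using perm_mat_comp[where 'k='k, OF permutes_lessThan[OF w] permutes_lessThan[OF s]]
        mult[OF permutes_GL[OF w] permutes_GL[OF s] y] by simp
    ultimately show "pm_scale (of_int (sign (w \<circ> s))) (\<rho> (perm_mat n (w \<circ> s)) y) =
      pm_scale (of_int (sign s)) (pm_scale (of_int (sign w)) (\<rho> (perm_mat n w) (\<rho> (perm_mat n s) y)))"
      by (simp add: mult.commute)
  qed simp
  also have "\<dots> = pm_scale (of_int (sign s)) (Sg k (\<rho> (perm_mat n s) y))"
    unfolding Sg_def by (rule pm.scale_sum_right[symmetric])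
  finally have "pm_scale (of_int (sign s)) (Sg k y) =
      pm_scale (of_int (sign s) * of_int (sign s)) (Sg k (\<rho> (perm_mat n s) y))" by simp
  then show ?thesis by (simp add: of_int_mult[symmetric] sign_idempotent del: of_int_mult)
qed

lemma Sg_swap:
  assumes i: "Suc i < n" and y: "y \<in> basis_space A"
  shows "Sg 0 (\<rho> (tm n i 0) y) = - Sg 0 y"
proof -
  have "Transposition.transpose i (Suc i) permutes {0..<n}" using i by (intro permutes_swap_id) auto
  from Sg_perm[OF this y] show ?thesis
    by (simp add: perm_mat_transpose[OF i] sign_swap_id)
qed

text \<open>The terms of w and w s_i cancel. From \<open>Sg_swap\<close> alone only
  \<open>Sg 0 y = - Sg 0 y\<close> would follow, which is empty in characteristic 2.\<close>

lemma Sg_fixed: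
  assumes i: "Suc i < n" and y: "y \<in> basis_space A" and fx: "\<rho> (tm n i 0) y = y"
  shows "Sg 0 y = 0"
  unfolding Sg_def
proof (rule sum_antisym_involution)
  let ?s = "Transposition.transpose i (Suc i)"
  have s: "?s permutes {0..<n}" using i by (intro permutes_swap_id) auto
  show "finite {w. w permutes {0..<n}}" by (simp add: finite_permutations)
  fix w assume "w \<in> {w. w permutes {0..<n}}"
  then have w: "w permutes {0..<n}" by simp
  show "w \<circ> ?s \<in> {w. w permutes {0..<n}}" using permutes_compose[OF s w] by simp
  show "(w \<circ> ?s) \<circ> ?s = w" by (simp add: comp_assoc)
  have "sign (w \<circ> ?s) = - sign w"
    using w s by (subst sign_compose) (auto simp: permutation_permutes sign_swap_id)
  moreover have "\<rho> (perm_mat n (w \<circ> ?s)) y = \<rho> (perm_mat n w) y"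
    using perm_mat_comp[where 'k='k, OF permutes_lessThan[OF w] permutes_lessThan[OF s]]
      mult[OF permutes_GL[OF w] permutes_GL[OF s] y] fx by (simp add: perm_mat_transpose[OF i])
  ultimately show "pm_scale (of_int (sign (w \<circ> ?s))) (\<rho> (perm_mat n (w \<circ> ?s)) y) =
      - pm_scale (of_int (sign w)) (\<rho> (perm_mat n w) y)" by simp
  assume "w \<circ> ?s = w"
  then have "w (?s i) = w i" by (metis comp_apply)
  then have "?s i = i" using permutes_inj[OF w] by (auto simp: inj_def)
  then show "pm_scale (of_int (sign w)) (\<rho> (perm_mat n w) y) = 0" by simp
qed

text \<open>The summand c = 0 is the reflection s_i and yields the sign. The others cancel in pairs
  c, 1/c by \<open>tm_Bruhat\<close>; where c = 1/c, the vector is fixed by s_i and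
  \<open>Sg_fixed\<close> kills it.\<close>

lemma Sg_tau:
  assumes v: "binv v" and i: "Suc i < n"
  shows "Sg 0 (tau i v) = - Sg 0 v"
proof -
  have vA: "v \<in> basis_space A" using v by (simp add: binv_def)
  define a where "a c = Sg 0 (\<rho> (tm n i c) v)" for c
  have cl: "\<rho> (tm n i c) v \<in> basis_space A" for c by (rule closed[OF tm_GL[OF i] vA])
  have br: "\<rho> (tm n i c) v = \<rho> (tm n i 0) (\<rho> (tm n i (1 / c)) v)" if nz: "c \<noteq> 0" for c
  proof -
    obtain b' where b': "b' \<in> Borel n" "tm n i c = tm n i 0 * (tm n i (1 / c) * b')"
      using tm_Bruhat[OF nz i] by metis
    have "\<rho> (tm n i c) v = \<rho> (tm n i 0) (\<rho> (tm n i (1 / c)) (\<rho> b' v))"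
      unfolding b'(2)
      by (simp add: mult tm_GL[OF i] GL_mult Borel_GL[OF b'(1)] vA closed)
    then show ?thesis using b'(1) v by (simp add: binv_def)
  qed
  have "Sg 0 (tau i v) = (\<Sum>c\<in>UNIV. a c)"
    unfolding tau_def a_def by (rule pm_linear_sum[OF lin_Sg])
  also have "\<dots> = a 0 + (\<Sum>c\<in>UNIV - {0}. a c)" by (rule sum.remove) auto
  also have "(\<Sum>c\<in>UNIV - {0}. a c) = 0"
  proof (rule sum_antisym_involution[where \<sigma> = "\<lambda>c. 1 / c"])
    fix c :: 'k assume c: "c \<in> UNIV - {0}"
    have "a c = - a (1 / c)"
      unfolding a_def using br[of c] Sg_swap[OF i cl] c by simp
    then show "a (1 / c) = - a c" by simp
    assume "1 / c = c"
    then show "a c = 0" unfolding a_def using br[of c] c by (intro Sg_fixed[OF i cl]) simp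
  qed auto
  also have "a 0 = - Sg 0 v" unfolding a_def by (rule Sg_swap[OF i vA])
  finally show ?thesis by simp
qed

lemma binv_foldr_tau: "binv v \<Longrightarrow> set is \<subseteq> {i. Suc i < n} \<Longrightarrow> binv (foldr tau is v)"
  by (induction "is") (auto intro: binv_tau)

lemma Sg_foldr_tau:
  "binv v \<Longrightarrow> set is \<subseteq> {i. Suc i < n} \<Longrightarrow> Sg 0 (foldr tau is v) = pm_scale ((- 1) ^ length is) (Sg 0 v)"
  by (induction "is") (auto simp: Sg_tau binv_foldr_tau)

lemma foldr_tau_eigen:
  assumes "\<And>i. Suc i < n \<Longrightarrow> tau i v = - v"
  shows "set is \<subseteq> {i. Suc i < n} \<Longrightarrow> foldr tau is v = pm_scale ((- 1) ^ length is) v"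
  by (induction "is") (auto simp: assms pm_linear_scale[OF lin_tau])

lemma binv_Bs:
  assumes y: "y \<in> basis_space A"
  shows "binv (Bs (Borel n) y)"
  unfolding binv_def
proof (intro conjI ballI)
  show "Bs (Borel n) y \<in> basis_space A" using y by (rule closed_Bs) (auto intro: Borel_GL)
  fix b :: "'k mat" assume b: "b \<in> Borel n"
  have inj: "inj_on (\<lambda>x. b * x) (Borel n)"
    by (rule inj_onI, rule GL_cancel_left[OF Borel_GL[OF b]]) (auto dest!: Borel_GL GL_carrier)
  have "(\<lambda>x. b * x) ` Borel n = Borel n"
    using b Borel_mult by (intro endo_inj_surj[OF finite_Borel _ inj]) auto
  then have bij: "bij_betw (\<lambda>x. b * x) (Borel n) (Borel n)" using inj by (simp add: bij_betw_def)
  have "\<rho> b (Bs (Borel n) y) = (\<Sum>x\<in>Borel n. \<rho> (b * x) y)"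
    unfolding Bs_def pm_linear_sum[OF lin] using b y by (intro sum.cong) (auto simp: mult Borel_GL)
  also have "\<dots> = Bs (Borel n) y" unfolding Bs_def by (rule sum.reindex_bij_betw[OF bij])
  finally show "\<rho> b (Bs (Borel n) y) = Bs (Borel n) y" .
qed

text \<open>Sum \<open>\<rho> g z\<close> over the minimal parabolic subgroup in two ways. Right
  multiplication by s_i is a sign-changing involution without fixed points, so the sum is 0;
  splitting the subgroup into B and the cosets \<open>tm n i c\<close> B gives \<open>Bs\<close>
  plus \<open>tau\<close> of \<open>Bs\<close>.\<close>

lemma tau_Bs:
  assumes z: "z \<in> basis_space A" and i: "Suc i < n" and sz: "\<rho> (tm n i 0) z = - z"
  shows "tau i (Bs (Borel n) z) = - Bs (Borel n) z"
proof -
  \<comment> \<open>The minimal parabolic subgroup: one entry below the diagonal, at (i + 1, i), is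
    left free.\<close>
  define P :: "'k mat set" where
    "P = {g \<in> GL n. \<forall>a<n. \<forall>l<a. \<not> (a = Suc i \<and> l = i) \<longrightarrow> g $$ (a, l) = 0}"
  have fP: "finite P" by (rule finite_subset[OF _ finite_GL[of n]]) (auto simp: P_def)
  have swap: "(g * tm n i 0) $$ (a, l) = (if l = i then g $$ (a, Suc i) else if l = Suc i then g $$ (a, i) else g $$ (a, l))"
    if "g \<in> carrier_mat n n" "a < n" "l < n" for g :: "'k mat" and a l
    using that i by (subst mult_tm) auto
  have P0: "(\<Sum>g\<in>P. \<rho> g z) = 0"
  proof (rule sum_antisym_involution[OF fP, where \<sigma> = "\<lambda>g. g * tm n i 0"])
    fix g assume g: "g \<in> P"
    have gG: "g \<in> GL n" and gc: "g \<in> carrier_mat n n" using g by (auto simp: P_def GL_carrier)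
    show "g * tm n i 0 \<in> P"
      using g gc i GL_mult[OF gG tm_GL[OF i]] by (auto simp: P_def swap simp del: index_mult_mat)
    show "g * tm n i 0 * tm n i 0 = g"
    proof (rule eq_matI)
      fix a l assume "a < dim_row g" "l < dim_col g"
      then have "a < n" "l < n" using gc by auto
      then show "(g * tm n i 0 * tm n i 0) $$ (a, l) = g $$ (a, l)"
        using gc i by (subst swap) (auto simp: swap simp del: index_mult_mat)
    qed (use gc in \<open>auto simp: tm_def\<close>)
    show "\<rho> (g * tm n i 0) z = - \<rho> g z"
      using mult[OF gG tm_GL[OF i] z] sz by (simp add: pm_linear_uminus[OF lin])
    assume "g * tm n i 0 = g"
    then have "g * tm n i 0 = g * 1\<^sub>m n" using gc by simp
    then have "tm n i 0 = (1\<^sub>m n :: 'k mat)" by (rule GL_cancel_left[OF gG tm_carrier one_carrier_mat])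
    then have "tm n i 0 $$ (i, i) = (1\<^sub>m n :: 'k mat) $$ (i, i)" by simp
    then show "\<rho> g z = 0" using i by (simp add: tm_def)
  qed
  let ?C = "{g \<in> P. g $$ (Suc i, i) \<noteq> 0}"
  have split: "P = Borel n \<union> ?C"
  proof -
    have "{g \<in> P. g $$ (Suc i, i) = 0} = Borel n"
      using i by (auto simp: P_def Borel_def GL_def upper_triangular_def)
    then show ?thesis by blast
  qed
  have disj: "Borel n \<inter> ?C = {}" using i by (auto simp: mem_Borel)
  \<comment> \<open>Inverse of (c, b) to \<open>tm n i c * b\<close>: since b is triangular, column
    i of the product has entries c * b_ii and b_ii in rows i and i + 1, so their quotient is
    c.\<close>
  define j :: "'k mat \<Rightarrow> 'k \<times> 'k mat" where
    "j = (\<lambda>g. (g $$ (i, i) / g $$ (Suc i, i), mat n n (\<lambda>(a, l). if a = i then g $$ (Suc i, l)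
         else if a = Suc i then g $$ (i, l) - g $$ (i, i) / g $$ (Suc i, i) * g $$ (Suc i, l) else g $$ (a, l))))"
  have C: "(\<Sum>g\<in>?C. \<rho> g z) = (\<Sum>(c, b)\<in>UNIV \<times> Borel n. \<rho> (tm n i c * b) z)"
  proof (rule sum.reindex_bij_witness[where i = "\<lambda>(c, b). tm n i c * b" and j = j])
    fix g assume g: "g \<in> ?C"
    have gG: "g \<in> GL n" and gc: "g \<in> carrier_mat n n" and nz: "g $$ (Suc i, i) \<noteq> 0"
      using g by (auto simp: P_def GL_carrier)
    let ?c = "g $$ (i, i) / g $$ (Suc i, i)"
    let ?b = "mat n n (\<lambda>(a, l). if a = i then g $$ (Suc i, l)
         else if a = Suc i then g $$ (i, l) - g $$ (i, i) / g $$ (Suc i, i) * g $$ (Suc i, l) else g $$ (a, l))"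
    have bc: "?b \<in> carrier_mat n n" by simp
    have e: "tm n i ?c * ?b = g"
    proof (rule eq_matI)
      fix a l assume "a < dim_row g" "l < dim_col g"
      then have al: "a < n" "l < n" using gc by auto
      show "(tm n i ?c * ?b) $$ (a, l) = g $$ (a, l)"
        using i al by (subst tm_mult[OF bc i al]) auto
    qed (use gc in \<open>auto simp: tm_def\<close>)
    then show "(case j g of (c, b) \<Rightarrow> tm n i c * b) = g" by (simp add: j_def)
    then show "(case j g of (c, b) \<Rightarrow> \<rho> (tm n i c * b) z) = \<rho> g z"
      by (simp add: case_prod_unfold)
    have "det (tm n i ?c) * det ?b = det g" using e det_mult[OF tm_carrier bc] by metis
    then have "det ?b \<noteq> 0" using gG by (auto simp: mem_GL)
    then have bG: "?b \<in> GL n" using bc by (simp add: mem_GL)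
    have "upper_triangular ?b"
    proof (rule upper_triangularI)
      fix a l assume la: "l < a" and "a < dim_row ?b"
      then have a: "a < n" by simp
      have z: "\<And>a l. a < n \<Longrightarrow> l < a \<Longrightarrow> \<not> (a = Suc i \<and> l = i) \<Longrightarrow> g $$ (a, l) = 0"
        using g by (auto simp: P_def)
      show "?b $$ (a, l) = 0" using la a i nz by (cases "l = i") (auto simp: z)
    qed
    then show "j g \<in> UNIV \<times> Borel n" using bG by (simp add: Borel_def j_def)
  next
    fix cb :: "'k \<times> 'k mat" assume cb: "cb \<in> UNIV \<times> Borel n"
    obtain c b where cbe: "cb = (c, b)" by (cases cb)
    have b: "b \<in> Borel n" using cb cbe by auto
    have bc: "b \<in> carrier_mat n n" and up: "\<And>a l. a < n \<Longrightarrow> l < a \<Longrightarrow> b $$ (a, l) = 0"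
      and dg: "\<And>a. a < n \<Longrightarrow> b $$ (a, a) \<noteq> 0" using b by (auto simp: mem_Borel)
    define g where "g = tm n i c * b"
    have ge: "g $$ (a, l) = (if a = i then c * b $$ (i, l) + b $$ (Suc i, l) else if a = Suc i then b $$ (i, l) else b $$ (a, l))"
      if "a < n" "l < n" for a l unfolding g_def by (rule tm_mult[OF bc i that])
    have gG: "g \<in> GL n" unfolding g_def by (rule GL_mult[OF tm_GL[OF i] Borel_GL[OF b]])
    have "g \<in> ?C" using gG i up dg by (auto simp: P_def ge)
    then show "(case cb of (c, b) \<Rightarrow> tm n i c * b) \<in> ?C" by (simp add: cbe g_def)
    have c: "g $$ (i, i) / g $$ (Suc i, i) = c" using i up dg by (simp add: ge)
    have "mat n n (\<lambda>(a, l). if a = i then g $$ (Suc i, l)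
         else if a = Suc i then g $$ (i, l) - g $$ (i, i) / g $$ (Suc i, i) * g $$ (Suc i, l) else g $$ (a, l)) = b"
      unfolding c using bc i by (intro eq_matI) (auto simp: ge)
    then show "j (case cb of (c, b) \<Rightarrow> tm n i c * b) = cb"
      by (simp add: cbe g_def[symmetric] c j_def)
  qed
  have "(\<Sum>(c, b)\<in>UNIV \<times> Borel n. \<rho> (tm n i c * b) z) = (\<Sum>c\<in>UNIV. \<Sum>b\<in>Borel n. \<rho> (tm n i c) (\<rho> b z))"
    unfolding sum.cartesian_product[symmetric]
    by (intro sum.cong refl) (simp add: mult tm_GL[OF i] Borel_GL z)
  also have "\<dots> = tau i (Bs (Borel n) z)"
    unfolding tau_def Bs_def by (simp add: pm_linear_sum[OF lin])
  finally have "(\<Sum>g\<in>P. \<rho> g z) = Bs (Borel n) z + tau i (Bs (Borel n) z)"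
    using C split disj fP finite_Borel unfolding Bs_def
    by (metis (no_types, lifting) finite_subset sum.union_disjoint sup_ge2)
  then show ?thesis using P0 by (metis add.inverse_unique)
qed

lemma perm_swap_Sg:
  assumes i: "Suc i < n" and y: "y \<in> basis_space A"
  shows "\<rho> (tm n i 0) (Sg 0 y) = - Sg 0 y"
proof -
  let ?s = "Transposition.transpose i (Suc i)"
  have s: "?s permutes {0..<n}" using i by (intro permutes_swap_id) auto
  have "Sg 0 y = (\<Sum>w | w permutes {0..<n}. pm_scale (of_int (sign (?s \<circ> w))) (\<rho> (perm_mat n (?s \<circ> w)) y))"
    unfolding Sg_def
    by (rule sum.reindex_bij_witness[of _ "\<lambda>w. ?s \<circ> w" "\<lambda>w. ?s \<circ> w"])
      (auto simp: comp_assoc[symmetric] intro: permutes_compose[OF _ s])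
  also have "\<dots> = (\<Sum>w | w permutes {0..<n}. - \<rho> (tm n i 0) (pm_scale (of_int (sign w)) (\<rho> (perm_mat n w) y)))"
  proof (rule sum.cong)
    fix w assume "w \<in> {w. w permutes {0..<n}}"
    then have w: "w permutes {0..<n}" by simp
    have "sign (?s \<circ> w) = - sign w"
      using w s by (subst sign_compose) (auto simp: permutation_permutes sign_swap_id)
    moreover have "\<rho> (perm_mat n (?s \<circ> w)) y = \<rho> (tm n i 0) (\<rho> (perm_mat n w) y)"
      using perm_mat_comp[where 'k='k, OF permutes_lessThan[OF s] permutes_lessThan[OF w]]
        mult[OF permutes_GL[OF s] permutes_GL[OF w] y] by (simp add: perm_mat_transpose[OF i])
    ultimately show "pm_scale (of_int (sign (?s \<circ> w))) (\<rho> (perm_mat n (?s \<circ> w)) y) =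
      - \<rho> (tm n i 0) (pm_scale (of_int (sign w)) (\<rho> (perm_mat n w) y))"
      by (simp add: pm_linear_scale[OF lin])
  qed simp
  also have "\<dots> = - \<rho> (tm n i 0) (Sg 0 y)"
    unfolding Sg_def by (simp add: pm_linear_sum[OF lin] sum_negf)
  finally have "Sg 0 y = - \<rho> (tm n i 0) (Sg 0 y)" .
  then show ?thesis by (metis minus_equation_iff)
qed

definition K where "K = {v. binv v \<and> (\<forall>i. Suc i < n \<longrightarrow> tau i v = - v)}"

lemma Bs_Sg_in_K: "y \<in> basis_space A \<Longrightarrow> Bs (Borel n) (Sg 0 y) \<in> K"
  by (simp add: K_def binv_Bs closed_Sg tau_Bs perm_swap_Sg)

end

section \<open>The Borel sum of a signed permutation sum, computed along a reduced word\<close>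

fun word :: "nat \<Rightarrow> nat \<Rightarrow> nat list" where
  "word n 0 = []"
| "word n (Suc d) = word n d @ [n - Suc d..<n - 1]"

text \<open>\<open>word n d\<close> is a reduced word of the longest permutation of the last d
  indices. Each step of \<open>wsign\<close> collects (-1)^d from the sign of \<open>sig k d\<close>
  and -1 from the q - 1 torus elements of one row.\<close>

fun wsign :: "nat \<Rightarrow> 'a::comm_ring_1" where
  "wsign 0 = 1"
| "wsign (Suc d) = - wsign d * (- 1) ^ d"

lemma word_bound: "d \<le> n \<Longrightarrow> set (word n d) \<subseteq> {i. Suc i < n}"
  by (induction d) auto

lemma wsign_square: "wsign d * wsign d = (1 :: 'a::comm_ring_1)"
proof (induction d)
  case (Suc d)
  have "wsign (Suc d) * wsign (Suc d) = (wsign d * wsign d) * ((- 1) ^ d * (- 1) ^ d :: 'a)"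
    by (simp add: algebra_simps)
  also have "((- 1) ^ d * (- 1) ^ d :: 'a) = 1" by (simp add: power_mult_distrib[symmetric])
  finally show ?case using Suc by simp
qed simp

text \<open>\<open>sig k d\<close> sends k + d to k and fixes k + d + 1, so it conjugates the root
  matrix at (k + d, k + d + 1) to the one at (k, k + d + 1); the last transposition of
  \<open>sig k (Suc d)\<close> then completes it to \<open>tm\<close>.\<close>

lemma em_tm_sig:
  assumes "Suc (k + d) < n"
  shows "em n k (Suc (k + d)) c * perm_mat n (sig k (Suc d)) = (perm_mat n (sig k d) * tm n (k + d) c :: 'k::field mat)"
proof -
  let ?t = "Transposition.transpose (k + d) (Suc (k + d))"
  have s: "sig k d permutes {..<n}" using sig_permutes[of k d n] assms by (auto intro: permutes_subset)
  have t: "?t permutes {..<n}" using assms by (intro permutes_swap_id) auto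
  have 1: "perm_mat n (sig k (Suc d)) = (perm_mat n (sig k d) * perm_mat n ?t :: 'k mat)"
    using perm_mat_comp[where 'k='k, OF s t] by simp
  have "em n k (Suc (k + d)) c * perm_mat n (sig k d) = (perm_mat n (sig k d) * em n (k + d) (Suc (k + d)) c :: 'k mat)"
    using perm_mat_em[OF s, of "k + d" "Suc (k + d)" c] assms by (simp add: sig_top sig_fix)
  then have 2: "em n k (Suc (k + d)) c * perm_mat n (sig k (Suc d)) =
      perm_mat n (sig k d) * (em n (k + d) (Suc (k + d)) c * perm_mat n ?t :: 'k mat)"
    unfolding 1 assoc_mult_mat[OF em_carrier perm_mat_carrier perm_mat_carrier, symmetric]
    by (simp only: assoc_mult_mat[OF perm_mat_carrier em_carrier perm_mat_carrier])
  have 3: "em n (k + d) (Suc (k + d)) c * perm_mat n ?t = (tm n (k + d) c :: 'k mat)"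
  proof (rule eq_matI)
    fix a b assume "a < dim_row (tm n (k + d) c :: 'k mat)" "b < dim_col (tm n (k + d) c :: 'k mat)"
    then have ab: "a < n" "b < n" by (auto simp: tm_def)
    then have tb: "?t b < n" using permutes_in_image[OF t, of b] by simp
    show "(em n (k + d) (Suc (k + d)) c * perm_mat n ?t) $$ (a, b) = (tm n (k + d) c :: 'k mat) $$ (a, b)"
      using ab tb assms by (subst mult_perm_mat[OF em_carrier t ab])
        (auto simp: em_def tm_def Transposition.transpose_def)
  qed (auto simp: em_def tm_def perm_mat_def)
  show ?thesis using 2 3 by simp
qed

context glrep
begin

lemma Borel_from_GL: "Borel_from n k \<subseteq> GL n"
  by (auto simp: Borel_from_def Borel_GL)

lemma row_group_GL: "k < n \<Longrightarrow> row_group n k m \<subseteq> GL n"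
  by (auto intro: Borel_GL row_group_Borel)

lemma Bs_Borel_from_step:
  assumes k: "k < n" and y: "y \<in> basis_space A"
  shows "Bs (Borel_from n k) y = Bs (Borel_from n (Suc k)) (Bs (row_group n k (n - 1)) y)"
proof -
  let ?d = "\<lambda>a l. if a = l then 1 else (0::'k)"
  define j :: "'k mat \<Rightarrow> 'k mat \<times> 'k mat" where
    "j = (\<lambda>g. (mat n n (\<lambda>(a, l). if a = k then ?d a l else g $$ (a, l)), mat n n (\<lambda>(a, l). if a = k then g $$ (a, l) else ?d a l)))"
  have "Bs (Borel_from n k) y = (\<Sum>(b, h)\<in>Borel_from n (Suc k) \<times> row_group n k (n - 1). \<rho> (b * h) y)"
    unfolding Bs_def
  proof (rule sum.reindex_bij_witness[where i = "\<lambda>(b, h). b * h" and j = j])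
    fix g :: "'k mat" assume g: "g \<in> Borel_from n k"
    have jg: "fst (j g) \<in> Borel_from n (Suc k)" "snd (j g) \<in> row_group n k (n - 1)"
      using g k by (auto simp: Borel_from_def row_group_def j_def mem_Borel less_Suc_eq)
    then show "j g \<in> Borel_from n (Suc k) \<times> row_group n k (n - 1)" by (metis mem_Times_iff)
    have gc: "g \<in> carrier_mat n n" using g by (auto simp: Borel_from_def mem_Borel)
    have e: "fst (j g) * snd (j g) = g"
    proof (rule eq_matI)
      fix a l assume "a < dim_row g" "l < dim_col g"
      then have al: "a < n" "l < n" using gc by auto
      show "(fst (j g) * snd (j g)) $$ (a, l) = g $$ (a, l)"
        unfolding Borel_from_row_group_entry[OF jg k al] using al k by (auto simp: j_def)
    qed (use gc in \<open>auto simp: j_def\<close>)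
    then show "(case j g of (b, h) \<Rightarrow> b * h) = g" by (simp add: case_prod_unfold)
    then show "(case j g of (b, h) \<Rightarrow> \<rho> (b * h) y) = \<rho> g y" by (simp add: case_prod_unfold)
  next
    fix bh :: "'k mat \<times> 'k mat" assume bh: "bh \<in> Borel_from n (Suc k) \<times> row_group n k (n - 1)"
    obtain b h where bhe: "bh = (b, h)" by (cases bh)
    have b: "b \<in> Borel_from n (Suc k)" and h: "h \<in> row_group n k (n - 1)" using bh bhe by auto
    have bc: "b \<in> carrier_mat n n" and hc: "h \<in> carrier_mat n n"
      using b h by (auto simp: Borel_from_def row_group_def mem_Borel)
    note e = Borel_from_row_group_entry[OF b h k]
    have "b * h \<in> Borel_from n k"
      using b Borel_mult[OF _ row_group_Borel[OF h k], of b] e k by (auto simp: Borel_from_def)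
    then show "(case bh of (b, h) \<Rightarrow> b * h) \<in> Borel_from n k" by (simp add: bhe)
    have 1: "fst (j (b * h)) = b"
      using bc b k by (intro eq_matI) (auto simp: j_def e Borel_from_def simp del: index_mult_mat)
    have 2: "snd (j (b * h)) = h"
      using hc h k by (intro eq_matI) (auto simp: j_def e row_group_def simp del: index_mult_mat)
    show "j (case bh of (b, h) \<Rightarrow> b * h) = bh" using 1 2 by (simp add: bhe prod_eq_iff)
  qed
  also have "\<dots> = (\<Sum>b\<in>Borel_from n (Suc k). \<Sum>h\<in>row_group n k (n - 1). \<rho> b (\<rho> h y))"
    unfolding sum.cartesian_product[symmetric] using Borel_from_GL[of "Suc k"] row_group_GL[OF k, of "n - 1"] y
    by (intro sum.cong refl) (auto intro!: mult)
  also have "\<dots> = Bs (Borel_from n (Suc k)) (Bs (row_group n k (n - 1)) y)"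
    unfolding Bs_def by (simp add: pm_linear_sum[OF lin])
  finally show ?thesis .
qed

text \<open>Right multiplication by \<open>em n k (Suc m) c\<close> adds c times column k to column
  m + 1. Hence the entry at m + 1 of row k splits off, with c its quotient by the diagonal
  entry.\<close>

lemma Bs_row_group_step:
  assumes k: "k \<le> m" "Suc m < n" and y: "y \<in> basis_space A"
  shows "Bs (row_group n k (Suc m)) y = Bs (row_group n k m) (\<Sum>c\<in>UNIV. \<rho> (em n k (Suc m) c) y)"
proof -
  have kn: "k < n" and kS: "k \<noteq> Suc m" using k by auto
  define j :: "'k mat \<Rightarrow> 'k mat \<times> 'k" where
    "j = (\<lambda>g. (mat n n (\<lambda>(a, l). if a = k \<and> l = Suc m then 0 else g $$ (a, l)), g $$ (k, Suc m) / g $$ (k, k)))"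
  have ent: "(h * em n k (Suc m) c) $$ (a, l) = h $$ (a, l) + (if l = Suc m \<and> a = k then c * h $$ (k, k) else 0)"
    if h: "h \<in> row_group n k m'" and al: "a < n" "l < n" for h :: "'k mat" and c a l m'
  proof -
    have hc: "h \<in> carrier_mat n n" using h by (simp add: row_group_def)
    show ?thesis using h al kn kS
      by (subst mult_em[OF hc kn k(2) kS al]) (auto simp: row_group_def)
  qed
  have "Bs (row_group n k (Suc m)) y = (\<Sum>(h, c)\<in>row_group n k m \<times> UNIV. \<rho> (h * em n k (Suc m) c) y)"
    unfolding Bs_def
  proof (rule sum.reindex_bij_witness[where i = "\<lambda>(h, c). h * em n k (Suc m) c" and j = j])
    fix g :: "'k mat" assume g: "g \<in> row_group n k (Suc m)"
    have jg: "fst (j g) \<in> row_group n k m" using g kn kS k by (auto simp: row_group_def j_def)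
    then show "j g \<in> row_group n k m \<times> UNIV" by (metis mem_Times_iff UNIV_I)
    have gc: "g \<in> carrier_mat n n" using g by (auto simp: row_group_def)
    have e: "fst (j g) * em n k (Suc m) (snd (j g)) = g"
    proof (rule eq_matI)
      fix a l assume "a < dim_row g" "l < dim_col g"
      then have al: "a < n" "l < n" using gc by auto
      show "(fst (j g) * em n k (Suc m) (snd (j g))) $$ (a, l) = g $$ (a, l)"
        unfolding ent[OF jg al] using al kn kS g by (auto simp: j_def row_group_def)
    qed (use gc in \<open>auto simp: j_def em_def\<close>)
    then show "(case j g of (h, c) \<Rightarrow> h * em n k (Suc m) c) = g" by (simp add: case_prod_unfold)
    then show "(case j g of (h, c) \<Rightarrow> \<rho> (h * em n k (Suc m) c) y) = \<rho> g y" by (simp add: case_prod_unfold)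
  next
    fix hc' :: "'k mat \<times> 'k" assume hc': "hc' \<in> row_group n k m \<times> UNIV"
    obtain h c where e: "hc' = (h, c)" by (cases hc')
    have h: "h \<in> row_group n k m" using hc' e by auto
    have hc: "h \<in> carrier_mat n n" using h by (auto simp: row_group_def)
    have gc: "h * em n k (Suc m) c \<in> carrier_mat n n" by (rule mult_carrier_mat[OF hc em_carrier])
    have "h * em n k (Suc m) c \<in> row_group n k (Suc m)"
      using gc h kn k by (auto simp: row_group_def[of n k "Suc m"] ent[OF h] simp del: index_mult_mat)
        (auto simp: row_group_def)
    then show "(case hc' of (h, c) \<Rightarrow> h * em n k (Suc m) c) \<in> row_group n k (Suc m)" by (simp add: e)
    have 1: "fst (j (h * em n k (Suc m) c)) = h"
      using hc kn k h by (intro eq_matI) (auto simp: j_def ent[OF h] row_group_def simp del: index_mult_mat)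
    have 2: "snd (j (h * em n k (Suc m) c)) = c"
      using hc kn k h kS by (auto simp: j_def ent[OF h] row_group_def simp del: index_mult_mat)
    show "j (case hc' of (h, c) \<Rightarrow> h * em n k (Suc m) c) = hc'" using 1 2 by (simp add: e prod_eq_iff)
  qed
  also have "\<dots> = (\<Sum>h\<in>row_group n k m. \<Sum>c\<in>UNIV. \<rho> h (\<rho> (em n k (Suc m) c) y))"
    unfolding sum.cartesian_product[symmetric] using row_group_GL[OF kn, of m] y k
    by (intro sum.cong refl mult Borel_GL[OF em_Borel]) auto
  also have "\<dots> = Bs (row_group n k m) (\<Sum>c\<in>UNIV. \<rho> (em n k (Suc m) c) y)"
    unfolding Bs_def by (simp add: pm_linear_sum[OF lin])
  finally show ?thesis .
qed

text \<open>The group is a torus of q - 1 elements, all fixing \<open>v\<close>, and q - 1 is -1 in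
  the field.\<close>

lemma Bs_row_group_diag:
  assumes v: "binv v" and k: "k < n"
  shows "Bs (row_group n k k) v = - v"
proof -
  let ?d = "\<lambda>c. mat n n (\<lambda>(a, l). if a = l then if a = k then c else 1 else (0::'k))"
  have "Bs (row_group n k k) v = (\<Sum>h\<in>(row_group n k k :: 'k mat set). v)"
    unfolding Bs_def using v row_group_Borel[OF _ k] by (intro sum.cong) (auto simp: binv_def)
  also have "\<dots> = (\<Sum>c\<in>UNIV - {0::'k}. v)"
  proof (rule sum.reindex_bij_witness[where i = ?d and j = "\<lambda>h. h $$ (k, k)"])
    fix h :: "'k mat" assume h: "h \<in> row_group n k k"
    have hc: "h \<in> carrier_mat n n" using h by (simp add: row_group_def)
    have z: "h $$ (k, l) = 0" if "l < n" "l \<noteq> k" for l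
      using h that by (cases "l < k") (auto simp: row_group_def)
    have z': "h $$ (a, l) = (if a = l then if a = k then h $$ (k, k) else 1 else 0)" if "a < n" "l < n" for a l
      using h that z by (cases "a = k") (auto simp: row_group_def)
    show "?d (h $$ (k, k)) = h"
      using hc by (intro eq_matI) (auto simp: z')
  qed (use k in \<open>auto simp: row_group_def\<close>)
  also have "\<dots> = pm_scale (of_nat (CARD('k) - 1)) v"
    by (simp add: pm_sum_const card_Diff_subset)
  finally show ?thesis by (simp add: of_nat_card_field)
qed

text \<open>Peeling off column k + d + 1 of the row replaces \<open>sig k (Suc d)\<close> by
  \<open>sig k d\<close> and \<open>v\<close> by \<open>tau (k + d) v\<close>, through
  \<open>em_tm_sig\<close>. What remains at the end is the torus, which gives the sign.\<close>

lemma Bs_row_group_sig: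
  "binv v \<Longrightarrow> k + d < n \<Longrightarrow> Bs (row_group n k (k + d)) (\<rho> (perm_mat n (sig k d)) v) = - foldr tau [k..<k + d] v"
proof (induction d arbitrary: v)
  case 0
  then show ?case using Bs_row_group_diag[of v k] by (simp add: perm_mat_id perm_mat_id[unfolded id_def] binv_def one)
next
  case (Suc d)
  have vA: "v \<in> basis_space A" using Suc.prems by (simp add: binv_def)
  have sG: "perm_mat n (sig k e) \<in> GL n" if "k + e < n" for e
    using sig_permutes[OF that] by (rule permutes_GL)
  have i: "Suc (k + d) < n" using Suc.prems by simp
  have sG': "perm_mat n (sig k (Suc d)) \<in> GL n" by (rule sG) (use i in simp)
  have sv: "\<rho> (perm_mat n (sig k (Suc d))) v \<in> basis_space A"
    by (rule closed[OF sG' vA])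
  have "\<rho> (em n k (Suc (k + d)) c) (\<rho> (perm_mat n (sig k (Suc d))) v) = \<rho> (perm_mat n (sig k d)) (\<rho> (tm n (k + d) c) v)" for c
    using em_tm_sig[OF i, of c] mult[OF Borel_GL[OF em_Borel[of k "Suc (k + d)" n c]] sG' vA]
      mult[OF sG[of d] tm_GL[OF i, of c] vA] i Suc.prems by (simp del: sig.simps)
  then have "Bs (row_group n k (k + Suc d)) (\<rho> (perm_mat n (sig k (Suc d))) v) =
      Bs (row_group n k (k + d)) (\<rho> (perm_mat n (sig k d)) (tau (k + d) v))"
    using Bs_row_group_step[of k "k + d", OF _ i sv] by (simp add: tau_def pm_linear_sum[OF lin])
  also have "\<dots> = - foldr tau [k..<k + d] (tau (k + d) v)"
    using Suc.prems by (intro Suc.IH binv_tau) auto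
  finally show ?case by (simp del: sig.simps)
qed

text \<open>If the cycle stops before the last index, the root matrices at (k, n - 1) are conjugated
  into B and fix \<open>v\<close>. The sum over the last column then consists of q equal
  vectors.\<close>

lemma Bs_row_group_sig_0:
  assumes v: "binv v" and d: "Suc (k + d) < n"
  shows "Bs (row_group n k (n - 1)) (\<rho> (perm_mat n (sig k d)) v) = 0"
proof -
  obtain m where m: "n = Suc (Suc m)" "k + d \<le> m" using d by (intro that[of "n - 2"]) auto
  have vA: "v \<in> basis_space A" using v by (simp add: binv_def)
  have s: "sig k d permutes {k..<n}" using d by (intro sig_permutes) auto
  have sv: "\<rho> (perm_mat n (sig k d)) v \<in> basis_space A" by (rule closed[OF permutes_GL[OF s] vA])
  have "\<rho> (em n k (Suc m) c) (\<rho> (perm_mat n (sig k d)) v) = \<rho> (perm_mat n (sig k d)) v" for c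
  proof -
    have e: "em n (k + d) (Suc m) c \<in> Borel n" "em n k (Suc m) c \<in> Borel n" using m by (auto intro!: em_Borel)
    have "perm_mat n (sig k d) * em n (k + d) (Suc m) c = em n k (Suc m) c * perm_mat n (sig k d)"
      using perm_mat_em[OF permutes_lessThan[OF s], of "k + d" "Suc m" c] m by (simp add: sig_top sig_fix)
    then have "\<rho> (em n k (Suc m) c) (\<rho> (perm_mat n (sig k d)) v) = \<rho> (perm_mat n (sig k d)) (\<rho> (em n (k + d) (Suc m) c) v)"
      using mult[OF permutes_GL[OF s] Borel_GL[OF e(1)] vA] mult[OF Borel_GL[OF e(2)] permutes_GL[OF s] vA] by simp
    then show ?thesis using v e by (simp add: binv_def)
  qed
  then have "(\<Sum>c\<in>UNIV. \<rho> (em n k (Suc m) c) (\<rho> (perm_mat n (sig k d)) v)) = 0"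
    by (simp add: pm_sum_const of_nat_card_field)
  then show ?thesis using Bs_row_group_step[of k m, OF _ _ sv] m pm_linear_0[OF lin_Bs] by simp
qed

text \<open>Such a permutation fixes k and only permutes the later columns, so conjugation by it
  permutes the row group.\<close>

lemma Bs_row_group_perm:
  assumes w: "w permutes {Suc k..<n}" and k: "k < n" and y: "y \<in> basis_space A"
  shows "Bs (row_group n k (n - 1)) (\<rho> (perm_mat n w) y) = \<rho> (perm_mat n w) (Bs (row_group n k (n - 1)) y)"
proof -
  have wn: "w permutes {..<n}" by (rule permutes_lessThan[OF w])
  define cj where "cj v h = mat n n (\<lambda>(a, l). h $$ (v a, v l))" for v :: "nat \<Rightarrow> nat" and h :: "'k mat"
  have cjH: "cj v h \<in> row_group n k (n - 1)" if v: "v permutes {Suc k..<n}" and h: "h \<in> row_group n k (n - 1)" for v h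
  proof -
    have vk: "v a = a" if "a \<le> k" for a using v that by (simp add: permutes_not_in)
    have vb: "v a < n" if "a < n" for a
      using permutes_in_image[OF permutes_lessThan[OF v], of a] that by simp
    have inj: "v x = v y \<longleftrightarrow> x = y" for x y using permutes_inj[OF v] by (auto simp: inj_def)
    have ne: "v a \<noteq> k" if "a \<noteq> k" for a using inj[of a k] vk[of k] that by simp
    show ?thesis using h k vk vb ne by (auto simp: row_group_def cj_def inj)
  qed
  have cjcj: "cj v (cj v' h) = h" if "v permutes {Suc k..<n}" "v' permutes {Suc k..<n}" "v' \<circ> v = id" and h: "h \<in> row_group n k (n - 1)" for v v' h
  proof -
    have vb: "v a < n" if "a < n" for a
      using permutes_in_image[OF permutes_lessThan[OF \<open>v permutes {Suc k..<n}\<close>], of a] that by simp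
    have "v' (v a) = a" for a using \<open>v' \<circ> v = id\<close> by (metis comp_apply id_apply)
    then show ?thesis using h vb by (intro eq_matI) (auto simp: cj_def row_group_def)
  qed
  have wi: "Hilbert_Choice.inv w permutes {Suc k..<n}" by (rule permutes_inv[OF w])
  have "Bs (row_group n k (n - 1)) (\<rho> (perm_mat n w) y) = (\<Sum>h\<in>row_group n k (n - 1). \<rho> (perm_mat n w) (\<rho> h y))"
    unfolding Bs_def
  proof (rule sum.reindex_bij_witness[where i = "cj (Hilbert_Choice.inv w)" and j = "cj w"])
    fix h :: "'k mat" assume h: "h \<in> row_group n k (n - 1)"
    show "cj w h \<in> row_group n k (n - 1)" "cj (Hilbert_Choice.inv w) h \<in> row_group n k (n - 1)"
      using cjH w wi h by auto
    show "cj (Hilbert_Choice.inv w) (cj w h) = h" "cj w (cj (Hilbert_Choice.inv w) h) = h"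
      using cjcj[OF wi w _ h] cjcj[OF w wi _ h] permutes_inv_o[OF w] by auto
    have hc: "h \<in> carrier_mat n n" using h by (simp add: row_group_def)
    have cc: "cj w h \<in> carrier_mat n n" by (simp add: cj_def)
    have "perm_mat n w * cj w h = h * perm_mat n w"
    proof (rule eq_matI)
      fix a l assume "a < dim_row (h * perm_mat n w)" "l < dim_col (h * perm_mat n w)"
      then have al: "a < n" "l < n" using hc by (auto simp: perm_mat_def)
      have wa: "Hilbert_Choice.inv w a < n" using permutes_in_image[OF permutes_inv[OF wn], of a] al by simp
      show "(perm_mat n w * cj w h) $$ (a, l) = (h * perm_mat n w) $$ (a, l)"
        using al wa permutes_inverses(1)[OF w]
        by (subst perm_mat_mult_entry[OF cc wn al], subst mult_perm_mat[OF hc wn al]) (simp add: cj_def)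
    qed (use hc in \<open>auto simp: perm_mat_def cj_def\<close>)
    moreover have "h \<in> GL n" "cj w h \<in> GL n" using row_group_GL[OF k] h cjH[OF w h] by auto
    ultimately show "\<rho> (perm_mat n w) (\<rho> (cj w h) y) = \<rho> h (\<rho> (perm_mat n w) y)"
      using mult[OF permutes_GL[OF w] _ y, of "cj w h"] mult[OF _ permutes_GL[OF w] y, of h] by simp
  qed
  then show ?thesis unfolding Bs_def by (simp add: pm_linear_sum[OF lin])
qed

lemma Bs_row_group_Sg:
  assumes k: "k < n" and y: "y \<in> basis_space A"
  shows "Bs (row_group n k (n - 1)) (Sg (Suc k) y) = Sg (Suc k) (Bs (row_group n k (n - 1)) y)"
  unfolding Sg_def pm_linear_sum[OF lin_Bs] pm_linear_scale[OF lin_Bs]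
  using Bs_row_group_perm[OF _ k y] by (intro sum.cong) auto

text \<open>Coset decomposition of the permutations of {k..<n} by those of {k+1..<n}, with the
  cycles \<open>sig k d\<close> as representatives.\<close>

lemma Sg_step:
  assumes k: "k < n" and y: "y \<in> basis_space A"
  shows "Sg k y = (\<Sum>d<n - k. pm_scale ((- 1) ^ d) (Sg (Suc k) (\<rho> (perm_mat n (sig k d)) y)))"
proof -
  define f where "f w = pm_scale (of_int (sign w)) (\<rho> (perm_mat n w) y)" for w
  have S: "{k..<n} = insert k {Suc k..<n}" using k by auto
  have inner: "(\<Sum>q | q permutes {Suc k..<n}. f (Hilbert_Choice.inv (Transposition.transpose k b \<circ> q))) =
      pm_scale ((- 1) ^ (b - k)) (Sg (Suc k) (\<rho> (perm_mat n (sig k (b - k))) y))" if b: "b \<in> {k..<n}" for b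
  proof -
    let ?t = "Transposition.transpose k b" and ?s = "sig k (b - k)"
    have s: "?s permutes {k..<n}" using b by (intro sig_permutes) auto
    have t: "?t permutes {k..<n}" using b by (intro permutes_swap_id) auto
    \<comment> \<open>The available summation rule uses transpositions (k b) as representatives;
      this product, which fixes k, lies in the smaller group and converts them to the
      cycles.\<close>
    have st: "?s \<circ> ?t permutes {Suc k..<n}"
    proof (rule permutes_superset[OF permutes_compose[OF t s]])
      fix x assume x: "x \<in> {k..<n} - {Suc k..<n}"
      then have "x = k" by auto
      then show "(?s \<circ> ?t) x = x" using sig_top[of k "b - k"] b by simp
    qed
    have "(\<Sum>q | q permutes {Suc k..<n}. f (Hilbert_Choice.inv (?t \<circ> q))) = (\<Sum>q | q permutes {Suc k..<n}. f (Hilbert_Choice.inv q \<circ> ?t))"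
    proof (rule sum.cong)
      fix q assume "q \<in> {q. q permutes {Suc k..<n}}"
      then have "bij q" by (auto intro: permutes_bij)
      then show "f (Hilbert_Choice.inv (?t \<circ> q)) = f (Hilbert_Choice.inv q \<circ> ?t)"
        by (simp add: o_inv_distrib[OF permutes_bij[OF t]])
    qed simp
    also have "\<dots> = (\<Sum>q | q permutes {Suc k..<n}. f (q \<circ> ?t))"
      by (rule sum_permutations_inverse[symmetric])
    also have "\<dots> = (\<Sum>q | q permutes {Suc k..<n}. f (q \<circ> (?s \<circ> ?t) \<circ> ?t))"
      by (rule sum_permutations_compose_right[OF st])
    also have "\<dots> = (\<Sum>q | q permutes {Suc k..<n}. pm_scale ((- 1) ^ (b - k)) (pm_scale (of_int (sign q)) (\<rho> (perm_mat n q) (\<rho> (perm_mat n ?s) y))))"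
    proof (rule sum.cong)
      fix q assume "q \<in> {q. q permutes {Suc k..<n}}"
      then have q: "q permutes {Suc k..<n}" by simp
      have pq: "permutation q" using q unfolding permutation_permutes by blast
      have e: "q \<circ> (?s \<circ> ?t) \<circ> ?t = q \<circ> ?s" by (simp add: comp_assoc)
      have "sign (q \<circ> ?s) = sign q * (- 1) ^ (b - k)"
        using sign_compose[OF pq permutation_sig] by (simp add: sign_sig)
      moreover have "\<rho> (perm_mat n (q \<circ> ?s)) y = \<rho> (perm_mat n q) (\<rho> (perm_mat n ?s) y)"
        using perm_mat_comp[where 'k='k, OF permutes_lessThan[OF q] permutes_lessThan[OF s]]
          mult[OF permutes_GL[OF q] permutes_GL[OF s] y] by simp
      ultimately show "f (q \<circ> (?s \<circ> ?t) \<circ> ?t) = pm_scale ((- 1) ^ (b - k)) (pm_scale (of_int (sign q)) (\<rho> (perm_mat n q) (\<rho> (perm_mat n ?s) y)))"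
        unfolding e f_def by (simp add: mult.commute)
    qed simp
    also have "\<dots> = pm_scale ((- 1) ^ (b - k)) (Sg (Suc k) (\<rho> (perm_mat n ?s) y))"
      unfolding Sg_def by (rule pm.scale_sum_right[symmetric])
    finally show ?thesis .
  qed
  have "Sg k y = sum f {w. w permutes {k..<n}}" by (simp add: Sg_def f_def[abs_def])
  also have "\<dots> = (\<Sum>w | w permutes {k..<n}. f (Hilbert_Choice.inv w))" by (rule sum_permutations_inverse)
  also have "\<dots> = (\<Sum>b\<in>{k..<n}. \<Sum>q | q permutes {Suc k..<n}. f (Hilbert_Choice.inv (Transposition.transpose k b \<circ> q)))"
    unfolding S by (rule sum_over_permutations_insert) auto
  also have "\<dots> = (\<Sum>b\<in>{k..<n}. pm_scale ((- 1) ^ (b - k)) (Sg (Suc k) (\<rho> (perm_mat n (sig k (b - k))) y)))"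
    using inner by (intro sum.cong) auto
  also have "\<dots> = (\<Sum>d<n - k. pm_scale ((- 1) ^ d) (Sg (Suc k) (\<rho> (perm_mat n (sig k d)) y)))"
    using k by (intro sum.reindex_bij_witness[of _ "\<lambda>d. d + k" "\<lambda>b. b - k"]) auto
  finally show ?thesis .
qed

text \<open>Among the coset representatives of \<open>Sg_step\<close>, all but the longest cycle are
  annihilated by row k (\<open>Bs_row_group_sig_0\<close>); the survivor contributes one more
  segment of the reduced word.\<close>

lemma Bs_Borel_from_Sg:
  "d \<le> n \<Longrightarrow> binv v \<Longrightarrow> Bs (Borel_from n (n - d)) (Sg (n - d) v) = pm_scale (wsign d) (foldr tau (word n d) v)"
proof (induction d arbitrary: v)
  case 0
  have "Borel_from n n = {1\<^sub>m n :: 'k mat}"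
    by (auto simp: Borel_from_def mem_Borel intro!: eq_matI)
  then show ?case using 0 by (simp add: Bs_def Sg_def binv_def one perm_mat_id[unfolded id_def] id_def)
next
  case (Suc d)
  define k where "k = n - Suc d"
  have k: "k < n" "n - d = Suc k" "k + d = n - 1" using Suc.prems by (auto simp: k_def)
  have dk: "d < n - k" using k(1,3) by linarith
  have vA: "v \<in> basis_space A" using Suc.prems by (simp add: binv_def)
  have sA: "\<rho> (perm_mat n (sig k e)) v \<in> basis_space A" if "k + e < n" for e
    by (rule closed[OF permutes_GL[OF sig_permutes[OF that]] vA])
  have "Bs (row_group n k (n - 1)) (Sg k v) =
      (\<Sum>e<n - k. pm_scale ((- 1) ^ e) (Sg (Suc k) (Bs (row_group n k (n - 1)) (\<rho> (perm_mat n (sig k e)) v))))"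
    unfolding Sg_step[OF k(1) vA] pm_linear_sum[OF lin_Bs] pm_linear_scale[OF lin_Bs]
    using sA by (intro sum.cong refl) (auto simp: Bs_row_group_Sg[OF k(1), simplified])
  also have "\<dots> = (\<Sum>e<n - k. if e = d then pm_scale ((- 1) ^ d) (Sg (Suc k) (- foldr tau [k..<k + d] v)) else 0)"
  proof (rule sum.cong)
    fix e assume "e \<in> {..<n - k}"
    then have e: "k + e < n" by auto
    show "pm_scale ((- 1) ^ e) (Sg (Suc k) (Bs (row_group n k (n - 1)) (\<rho> (perm_mat n (sig k e)) v))) =
       (if e = d then pm_scale ((- 1) ^ d) (Sg (Suc k) (- foldr tau [k..<k + d] v)) else 0)"
      using e k Suc.prems Bs_row_group_sig[of v k d] Bs_row_group_sig_0[of v k e] by (auto simp: pm_linear_0[OF lin_Sg])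
  qed simp
  also have "\<dots> = pm_scale (- ((- 1) ^ d)) (Sg (Suc k) (foldr tau [k..<k + d] v))"
    using dk by (simp add: pm_linear_uminus[OF lin_Sg])
  finally have H: "Bs (row_group n k (n - 1)) (Sg k v) = pm_scale (- ((- 1) ^ d)) (Sg (Suc k) (foldr tau [k..<k + d] v))" .
  have "Bs (Borel_from n k) (Sg k v) = pm_scale (- ((- 1) ^ d)) (Bs (Borel_from n (Suc k)) (Sg (Suc k) (foldr tau [k..<k + d] v)))"
    unfolding Bs_Borel_from_step[OF k(1) closed_Sg[OF vA]] H by (rule pm_linear_scale[OF lin_Bs])
  also have "Bs (Borel_from n (Suc k)) (Sg (Suc k) (foldr tau [k..<k + d] v)) =
      pm_scale (wsign d) (foldr tau (word n d) (foldr tau [k..<k + d] v))"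
    unfolding k(2)[symmetric] using Suc.prems k by (intro Suc.IH binv_foldr_tau) auto
  finally show ?case using k by (simp add: k_def[symmetric] mult.commute)
qed

text \<open>
  On \<open>B\<close>-invariants the projector onto \<open>K\<close> is thus, up to sign, the operator \<open>\<tau>\<^sub>w\<close> of a reduced
  word of the longest permutation. On \<open>K\<close> itself it acts as a sign, so no division by a group order is needed.
\<close>

lemma Bs_Sg:
  assumes "binv v" shows "Bs (Borel n) (Sg 0 v) = pm_scale (wsign n) (foldr tau (word n n) v)"
proof -
  have "Borel_from n 0 = (Borel n :: 'k mat set)" by (auto simp: Borel_from_def)
  then show ?thesis using Bs_Borel_from_Sg[OF order_refl assms] by simp
qed

definition St_const :: 'k where "St_const = wsign n * (- 1) ^ length (word n n)"

lemma St_const_square: "St_const * St_const = 1"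
proof -
  have "St_const * St_const = (wsign n * wsign n) * ((- 1) ^ length (word n n) * (- 1) ^ length (word n n) :: 'k)"
    by (simp add: St_const_def algebra_simps)
  then show ?thesis by (simp add: wsign_square power_mult_distrib[symmetric])
qed

lemma Bs_Sg_K: "y \<in> K \<Longrightarrow> Bs (Borel n) (Sg 0 y) = pm_scale St_const y"
  using foldr_tau_eigen[of y "word n n"] word_bound[of n n] by (simp add: K_def Bs_Sg St_const_def)

text \<open>By \<open>Bs_Sg\<close> the Borel sum becomes a word in the operators
  \<open>tau\<close>, each of which \<open>Sg 0\<close> absorbs as -1. This is the Steinberg
  quasi-idempotent relation.\<close>

lemma Sg_Bs_Sg: "binv v \<Longrightarrow> Sg 0 (Bs (Borel n) (Sg 0 v)) = pm_scale St_const (Sg 0 v)"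
  using Sg_foldr_tau[of v "word n n"] word_bound[of n n]
  by (simp add: Bs_Sg St_const_def pm_linear_scale[OF lin_Sg])

end

section \<open>The group algebra as a module, and homomorphisms out of its Steinberg ideal\<close>

lemma left_act_lin_ext: "left_act g x = lin_ext (\<lambda>h. Poly_Mapping.single (g * h) 1) x"
  by (simp add: left_act_def galg_mult_def)

lemma galg_mult_left_act: "galg_mult x y = lin_ext (\<lambda>g. left_act g y) x"
  by (simp add: galg_mult_def left_act_lin_ext)

lemma left_act_single: "left_act g (Poly_Mapping.single h 1) = Poly_Mapping.single (g * h) 1"
  by (simp add: left_act_lin_ext)

lemma group_algebra_basis_space: "group_algebra n = basis_space (GL n)"
  by (simp add: group_algebra_def basis_space_def)

lemma pm_linear_left_act: "pm_linear (left_act g)"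
  using pm_linear_lin_ext by (simp add: left_act_lin_ext[abs_def])

interpretation fg: glrep n "GL n" "left_act :: 'k::{field,finite} mat \<Rightarrow> _" for n
proof
  show lin: "pm_linear (left_act g)" for g :: "'k mat" by (rule pm_linear_left_act)
  fix g h :: "'k mat" and x :: "'k mat \<Rightarrow>\<^sub>0 'k"
  assume x: "x \<in> basis_space (GL n)"
  show "left_act (1\<^sub>m n) x = x"
    by (rule pm_linear_eqI[OF lin _ _ x]) (auto simp: pm_linear_def left_act_single left_mult_one_mat[OF GL_carrier])
  assume g: "g \<in> GL n"
  show "left_act g x \<in> basis_space (GL n)"
    by (rule pm_linear_closed[OF lin _ x]) (auto simp: left_act_single GL_mult g intro: basis_space_single)
  assume h: "h \<in> GL n"
  show "left_act (g * h) x = left_act g (left_act h x)"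

    by (rule pm_linear_eqI[OF lin pm_linear_comp[OF lin lin] _ x])
      (simp add: left_act_single assoc_mult_mat[OF GL_carrier[OF g] GL_carrier[OF h] GL_carrier])
qed

lemma binv_Bs_one: "fg.binv n (fg.Bs (Borel n) (Poly_Mapping.single (1\<^sub>m n) (1::'k::{field,finite})))"
  by (rule fg.binv_Bs) (simp add: basis_space_single GL_one)

lemma steinberg_gen_alt:
  "steinberg_gen n = fg.Sg n 0 (fg.Bs (Borel n) (Poly_Mapping.single (1\<^sub>m n) (1::'k::{field,finite})))"
proof -
  let ?B = "\<Sum>b\<in>Borel n. Poly_Mapping.single b (1::'k)"
  have B: "fg.Bs (Borel n) (Poly_Mapping.single (1\<^sub>m n) (1::'k)) = ?B"
    unfolding fg.Bs_def by (intro sum.cong) (auto simp: left_act_single mem_Borel)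
  have "steinberg_gen n = lin_ext (\<lambda>g. left_act g ?B)
      (\<Sum>w | w permutes {..<n}. Poly_Mapping.single (perm_mat n w) (of_int (sign w)))"
    by (simp add: steinberg_gen_def galg_mult_left_act)
  also have "\<dots> = fg.Sg n 0 ?B"
    unfolding fg.Sg_def pm_linear_sum[OF pm_linear_lin_ext] lin_ext_single
    by (simp add: lessThan_atLeast0)
  finally show ?thesis by (simp add: B)
qed

lemma steinberg_gen_mem: "(steinberg_gen n :: 'k::{field,finite} mat \<Rightarrow>\<^sub>0 'k) \<in> basis_space (GL n)"
  unfolding steinberg_gen_alt using binv_Bs_one[where 'k = 'k and n = n] by (intro fg.closed_Sg) (simp add: fg.binv_def)

context glrep
begin

text \<open>The module map from the group algebra that sends the identity to \<open>y\<close>; for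
  \<open>left_act\<close> it is right multiplication by \<open>y\<close>.\<close>

definition orbit_map :: "('c \<Rightarrow>\<^sub>0 'k) \<Rightarrow> ('k mat \<Rightarrow>\<^sub>0 'k) \<Rightarrow> ('c \<Rightarrow>\<^sub>0 'k)" where
  "orbit_map y z = lin_ext (\<lambda>g. \<rho> g y) z"

lemma lin_orbit_map: "pm_linear (orbit_map y)"
  unfolding orbit_map_def[abs_def] by (rule pm_linear_lin_ext)

lemma orbit_map_closed: "y \<in> basis_space A \<Longrightarrow> z \<in> basis_space (GL n) \<Longrightarrow> orbit_map y z \<in> basis_space A"
  by (rule pm_linear_closed[OF lin_orbit_map]) (auto simp: orbit_map_def closed)

lemma orbit_map_left_act:
  assumes y: "y \<in> basis_space A" and g: "g \<in> GL n" and z: "z \<in> basis_space (GL n)"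
  shows "orbit_map y (left_act g z) = \<rho> g (orbit_map y z)"
  by (rule pm_linear_eqI[OF pm_linear_comp[OF lin_orbit_map pm_linear_left_act] pm_linear_comp[OF lin lin_orbit_map] _ z])
    (simp add: left_act_single, simp add: orbit_map_def mult g y)

lemma orbit_map_one: "y \<in> basis_space A \<Longrightarrow> orbit_map y (Poly_Mapping.single (1\<^sub>m n) 1) = y"
  by (simp add: orbit_map_def one)

lemma steinberg_orbit_map: "steinberg n = fg.orbit_map (steinberg_gen n) ` basis_space (GL n)"
  by (auto simp: steinberg_def group_algebra_basis_space galg_mult_left_act fg.orbit_map_def)

lemma steinberg_subset: "steinberg n \<subseteq> basis_space (GL n)"
  unfolding steinberg_orbit_map using fg.orbit_map_closed[OF steinberg_gen_mem] by auto

lemma steinberg_gen_in: "(steinberg_gen n :: 'k mat \<Rightarrow>\<^sub>0 'k) \<in> steinberg n"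
  unfolding steinberg_orbit_map using fg.orbit_map_one[OF steinberg_gen_mem[where 'k = 'k and n = n]] GL_one[where 'k = 'k and n = n]
  by (intro image_eqI[of _ _ "Poly_Mapping.single (1\<^sub>m n) 1"]) (auto intro: basis_space_single)

lemma steinberg_add: "x \<in> steinberg n \<Longrightarrow> y \<in> steinberg n \<Longrightarrow> x + y \<in> steinberg n"
  unfolding steinberg_orbit_map by (auto simp: pm_linear_add[OF fg.lin_orbit_map, symmetric] intro: basis_space_add)

lemma steinberg_scale: "x \<in> steinberg n \<Longrightarrow> pm_scale c x \<in> steinberg n"
  unfolding steinberg_orbit_map by (auto simp: pm_linear_scale[OF fg.lin_orbit_map, symmetric] intro: basis_space_scale)

lemma steinberg_0: "(0 :: 'k mat \<Rightarrow>\<^sub>0 'k) \<in> steinberg n"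
  using steinberg_scale[OF steinberg_gen_in, of 0] by simp

lemma steinberg_sum:
  fixes f :: "'i \<Rightarrow> ('k mat \<Rightarrow>\<^sub>0 'k)"
  shows "(\<And>i. i \<in> I \<Longrightarrow> f i \<in> steinberg n) \<Longrightarrow> sum f I \<in> steinberg n"
  by (induction I rule: infinite_finite_induct) (auto intro: steinberg_add steinberg_0)

lemma steinberg_left_act:
  assumes "g \<in> GL n" "x \<in> steinberg n" shows "left_act g x \<in> steinberg n"
proof -
  obtain z where z: "z \<in> basis_space (GL n)" "x = fg.orbit_map (steinberg_gen n) z"
    using assms(2) unfolding steinberg_orbit_map by auto
  show ?thesis unfolding z(2) fg.orbit_map_left_act[OF steinberg_gen_mem assms(1) z(1), symmetric] steinberg_orbit_map
    using fg.closed[OF assms(1) z(1)] by auto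
qed

abbreviation "Homs \<equiv> Hom_set (GL n) (steinberg n) left_act (basis_space A) \<rho>"

lemma Homs_sum:
  assumes h: "h \<in> Homs" and f: "\<And>i. i \<in> I \<Longrightarrow> f i \<in> steinberg n"
  shows "h (sum f I) = (\<Sum>i\<in>I. h (f i))"
proof -
  have h0: "h 0 = 0"
  proof -
    have "h (pm_scale 0 0) = pm_scale 0 (h 0)" using h steinberg_0 unfolding Hom_set_def by blast
    then show ?thesis by simp
  qed
  show ?thesis using f
  proof (induction I rule: infinite_finite_induct)
    case (insert i I)
    have "h (f i + sum f I) = h (f i) + h (sum f I)"
      using h insert.prems steinberg_sum[of I f] unfolding Hom_set_def by blast
    then show ?case using insert by simp
  qed (auto simp: h0)
qed

lemma Homs_scale: "h \<in> Homs \<Longrightarrow> x \<in> steinberg n \<Longrightarrow> h (pm_scale c x) = pm_scale c (h x)"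
  and Homs_act: "h \<in> Homs \<Longrightarrow> x \<in> steinberg n \<Longrightarrow> g \<in> GL n \<Longrightarrow> h (left_act g x) = \<rho> g (h x)"
  and Homs_closed: "h \<in> Homs \<Longrightarrow> x \<in> steinberg n \<Longrightarrow> h x \<in> basis_space A"
  by (auto simp: Hom_set_def)

lemma Homs_Bs:
  assumes h: "h \<in> Homs" and x: "x \<in> steinberg n"
  shows "h (fg.Bs (Borel n) x) = Bs (Borel n) (h x)"
  unfolding fg.Bs_def Bs_def using x
  by (subst Homs_sum[OF h]) (auto intro!: steinberg_left_act sum.cong Homs_act[OF h] intro: Borel_GL)

lemma Homs_Sg:
  assumes h: "h \<in> Homs" and x: "x \<in> steinberg n"
  shows "h (fg.Sg n 0 x) = Sg 0 (h x)"
  unfolding fg.Sg_def Sg_def using x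
  by (subst Homs_sum[OF h])
    (auto intro!: steinberg_left_act steinberg_scale permutes_GL sum.cong simp: Homs_scale[OF h] Homs_act[OF h] steinberg_left_act permutes_GL)

text \<open>The image under \<open>h\<close> of the quasi-idempotent relation for the generator. It
  shows that the value of \<open>h\<close> at the generator can be recovered from its Borel
  sum.\<close>

lemma Homs_gen:
  assumes h: "h \<in> Homs"
  shows "Sg 0 (Bs (Borel n) (h (steinberg_gen n))) = pm_scale St_const (h (steinberg_gen n))"
proof -
  let ?e = "steinberg_gen n :: 'k mat \<Rightarrow>\<^sub>0 'k"
  have e: "fg.Sg n 0 (fg.Bs (Borel n) ?e) = pm_scale St_const ?e"
    using fg.Sg_Bs_Sg[OF binv_Bs_one] unfolding steinberg_gen_alt[symmetric] by (simp add: St_const_def fg.St_const_def)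
  have Be: "fg.Bs (Borel n) ?e \<in> steinberg n"
    unfolding fg.Bs_def by (intro steinberg_sum steinberg_left_act steinberg_gen_in) (auto intro: Borel_GL)
  have "h (fg.Sg n 0 (fg.Bs (Borel n) ?e)) = Sg 0 (Bs (Borel n) (h ?e))"
    by (simp add: Homs_Sg[OF h Be] Homs_Bs[OF h steinberg_gen_in])
  then show ?thesis by (simp add: e Homs_scale[OF h steinberg_gen_in])
qed

lemma Homs_orbit_map:
  assumes h: "h \<in> Homs" and x: "x \<in> basis_space (GL n)"
  shows "h (fg.orbit_map (steinberg_gen n) x) = orbit_map (h (steinberg_gen n)) x"
proof -
  have k: "Poly_Mapping.keys x \<subseteq> GL n" using x by (simp add: basis_space_def)
  have "h (fg.orbit_map (steinberg_gen n) x) = (\<Sum>g\<in>Poly_Mapping.keys x. h (pm_scale (Poly_Mapping.lookup x g) (left_act g (steinberg_gen n))))"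
    unfolding fg.orbit_map_def lin_ext_def using k
    by (intro Homs_sum[OF h] steinberg_scale steinberg_left_act steinberg_gen_in) auto
  also have "\<dots> = orbit_map (h (steinberg_gen n)) x"
    unfolding orbit_map_def lin_ext_def using k
    by (intro sum.cong) (auto simp: Homs_scale[OF h] Homs_act[OF h] steinberg_left_act steinberg_gen_in)
  finally show ?thesis .
qed

lemma K_scale: "y \<in> K \<Longrightarrow> pm_scale c y \<in> K"
  by (auto simp: K_def binv_def basis_space_scale pm_linear_scale[OF lin] pm_linear_scale[OF lin_tau])

text \<open>A homomorphism is determined by its value at the generator, which
  \<open>Homs_gen\<close> recovers from the Borel sum. Conversely y in \<open>K\<close> comes from
  acting on \<open>Sg 0 y\<close>: the generator goes to \<open>St_const\<close> times
  \<open>Sg 0 y\<close>, and the Borel sum of \<open>Sg 0 y\<close> is again \<open>St_const\<close>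
  times y, so the two signs cancel.\<close>

lemma bij_Homs_K: "bij_betw (\<lambda>h. Bs (Borel n) (h (steinberg_gen n))) Homs K"
proof (rule bij_betw_imageI)
  let ?e = "steinberg_gen n :: 'k mat \<Rightarrow>\<^sub>0 'k" and ?P = "\<lambda>h. Bs (Borel n) (h (steinberg_gen n))"
  show "inj_on ?P Homs"
  proof (rule inj_onI)
    fix h h' assume h: "h \<in> Homs" "h' \<in> Homs" and eq: "?P h = ?P h'"
    have "pm_scale St_const (h ?e) = pm_scale St_const (h' ?e)"
      using Homs_gen[OF h(1)] Homs_gen[OF h(2)] eq by metis
    then have e: "h ?e = h' ?e" by (metis St_const_square pm.scale_scale pm.scale_one)
    show "h = h'"
    proof
      fix x show "h x = h' x"
      proof (cases "x \<in> steinberg n")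
        case True
        then show ?thesis unfolding steinberg_orbit_map using Homs_orbit_map[OF h(1)] Homs_orbit_map[OF h(2)] e by auto
      next
        case False
        then show ?thesis using h by (simp add: Hom_set_def)
      qed
    qed
  qed
  show "?P ` Homs = K"
  proof (intro equalityI subsetI)
    fix y assume "y \<in> ?P ` Homs"
    then obtain h where h: "h \<in> Homs" "y = ?P h" by auto
    have yA: "y \<in> basis_space A"
      unfolding h(2) using Homs_closed[OF h(1) steinberg_gen_in] by (intro closed_Bs) (auto intro: Borel_GL)
    have "Bs (Borel n) (Sg 0 y) = pm_scale St_const y"
      using arg_cong[OF Homs_gen[OF h(1)], of "Bs (Borel n)"] h(2) by (simp add: pm_linear_scale[OF lin_Bs])
    then have "y = pm_scale St_const (Bs (Borel n) (Sg 0 y))" by (simp add: St_const_square)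
    then show "y \<in> K" using K_scale[OF Bs_Sg_in_K[OF yA]] by metis
  next
    fix y assume y: "y \<in> K"
    then have yA: "y \<in> basis_space A" by (simp add: K_def binv_def)
    have sA: "Sg 0 y \<in> basis_space A" by (rule closed_Sg[OF yA])
    \<comment> \<open>Extension by 0 off the ideal is the normalisation built into
      \<open>Hom_set\<close>.\<close>
    define h where "h z = (if z \<in> steinberg n then orbit_map (Sg 0 y) z else 0)" for z
    have "h \<in> Homs"
      using steinberg_subset
      by (auto simp: Hom_set_def h_def steinberg_add steinberg_scale steinberg_left_act
          pm_linear_add[OF lin_orbit_map] pm_linear_scale[OF lin_orbit_map] intro!: orbit_map_closed[OF sA] orbit_map_left_act[OF sA])
    moreover have "?P h = y"
    proof -
      let ?o = "Poly_Mapping.single (1\<^sub>m n) (1::'k)"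
      have 1: "?o \<in> basis_space (GL n)" by (simp add: basis_space_single GL_one)
      have B1: "fg.Bs (Borel n) ?o \<in> basis_space (GL n)" using binv_Bs_one[where 'k = 'k and n = n] by (simp add: fg.binv_def)
      have "orbit_map (Sg 0 y) (fg.Bs (Borel n) ?o) = Bs (Borel n) (orbit_map (Sg 0 y) ?o)"
        unfolding fg.Bs_def Bs_def pm_linear_sum[OF lin_orbit_map]
        using 1 by (intro sum.cong) (auto intro!: orbit_map_left_act[OF sA] intro: Borel_GL)
      then have b: "orbit_map (Sg 0 y) (fg.Bs (Borel n) ?o) = pm_scale St_const y"
        by (simp add: orbit_map_one[OF sA] Bs_Sg_K[OF y])
      have "orbit_map (Sg 0 y) ?e = Sg 0 (orbit_map (Sg 0 y) (fg.Bs (Borel n) ?o))"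
        unfolding steinberg_gen_alt fg.Sg_def[of n 0 "fg.Bs _ _"] Sg_def[of 0 "orbit_map _ _"]
          pm_linear_sum[OF lin_orbit_map] pm_linear_scale[OF lin_orbit_map]
        using B1 by (intro sum.cong) (auto simp: orbit_map_left_act[OF sA permutes_GL])
      then have "h ?e = pm_scale St_const (Sg 0 y)"
        using steinberg_gen_in by (simp add: h_def b pm_linear_scale[OF lin_Sg])
      then show ?thesis by (simp add: pm_linear_scale[OF lin_Bs] Bs_Sg_K[OF y] St_const_square)
    qed
    ultimately show "y \<in> ?P ` Homs" by force
  qed
qed

lemma card_K:
  assumes "finite A"
  shows "CARD('k) ^ steinberg_mult n (basis_space A) \<rho> = card K"
proof -
  have "K \<subseteq> basis_space A" by (auto simp: K_def binv_def)
  then have fK: "finite K" using finite_basis_space[OF assms] finite_subset by blast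
  then have fH: "finite Homs" using bij_betw_finite[OF bij_Homs_K] by simp
  have "fs.subspace Homs"
    unfolding fs.subspace_def
    by (auto simp: Hom_set_def fun_scale_def basis_space_add basis_space_scale pm_linear_0[OF lin]
        pm_linear_add[OF lin] pm_linear_scale[OF lin] pm.scale_right_distrib mult.commute)
  then have "card Homs = CARD('k) ^ fs.dim Homs" using fH by (intro fs.card_subspace) auto
  then show ?thesis using bij_betw_same_card[OF bij_Homs_K] by (simp add: steinberg_mult_def)
qed

end

section \<open>Forms: creation and annihilation operators\<close>

text \<open>The squares are an axiom of their own because anticommutation does not make them vanish
  in characteristic 2.\<close>

locale anticomm =
  fixes D :: "'i \<Rightarrow> 'v::ab_group_add \<Rightarrow> 'v"
  assumes zero: "D i 0 = 0" and neg: "D i (- x) = - D i x"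
    and anti: "D i (D j x) = - D j (D i x)" and sq: "D i (D i x) = 0"
begin

lemma foldr_zero: "foldr D xs 0 = 0"
  by (induction xs) (auto simp: zero)

lemma foldr_neg: "foldr D xs (- x) = - foldr D xs x"
  by (induction xs) (auto simp: neg)

lemma foldr_move: "foldr D xs (D l x) = (if even (length xs) then D l (foldr D xs x) else - D l (foldr D xs x))"
proof (induction xs)
  case (Cons y ys)
  then show ?case using anti[of y l] by (auto simp: neg)
qed simp

lemma foldr_mem: "l \<in> set xs \<Longrightarrow> foldr D xs (D l x) = 0"
proof (induction xs)
  case (Cons y ys)
  show ?case
  proof (cases "l \<in> set ys")
    case False
    then have "l = y" using Cons.prems by simp
    then show ?thesis by (simp add: foldr_move neg sq)
  qed (use Cons.IH zero in simp)
qed simp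

lemma foldr_not_distinct: "\<not> distinct xs \<Longrightarrow> foldr D xs x = 0"
proof (induction xs)
  case (Cons y ys)
  show ?case
  proof (cases "distinct ys")
    case True
    then have "y \<in> set ys" using Cons.prems by simp
    then have "foldr D ys (D y x) = 0" by (rule foldr_mem)
    then have "D y (foldr D ys x) = 0" by (simp add: foldr_move split: if_splits)
    then show ?thesis by simp
  qed (use Cons.IH zero in simp)
qed simp

text \<open>The sign is the same for all arguments x but is left undetermined: later arguments need
  operators only up to sign, so no permutation sign has to be computed.\<close>

lemma foldr_mset:
  "mset xs = mset ys \<Longrightarrow> (\<forall>x. foldr D xs x = foldr D ys x) \<or> (\<forall>x. foldr D xs x = - foldr D ys x)"
proof (induction xs arbitrary: ys)
  case (Cons z xs)
  have "z \<in> set ys" using Cons.prems by (metis list.set_intros(1) set_mset_mset)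
  then obtain us vs where ys: "ys = us @ z # vs" by (meson split_list)
  have "mset xs = mset (us @ vs)" using Cons.prems ys by simp
  from Cons.IH[OF this] show ?case
    by (cases "even (length us)") (auto simp: ys foldr_move neg)
qed simp

end

text \<open>The sign of moving e_l past the factors of e_J with smaller index.\<close>

definition sg :: "nat \<Rightarrow> nat set \<Rightarrow> 'a::comm_ring_1" where
  "sg l J = (- 1) ^ card {i \<in> J. i < l}"

text \<open>
  A form is represented by its coefficients at the basis elements \<open>e\<^sub>J\<close>. Exterior multiplication
  by \<open>e\<^sub>l\<close> is \<open>cr l\<close>, contraction with the dual vector of \<open>e\<^sub>l\<close> is \<open>an l\<close>.
\<close>

definition cr :: "nat \<Rightarrow> (nat set \<Rightarrow> 'a::comm_ring_1) \<Rightarrow> nat set \<Rightarrow> 'a" where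
  "cr l \<omega> = (\<lambda>J. if l \<in> J then sg l J * \<omega> (J - {l}) else 0)"

definition an :: "nat \<Rightarrow> (nat set \<Rightarrow> 'a::comm_ring_1) \<Rightarrow> nat set \<Rightarrow> 'a" where
  "an l \<omega> = (\<lambda>J. if l \<in> J then 0 else sg l J * \<omega> (insert l J))"

definition sm :: "'a::comm_ring_1 \<Rightarrow> (nat set \<Rightarrow> 'a) \<Rightarrow> nat set \<Rightarrow> 'a" where
  "sm c \<omega> = (\<lambda>J. c * \<omega> J)"

definition ev :: "nat set \<Rightarrow> nat set \<Rightarrow> 'a::comm_ring_1" where
  "ev I = (\<lambda>J. if J = I then 1 else 0)"

lemma finite_lt: "finite {i \<in> J. i < (l::nat)}"
  by (rule finite_subset[of _ "{..<l}"]) auto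

lemma sg_insert:
  assumes "m \<notin> J" shows "sg l (insert m J) = (if m < l then - sg l J else sg l J)"
proof (cases "m < l")
  case True
  then have "{i \<in> insert m J. i < l} = insert m {i \<in> J. i < l}" by auto
  then show ?thesis using True assms finite_lt[of J l] by (simp add: sg_def)
next
  case False
  then have "{i \<in> insert m J. i < l} = {i \<in> J. i < l}" by auto
  then show ?thesis using False by (simp add: sg_def)
qed

lemma sg_eq_1: "(\<And>i.  i \<in> J \<Longrightarrow> l \<le> i) \<Longrightarrow> sg l J = 1"
proof -
  assume "\<And>i. i \<in> J \<Longrightarrow> l \<le> i"
  then have e: "{i \<in> J. i < l} = {}" by force
  show ?thesis unfolding sg_def e by simp
qed

lemma sg_remove:
  assumes "m \<in> J" shows "(sg l (J - {m}) :: 'a::comm_ring_1) = (if m < l then - sg l J else sg l J)"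
  using sg_insert[where 'a = 'a, of m "J - {m}" l] assms by (auto simp: insert_absorb split: if_splits)

lemma sg_sq: "sg l J * sg l J = 1"
  by (simp add: sg_def power_mult_distrib[symmetric])

lemma sg_sq': "sg l J * (sg l J * x) = x"
  by (simp add: mult.assoc[symmetric] sg_sq)

lemma cr_cr: "cr l (cr m \<omega>) = - cr m (cr l \<omega>)"
proof
  fix J
  have "J - {m} - {l} = J - {l} - {m}" by auto
  then show "cr l (cr m \<omega>) J = (- cr m (cr l \<omega>)) J"
    by (auto simp: cr_def sg_remove algebra_simps)
qed

lemma cr_cr_same: "cr l (cr l \<omega>) = 0"
  by (auto simp: cr_def fun_eq_iff)

lemma an_an: "an l (an m \<omega>) = - an m (an l \<omega>)"
proof
  fix J
  show "an l (an m \<omega>) J = (- an m (an l \<omega>)) J"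
    by (auto simp: an_def sg_insert algebra_simps insert_commute)
qed

lemma an_an_same: "an l (an l \<omega>) = 0"
  by (auto simp: an_def fun_eq_iff)

text \<open>The Clifford relation, from which all commutation rules of contractions with exterior
  multiplications follow.\<close>

lemma an_cr: "an l (cr m \<omega>) J + cr m (an l \<omega>) J = (if l = m then \<omega> J else 0)"
proof (cases "l = m")
  case True
  then show ?thesis by (auto simp: an_def cr_def sg_insert sg_remove sg_sq' insert_absorb)
next
  case False
  have "insert l J - {m} = insert l (J - {m})" using False by auto
  then show ?thesis using False by (auto simp: an_def cr_def sg_insert sg_remove algebra_simps)
qed

lemma cr_sm: "cr l (sm c \<omega>) = sm c (cr l \<omega>)" and an_sm: "an l (sm c \<omega>) = sm c (an l \<omega>)"
  by (auto simp: cr_def an_def sm_def fun_eq_iff)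

lemma cr_add: "cr l (\<omega> + \<eta>) = cr l \<omega> + cr l \<eta>" and an_add: "an l (\<omega> + \<eta>) = an l \<omega> + an l \<eta>"
  by (auto simp: cr_def an_def fun_eq_iff algebra_simps)

lemma cr_zero: "cr l 0 = 0" and an_zero: "an l 0 = 0"
  by (auto simp: cr_def an_def fun_eq_iff)

lemma cr_neg: "cr l (- \<omega>) = - cr l \<omega>" and an_neg: "an l (- \<omega>) = - an l \<omega>"
  by (auto simp: cr_def an_def fun_eq_iff)

lemma cr_sum: "cr l (\<lambda>J. \<Sum>i\<in>I. w i J) J = (\<Sum>i\<in>I. cr l (w i) J)"
  and an_sum: "an l (\<lambda>J. \<Sum>i\<in>I. w i J) J = (\<Sum>i\<in>I. an l (w i) J)"
  by (auto simp: cr_def an_def sum_distrib_left)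

lemma cr_ev: "cr l (ev I) = (if l \<in> I then 0 else sm (sg l I) (ev (insert l I)))"
proof
  fix J
  show "cr l (ev I) J = (if l \<in> I then 0 else sm (sg l I) (ev (insert l I))) J"
    by (auto simp: cr_def ev_def sm_def sg_insert)
qed

lemma an_ev: "an l (ev I) = (if l \<in> I then sm (sg l I) (ev (I - {l})) else 0)"
proof
  fix J
  show "an l (ev I) J = (if l \<in> I then sm (sg l I) (ev (I - {l})) else 0) J"
    by (auto simp: an_def ev_def sm_def sg_remove sg_insert)
qed

lemma sm_simps: "sm c (sm d \<omega>) = sm (c * d) \<omega>" "sm 1 \<omega> = \<omega>" "sm c 0 = 0" "sm 0 \<omega> = 0"
  "sm (- c) \<omega> = - sm c \<omega>" "sm c (- \<omega>) = - sm c \<omega>" "sm c (\<omega> + \<eta>) = sm c \<omega> + sm c \<eta>"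
  by (auto simp: sm_def fun_eq_iff algebra_simps)

interpretation cr: anticomm "cr :: nat \<Rightarrow> (nat set \<Rightarrow> 'a::comm_ring_1) \<Rightarrow> _"
  by standard (rule cr_zero cr_neg cr_cr cr_cr_same)+

interpretation an: anticomm "an :: nat \<Rightarrow> (nat set \<Rightarrow> 'a::comm_ring_1) \<Rightarrow> _"
  by standard (rule an_zero an_neg an_an an_an_same)+

section \<open>Multiplication by vectors, contraction with covectors, and minors\<close>

definition cre :: "nat \<Rightarrow> (nat \<Rightarrow> 'a::comm_ring_1) \<Rightarrow> (nat set \<Rightarrow> 'a) \<Rightarrow> nat set \<Rightarrow> 'a" where
  "cre n v \<omega> = (\<lambda>J. \<Sum>l<n. v l * cr l \<omega> J)"

definition ann :: "nat \<Rightarrow> (nat \<Rightarrow> 'a::comm_ring_1) \<Rightarrow> (nat set \<Rightarrow> 'a) \<Rightarrow> nat set \<Rightarrow> 'a" where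
  "ann n a \<omega> = (\<lambda>J. \<Sum>l<n. a l * an l \<omega> J)"

lemma cre_sm: "cre n v (sm c \<omega>) = sm c (cre n v \<omega>)" and ann_sm: "ann n v (sm c \<omega>) = sm c (ann n v \<omega>)"
  unfolding cre_def ann_def cr_sm an_sm
  by (auto simp: sm_def fun_eq_iff sum_distrib_left algebra_simps)

lemma cre_add: "cre n v (\<omega> + \<eta>) = cre n v \<omega> + cre n v \<eta>" and ann_add: "ann n v (\<omega> + \<eta>) = ann n v \<omega> + ann n v \<eta>"
  by (auto simp: cre_def ann_def cr_add an_add fun_eq_iff sum.distrib algebra_simps)

lemma cre_zero: "cre n v 0 = 0" and ann_zero: "ann n v 0 = 0"
  by (auto simp: cre_def ann_def cr_zero an_zero fun_eq_iff)

lemma cre_neg: "cre n v (- \<omega>) = - cre n v \<omega>" and ann_neg: "ann n v (- \<omega>) = - ann n v \<omega>"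
  by (auto simp: cre_def ann_def cr_neg an_neg fun_eq_iff sum_negf)

lemma cre_sum: "cre n v (\<lambda>J. \<Sum>i\<in>I. w i J) J = (\<Sum>i\<in>I. cre n v (w i) J)"
  and ann_sum: "ann n v (\<lambda>J. \<Sum>i\<in>I. w i J) J = (\<Sum>i\<in>I. ann n v (w i) J)"
  unfolding cre_def ann_def cr_sum an_sum sum_distrib_left by (rule sum.swap)+

lemma ann_covector_sum: "ann n (\<lambda>l. \<Sum>i\<in>I. c i * a i l) \<omega> J = (\<Sum>i\<in>I. c i * ann n (a i) \<omega> J)"
  unfolding ann_def sum_distrib_left sum_distrib_right
  by (subst sum.swap) (simp add: mult.assoc)

lemma cre_vector_sum: "cre n (\<lambda>l. \<Sum>i\<in>I. c i * a i l) \<omega> J = (\<Sum>i\<in>I. c i * cre n (a i) \<omega> J)"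
  unfolding cre_def sum_distrib_left sum_distrib_right
  by (subst sum.swap) (simp add: mult.assoc)

lemma ann_covector_add: "ann n (\<lambda>l. a l + b l) \<omega> J = ann n a \<omega> J + ann n b \<omega> J"
  and ann_covector_diff: "ann n (\<lambda>l. a l - b l) \<omega> J = ann n a \<omega> J - ann n b \<omega> J"
  by (simp_all add: ann_def algebra_simps sum.distrib sum_subtractf)

lemma double_sum_alternating:
  fixes T :: "nat \<Rightarrow> nat \<Rightarrow> 'a::comm_ring_1"
  assumes "\<And>l m. T l m = - T m l" and "\<And>l. T l l = 0"
  shows "(\<Sum>l<n. \<Sum>m<n. v l * (v m * T l m)) = 0"
proof -
  have "(\<Sum>x\<in>{..<n} \<times> {..<n}. v (fst x) * (v (snd x) * T (fst x) (snd x))) = 0"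
  proof (rule sum_antisym_involution[where \<sigma> = "\<lambda>(l, m). (m, l)"])
    fix x assume "x \<in> {..<n} \<times> {..<n}"
    obtain l m where x: "x = (l, m)" by (cases x)
    show "v (fst (case x of (l, m) \<Rightarrow> (m, l))) * (v (snd (case x of (l, m) \<Rightarrow> (m, l))) *
        T (fst (case x of (l, m) \<Rightarrow> (m, l))) (snd (case x of (l, m) \<Rightarrow> (m, l)))) =
      - (v (fst x) * (v (snd x) * T (fst x) (snd x)))"
      using assms(1)[of m l] by (simp add: x algebra_simps)
  qed (auto simp: assms(2))
  then show ?thesis by (simp add: sum.cartesian_product case_prod_unfold)
qed

lemma cre_cre_expand: "cre n v (cre n w \<omega>) J = (\<Sum>l<n. \<Sum>m<n. v l * (w m * cr l (cr m \<omega>) J))"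
proof -
  have "cr l (cre n w \<omega>) J = (\<Sum>m<n. w m * cr l (cr m \<omega>) J)" for l
    using cr_sum[of l "\<lambda>m. sm (w m) (cr m \<omega>)" "{..<n}" J] by (simp add: cre_def[abs_def] sm_def[abs_def] cr_sm[unfolded sm_def])
  then show ?thesis unfolding cre_def[of n v] by (simp add: sum_distrib_left)
qed

lemma ann_ann_expand: "ann n v (ann n w \<omega>) J = (\<Sum>l<n. \<Sum>m<n. v l * (w m * an l (an m \<omega>) J))"
proof -
  have "an l (ann n w \<omega>) J = (\<Sum>m<n. w m * an l (an m \<omega>) J)" for l
    using an_sum[of l "\<lambda>m. sm (w m) (an m \<omega>)" "{..<n}" J] by (simp add: ann_def[abs_def] sm_def[abs_def] an_sm[unfolded sm_def])
  then show ?thesis unfolding ann_def[of n v] by (simp add: sum_distrib_left)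
qed

lemma cre_cre: "cre n v (cre n w \<omega>) = - cre n w (cre n v \<omega>)"
proof
  fix J
  have "cre n v (cre n w \<omega>) J = (\<Sum>m<n. \<Sum>l<n. v l * (w m * cr l (cr m \<omega>) J))"
    unfolding cre_cre_expand by (rule sum.swap)
  also have "\<dots> = (\<Sum>m<n. \<Sum>l<n. - (w m * (v l * cr m (cr l \<omega>) J)))"
    by (intro sum.cong refl) (subst cr_cr, simp add: algebra_simps)
  finally show "cre n v (cre n w \<omega>) J = (- cre n w (cre n v \<omega>)) J"
    by (simp add: cre_cre_expand sum_negf)
qed

lemma ann_ann: "ann n v (ann n w \<omega>) = - ann n w (ann n v \<omega>)"
proof
  fix J
  have "ann n v (ann n w \<omega>) J = (\<Sum>m<n. \<Sum>l<n. v l * (w m * an l (an m \<omega>) J))"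
    unfolding ann_ann_expand by (rule sum.swap)
  also have "\<dots> = (\<Sum>m<n. \<Sum>l<n. - (w m * (v l * an m (an l \<omega>) J)))"
    by (intro sum.cong refl) (subst an_an, simp add: algebra_simps)
  finally show "ann n v (ann n w \<omega>) J = (- ann n w (ann n v \<omega>)) J"
    by (simp add: ann_ann_expand sum_negf)
qed

lemma cre_cre_same: "cre n v (cre n v \<omega>) = 0"
proof
  fix J
  have alt: "cr l (cr m \<omega>) J = - cr m (cr l \<omega>) J" for l m by (subst cr_cr) simp
  moreover have "cr l (cr l \<omega>) J = 0" for l by (simp add: cr_cr_same)
  ultimately have "(\<Sum>l<n. \<Sum>m<n. v l * (v m * cr l (cr m \<omega>) J)) = 0"
    by (rule double_sum_alternating)
  then show "cre n v (cre n v \<omega>) J = 0 J"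
    unfolding cre_cre_expand by simp
qed

lemma ann_ann_same: "ann n v (ann n v \<omega>) = 0"
proof
  fix J
  have alt: "an l (an m \<omega>) J = - an m (an l \<omega>) J" for l m by (subst an_an) simp
  moreover have "an l (an l \<omega>) J = 0" for l by (simp add: an_an_same)
  ultimately have "(\<Sum>l<n. \<Sum>m<n. v l * (v m * an l (an m \<omega>) J)) = 0"
    by (rule double_sum_alternating)
  then show "ann n v (ann n v \<omega>) J = 0 J"
    unfolding ann_ann_expand by simp
qed

interpretation cre: anticomm "\<lambda>j. cre n (G j)" for n and G :: "'i \<Rightarrow> nat \<Rightarrow> 'a::comm_ring_1"
  by standard (rule cre_zero cre_neg cre_cre cre_cre_same)+

interpretation ann: anticomm "\<lambda>j. ann n (a j)" for n and a :: "'i \<Rightarrow> nat \<Rightarrow> 'a::comm_ring_1"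
  by standard (rule ann_zero ann_neg ann_ann ann_ann_same)+

lemma ann_cr:
  assumes l: "l < n"
  shows "ann n a (cr l \<omega>) J + cr l (ann n a \<omega>) J = a l * \<omega> J"
proof -
  have "cr l (ann n a \<omega>) J = (\<Sum>m<n. a m * cr l (an m \<omega>) J)"
    using cr_sum[of l "\<lambda>m. sm (a m) (an m \<omega>)" "{..<n}" J] by (simp add: ann_def[abs_def] sm_def[abs_def] cr_sm[unfolded sm_def])
  then have "ann n a (cr l \<omega>) J + cr l (ann n a \<omega>) J = (\<Sum>m<n. a m * (an m (cr l \<omega>) J + cr l (an m \<omega>) J))"
    by (simp add: ann_def sum.distrib algebra_simps)
  also have "\<dots> = (\<Sum>m<n. if m = l then a m * \<omega> J else 0)"
    unfolding an_cr by (intro sum.cong) auto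
  finally show ?thesis using l by simp
qed

lemma ann_cre: "ann n a (cre n v \<omega>) J + cre n v (ann n a \<omega>) J = (\<Sum>l<n. v l * a l) * \<omega> J"
proof -
  have "ann n a (cre n v \<omega>) J = (\<Sum>l<n. v l * ann n a (cr l \<omega>) J)"
    using ann_sum[of n a "\<lambda>l. sm (v l) (cr l \<omega>)" "{..<n}" J]
    by (simp add: cre_def[abs_def] sm_def[abs_def] ann_sm[unfolded sm_def])
  then have "ann n a (cre n v \<omega>) J + cre n v (ann n a \<omega>) J = (\<Sum>l<n. v l * (ann n a (cr l \<omega>) J + cr l (ann n a \<omega>) J))"
    by (simp add: cre_def sum.distrib algebra_simps)
  also have "\<dots> = (\<Sum>l<n. v l * a l * \<omega> J)"
    by (intro sum.cong) (auto simp: ann_cr)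
  finally show ?thesis by (simp add: sum_distrib_right)
qed

text \<open>
  \<open>EE n G I\<close> is the image of \<open>e\<^sub>I\<close> under the algebra map \<open>e\<^sub>j \<mapsto> \<Sum>\<^sub>l G j l e\<^sub>l\<close>; its coefficients are the
  minors of \<open>G\<close>.
\<close>

definition EL :: "nat \<Rightarrow> (nat \<Rightarrow> nat \<Rightarrow> 'a::comm_ring_1) \<Rightarrow> nat list \<Rightarrow> nat set \<Rightarrow> 'a" where
  "EL n G xs = foldr (\<lambda>j. cre n (G j)) xs (ev {})"

abbreviation EE :: "nat \<Rightarrow> (nat \<Rightarrow> nat \<Rightarrow> 'a::comm_ring_1) \<Rightarrow> nat set \<Rightarrow> nat set \<Rightarrow> 'a" where
  "EE n G I \<equiv> EL n G (sorted_list_of_set I)"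

lemma EL_insort:
  assumes "sorted xs" "distinct xs"
  shows "cre n (G l) (EL n G xs) = (if l \<in> set xs then 0 else sm (sg l (set xs)) (EL n G (insort l xs)))"
  using assms
proof (induction xs)
  case Nil
  then show ?case by (simp add: EL_def sg_def sm_simps)
next
  case (Cons x xs)
  have eq: "EL n G (x # xs) = cre n (G x) (EL n G xs)" by (simp add: EL_def)
  consider "l < x" | "l = x" | "x < l" by linarith
  then show ?case
  proof cases
    case 1
    have "sg l (set (x # xs)) = (1::'a)" using Cons.prems 1 by (intro sg_eq_1) auto
    moreover have "l \<notin> set (x # xs)" using Cons.prems 1 by auto
    moreover have "insort l (x # xs) = l # x # xs" using 1 by simp
    ultimately show ?thesis by (simp add: EL_def sm_simps del: insort_key.simps set_simps)
  next
    case 2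
    then show ?thesis by (simp add: eq cre_cre_same)
  next
    case 3
    have IH: "cre n (G l) (EL n G xs) = (if l \<in> set xs then 0 else sm (sg l (set xs)) (EL n G (insort l xs)))"
      using Cons by simp
    have sg: "sg l (set (x # xs)) = (- sg l (set xs) :: 'a)"
      using sg_insert[of x "set xs" l] Cons.prems 3 by simp
    have "cre n (G l) (EL n G (x # xs)) = - cre n (G x) (cre n (G l) (EL n G xs))"
      unfolding eq by (rule cre_cre)
    also have "\<dots> = (if l \<in> set xs then 0 else sm (sg l (set (x # xs))) (cre n (G x) (EL n G (insort l xs))))"
      unfolding IH sg by (simp add: cre_zero cre_sm sm_simps)
    also have "\<dots> = (if l \<in> set (x # xs) then 0 else sm (sg l (set (x # xs))) (EL n G (insort l (x # xs))))"
      using 3 by (auto simp: EL_def)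
    finally show ?thesis .
  qed
qed

lemma EE_insert:
  assumes "finite I"
  shows "cre n (G l) (EE n G I) = (if l \<in> I then 0 else sm (sg l I) (EE n G (insert l I)))"
  using EL_insort[of "sorted_list_of_set I" n G l] assms by simp

lemma EE_empty: "EE n G {} = ev {}"
  by (simp add: EL_def)

lemma EL_support: "EL n G xs J \<noteq> 0 \<Longrightarrow> finite J \<and> J \<subseteq> {..<n} \<and> card J = length xs"
proof (induction xs arbitrary: J)
  case Nil
  then show ?case by (auto simp: EL_def ev_def split: if_splits)
next
  case (Cons x xs)
  have "(\<Sum>l<n. G x l * cr l (EL n G xs) J) \<noteq> 0" using Cons.prems by (simp add: EL_def cre_def)
  then obtain l where l: "l < n" "cr l (EL n G xs) J \<noteq> 0"
    by (metis (no_types, lifting) lessThan_iff mult_zero_right sum.neutral)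
  then have lJ: "l \<in> J" "EL n G xs (J - {l}) \<noteq> 0" by (auto simp: cr_def split: if_splits)
  from Cons.IH[OF lJ(2)] lJ(1) l(1) show ?case
    by (auto simp: card_Diff_singleton) (metis Suc_pred card_gt_0_iff empty_iff)
qed

text \<open>The endomorphism of the exterior algebra induced by G, linear over the coefficient
  ring.\<close>

definition Ehat :: "nat \<Rightarrow> (nat \<Rightarrow> nat \<Rightarrow> 'a::comm_ring_1) \<Rightarrow> (nat set \<Rightarrow> 'a) \<Rightarrow> nat set \<Rightarrow> 'a" where
  "Ehat n G \<eta> = (\<lambda>J. \<Sum>I\<in>Pow {..<n}. EE n G I J * \<eta> I)"

lemma Ehat_cr:
  assumes l: "l < n"
  shows "Ehat n G (cr l \<eta>) = cre n (G l) (Ehat n G \<eta>)"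
proof
  fix J
  have sgd: "sg l (I - {l}) = (sg l I :: 'a)" for I
    by (cases "l \<in> I") (auto simp: sg_remove)
  have "Ehat n G (cr l \<eta>) J = (\<Sum>I\<in>{I \<in> Pow {..<n}. l \<in> I}. EE n G I J * (sg l I * \<eta> (I - {l})))"
    unfolding Ehat_def by (rule sum.mono_neutral_cong_right) (auto simp: cr_def)
  also have "\<dots> = (\<Sum>I\<in>{I \<in> Pow {..<n}. l \<notin> I}. sg l I * EE n G (insert l I) J * \<eta> I)"
    by (rule sum.reindex_bij_witness[of _ "insert l" "\<lambda>I. I - {l}"])
      (use l in \<open>auto simp: insert_absorb sgd\<close>)
  also have "\<dots> = (\<Sum>I\<in>Pow {..<n}. cre n (G l) (EE n G I) J * \<eta> I)"
    by (rule sum.mono_neutral_cong_left) (auto simp: EE_insert finite_subset sm_def)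
  also have "\<dots> = cre n (G l) (Ehat n G \<eta>) J"
    using cre_sum[of n "G l" "\<lambda>I. sm (\<eta> I) (EE n G I)" "Pow {..<n}" J]
    by (simp add: Ehat_def[abs_def] sm_def[abs_def] cre_sm[unfolded sm_def] mult.commute)
  finally show "Ehat n G (cr l \<eta>) J = cre n (G l) (Ehat n G \<eta>) J" .
qed

lemma Ehat_ev_empty: "Ehat n G (ev {}) = ev {}"
proof
  fix J
  have "Ehat n G (ev {}) J = (\<Sum>I\<in>Pow {..<n}. if I = {} then EE n G I J else 0)"
    unfolding Ehat_def by (intro sum.cong) (auto simp: ev_def)
  then show "Ehat n G (ev {}) J = ev {} J" by (simp add: EL_def)
qed

lemma Ehat_sm: "Ehat n G (sm c \<eta>) = sm c (Ehat n G \<eta>)"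
  by (auto simp: Ehat_def sm_def fun_eq_iff sum_distrib_left algebra_simps)

lemma Ehat_add: "Ehat n G (\<omega> + \<eta>) = Ehat n G \<omega> + Ehat n G \<eta>"
  by (auto simp: Ehat_def fun_eq_iff sum.distrib algebra_simps)

lemma Ehat_sum: "Ehat n G (\<lambda>J. \<Sum>i\<in>I. w i J) J = (\<Sum>i\<in>I. Ehat n G (w i) J)"
  unfolding Ehat_def sum_distrib_left by (rule sum.swap)

text \<open>The Cauchy-Binet formula. It follows from \<open>Ehat_cr\<close> by building the form up
  one factor at a time, without expanding minors.\<close>

lemma Ehat_EL: "Ehat n G (EL n H xs) = EL n (\<lambda>j l. \<Sum>k<n. H j k * G k l) xs"
proof (induction xs)
  case Nil
  then show ?case by (simp add: EL_def Ehat_ev_empty)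
next
  case (Cons x xs)
  let ?e = "EL n H xs"
  show ?case
  proof
    fix J
    have "Ehat n G (EL n H (x # xs)) J = (\<Sum>k<n. H x k * Ehat n G (cr k ?e) J)"
      using Ehat_sum[of n G "\<lambda>k. sm (H x k) (cr k ?e)" "{..<n}" J]
      by (simp add: EL_def cre_def sm_def[abs_def] Ehat_sm[unfolded sm_def])
    also have "\<dots> = (\<Sum>k<n. H x k * cre n (G k) (Ehat n G ?e) J)"
      by (intro sum.cong) (auto simp: Ehat_cr)
    also have "\<dots> = cre n (\<lambda>l. \<Sum>k<n. H x k * G k l) (Ehat n G ?e) J"
      by (rule cre_vector_sum[symmetric])
    finally show "Ehat n G (EL n H (x # xs)) J = EL n (\<lambda>j l. \<Sum>k<n. H j k * G k l) (x # xs) J"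
      unfolding Cons.IH by (simp add: EL_def)
  qed
qed

lemma foldr_cr_upt: "k \<le> m \<Longrightarrow> foldr cr [k..<m] (ev {}) = (ev {k..<m} :: nat set \<Rightarrow> 'a::comm_ring_1)"
proof (induction rule: inc_induct)
  case base
  then show ?case by simp
next
  case (step k)
  have "sg k {Suc k..<m} = (1::'a)" by (intro sg_eq_1) auto
  moreover have "insert k {Suc k..<m} = {k..<m}" using step.hyps by auto
  ultimately show ?case using step by (simp add: upt_conv_Cons cr_ev sm_simps)
qed

lemma foldr_cr_sm: "foldr cr xs (sm c \<omega>) = sm c (foldr cr xs \<omega>)"
  by (induction xs) (auto simp: cr_sm)

lemma foldr_cr_sum: "foldr cr xs (\<lambda>J. \<Sum>i\<in>I. w i J) J = (\<Sum>i\<in>I. foldr cr xs (w i) J)"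
proof (induction xs arbitrary: J)
  case (Cons x xs)
  have "foldr cr xs (\<lambda>J. \<Sum>i\<in>I. w i J) = (\<lambda>J. \<Sum>i\<in>I. foldr cr xs (w i) J)" using Cons by auto
  then show ?case by (simp add: cr_sum)
qed simp

text \<open>In row k the terms l > k are absent by triangularity, and the terms l < k die because
  e_l is multiplied in again by the outer factors.\<close>

lemma foldr_cre_triangular:
  assumes tri: "\<And>j l. j < n \<Longrightarrow> l < n \<Longrightarrow> j < l \<Longrightarrow> G j l = 0"
  shows "k \<le> n \<Longrightarrow> foldr (\<lambda>j. cre n (G j)) [0..<k] \<eta> = sm (\<Prod>j<k. G j j) (foldr cr [0..<k] \<eta>)"
proof (induction k arbitrary: \<eta>)
  case 0
  then show ?case by (simp add: sm_simps)
next
  case (Suc k)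
  have "foldr cr [0..<k] (cre n (G k) \<eta>) = sm (G k k) (foldr cr [0..<k] (cr k \<eta>))"
  proof
    fix J
    have "foldr cr [0..<k] (cre n (G k) \<eta>) J = (\<Sum>l<n. foldr cr [0..<k] (sm (G k l) (cr l \<eta>)) J)"
      using foldr_cr_sum[of "[0..<k]" "\<lambda>l. sm (G k l) (cr l \<eta>)" "{..<n}" J]
      by (simp add: cre_def[abs_def] sm_def[abs_def])
    also have "\<dots> = (\<Sum>l<n. if l = k then sm (G k k) (foldr cr [0..<k] (cr k \<eta>)) J else 0)"
    proof (rule sum.cong)
      fix l assume "l \<in> {..<n}"
      moreover have "foldr cr [0..<k] (sm (G k l) (cr l \<eta>)) J = G k l * foldr cr [0..<k] (cr l \<eta>) J"
        unfolding foldr_cr_sm by (simp add: sm_def)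
      ultimately show "foldr cr [0..<k] (sm (G k l) (cr l \<eta>)) J = (if l = k then sm (G k k) (foldr cr [0..<k] (cr k \<eta>)) J else 0)"
        using tri[of k l] Suc.prems cr.foldr_mem[of l "[0..<k]" \<eta>]
        by (cases l k rule: linorder_cases) (auto simp: sm_def)
    qed simp
    finally show "foldr cr [0..<k] (cre n (G k) \<eta>) J = sm (G k k) (foldr cr [0..<k] (cr k \<eta>)) J"
      using Suc.prems by simp
  qed
  then show ?case using Suc by (simp add: sm_simps)
qed

lemma sg_cases: "sg l J = (1 :: 'a::comm_ring_1) \<or> sg l J = (- 1 :: 'a)"
  by (simp add: sg_def minus_one_power_iff)

lemma mset_sorted_list: "mset (sorted_list_of_set A) = mset_set A"
  by (metis mset_sorted_list_of_multiset sorted_list_of_mset_set)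

section \<open>Semilinear actions on forms\<close>

definition rhom :: "('a::comm_ring_1 \<Rightarrow> 'b::comm_ring_1) \<Rightarrow> bool" where
  "rhom s \<longleftrightarrow> (\<forall>x y. s (x + y) = s x + s y) \<and> (\<forall>x y. s (x * y) = s x * s y) \<and> s 1 = 1"

lemma rhom_add: "rhom s \<Longrightarrow> s (x + y) = s x + s y"
  and rhom_mult: "rhom s \<Longrightarrow> s (x * y) = s x * s y"
  and rhom_1: "rhom s \<Longrightarrow> s 1 = 1"
  by (auto simp: rhom_def)

lemma rhom_0: "rhom s \<Longrightarrow> s 0 = 0"
  using rhom_add[of s 0 0] by simp

lemma rhom_neg: "rhom s \<Longrightarrow> s (- x) = - s x"
  using rhom_add[of s x "- x"] by (simp add: rhom_0 minus_unique)

lemma rhom_diff: "rhom s \<Longrightarrow> s (x - y) = s x - s y"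
  using rhom_add[of s x "- y"] by (simp add: rhom_neg)

lemma rhom_sum: "rhom s \<Longrightarrow> s (sum f I) = (\<Sum>i\<in>I. s (f i))"
  by (induction I rule: infinite_finite_induct) (auto simp: rhom_0 rhom_add)

lemma rhom_prod: "rhom s \<Longrightarrow> s (prod f I) = (\<Prod>i\<in>I. s (f i))"
  by (induction I rule: infinite_finite_induct) (auto simp: rhom_1 rhom_mult)

lemma rhom_power: "rhom s \<Longrightarrow> s (x ^ m) = s x ^ m"
  by (induction m) (auto simp: rhom_1 rhom_mult)

lemma rhom_sg: "rhom s \<Longrightarrow> s (sg l J) = sg l J"
  by (simp add: sg_def rhom_power rhom_neg rhom_1)

text \<open>
  The semilinear action: \<open>s\<close> on coefficients, \<open>G\<close> on the exterior algebra.
\<close>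

definition fa :: "nat \<Rightarrow> (nat \<Rightarrow> nat \<Rightarrow> 'b::comm_ring_1) \<Rightarrow> ('a::comm_ring_1 \<Rightarrow> 'b) \<Rightarrow> (nat set \<Rightarrow> 'a) \<Rightarrow> nat set \<Rightarrow> 'b" where
  "fa n G s \<omega> = Ehat n G (\<lambda>I. s (\<omega> I))"

lemma fa_add: "rhom s \<Longrightarrow> fa n G s (\<omega> + \<eta>) = fa n G s \<omega> + fa n G s \<eta>"
  using Ehat_add[of n G "\<lambda>I. s (\<omega> I)" "\<lambda>I. s (\<eta> I)"] by (simp add: fa_def rhom_add plus_fun_def)

lemma fa_sm: "rhom s \<Longrightarrow> fa n G s (sm c \<omega>) = sm (s c) (fa n G s \<omega>)"
  using Ehat_sm[of n G "s c" "\<lambda>I. s (\<omega> I)"] by (simp add: fa_def rhom_mult sm_def)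

lemma fa_neg: "rhom s \<Longrightarrow> fa n G s (- \<omega>) = - fa n G s \<omega>"
  using fa_sm[of s n G "- 1" \<omega>] by (simp add: sm_simps rhom_neg rhom_1)

lemma fa_sum: "rhom s \<Longrightarrow> fa n G s (\<lambda>J. \<Sum>i\<in>I. w i J) J = (\<Sum>i\<in>I. fa n G s (w i) J)"
  using Ehat_sum[of n G "\<lambda>i J. s (w i J)" I J] by (simp add: fa_def rhom_sum)

lemma fa_cr:
  assumes "rhom s" "l < n"
  shows "fa n G s (cr l \<omega>) = cre n (G l) (fa n G s \<omega>)"
proof -
  have "(\<lambda>I. s (cr l \<omega> I)) = cr l (\<lambda>I. s (\<omega> I))"
    using assms(1) by (auto simp: cr_def fun_eq_iff rhom_mult rhom_sg rhom_0)
  then show ?thesis using Ehat_cr[OF assms(2), of G "\<lambda>I. s (\<omega> I)"] by (simp add: fa_def)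
qed

lemma fa_zero: "rhom s \<Longrightarrow> fa n G s 0 = 0"
  using fa_sm[of s n G 0 0] by (simp add: sm_simps rhom_0)

lemma Ehat_ev:
  assumes "I \<subseteq> {..<n}" shows "Ehat n G (ev I) = EE n G I"
proof
  fix J
  have "Ehat n G (ev I) J = (\<Sum>I'\<in>Pow {..<n}. if I' = I then EE n G I' J else 0)"
    unfolding Ehat_def by (intro sum.cong) (auto simp: ev_def)
  then show "Ehat n G (ev I) J = EE n G I J" using assms by simp
qed

lemma fa_ev: "rhom s \<Longrightarrow> I \<subseteq> {..<n} \<Longrightarrow> fa n G s (ev I) = EE n G I"
proof -
  assume "rhom s" "I \<subseteq> {..<n}"
  moreover from \<open>rhom s\<close> have "(\<lambda>J. s (ev I J)) = ev I" by (auto simp: ev_def rhom_0 rhom_1)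
  ultimately show ?thesis by (simp add: fa_def Ehat_ev)
qed

lemma form_expand:
  assumes "\<And>I. \<omega> I \<noteq> 0 \<Longrightarrow> I \<subseteq> {..<n::nat}"
  shows "\<omega> = (\<lambda>J. \<Sum>I\<in>Pow {..<n}. sm (\<omega> I) (ev I) J)"
proof
  fix J
  have "(\<Sum>I\<in>Pow {..<n}. sm (\<omega> I) (ev I) J) = (\<Sum>I\<in>Pow {..<n}. if I = J then \<omega> I else 0)"
    by (intro sum.cong) (auto simp: sm_def ev_def)
  then show "\<omega> J = (\<Sum>I\<in>Pow {..<n}. sm (\<omega> I) (ev I) J)" using assms[of J] by auto
qed

text \<open>By the Clifford relation both sides differ from the hypothesis \<open>IH\<close> only by
  the pairing of the covector with the new vector, and \<open>G\<close> says that these pairings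
  correspond.\<close>

lemma fa_ann_cr:
  assumes s: "rhom s" and i: "i < n" and G: "(\<Sum>l<n. G i l * a' l) = s (a i)"
    and IH: "fa n G s (ann n a \<omega>) = ann n a' (fa n G s \<omega>)"
  shows "fa n G s (ann n a (cr i \<omega>)) = ann n a' (fa n G s (cr i \<omega>))"
proof -
  have e: "ann n a (cr i \<omega>) = sm (a i) \<omega> + - cr i (ann n a \<omega>)"
    using ann_cr[OF i, of a \<omega>] by (auto simp: fun_eq_iff sm_def eq_diff_eq)
  have "fa n G s (ann n a (cr i \<omega>)) = sm (s (a i)) (fa n G s \<omega>) + - cre n (G i) (ann n a' (fa n G s \<omega>))"
    unfolding e fa_add[OF s] fa_sm[OF s] fa_neg[OF s] fa_cr[OF s i] IH ..
  also have "\<dots> = ann n a' (cre n (G i) (fa n G s \<omega>))"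
    using ann_cre[of n a' "G i" "fa n G s \<omega>"] G by (auto simp: fun_eq_iff sm_def diff_eq_eq)
  finally show ?thesis by (simp add: fa_cr[OF s i])
qed

text \<open>Equivariance of contraction reduces to equivariance of the covector, assumption
  \<open>G\<close>. Basis forms are built by successive \<open>cr i\<close>, starting from the empty
  form, which every contraction kills.\<close>

lemma fa_ann:
  assumes s: "rhom s" and G: "\<And>i. i < n \<Longrightarrow> (\<Sum>l<n. G i l * a' l) = s (a i)"
    and supp: "\<And>I. \<omega> I \<noteq> 0 \<Longrightarrow> I \<subseteq> {..<n}"
  shows "fa n G s (ann n a \<omega>) = ann n a' (fa n G s \<omega>)"
proof -
  have ev: "fa n G s (ann n a (sm f (ev I))) = ann n a' (fa n G s (sm f (ev I)))" if "I \<subseteq> {..<n}" for f I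
  proof -
    have "finite I" using that finite_subset by blast
    then show ?thesis using that
    proof (induction I arbitrary: f)
      case empty
      have 0: "ann n v (ev {}) = 0" for v :: "nat \<Rightarrow> 'x::comm_ring_1"
        by (auto simp: ann_def an_ev fun_eq_iff)
      show ?case unfolding ann_sm fa_sm[OF s] fa_ev[OF s empty.prems] EE_empty 0
        by (simp add: fa_zero[OF s] sm_simps)
    next
      case (insert i I)
      have "cr i (sm (f * sg i I) (ev I)) = sm f (ev (insert i I))"
        using insert.hyps by (simp add: cr_sm cr_ev sm_simps mult.assoc sg_sq)
      moreover have "fa n G s (ann n a (cr i (sm (f * sg i I) (ev I)))) = ann n a' (fa n G s (cr i (sm (f * sg i I) (ev I))))"
        using insert by (intro fa_ann_cr[OF s _ G]) auto
      ultimately show ?case by simp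
    qed
  qed
  note w = form_expand[of \<omega> n, OF supp]
  show ?thesis
  proof
    fix J
    have "ann n a \<omega> = (\<lambda>J. \<Sum>I\<in>Pow {..<n}. ann n a (sm (\<omega> I) (ev I)) J)"
      by (subst w) (auto simp: ann_sum)
    then have "fa n G s (ann n a \<omega>) J = (\<Sum>I\<in>Pow {..<n}. fa n G s (ann n a (sm (\<omega> I) (ev I))) J)"
      by (simp add: fa_sum[OF s])
    also have "\<dots> = (\<Sum>I\<in>Pow {..<n}. ann n a' (fa n G s (sm (\<omega> I) (ev I))) J)"
      using ev by (intro sum.cong) auto
    also have "\<dots> = ann n a' (\<lambda>J. \<Sum>I\<in>Pow {..<n}. fa n G s (sm (\<omega> I) (ev I)) J) J"
      by (rule ann_sum[symmetric])
    also have "(\<lambda>J. \<Sum>I\<in>Pow {..<n}. fa n G s (sm (\<omega> I) (ev I)) J) = fa n G s \<omega>"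
      by (subst (2) w) (auto simp: fa_sum[OF s])
    finally show "fa n G s (ann n a \<omega>) J = ann n a' (fa n G s \<omega>) J" .
  qed
qed

lemma sorted_list_lessThan: "sorted_list_of_set {..<n} = [0..<n::nat]"
  by (simp add: lessThan_atLeast0)

lemma EE_top_triangular:
  assumes "\<And>j l. j < n \<Longrightarrow> l < n \<Longrightarrow> j < l \<Longrightarrow> G j l = (0::'a::comm_ring_1)"
  shows "EE n G {..<n} = sm (\<Prod>j<n. G j j) (ev {..<n})"
  unfolding EL_def sorted_list_lessThan
  using foldr_cre_triangular[of n G n "ev {}", OF assms order_refl] foldr_cr_upt[where 'a = 'a, of 0 n]
  by (simp add: lessThan_atLeast0)

lemma cre_unit:
  assumes "m < n" shows "cre n (\<lambda>l. if l = m then 1 else 0) \<omega> = cr m \<omega>"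
proof
  fix J
  have "cre n (\<lambda>l. if l = m then 1 else 0) \<omega> J = (\<Sum>l<n. if l = m then cr l \<omega> J else 0)"
    unfolding cre_def by (intro sum.cong) auto
  then show "cre n (\<lambda>l. if l = m then 1 else 0) \<omega> J = cr m \<omega> J" using assms by simp
qed

text \<open>Together with \<open>EE_top_triangular\<close> this gives the action on the top exterior
  power for just those matrices that enter the definition of \<open>K\<close>; the general
  identification with the determinant is bypassed.\<close>

lemma EE_top_swap:
  fixes G :: "nat \<Rightarrow> nat \<Rightarrow> 'a::comm_ring_1"
  assumes i: "Suc i < n"
    and Gi: "\<And>l. G i l = (if l = i then c else if l = Suc i then 1 else 0)"
    and GS: "\<And>l. G (Suc i) l = (if l = i then 1 else 0)"
    and Gj: "\<And>j l. j \<noteq> i \<Longrightarrow> j \<noteq> Suc i \<Longrightarrow> G j l = (if l = j then 1 else 0)"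
  shows "EE n G {..<n} = - ev {..<n}"
proof -
  have other: "foldr (\<lambda>j. cre n (G j)) xs \<omega> = foldr cr xs \<omega>"
    if "i \<notin> set xs" "Suc i \<notin> set xs" "set xs \<subseteq> {..<n}" for xs \<omega>
    using that
  proof (induction xs)
    case (Cons x xs)
    have "G x = (\<lambda>l. if l = x then 1 else 0)" using Gj Cons.prems by auto
    then show ?case using Cons cre_unit[of x n] by simp
  qed simp
  have "[0..<n] = [0..<i] @ [i..<n]" using i upt_add_eq_append[of 0 i "n - i"] by simp
  then have upt: "[0..<n] = [0..<i] @ i # Suc i # [Suc (Suc i)..<n]"
    using i by (simp add: upt_conv_Cons)
  define w where "w = foldr cr [Suc (Suc i)..<n] (ev {} :: nat set \<Rightarrow> 'a)"
  have S: "cre n (G (Suc i)) w = cr i w"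
    using i by (simp add: GS[abs_def] cre_unit)
  have I: "cre n (G i) (cr i w) = - cr i (cr (Suc i) w)"
  proof
    fix J
    have "cre n (G i) (cr i w) J = (\<Sum>l<n. (if l = i then c else if l = Suc i then 1 else 0) * cr l (cr i w) J)"
      by (simp add: cre_def Gi)
    also have "\<dots> = c * cr i (cr i w) J + 1 * cr (Suc i) (cr i w) J"
      using i by (intro sum_if_two) auto
    also have "\<dots> = cr (Suc i) (cr i w) J" by (simp add: cr_cr_same)
    also have "\<dots> = (- cr i (cr (Suc i) w)) J" by (subst cr_cr) simp
    finally show "cre n (G i) (cr i w) J = (- cr i (cr (Suc i) w)) J" .
  qed
  have "EE n G {..<n} = foldr cr [0..<i] (cre n (G i) (cre n (G (Suc i)) w))"
    unfolding EL_def sorted_list_lessThan upt w_def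
    using i other[of "[0..<i]"] other[of "[Suc (Suc i)..<n]"] by (auto simp: subset_iff)
  also have "\<dots> = - foldr cr [0..<i] (cr i (cr (Suc i) w))"
    by (simp add: S I cr.foldr_neg)
  also have "foldr cr [0..<i] (cr i (cr (Suc i) w)) = foldr cr [0..<n] (ev {})"
    by (simp add: upt w_def)
  also have "\<dots> = ev {..<n}" by (simp add: foldr_cr_upt lessThan_atLeast0)
  finally show ?thesis .
qed

definition Fsup :: "nat \<Rightarrow> nat \<Rightarrow> (nat set \<Rightarrow> 'a::zero) set" where
  "Fsup n j = {\<omega>. \<forall>J. \<omega> J \<noteq> 0 \<longrightarrow> J \<subseteq> {..<n} \<and> card J = j}"

lemma FsupD: "\<omega> \<in> Fsup n j \<Longrightarrow> \<omega> J \<noteq> 0 \<Longrightarrow> J \<subseteq> {..<n}" "\<omega> \<in> Fsup n j \<Longrightarrow> \<omega> J \<noteq> 0 \<Longrightarrow> card J = j"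
  by (auto simp: Fsup_def)

lemma Fsup_add: "\<omega> \<in> Fsup n j \<Longrightarrow> \<eta> \<in> Fsup n j \<Longrightarrow> \<omega> + \<eta> \<in> Fsup n j" for \<omega> :: "nat set \<Rightarrow> 'a::monoid_add"
proof -
  assume w: "\<omega> \<in> Fsup n j" "\<eta> \<in> Fsup n j"
  have "\<omega> J \<noteq> 0 \<or> \<eta> J \<noteq> 0" if "(\<omega> + \<eta>) J \<noteq> 0" for J using that by auto
  then show ?thesis using w unfolding Fsup_def by blast
qed

lemma Fsup_sm: "\<omega> \<in> Fsup n j \<Longrightarrow> sm c \<omega> \<in> Fsup n j"
proof -
  assume w: "\<omega> \<in> Fsup n j"
  have "\<omega> J \<noteq> 0" if "sm c \<omega> J \<noteq> 0" for J using that by (auto simp: sm_def)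
  then show ?thesis using w unfolding Fsup_def by blast
qed

lemma Fsup_sum: "(\<And>i. i \<in> I \<Longrightarrow> w i \<in> Fsup n j) \<Longrightarrow> (\<lambda>J. \<Sum>i\<in>I. w i J) \<in> Fsup n j" for w :: "'i \<Rightarrow> nat set \<Rightarrow> 'a::comm_monoid_add"
proof -
  assume w: "\<And>i. i \<in> I \<Longrightarrow> w i \<in> Fsup n j"
  have "\<exists>i\<in>I. w i J \<noteq> 0" if "(\<Sum>i\<in>I. w i J) \<noteq> 0" for J using that by (meson sum.neutral)
  then show ?thesis using w unfolding Fsup_def by blast
qed

lemma Fsup_ann:
  assumes "\<omega> \<in> Fsup n (Suc j)" shows "ann n a \<omega> \<in> Fsup n j"
  unfolding Fsup_def
proof (intro CollectI allI impI)
  fix J assume "ann n a \<omega> J \<noteq> 0"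
  then obtain l where "an l \<omega> J \<noteq> 0"
    unfolding ann_def by (metis (no_types, lifting) mult_zero_right sum.neutral)
  then have "l \<notin> J" "\<omega> (insert l J) \<noteq> 0" by (auto simp: an_def split: if_splits)
  then have "insert l J \<subseteq> {..<n}" "card (insert l J) = Suc j" using assms by (auto simp: Fsup_def)
  moreover have "finite J" using \<open>insert l J \<subseteq> {..<n}\<close> by (meson finite_lessThan finite_subset insert_subset)
  ultimately show "J \<subseteq> {..<n} \<and> card J = j" using \<open>l \<notin> J\<close> by auto
qed

lemma Fsup_foldr_ann:
  "\<omega> \<in> Fsup n (j + length ms) \<Longrightarrow> foldr (\<lambda>m. ann n (a m)) ms \<omega> \<in> Fsup n j"
  by (induction ms arbitrary: j) (auto intro: Fsup_ann)

lemma Fsup_ev: "I \<subseteq> {..<n} \<Longrightarrow> ev I \<in> Fsup n (card I)"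
  by (auto simp: Fsup_def ev_def split: if_splits)

lemma foldr_ann_sm: "foldr (\<lambda>m. ann n (a m)) ms (sm c \<omega>) = sm c (foldr (\<lambda>m. ann n (a m)) ms \<omega>)"
  by (induction ms) (auto simp: ann_sm)

lemma foldr_ann_add: "foldr (\<lambda>m. ann n (a m)) ms (\<omega> + \<eta>) = foldr (\<lambda>m. ann n (a m)) ms \<omega> + foldr (\<lambda>m. ann n (a m)) ms \<eta>"
  by (induction ms) (simp_all only: foldr.simps comp_apply id_apply ann_add)

lemma foldr_ann_sum: "foldr (\<lambda>m. ann n (a m)) ms (\<lambda>J. \<Sum>i\<in>I. w i J) J = (\<Sum>i\<in>I. foldr (\<lambda>m. ann n (a m)) ms (w i) J)"
proof (induction ms arbitrary: J)
  case (Cons x xs)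
  have "foldr (\<lambda>m. ann n (a m)) xs (\<lambda>J. \<Sum>i\<in>I. w i J) = (\<lambda>J. \<Sum>i\<in>I. foldr (\<lambda>m. ann n (a m)) xs (w i) J)" using Cons by auto
  then show ?case by (simp add: ann_sum)
qed simp

lemma foldr_an_sm: "foldr an ms (sm c \<omega>) = sm c (foldr an ms \<omega>)"
  by (induction ms) (auto simp: an_sm)

lemma foldr_an_sum: "foldr an ms (\<lambda>J. \<Sum>i\<in>I. w i J) J = (\<Sum>i\<in>I. foldr an ms (w i) J)"
proof (induction ms arbitrary: J)
  case (Cons x xs)
  have "foldr an xs (\<lambda>J. \<Sum>i\<in>I. w i J) = (\<lambda>J. \<Sum>i\<in>I. foldr an xs (w i) J)" using Cons by auto
  then show ?case by (simp add: an_sum)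
qed simp

lemma fa_foldr_ann:
  assumes s: "rhom s" and G: "\<And>i m. i < n \<Longrightarrow> (\<Sum>l<n. G i l * a m l) = s (a m i)"
  shows "\<omega> \<in> Fsup n (j + length ms) \<Longrightarrow> fa n G s (foldr (\<lambda>m. ann n (a m)) ms \<omega>) = foldr (\<lambda>m. ann n (a m)) ms (fa n G s \<omega>)"
proof (induction ms arbitrary: j)
  case (Cons m ms)
  have "foldr (\<lambda>m. ann n (a m)) ms \<omega> \<in> Fsup n (Suc j)" using Cons.prems by (intro Fsup_foldr_ann) simp
  then show ?case using Cons.IH[of "Suc j"] Cons.prems
    by (simp add: fa_ann[OF s, where a = "a m" and a' = "a m", OF G] FsupD(1))
qed simp

text \<open>Each \<open>an l\<close> reads off a coefficient up to a sign whose square is 1, so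
  iterated coordinate contractions detect every coefficient.\<close>

lemma foldr_an_value:
  "distinct ls \<Longrightarrow> J \<inter> set ls = {} \<Longrightarrow> foldr an ls \<omega> J = 0 \<Longrightarrow> \<omega> (J \<union> set ls) = (0::'a::comm_ring_1)"
proof (induction ls arbitrary: J)
  case (Cons l ls)
  have "an l (foldr an ls \<omega>) J = 0" using Cons.prems by simp
  then have "sg l J * foldr an ls \<omega> (insert l J) = 0"
    using Cons.prems(2) unfolding an_def[of l "foldr an ls \<omega>"] by simp
  then have "sg l J * (sg l J * foldr an ls \<omega> (insert l J)) = 0" by simp
  then have "foldr an ls \<omega> (insert l J) = 0" unfolding sg_sq' .
  then have "\<omega> (insert l J \<union> set ls) = 0" using Cons.prems by (intro Cons.IH) auto
  then show ?case by simp
qed simp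

section \<open>Contractions with a Moore matrix of covectors\<close>

text \<open>
  Subtracting from the covector \<open>a k\<close> the combination \<open>\<Sum>m<k. c k m * a m\<close> makes the matrix triangular with
  diagonal \<open>V\<close>.
\<close>

locale moore =
  fixes n :: nat and a :: "nat \<Rightarrow> nat \<Rightarrow> 'a::idom" and c :: "nat \<Rightarrow> nat \<Rightarrow> 'a" and V :: "nat \<Rightarrow> 'a"
  assumes below: "k < n \<Longrightarrow> l < k \<Longrightarrow> a k l = (\<Sum>m<k. c k m * a m l)"
    and diag: "k < n \<Longrightarrow> a k k = (\<Sum>m<k. c k m * a m k) + V k"
    and V_nz: "k < n \<Longrightarrow> V k \<noteq> 0"
begin

abbreviation "A ms \<equiv> foldr (\<lambda>m. ann n (a m)) ms"

definition "\<delta> k l = a k l - (\<Sum>m<k. c k m * a m l)"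

lemma delta: "k < n \<Longrightarrow> l < k \<Longrightarrow> \<delta> k l = 0" "k < n \<Longrightarrow> \<delta> k k = V k"
  using below[of k l] diag[of k] by (auto simp: \<delta>_def)

lemma ann_delta: "ann n (a k) \<omega> J = ann n (\<delta> k) \<omega> J + (\<Sum>m<k. c k m * ann n (a m) \<omega> J)"
  unfolding \<delta>_def[abs_def] ann_covector_diff ann_covector_sum by simp

text \<open>The constant is the Moore determinant up to sign. The covector a_k may be replaced by
  its reduction \<open>\<delta> k\<close>, because the earlier covectors subtracted from it are
  contracted once more and give 0; on e_0 ... e_k only the diagonal entry V_k of the reduction
  survives.\<close>

lemma A_top: "k \<le> n \<Longrightarrow> \<exists>e\<in>{1,-1}. A [0..<k] (ev {..<k}) = sm (e * (\<Prod>i<k. V i)) (ev {})"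
proof (induction k)
  case 0
  then show ?case by (simp add: sm_simps)
next
  case (Suc k)
  obtain e where e: "e \<in> {1,-1}" "A [0..<k] (ev {..<k}) = sm (e * (\<Prod>i<k. V i)) (ev {})"
    using Suc.IH[OF Suc_leD[OF Suc.prems]] by blast
  let ?v = "ev {..<Suc k} :: nat set \<Rightarrow> 'a"
  have k: "k < n" using Suc.prems by simp
  have d: "ann n (\<delta> k) ?v = sm (V k * sg k {..<Suc k}) (ev {..<k})"
  proof
    fix J
    have "ann n (\<delta> k) ?v J = (\<Sum>l<n. if l = k then V k * sm (sg k {..<Suc k}) (ev {..<k}) J else 0)"
      unfolding ann_def
    proof (rule sum.cong)
      fix l assume "l \<in> {..<n}"
      have "{..<Suc k} - {k} = {..<k}" by auto
      then show "\<delta> k l * an l ?v J = (if l = k then V k * sm (sg k {..<Suc k}) (ev {..<k}) J else 0)"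
        using delta(1)[OF k, of l] delta(2)[OF k] by (cases l k rule: linorder_cases) (auto simp: an_ev)
    qed simp
    then show "ann n (\<delta> k) ?v J = sm (V k * sg k {..<Suc k}) (ev {..<k}) J" using k by (simp add: sm_def)
  qed
  have "A [0..<Suc k] ?v = A [0..<k] (ann n (a k) ?v)" by simp
  also have "ann n (a k) ?v = (\<lambda>J. \<Sum>m\<in>{..k}. (if m = k then ann n (\<delta> k) ?v else sm (c k m) (ann n (a m) ?v)) J)"
  proof
    fix J
    have "(\<Sum>m\<in>{..k}. (if m = k then ann n (\<delta> k) ?v else sm (c k m) (ann n (a m) ?v)) J) =
       ann n (\<delta> k) ?v J + (\<Sum>m<k. c k m * ann n (a m) ?v J)"
      by (simp add: lessThan_Suc_atMost[symmetric] sm_def add.commute)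
    then show "ann n (a k) ?v J = (\<Sum>m\<in>{..k}. (if m = k then ann n (\<delta> k) ?v else sm (c k m) (ann n (a m) ?v)) J)"
      using ann_delta[of k ?v J] by simp
  qed
  also have "A [0..<k] \<dots> = sm (V k * sg k {..<Suc k} * (e * (\<Prod>i<k. V i))) (ev {})"
  proof
    fix J
    have "A [0..<k] (\<lambda>J. \<Sum>m\<in>{..k}. (if m = k then ann n (\<delta> k) ?v else sm (c k m) (ann n (a m) ?v)) J) J =
      (\<Sum>m\<in>{..k}. A [0..<k] (if m = k then ann n (\<delta> k) ?v else sm (c k m) (ann n (a m) ?v)) J)"
      by (rule foldr_ann_sum)
    also have "\<dots> = (\<Sum>m\<in>{..k}. if m = k then A [0..<k] (ann n (\<delta> k) ?v) J else 0)"
    proof (rule sum.cong)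
      fix m assume m: "m \<in> {..k}"
      show "A [0..<k] (if m = k then ann n (\<delta> k) ?v else sm (c k m) (ann n (a m) ?v)) J =
        (if m = k then A [0..<k] (ann n (\<delta> k) ?v) J else 0)"
      proof (cases "m = k")
        case False
        then have "A [0..<k] (ann n (a m) ?v) = 0" using m by (intro ann.foldr_mem) auto
        then have "A [0..<k] (sm (c k m) (ann n (a m) ?v)) = 0" unfolding foldr_ann_sm by (simp only: sm_simps)
        then show ?thesis using False by simp
      qed simp
    qed simp
    also have "\<dots> = A [0..<k] (ann n (\<delta> k) ?v) J" by simp
    also have "\<dots> = sm (V k * sg k {..<Suc k} * (e * (\<Prod>i<k. V i))) (ev {}) J"
      unfolding d foldr_ann_sm e(2) sm_simps(1) ..
    finally show "A [0..<k] (\<lambda>J. \<Sum>m\<in>{..k}. (if m = k then ann n (\<delta> k) ?v else sm (c k m) (ann n (a m) ?v)) J) J =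
      sm (V k * sg k {..<Suc k} * (e * (\<Prod>i<k. V i))) (ev {}) J" .
  qed
  also have "V k * sg k {..<Suc k} * (e * (\<Prod>i<k. V i)) = (sg k {..<Suc k} * e) * (\<Prod>i<Suc k. V i)"
    by (simp only: prod.lessThan_Suc mult_ac)
  finally have *: "A [0..<Suc k] ?v = sm ((sg k {..<Suc k} * e) * (\<Prod>i<Suc k. V i)) (ev {})" .
  moreover have "sg k {..<Suc k} * e \<in> {1,-1}"
    using e(1) sg_cases[where 'a = 'a, of k "{..<Suc k}"] by (elim disjE) auto
  ultimately show ?case by blast
qed

text \<open>Back substitution in the triangular matrix, from the last row upwards. Entries lie in a
  domain rather than a field, so a common denominator \<open>D\<close> is carried along.\<close>

lemma ann_invert:
  "k \<le> n \<Longrightarrow> \<exists>D \<gamma>. D \<noteq> 0 \<and> (\<forall>l \<omega> J. k \<le> l \<and> l < n \<longrightarrow> D * an l \<omega> J = (\<Sum>m<n. \<gamma> l m * ann n (a m) \<omega> J))"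
proof (induction rule: inc_induct)
  case base
  then show ?case by (intro exI[of _ 1]) auto
next
  case (step k)
  then obtain D \<gamma> where D: "D \<noteq> 0"
    and g: "\<And>l \<omega> J. Suc k \<le> l \<Longrightarrow> l < n \<Longrightarrow> D * an l \<omega> J = (\<Sum>m<n. \<gamma> l m * ann n (a m) \<omega> J)" by blast
  have k: "k < n" using step by simp
  \<comment> \<open>For l = k these are the coefficients of D times the equation V_k an_k = ann
    \<delta>_k - (sum over i > k of \<delta>_ki an_i), with the later an_i already eliminated; the
    other rows are rescaled by V_k.\<close>
  define \<gamma>' where "\<gamma>' l m = (if l = k then D * ((if m = k then 1 else 0) - (if m < k then c k m else 0)) - (\<Sum>i\<in>{Suc k..<n}. \<delta> k i * \<gamma> i m)
     else V k * \<gamma> l m)" for l m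
  have "(D * V k) * an l \<omega> J = (\<Sum>m<n. \<gamma>' l m * ann n (a m) \<omega> J)" if l: "k \<le> l" "l < n" for l \<omega> J
  proof (cases "l = k")
    case False
    then have "D * an l \<omega> J = (\<Sum>m<n. \<gamma> l m * ann n (a m) \<omega> J)" using l by (intro g) auto
    then have "V k * (D * an l \<omega> J) = (\<Sum>m<n. V k * \<gamma> l m * ann n (a m) \<omega> J)"
      by (simp add: sum_distrib_left mult.assoc)
    then show ?thesis using False by (simp add: \<gamma>'_def mult_ac)
  next
    case True
    have split: "{..<n} = {..<k} \<union> ({k} \<union> {Suc k..<n})" using k by auto
    have "ann n (\<delta> k) \<omega> J = V k * an k \<omega> J + (\<Sum>i\<in>{Suc k..<n}. \<delta> k i * an i \<omega> J)"
      unfolding ann_def split using delta[OF k] by (subst sum.union_disjoint, auto)+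
    then have "D * V k * an k \<omega> J = D * ann n (\<delta> k) \<omega> J - (\<Sum>i\<in>{Suc k..<n}. \<delta> k i * (D * an i \<omega> J))"
      by (simp add: algebra_simps sum_distrib_left)
    also have "(\<Sum>i\<in>{Suc k..<n}. \<delta> k i * (D * an i \<omega> J)) = (\<Sum>i\<in>{Suc k..<n}. \<Sum>m<n. \<delta> k i * \<gamma> i m * ann n (a m) \<omega> J)"
      by (intro sum.cong refl) (simp add: g sum_distrib_left mult.assoc)
    also have "\<dots> = (\<Sum>m<n. (\<Sum>i\<in>{Suc k..<n}. \<delta> k i * \<gamma> i m) * ann n (a m) \<omega> J)"
      by (subst sum.swap) (simp add: sum_distrib_right)
    also have "D * ann n (\<delta> k) \<omega> J = (\<Sum>m<n. D * ((if m = k then 1 else 0) - (if m < k then c k m else 0)) * ann n (a m) \<omega> J)"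
    proof -
      have "(\<Sum>m<n. ((if m = k then 1 else 0) - (if m < k then c k m else 0)) * ann n (a m) \<omega> J) =
        (\<Sum>m<n. (if m = k then ann n (a m) \<omega> J else 0)) - (\<Sum>m<n. if m < k then c k m * ann n (a m) \<omega> J else 0)"
        unfolding sum_subtractf[symmetric] by (intro sum.cong) (auto simp: algebra_simps)
      also have "(\<Sum>m<n. if m < k then c k m * ann n (a m) \<omega> J else 0) = (\<Sum>m<k. c k m * ann n (a m) \<omega> J)"
        using k by (intro sum.mono_neutral_cong_right) auto
      finally have "(\<Sum>m<n. ((if m = k then 1 else 0) - (if m < k then c k m else 0)) * ann n (a m) \<omega> J) = ann n (\<delta> k) \<omega> J"
        using ann_delta[of k \<omega> J] k by simp
      then show ?thesis by (simp add: sum_distrib_left[symmetric] mult.assoc)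
    qed
    finally show ?thesis
      by (simp only: True \<gamma>'_def simp_thms if_True sum_subtractf[symmetric] left_diff_distrib[symmetric])
  qed
  moreover have "D * V k \<noteq> 0" using D V_nz[OF k] by simp
  ultimately show ?case by blast
qed

text \<open>The innermost coordinate contraction is, up to the denominator \<open>D\<close>, a
  combination of the covector contractions; the induction hypothesis applies to each of the
  contracted forms.\<close>

lemma A_zero_an_zero:
  assumes "\<And>ms. length ms = j \<Longrightarrow> set ms \<subseteq> {..<n} \<Longrightarrow> A ms \<omega> {} = 0"
    and "length ls = j" "set ls \<subseteq> {..<n}"
  shows "foldr an ls \<omega> {} = 0"
  using assms
proof (induction j arbitrary: \<omega> ls)
  case 0
  then show ?case using "0.prems"(1)[of "[]"] by simp
next
  case (Suc j)
  obtain D \<gamma> where D: "D \<noteq> 0"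
    and g: "\<And>l \<omega> J. l < n \<Longrightarrow> D * an l \<omega> J = (\<Sum>m<n. \<gamma> l m * ann n (a m) \<omega> J)"
    using ann_invert[of 0] by auto
  obtain ls' l where ls: "ls = ls' @ [l]" "length ls' = j" using Suc.prems(2) by (metis length_Suc_conv_rev)
  have l: "l < n" "set ls' \<subseteq> {..<n}" using Suc.prems(3) ls by auto
  have z: "foldr an ls' (ann n (a m) \<omega>) {} = 0" if m: "m < n" for m
  proof (rule Suc.IH[OF _ ls(2) l(2)])
    fix ms :: "nat list" assume "length ms = j" "set ms \<subseteq> {..<n}"
    then show "A ms (ann n (a m) \<omega>) {} = 0" using Suc.prems(1)[of "ms @ [m]"] m by simp
  qed
  have "sm D (an l \<omega>) = (\<lambda>J. \<Sum>m<n. sm (\<gamma> l m) (ann n (a m) \<omega>) J)"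
    using g[OF l(1)] by (simp add: sm_def fun_eq_iff)
  then have "sm D (foldr an ls' (an l \<omega>)) {} = (\<Sum>m<n. foldr an ls' (sm (\<gamma> l m) (ann n (a m) \<omega>)) {})"
    unfolding foldr_an_sm[symmetric] by (simp add: foldr_an_sum)
  also have "\<dots> = 0" using z by (intro sum.neutral ballI) (simp only: foldr_an_sm, simp add: sm_def)
  finally show ?case using D by (simp add: ls sm_def)
qed

definition "DD J \<omega> = A (sorted_list_of_set J) \<omega>"

lemma A_DD:
  assumes "set ms \<subseteq> {..<n}" "\<And>J. J \<subseteq> {..<n} \<Longrightarrow> card J = length ms \<Longrightarrow> DD J \<omega> {} = 0"
  shows "A ms \<omega> {} = 0"
proof (cases "distinct ms")
  case True
  have "mset ms = mset (sorted_list_of_set (set ms))"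
    using True by (metis mset_set_set mset_sorted_list_of_multiset sorted_list_of_mset_set)
  moreover have "DD (set ms) \<omega> {} = 0" using assms True by (simp add: distinct_card)
  ultimately show ?thesis using ann.foldr_mset[of ms "sorted_list_of_set (set ms)" n a]
    by (auto simp: DD_def)
next
  case False
  then show ?thesis by (simp add: ann.foldr_not_distinct)
qed

text \<open>Vanishing passes from increasing lists to all lists (\<open>A_DD\<close>), then to
  coordinate contractions (\<open>A_zero_an_zero\<close>), and these read off the
  coefficients.\<close>

lemma DD_inj:
  assumes w: "\<omega> \<in> Fsup n j" and 0: "\<And>J. J \<subseteq> {..<n} \<Longrightarrow> card J = j \<Longrightarrow> DD J \<omega> {} = 0"
  shows "\<omega> = 0"
proof
  fix J show "\<omega> J = 0 J"
  proof (rule ccontr)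
    assume "\<omega> J \<noteq> 0 J"
    then have nz: "\<omega> J \<noteq> 0" and J: "J \<subseteq> {..<n}" "card J = j" using w by (auto simp: Fsup_def)
    have fJ: "finite J" using J(1) finite_subset by blast
    have "foldr an (sorted_list_of_set J) \<omega> {} = 0"
    proof (rule A_zero_an_zero)
      fix ms :: "nat list" assume "length ms = j" "set ms \<subseteq> {..<n}"
      then show "A ms \<omega> {} = 0" using 0 by (intro A_DD) auto
    qed (use J fJ in auto)
    from foldr_an_value[OF _ _ this] have "\<omega> ({} \<union> set (sorted_list_of_set J)) = 0" by simp
    then show False using nz fJ by simp
  qed
qed

abbreviation "L \<equiv> \<Prod>i<n. V i"
abbreviation "vol \<equiv> (ev {..<n} :: nat set \<Rightarrow> 'a)"

lemma dual_sign:
  assumes "J \<subseteq> {..<n}"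
  shows "\<exists>e\<in>{1,-1}. DD J (DD ({..<n} - J) vol) = sm (e * L) (ev {})"
proof -
  have f: "finite J" using assms finite_subset by blast
  have "mset (sorted_list_of_set J @ sorted_list_of_set ({..<n} - J)) = mset_set (J \<union> ({..<n} - J))"
    using f by (subst mset_set_Union) (auto simp: mset_sorted_list)
  also have "J \<union> ({..<n} - J) = set [0..<n]" using assms by auto
  finally have "mset (sorted_list_of_set J @ sorted_list_of_set ({..<n} - J)) = mset [0..<n]"
    by (simp add: mset_set_set)
  from ann.foldr_mset[OF this, of n a]
  have "DD J (DD ({..<n} - J) vol) = A [0..<n] vol \<or> DD J (DD ({..<n} - J) vol) = - A [0..<n] vol"
    by (auto simp: DD_def)
  moreover obtain e where "e \<in> {1,-1}" "A [0..<n] vol = sm (e * L) (ev {})" using A_top[OF order_refl] by blast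
  ultimately show ?thesis by (auto simp: sm_simps[symmetric])
qed

text \<open>
  \<open>beta J\<close> is the dual basis to the functionals \<open>DD J\<close>, scaled by the determinant \<open>L\<close>.
\<close>

definition "dsign J = (SOME e. e \<in> {1,-1} \<and> DD J (DD ({..<n} - J) vol) = sm (e * L) (ev {}))"
definition "beta J = sm (dsign J) (DD ({..<n} - J) vol)"

lemma dsign: "J \<subseteq> {..<n} \<Longrightarrow> dsign J \<in> {1,-1}"
    "J \<subseteq> {..<n} \<Longrightarrow> DD J (DD ({..<n} - J) vol) = sm (dsign J * L) (ev {})"
  using someI_ex[OF dual_sign[unfolded Bex_def, of J]] by (auto simp: dsign_def)

lemma DD_sm: "DD J (sm d \<omega>) = sm d (DD J \<omega>)"
  by (simp add: DD_def foldr_ann_sm)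

text \<open>A different J' of the same size meets the complement of J, so some covector is
  contracted twice.\<close>

lemma DD_beta:
  assumes J: "J \<subseteq> {..<n}" "J' \<subseteq> {..<n}" "card J' = card J"
  shows "DD J' (beta J) = (if J' = J then sm L (ev {}) else 0)"
proof (cases "J' = J")
  case True
  have "dsign J * (dsign J * L) = L" using dsign(1)[OF J(1)] by auto
  then show ?thesis unfolding True beta_def DD_sm dsign(2)[OF J(1)] sm_simps(1) by (simp only: if_True simp_thms)
next
  case False
  have fin: "finite J" "finite J'" using J finite_subset by blast+
  have "\<not> J' \<subseteq> J" using False J(3) fin card_subset_eq by metis
  then have "J' \<inter> ({..<n} - J) \<noteq> {}" using J by auto
  then have "\<not> distinct (sorted_list_of_set J' @ sorted_list_of_set ({..<n} - J))"
    using fin by simp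
  from ann.foldr_not_distinct[OF this, of n a vol]
  have "DD J' (DD ({..<n} - J) vol) = 0" by (simp add: DD_def)
  then show ?thesis using False by (simp add: beta_def DD_sm sm_simps)
qed

lemma beta_Fsup:
  assumes "J \<subseteq> {..<n}" shows "beta J \<in> Fsup n (card J)"
proof -
  have "finite J" using assms finite_subset by blast
  then have "card J + card ({..<n} - J) = n" using assms by (metis card_Diff_subset card_lessThan card_mono finite_lessThan le_add_diff_inverse)
  then show ?thesis unfolding beta_def DD_def
    using Fsup_ev[of "{..<n}" n] by (intro Fsup_sm Fsup_foldr_ann) simp
qed

lemma DD_Fsup: "J \<subseteq> {..<n} \<Longrightarrow> \<omega> \<in> Fsup n (card J) \<Longrightarrow> DD J \<omega> \<in> Fsup n 0"
  unfolding DD_def by (rule Fsup_foldr_ann) simp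

end

section \<open>Polynomials\<close>

type_synonym 'k mpol = "(nat \<Rightarrow>\<^sub>0 nat) \<Rightarrow>\<^sub>0 'k"

definition X :: "nat \<Rightarrow> 'k::field mpol" where
  "X i = Poly_Mapping.single (Poly_Mapping.single i 1) 1"

definition C :: "'k::field \<Rightarrow> 'k mpol" where
  "C c = Poly_Mapping.single 0 c"

definition mon :: "(nat \<Rightarrow> 'a::comm_monoid_mult) \<Rightarrow> (nat \<Rightarrow>\<^sub>0 nat) \<Rightarrow> 'a" where
  "mon \<theta> m = (\<Prod>i\<in>Poly_Mapping.keys m. \<theta> i ^ Poly_Mapping.lookup m i)"

definition sub :: "(nat \<Rightarrow> 'k::field mpol) \<Rightarrow> 'k mpol \<Rightarrow> 'k mpol" where
  "sub \<theta> = lin_ext (mon \<theta>)"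

lemma C_add: "C (a + b) = C a + C b" and C_mult: "C (a * b) = C a * C b" and C_1: "C 1 = 1" and C_0: "C 0 = 0"
  by (auto simp: C_def single_add mult_single)

lemma rhom_C: "rhom C"
  by (simp add: rhom_def C_add C_mult C_1)

lemma C_neg: "C (- a) = - C a"
  by (rule rhom_neg[OF rhom_C])

lemma C_power: "C (a ^ m) = C a ^ m"
  by (rule rhom_power[OF rhom_C])

lemma C_eq_iff: "C a = C b \<longleftrightarrow> a = b"
  by (metis C_def lookup_single_eq)

lemma pm_scale_C: "pm_scale c p = C c * p"
  unfolding pm_scale_def C_def by (rule mult_map_scale_conv_mult)

lemma mon_superset:
  assumes "finite S" "Poly_Mapping.keys m \<subseteq> S"
  shows "mon \<theta> m = (\<Prod>i\<in>S. \<theta> i ^ Poly_Mapping.lookup m i)"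
  unfolding mon_def using assms by (intro prod.mono_neutral_left) (auto simp: in_keys_iff)

lemma mon_add: "mon \<theta> (m + m') = mon \<theta> m * mon \<theta> m'"
proof -
  let ?S = "Poly_Mapping.keys m \<union> Poly_Mapping.keys m'"
  have "Poly_Mapping.keys (m + m') \<subseteq> ?S" by (rule keys_add)
  then show ?thesis
    by (subst (1 2 3) mon_superset[of ?S]) (auto simp: lookup_add power_add prod.distrib)
qed

lemma mon_0: "mon \<theta> 0 = 1"
  by (simp add: mon_def)

lemma sub_single: "sub \<theta> (Poly_Mapping.single m a) = C a * mon \<theta> m"
  by (simp add: sub_def lin_ext_single pm_scale_C)

lemma pm_linear_sub: "pm_linear (sub \<theta>)"
  unfolding sub_def by (rule pm_linear_lin_ext)

lemma pm_linear_mult_left: "pm_linear (\<lambda>q. f * q)" and pm_linear_mult_right: "pm_linear (\<lambda>q. q * f)" for f :: "'k::field mpol"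
  by (auto simp: pm_linear_def pm_scale_C algebra_simps)

lemma sub_mult: "sub \<theta> (p * q) = sub \<theta> p * sub \<theta> q"
proof -
  have 1: "sub \<theta> (Poly_Mapping.single m 1 * q) = sub \<theta> (Poly_Mapping.single m 1) * sub \<theta> q" for m q
    by (rule pm_linear_eqI[where A = UNIV, OF pm_linear_comp[OF pm_linear_sub pm_linear_mult_left]
          pm_linear_comp[OF pm_linear_mult_left pm_linear_sub]])
      (auto simp: mult_single sub_single C_1 mon_add basis_space_def)
  show ?thesis
    by (rule pm_linear_eqI[where A = UNIV and S = "\<lambda>p. sub \<theta> (p * q)" and T = "\<lambda>p. sub \<theta> p * sub \<theta> q",
          OF pm_linear_comp[OF pm_linear_sub pm_linear_mult_right] pm_linear_comp[OF pm_linear_mult_right pm_linear_sub]])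
      (auto simp: 1 basis_space_def)
qed

lemma sub_C: "sub \<theta> (C a) = C a"
  by (subst C_def, subst sub_single) (simp add: mon_0)

lemma sub_X: "sub \<theta> (X i) = \<theta> i"
  by (subst X_def, subst sub_single) (simp add: mon_def C_1)

lemma rhom_sub: "rhom (sub \<theta>)"
  using sub_C[of \<theta> 1] by (simp add: rhom_def pm_linear_add[OF pm_linear_sub] sub_mult C_1)

lemmas sub_simps = rhom_add[OF rhom_sub] rhom_neg[OF rhom_sub] rhom_diff[OF rhom_sub] sub_mult rhom_1[OF rhom_sub]
  rhom_0[OF rhom_sub] rhom_sum[OF rhom_sub] rhom_prod[OF rhom_sub] rhom_power[OF rhom_sub] sub_C sub_X

lemma single_eq_mon: "(Poly_Mapping.single m 1 :: 'k::field mpol) = mon X m"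
proof -
  have pw: "X i ^ k = Poly_Mapping.single (Poly_Mapping.single i k) 1" for i k
    by (induction k) (auto simp: X_def mult_single single_add[symmetric])
  have "finite S \<Longrightarrow> (\<Prod>i\<in>S. Poly_Mapping.single (f i) 1) = Poly_Mapping.single (\<Sum>i\<in>S. f i) (1 :: 'k::field)"
    for S and f :: "nat \<Rightarrow> nat \<Rightarrow>\<^sub>0 nat"
    by (induction S rule: finite_induct) (auto simp: mult_single)
  then have "mon X m = Poly_Mapping.single (\<Sum>i\<in>Poly_Mapping.keys m. Poly_Mapping.single i (Poly_Mapping.lookup m i)) (1 :: 'k::field)"
    unfolding mon_def pw by simp
  also have "(\<Sum>i\<in>Poly_Mapping.keys m. Poly_Mapping.single i (Poly_Mapping.lookup m i)) = m"
  proof (rule poly_mapping_eqI)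
    fix j
    have "(\<Sum>i\<in>Poly_Mapping.keys m. Poly_Mapping.lookup m i when i = j) = Poly_Mapping.lookup m j"
      by (auto simp: when_def in_keys_iff)
    then show "Poly_Mapping.lookup (\<Sum>i\<in>Poly_Mapping.keys m. Poly_Mapping.single i (Poly_Mapping.lookup m i)) j = Poly_Mapping.lookup m j"
      by (simp add: lookup_sum lookup_single)
  qed
  finally show ?thesis ..
qed

lemma mpol_basis_UNIV: "p \<in> basis_space UNIV"
  by (simp add: basis_space_def)

lemma pm_linear_rhom: "rhom s \<Longrightarrow> (\<And>a. s (C a) = C a) \<Longrightarrow> pm_linear s"
  by (simp add: pm_linear_def rhom_add pm_scale_C rhom_mult)

lemma rhom_mon: "rhom s \<Longrightarrow> s (mon \<theta> m) = mon (\<lambda>i. s (\<theta> i)) m"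
  by (simp add: mon_def rhom_prod rhom_power)

lemma sub_unique:
  assumes "rhom s" and "\<And>a. s (C a) = C a"
  shows "s p = sub (\<lambda>i. s (X i)) p"
  by (rule pm_linear_eqI[OF pm_linear_rhom[OF assms] pm_linear_sub _ mpol_basis_UNIV])
    (simp add: single_eq_mon rhom_mon[OF assms(1)] rhom_mon[OF rhom_sub] sub_X)

lemma rhom_comp: "rhom s \<Longrightarrow> rhom t \<Longrightarrow> rhom (\<lambda>x. s (t x))"
  by (simp add: rhom_def)

lemma sub_sub: "sub \<theta> (sub \<eta> p) = sub (\<lambda>i. sub \<theta> (\<eta> i)) p"
  using sub_unique[OF rhom_comp[OF rhom_sub rhom_sub], of \<theta> \<eta> p] by (simp add: sub_C sub_X)

lemma sub_id: "sub X p = p"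
  using sub_unique[of "\<lambda>p. p" p] by (simp add: rhom_def)

definition P :: "nat \<Rightarrow> 'k::field mpol set" where
  "P n = basis_space {m. Poly_Mapping.keys m \<subseteq> {..<n}}"

definition mdeg :: "(nat \<Rightarrow>\<^sub>0 nat) \<Rightarrow> nat" where
  "mdeg m = (\<Sum>l\<in>Poly_Mapping.keys m. Poly_Mapping.lookup m l)"

definition Hm :: "nat \<Rightarrow> 'k::field mpol set" where
  "Hm d = basis_space {m. mdeg m = d}"

lemma sym_power_alt: "sym_power n d = P n \<inter> Hm d"
  by (auto simp: sym_power_def P_def Hm_def basis_space_def mdeg_def)

lemma P_0: "0 \<in> P n" and P_add: "p \<in> P n \<Longrightarrow> r \<in> P n \<Longrightarrow> p + r \<in> P n" and P_neg: "p \<in> P n \<Longrightarrow> - p \<in> P n"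
  and P_sum: "(\<And>i. i \<in> I \<Longrightarrow> f i \<in> P n) \<Longrightarrow> sum f I \<in> P n"
  by (auto simp: P_def intro: basis_space_add basis_space_uminus basis_space_sum)

lemma P_diff: "p \<in> P n \<Longrightarrow> r \<in> P n \<Longrightarrow> p - r \<in> P n"
  using P_add[of p n "- r"] P_neg[of r n] by simp

lemma Hm_0: "0 \<in> Hm n" and Hm_add: "p \<in> Hm n \<Longrightarrow> r \<in> Hm n \<Longrightarrow> p + r \<in> Hm n" and Hm_neg: "p \<in> Hm n \<Longrightarrow> - p \<in> Hm n"
  and Hm_sum: "(\<And>i. i \<in> I \<Longrightarrow> f i \<in> Hm n) \<Longrightarrow> sum f I \<in> Hm n"
  by (auto simp: Hm_def intro: basis_space_add basis_space_uminus basis_space_sum)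

lemma Hm_diff: "p \<in> Hm n \<Longrightarrow> r \<in> Hm n \<Longrightarrow> p - r \<in> Hm n"
  using Hm_add[of p n "- r"] Hm_neg[of r n] by simp

lemma P_mult: "p \<in> P n \<Longrightarrow> r \<in> P n \<Longrightarrow> p * r \<in> P n"
proof -
  assume p: "p \<in> P n" and r: "r \<in> P n"
  show ?thesis unfolding P_def basis_space_def
  proof (intro CollectI subsetI)
    fix m i assume "m \<in> Poly_Mapping.keys (p * r)" and i: "i \<in> Poly_Mapping.keys m"
    then obtain a b where m: "m = a + b" "a \<in> Poly_Mapping.keys p" "b \<in> Poly_Mapping.keys r" using keys_mult[of p r] by blast
    then have "i \<in> Poly_Mapping.keys a \<union> Poly_Mapping.keys b" using i keys_add[of a b] by blast
    then show "i \<in> {..<n}" using p r m(2,3) by (auto simp: P_def basis_space_def)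
  qed
qed

lemma mdeg_superset: "finite S \<Longrightarrow> Poly_Mapping.keys m \<subseteq> S \<Longrightarrow> mdeg m = (\<Sum>l\<in>S. Poly_Mapping.lookup m l)"
  unfolding mdeg_def by (intro sum.mono_neutral_left) (auto simp: in_keys_iff)

lemma mdeg_add: "mdeg (m + m') = mdeg m + mdeg m'"
proof -
  let ?S = "Poly_Mapping.keys m \<union> Poly_Mapping.keys m'"
  have "Poly_Mapping.keys (m + m') \<subseteq> ?S" by (rule keys_add)
  then show ?thesis
    by (subst (1 2 3) mdeg_superset[of ?S]) (auto simp: lookup_add sum.distrib)
qed

lemma Hm_mult: "p \<in> Hm d \<Longrightarrow> r \<in> Hm e \<Longrightarrow> p * r \<in> Hm (d + e)"
proof -
  assume p: "p \<in> Hm d" and r: "r \<in> Hm e"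
  show ?thesis unfolding Hm_def basis_space_def
  proof (intro CollectI subsetI)
    fix m assume "m \<in> Poly_Mapping.keys (p * r)"
    then obtain a b where "m = a + b" "a \<in> Poly_Mapping.keys p" "b \<in> Poly_Mapping.keys r" using keys_mult[of p r] by blast
    then show "mdeg m = d + e" using p r by (auto simp: Hm_def basis_space_def mdeg_add)
  qed
qed

lemma P_C: "C a \<in> P n" and Hm_C: "C a \<in> Hm 0" and P_X: "i < n \<Longrightarrow> X i \<in> P n" and Hm_X: "X i \<in> Hm 1"
  by (auto simp: P_def Hm_def C_def X_def mdeg_def intro!: basis_space_single)

lemma P_1: "1 \<in> P n" and Hm_1: "1 \<in> Hm 0"
  using P_C[of 1] Hm_C[of 1] by (simp_all add: C_1)

lemma P_power: "p \<in> P n \<Longrightarrow> p ^ k \<in> P n"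
  by (induction k) (auto simp: P_1 P_mult)

lemma Hm_power: "p \<in> Hm d \<Longrightarrow> p ^ k \<in> Hm (d * k)"
  by (induction k) (auto simp: Hm_1 dest: Hm_mult)

lemma P_prod: "(\<And>i. i \<in> I \<Longrightarrow> f i \<in> P n) \<Longrightarrow> prod f I \<in> P n"
  by (induction I rule: infinite_finite_induct) (auto simp: P_1 P_mult)

lemma Hm_prod: "(\<And>i. i \<in> I \<Longrightarrow> f i \<in> Hm (d i)) \<Longrightarrow> prod f I \<in> Hm (sum d I)"
  by (induction I rule: infinite_finite_induct) (auto simp: Hm_1 Hm_mult)

lemma P_mono: "n \<le> m \<Longrightarrow> p \<in> P n \<Longrightarrow> p \<in> P m"
proof -
  assume n: "n \<le> m" and p: "p \<in> P n"
  show ?thesis unfolding P_def basis_space_def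
  proof (intro CollectI subsetI)
    fix a i assume "a \<in> Poly_Mapping.keys p" "i \<in> Poly_Mapping.keys a"
    then have "i < n" using p by (auto simp: P_def basis_space_def)
    then show "i \<in> {..<m}" using n by simp
  qed
qed

lemma P_sub:
  assumes p: "p \<in> P n" and t: "\<And>i. i < n \<Longrightarrow> \<theta> i \<in> P k"
  shows "sub \<theta> p \<in> P k"
  unfolding P_def
proof (rule pm_linear_closed[OF pm_linear_sub _ p[unfolded P_def]])
  fix m :: "nat \<Rightarrow>\<^sub>0 nat" assume "m \<in> {m. Poly_Mapping.keys m \<subseteq> {..<n}}"
  then have "mon \<theta> m \<in> P k" unfolding mon_def using t by (intro P_prod P_power) auto
  then show "sub \<theta> (Poly_Mapping.single m 1) \<in> basis_space {m. Poly_Mapping.keys m \<subseteq> {..<k}}"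
    by (simp add: sub_single C_1 P_def)
qed

lemma Hm_sub:
  assumes p: "p \<in> Hm d" and t: "\<And>i. \<theta> i \<in> Hm 1"
  shows "sub \<theta> p \<in> Hm d"
  unfolding Hm_def
proof (rule pm_linear_closed[OF pm_linear_sub _ p[unfolded Hm_def]])
  fix m :: "nat \<Rightarrow>\<^sub>0 nat" assume m: "m \<in> {m. mdeg m = d}"
  have "mon \<theta> m \<in> Hm (\<Sum>i\<in>Poly_Mapping.keys m. 1 * Poly_Mapping.lookup m i)"
    unfolding mon_def using t by (intro Hm_prod Hm_power)
  then show "sub \<theta> (Poly_Mapping.single m 1) \<in> basis_space {m. mdeg m = d}"
    using m by (simp add: sub_single C_1 Hm_def mdeg_def)
qed

lemma sub_cong:
  assumes p: "p \<in> P n" and t: "\<And>i. i < n \<Longrightarrow> \<theta> i = \<eta> i"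
  shows "sub \<theta> p = sub \<eta> p"
proof (rule pm_linear_eqI[OF pm_linear_sub pm_linear_sub _ p[unfolded P_def]])
  fix m :: "nat \<Rightarrow>\<^sub>0 nat" assume "m \<in> {m. Poly_Mapping.keys m \<subseteq> {..<n}}"
  then have "mon \<theta> m = mon \<eta> m" unfolding mon_def using t by (intro prod.cong) auto
  then show "sub \<theta> (Poly_Mapping.single m 1) = sub \<eta> (Poly_Mapping.single m 1)" by (simp add: sub_single)
qed

lemma sub_fix: "p \<in> P n \<Longrightarrow> (\<And>i. i < n \<Longrightarrow> \<theta> i = X i) \<Longrightarrow> sub \<theta> p = p"
  using sub_cong[of p n \<theta> X] by (simp add: sub_id)

section \<open>Divisibility by linear forms\<close>

lemma dvd_power_diff: "d dvd x - y \<Longrightarrow> d dvd x ^ k - y ^ k" for d x y :: "'a::comm_ring_1"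
proof (induction k)
  case (Suc k)
  have "x ^ Suc k - y ^ Suc k = x * (x ^ k - y ^ k) + (x - y) * y ^ k" by (simp add: algebra_simps)
  then show ?case using Suc by simp
qed simp

lemma dvd_prod_diff: "(\<And>i. i \<in> I \<Longrightarrow> d dvd f i - g i) \<Longrightarrow> d dvd prod f I - prod g I" for d :: "'a::comm_ring_1"
proof (induction I rule: infinite_finite_induct)
  case (insert i I)
  have "prod f (insert i I) - prod g (insert i I) = f i * (prod f I - prod g I) + (f i - g i) * prod g I"
    using insert.hyps by (simp add: algebra_simps)
  then show ?case using insert by simp
qed auto

lemma sub_diff_dvd:
  assumes "\<And>i. d dvd \<theta> i - \<eta> i"
  shows "d dvd sub \<theta> p - sub \<eta> p"
proof -
  have "sub \<theta> p - sub \<eta> p = (\<Sum>m\<in>Poly_Mapping.keys p. C (Poly_Mapping.lookup p m) * (mon \<theta> m - mon \<eta> m))"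
    by (simp add: sub_def lin_ext_def pm_scale_C sum_subtractf algebra_simps)
  also have "d dvd \<dots>"
    unfolding mon_def using assms by (intro dvd_sum dvd_mult dvd_prod_diff dvd_power_diff)
  finally show ?thesis .
qed

text \<open>Substitution of the root of X_i + w, that is, reduction modulo this linear form when w
  involves only earlier variables.\<close>

definition kill :: "nat \<Rightarrow> 'k::field mpol \<Rightarrow> 'k mpol \<Rightarrow> 'k mpol" where
  "kill i w = sub (\<lambda>j. if j = i then - w else X j)"

lemma rhom_kill: "rhom (kill i w)"
  unfolding kill_def by (rule rhom_sub)

lemma kill_P: "w \<in> P i \<Longrightarrow> kill i v w = w"
  unfolding kill_def by (rule sub_fix[of w i]) auto

text \<open>The substitution annihilates X_i + w, and it changes every polynomial by a multiple of
  X_i + w since it changes X_i by exactly that.\<close>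

lemma line_dvd_iff:
  assumes w: "w \<in> P i" shows "X i + w dvd f \<longleftrightarrow> kill i w f = 0"
proof
  assume "X i + w dvd f"
  then obtain g where f: "f = (X i + w) * g" by (elim dvdE)
  have "kill i w (X i + w) = 0"
    using kill_P[OF w, of w] by (simp add: rhom_add[OF rhom_kill]) (simp add: kill_def sub_X)
  then show "kill i w f = 0" by (simp add: f rhom_mult[OF rhom_kill])
next
  assume 0: "kill i w f = 0"
  have "X i + w dvd sub X f - kill i w f" unfolding kill_def by (rule sub_diff_dvd) auto
  then show "X i + w dvd f" by (simp add: 0 sub_id)
qed

lemma lookup_P_X: "w \<in> P i \<Longrightarrow> Poly_Mapping.lookup w (Poly_Mapping.single i 1) = 0"
  by (auto simp: P_def basis_space_iff)

lemma X_add_nonzero: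
  assumes "w \<in> P i" shows "X i + w \<noteq> 0"
proof
  assume "X i + w = 0"
  then have "Poly_Mapping.lookup (X i + w) (Poly_Mapping.single i 1) = 0" by simp
  then show False using lookup_P_X[OF assms] by (simp add: lookup_add X_def)
qed

lemma line_not_dvd:
  assumes w: "w \<in> P i" and v: "v \<in> P j" and ne: "(i, w) \<noteq> (j, v)"
  shows "\<not> X i + w dvd X j + v"
proof -
  consider "i = j" | "j < i" | "i < j" by linarith
  then have "kill i w (X j + v) \<noteq> 0"
  proof cases
    case 1
    then have "kill i w (X j + v) = v - w" using kill_P[of v i w] v
      by (simp add: rhom_add[OF rhom_kill]) (simp add: kill_def sub_X)
    then show ?thesis using 1 ne by auto
  next
    case 2
    then have "kill i w (X j + v) = X j + v" using kill_P[OF P_mono[OF _ v], of i w]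
      by (simp add: rhom_add[OF rhom_kill]) (simp add: kill_def sub_X)
    then show ?thesis using X_add_nonzero[OF v] by simp
  next
    case 3
    then have e: "kill i w (X j + v) = X j + kill i w v"
      by (simp add: rhom_add[OF rhom_kill]) (simp add: kill_def sub_X)
    have "kill i w v \<in> P j" unfolding kill_def using v
      by (rule P_sub) (use w 3 in \<open>auto intro: P_X P_neg P_mono[of i j]\<close>)
    then show ?thesis unfolding e by (rule X_add_nonzero)
  qed
  then show ?thesis by (simp add: line_dvd_iff[OF w])
qed

text \<open>
  Multivariate polynomials carry no unique factorisation instance here; linear forms are shown to be prime by
  substitution.
\<close>

definition primelike :: "'a::comm_ring_1 \<Rightarrow> bool" where
  "primelike d \<longleftrightarrow> (\<forall>f g. d dvd f * g \<longrightarrow> d dvd f \<or> d dvd g) \<and> \<not> d dvd 1"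

lemma primelike_not_dvd_prod:
  "primelike d \<Longrightarrow> (\<And>j. j \<in> T \<Longrightarrow> \<not> d dvd l j) \<Longrightarrow> \<not> d dvd prod l T"
proof (induction T rule: infinite_finite_induct)
  case (insert j T)
  have "\<not> d dvd l j" "\<not> d dvd prod l T" using insert by simp_all
  then have "\<not> d dvd l j * prod l T" using insert.prems(1) unfolding primelike_def by blast
  then show ?case using insert.hyps by simp
qed (simp_all add: primelike_def)

lemma prime_family_dvd:
  fixes l :: "'i \<Rightarrow> 'a::comm_ring_1"
  shows "finite S \<Longrightarrow> (\<And>i. i \<in> S \<Longrightarrow> primelike (l i)) \<Longrightarrow>
    (\<And>i j. i \<in> S \<Longrightarrow> j \<in> S \<Longrightarrow> i \<noteq> j \<Longrightarrow> \<not> l i dvd l j) \<Longrightarrow> (\<And>i. i \<in> S \<Longrightarrow> l i dvd f) \<Longrightarrow> prod l S dvd f"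
proof (induction S rule: finite_induct)
  case (insert i S)
  have "prod l S dvd f"
    by (rule insert.IH) (simp_all add: insert.prems)
  then obtain g where f: "f = prod l S * g" by (elim dvdE)
  have "\<not> l i dvd l j" if "j \<in> S" for j
    using insert.hyps that by (intro insert.prems(2)) auto
  then have "\<not> l i dvd prod l S" by (intro primelike_not_dvd_prod insert.prems(1)) auto
  moreover have "l i dvd prod l S * g" using insert.prems(3)[of i] f by simp
  ultimately have "l i dvd g" using insert.prems(1)[of i] by (auto simp: primelike_def)
  then have "l i * prod l S dvd prod l S * g" by (subst mult.commute) (intro mult_dvd_mono dvd_refl)
  then show ?case using f insert.hyps by simp
qed simp

text \<open>By \<open>line_dvd_iff\<close> the multiples form the kernel of a ring homomorphism into
  a domain.\<close>

lemma line_prime: "w \<in> P i \<Longrightarrow> primelike (X i + w)"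
  by (auto simp: primelike_def line_dvd_iff rhom_mult[OF rhom_kill] rhom_1[OF rhom_kill])

definition hcomp :: "nat \<Rightarrow> 'k::field mpol \<Rightarrow> 'k mpol" where
  "hcomp k = lin_ext (\<lambda>m. if mdeg m = k then Poly_Mapping.single m 1 else 0)"

lemma pm_linear_hcomp: "pm_linear (hcomp k)"
  unfolding hcomp_def by (rule pm_linear_lin_ext)

lemma comp_Hm: "p \<in> Hm d \<Longrightarrow> hcomp k p = (if k = d then p else 0)"
proof -
  assume p: "p \<in> Hm d"
  have "pm_linear (\<lambda>p. if k = d then p else 0)" by (auto simp: pm_linear_def)
  from pm_linear_eqI[OF pm_linear_hcomp this _ p[unfolded Hm_def]] show ?thesis by (auto simp: hcomp_def)
qed

lemma lookup_hcomp: "Poly_Mapping.lookup (hcomp k p) m = (if mdeg m = k then Poly_Mapping.lookup p m else 0)"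
proof -
  have "Poly_Mapping.lookup (hcomp k p) m =
      (\<Sum>m'\<in>Poly_Mapping.keys p. if m' = m then (if mdeg m = k then Poly_Mapping.lookup p m else 0) else 0)"
    unfolding hcomp_def lin_ext_def lookup_sum
    by (intro sum.cong) (auto simp: lookup_pm_scale lookup_single when_def)
  then show ?thesis by (auto simp: in_keys_iff)
qed

lemma comp_mult:
  assumes l: "l \<in> Hm e"
  shows "hcomp (e + k) (l * f) = l * hcomp k f"
proof (rule pm_linear_eqI[OF pm_linear_comp[OF pm_linear_hcomp pm_linear_mult_left]
      pm_linear_comp[OF pm_linear_mult_left pm_linear_hcomp] _ mpol_basis_UNIV])
  fix m :: "nat \<Rightarrow>\<^sub>0 nat"
  have s: "Poly_Mapping.single m (1::'a) \<in> Hm (mdeg m)" by (simp add: Hm_def basis_space_single)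
  show "hcomp (e + k) (l * Poly_Mapping.single m 1) = l * hcomp k (Poly_Mapping.single m 1)"
    using comp_Hm[OF s] comp_Hm[OF Hm_mult[OF l s]] by simp
qed

text \<open>Multiplication by a form of degree e maps the component of degree k to that of degree e
  + k, so all components of \<open>f\<close> but one are killed by the nonzero
  \<open>l\<close>.\<close>

lemma Hm_cancel:
  fixes f :: "'k::field mpol"
  assumes l: "l \<in> Hm e" "l \<noteq> 0" and lf: "l * f \<in> Hm d" and f: "f \<noteq> 0"
  shows "e \<le> d" "f \<in> Hm (d - e)"
proof -
  have z: "hcomp k f = 0" if "e + k \<noteq> d" for k
    using comp_mult[OF l(1), of k f] comp_Hm[OF lf, of "e + k"] that l(2) by auto
  have m: "e + mdeg m = d" if "m \<in> Poly_Mapping.keys f" for m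
  proof (rule ccontr)
    assume "e + mdeg m \<noteq> d"
    then have "Poly_Mapping.lookup (hcomp (mdeg m) f) m = 0" using z by simp
    then show False using that by (simp add: lookup_hcomp in_keys_iff)
  qed
  obtain m0 where m0: "m0 \<in> Poly_Mapping.keys f"
    using f by (metis all_not_in_conv in_keys_iff lookup_zero poly_mapping_eqI)
  show "e \<le> d" using m[OF m0] by simp
  have "mdeg m = d - e" if "m \<in> Poly_Mapping.keys f" for m using m[OF that] by simp
  then show "f \<in> Hm (d - e)" by (auto simp: Hm_def basis_space_def)
qed

text \<open>The substitution \<open>r\<close> sets the variables from index n on to 0. It fixes
  \<open>l\<close> and \<open>l * f\<close>, so cancelling \<open>l\<close> shows that it fixes
  \<open>f\<close>.\<close>

lemma P_cancel:
  fixes f :: "'k::field mpol"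
  assumes l: "l \<in> P n" "l \<noteq> 0" and lf: "l * f \<in> P n" shows "f \<in> P n"
proof -
  define r where "r = sub (\<lambda>i. if i < n then X i else (0 :: 'k mpol))"
  have rP: "r g \<in> P n" for g
  proof -
    obtain N where "g \<in> P N"
    proof -
      have "finite (\<Union>(Poly_Mapping.keys ` Poly_Mapping.keys g))" by auto
      then obtain N where "\<Union>(Poly_Mapping.keys ` Poly_Mapping.keys g) \<subseteq> {..<N}"
        by (metis finite_nat_iff_bounded)
      then show thesis using that[of N] by (auto simp: P_def basis_space_def)
    qed
    then show ?thesis unfolding r_def by (rule P_sub) (auto simp: P_X P_0)
  qed
  have rf: "r g = g" if "g \<in> P n" for g unfolding r_def using that by (rule sub_fix) auto
  have "l * r f = l * f" using rf[OF l(1)] rf[OF lf] unfolding r_def by (simp add: sub_mult)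
  then have "r f = f" using l(2) by simp
  then show ?thesis using rP by metis
qed

section \<open>Dickson polynomials and the Moore determinant\<close>

text \<open>
  \<open>FF k Y = \<Prod>\<^sub>w (Y + w)\<close>, where \<open>w\<close> runs over the span of \<open>X 0, \<dots>, X (k - 1)\<close>; its coefficients
  satisfy \<open>FF (k + 1) Y = (FF k Y)^q - (VV k)^(q - 1) * FF k Y\<close>.
\<close>

fun dickson_coeff :: "nat \<Rightarrow> nat \<Rightarrow> 'k::{field,finite} mpol" where
  "dickson_coeff 0 m = (if m = 0 then 1 else 0)"
| "dickson_coeff (Suc k) m = (case m of 0 \<Rightarrow> 0 | Suc m' \<Rightarrow> dickson_coeff k m' ^ CARD('k)) -
     (\<Sum>i\<le>k. dickson_coeff k i * X k ^ (CARD('k) ^ i)) ^ (CARD('k) - 1) * dickson_coeff k m"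

definition FF :: "nat \<Rightarrow> 'k::{field,finite} mpol \<Rightarrow> 'k mpol" where
  "FF k Y = (\<Sum>m\<le>k. dickson_coeff k m * Y ^ (CARD('k) ^ m))"

definition VV :: "nat \<Rightarrow> 'k::{field,finite} mpol" where
  "VV k = FF k (X k)"

definition Lam :: "nat \<Rightarrow> 'k::{field,finite} mpol" where
  "Lam n = (\<Prod>i<n. VV i)"

definition lf :: "nat \<Rightarrow> (nat \<Rightarrow> 'k::field) \<Rightarrow> 'k mpol" where
  "lf k u = (\<Sum>j<k. C (u j) * X j)"

definition UU :: "nat \<Rightarrow> (nat \<Rightarrow> 'k) set" where
  "UU k = {..<k} \<rightarrow>\<^sub>E UNIV"

text \<open>For c nonzero, multiplication by c permutes the nonzero elements; compare their product
  before and after.\<close>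

lemma field_power_card: "(c :: 'k::{field,finite}) ^ CARD('k) = c"
proof (cases "c = 0")
  case False
  have "c * (\<Prod>y\<in>UNIV-{0}. c * y) = c * c ^ (CARD('k) - 1) * \<Prod>(UNIV-{0})"
    by (simp add: prod.distrib mult_ac card_Diff_subset)
  also have "c * c ^ (CARD('k) - 1) = c ^ CARD('k)"
    by (metis power_Suc Suc_diff_1 zero_less_card_finite)
  also have "(\<Prod>y\<in>UNIV-{0}. c * y) = (\<Prod>y\<in>UNIV-{0}. y)"
    by (rule prod.reindex_bij_witness[of _ "\<lambda>y. y / c" "\<lambda>y. c * y"]) (use False in auto)
  finally show ?thesis by simp
qed (simp add: zero_less_card_finite)

lemma card_field_gt_1: "CARD('k::{field,finite}) > 1"
proof -
  have "card {0, 1 :: 'k} \<le> CARD('k)" by (rule card_mono) auto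
  then show ?thesis by simp
qed

lemma field_power_card_minus_1: "(c :: 'k::{field,finite}) \<noteq> 0 \<Longrightarrow> c ^ (CARD('k) - 1) = 1"
proof -
  assume "c \<noteq> 0"
  moreover have "c * c ^ (CARD('k) - 1) = c * 1"
    using field_power_card[of c] power_minus_mult[of "CARD('k)" c] by (simp add: mult.commute)
  ultimately show ?thesis using mult_cancel_left by blast
qed

lemma C_power_card: "C c ^ (CARD('k) ^ m) = (C c :: 'k::{field,finite} mpol)"
  by (induction m) (auto simp: power_mult C_power[symmetric] field_power_card)

lemma dickson_coeff_zero: "k < m \<Longrightarrow> dickson_coeff k m = 0"
  by (induction k arbitrary: m) (auto split: nat.splits simp: zero_less_card_finite)

lemma dickson_coeff_top: "dickson_coeff k k = 1"
  by (induction k) (auto simp: dickson_coeff_zero)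

lemma FF_P: "(\<And>m. (dickson_coeff k m :: 'k::{field,finite} mpol) \<in> P n) \<Longrightarrow> Y \<in> P n \<Longrightarrow> FF k (Y :: 'k mpol) \<in> P n"
  unfolding FF_def by (intro P_sum P_mult P_power)

lemma dickson_coeff_P: "(dickson_coeff k m :: 'k::{field,finite} mpol) \<in> P k"
proof (induction k arbitrary: m)
  case (Suc k)
  have 1: "(dickson_coeff k i :: 'k mpol) \<in> P (Suc k)" for i by (rule P_mono[OF _ Suc]) simp
  show ?case unfolding dickson_coeff.simps
    by (intro P_diff P_mult P_power P_sum 1 P_X) (auto split: nat.split intro: P_0 P_power 1)
qed (simp add: P_0 P_1)

lemma VV_P: "VV k \<in> P (Suc k)"
  unfolding VV_def by (intro FF_P P_mono[OF _ dickson_coeff_P] P_X) auto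

lemma FF_Hm:
  assumes "\<And>m. m \<le> k \<Longrightarrow> dickson_coeff k m \<in> (Hm (CARD('k) ^ k - CARD('k) ^ m) :: 'k::{field,finite} mpol set)"
    and Y: "Y \<in> Hm 1"
  shows "FF k Y \<in> (Hm (CARD('k) ^ k) :: 'k mpol set)"
  unfolding FF_def
proof (rule Hm_sum)
  fix m assume m: "m \<in> {..k}"
  have "CARD('k) ^ m \<le> CARD('k) ^ k" using m by (intro power_increasing) (auto simp: Suc_leI)
  then show "dickson_coeff k m * Y ^ (CARD('k) ^ m) \<in> Hm (CARD('k) ^ k)"
    using Hm_mult[OF assms(1)[of m] Hm_power[OF Y, of "CARD('k) ^ m"]] m by simp
qed

lemma dickson_coeff_Hm: "m \<le> k \<Longrightarrow> dickson_coeff k m \<in> (Hm (CARD('k) ^ k - CARD('k) ^ m) :: 'k::{field,finite} mpol set)"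
proof (induction k arbitrary: m)
  case (Suc k)
  let ?q = "CARD('k)"
  have q1: "?q \<ge> 1" by (simp add: Suc_leI)
  have V: "FF k (X k) \<in> (Hm (?q ^ k) :: 'k mpol set)" by (rule FF_Hm[OF Suc.IH Hm_X])
  have V': "FF k (X k) ^ (?q - 1) \<in> (Hm (?q ^ k * (?q - 1)) :: 'k mpol set)" by (rule Hm_power[OF V])
  have 2: "FF k (X k) ^ (?q - 1) * dickson_coeff k m \<in> (Hm (?q ^ Suc k - ?q ^ m) :: 'k mpol set)"
  proof (cases "m \<le> k")
    case True
    have "?q ^ m \<le> ?q ^ k" using True q1 by (rule power_increasing)
    moreover have "?q ^ k * (?q - 1) = ?q ^ Suc k - ?q ^ k" by (simp add: algebra_simps)
    moreover have "?q ^ k \<le> ?q ^ Suc k" using q1 by simp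
    ultimately have "?q ^ k * (?q - 1) + (?q ^ k - ?q ^ m) = ?q ^ Suc k - ?q ^ m" by linarith
    then show ?thesis using Hm_mult[OF V' Suc.IH[OF True]] by simp
  qed (simp add: dickson_coeff_zero Hm_0)
  have 1: "(case m of 0 \<Rightarrow> 0 | Suc m' \<Rightarrow> dickson_coeff k m' ^ ?q) \<in> (Hm (?q ^ Suc k - ?q ^ m) :: 'k mpol set)"
  proof (cases m)
    case (Suc m')
    then have "dickson_coeff k m' ^ ?q \<in> (Hm ((?q ^ k - ?q ^ m') * ?q) :: 'k mpol set)"
      using Suc.IH[of m'] Suc.prems by (intro Hm_power) simp
    then show ?thesis using Suc by (simp add: algebra_simps)
  qed (simp add: Hm_0)
  show ?case unfolding dickson_coeff.simps using Hm_diff[OF 1 2] by (simp add: FF_def)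
qed (simp add: Hm_1)

lemma VV_Hm: "VV k \<in> (Hm (CARD('k) ^ k) :: 'k::{field,finite} mpol set)"
  unfolding VV_def by (rule FF_Hm[OF dickson_coeff_Hm Hm_X])

lemma lf_P: "lf k u \<in> P k"
  unfolding lf_def by (intro P_sum P_mult P_C P_X) auto

lemma lookup_lf: "j < k \<Longrightarrow> Poly_Mapping.lookup (lf k u) (Poly_Mapping.single j 1) = u j"
proof -
  assume j: "j < k"
  have "C (u i) * X i = Poly_Mapping.single (Poly_Mapping.single i 1) (u i)" for i
    by (simp add: C_def X_def mult_single)
  moreover have "Poly_Mapping.single i (1::nat) = Poly_Mapping.single j 1 \<longleftrightarrow> i = j" for i
    by (metis lookup_single_eq lookup_single_not_eq zero_neq_one)
  ultimately have "Poly_Mapping.lookup (lf k u) (Poly_Mapping.single j 1) = (\<Sum>i<k. if i = j then u i else 0)"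
    unfolding lf_def lookup_sum by (intro sum.cong) (auto simp: lookup_single when_def)
  then show ?thesis using j by simp
qed

lemma lf_inj: "u \<in> UU k \<Longrightarrow> v \<in> UU k \<Longrightarrow> lf k u = lf k v \<Longrightarrow> u = v"
  by (rule PiE_ext[of _ "{..<k}" "\<lambda>_. UNIV"]) (auto simp: UU_def lookup_lf[symmetric])

lemma finite_UU: "finite (UU k :: (nat \<Rightarrow> 'k::finite) set)"
  by (simp add: UU_def finite_PiE)

text \<open>
  The argument \<open>ty\<close> only fixes the type \<open>'k\<close>.
\<close>

locale prime_power_field =
  fixes ty :: "'k::{field,finite} itself" and p r :: nat
  assumes prime: "prime p" and card: "CARD('k) = p ^ r"
begin

lemma CHAR_mpol: "CHAR('k mpol) = p"
proof -
  have "of_nat p ^ r = (0 :: 'k)" using of_nat_card_field[where 'k = 'k] card by simp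
  then have p0: "of_nat p = (0 :: 'k)" by simp
  have "of_nat p = C (of_nat p :: 'k)" by (induction p) (auto simp: C_0 C_add C_1)
  then have "of_nat p = (0 :: 'k mpol)" using p0 by (simp add: C_0)
  then have "CHAR('k mpol) dvd p" by (simp add: of_nat_eq_0_iff_char_dvd)
  moreover have "CHAR('k mpol) \<noteq> 1" by simp
  ultimately show ?thesis using prime by (metis prime_nat_iff)
qed

lemma frob: "(x + y) ^ (CARD('k) ^ m) = x ^ (CARD('k) ^ m) + y ^ (CARD('k) ^ m)" for x y :: "'k mpol"
  by (rule freshmans_dream'[where n = "r * m"]) (auto simp: CHAR_mpol prime card power_mult)

lemma frob_sum: "sum f I ^ (CARD('k) ^ m) = (\<Sum>i\<in>I. f i ^ (CARD('k) ^ m))" for f :: "'i \<Rightarrow> 'k mpol"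
  by (rule freshmans_dream_sum'[where n = "r * m"]) (auto simp: CHAR_mpol prime card power_mult)

lemma frob_neg: "(- x) ^ (CARD('k) ^ m) = - (x ^ (CARD('k) ^ m))" for x :: "'k mpol"
  using frob[of x "- x" m] by (simp add: eq_neg_iff_add_eq_0 add.commute power_0_left)

text \<open>As polynomials in A both sides are monic of degree q and vanish at the points -cB. These
  are q distinct points when B is nonzero, which is enough for equality.\<close>

lemma prod_lines: "(\<Prod>c\<in>UNIV. A + C c * B) = A ^ CARD('k) - B ^ (CARD('k) - 1) * A" for A B :: "'k mpol"
proof (cases "B = 0")
  case True
  then show ?thesis using card_field_gt_1[where 'k = 'k] by (simp add: power_0_left)
next
  case False
  define f where "f = (\<Prod>c\<in>(UNIV :: 'k set). [:C c * B, 1:])"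
  define g where "g = monom 1 CARD('k) - smult (B ^ (CARD('k) - 1)) [:0, 1:]"
  have q: "CARD('k) > 1" by (rule card_field_gt_1)
  have d1: "degree f = CARD('k)"
    unfolding f_def by (simp add: degree_prod_sum_eq)
  have d2: "lead_coeff f = 1"
    unfolding f_def lead_coeff_prod by simp
  note df = d1 d2
  have dg: "degree g \<le> CARD('k)" unfolding g_def
    using q by (intro degree_diff_le degree_monom_le) (auto intro: order_trans[OF degree_smult_le])
  have cg: "poly.coeff g CARD('k) = 1" unfolding g_def using q by (simp add: coeff_eq_0)
  have "f = g"
  proof (rule poly_eqI_degree_lead_coeff[where A = "(\<lambda>c. - (C c * B)) ` UNIV" and n = "CARD('k)"])
    show "poly.coeff f CARD('k) = poly.coeff g CARD('k)" using df cg by simp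
    have "inj (\<lambda>c::'k. - (C c * B))" using False by (auto simp: inj_def C_eq_iff)
    then show "card ((\<lambda>c::'k. - (C c * B)) ` UNIV) \<ge> CARD('k)" by (simp add: card_image)
    fix z assume "z \<in> (\<lambda>c. - (C c * B)) ` UNIV"
    then obtain c where z: "z = - (C c * B)" by auto
    have "poly f z = 0" unfolding f_def poly_prod z by (rule prod_zero) (auto intro!: bexI[of _ c])
    moreover have "poly g z = 0"
    proof -
      have "z ^ CARD('k) = - (C c * B ^ CARD('k))"
        using frob_neg[of "C c * B" 1] C_power_card[of c 1] by (simp add: z power_mult_distrib)
      moreover have "B ^ (CARD('k) - 1) * z = - (C c * B ^ CARD('k))"
        using q power_minus_mult[of "CARD('k)" B] by (simp add: z mult.left_commute[of _ "C c"])
      ultimately show ?thesis by (simp add: g_def poly_monom mult.commute[of z])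
    qed
    ultimately show "poly f z = poly g z" by simp
  qed (use df dg in auto)
  then have "poly f A = poly g A" by simp
  then show ?thesis by (simp add: f_def g_def poly_prod poly_monom add.commute)
qed

lemma FF_add: "FF k (Y + Z) = FF k Y + FF k Z" for Y Z :: "'k mpol"
  by (simp add: FF_def frob sum.distrib algebra_simps)

lemma FF_scale: "FF k (C c * Y) = C c * FF k Y" for Y :: "'k mpol"
  by (simp add: FF_def power_mult_distrib C_power_card sum_distrib_left algebra_simps)

lemma FF_Suc: "FF (Suc k) Y = FF k Y ^ CARD('k) - VV k ^ (CARD('k) - 1) * FF k Y" for Y :: "'k mpol"
proof -
  have e: "(dickson_coeff (Suc k) m :: 'k mpol) = (case m of 0 \<Rightarrow> 0 | Suc m' \<Rightarrow> dickson_coeff k m' ^ CARD('k)) - VV k ^ (CARD('k) - 1) * dickson_coeff k m" for m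
    by (simp add: VV_def FF_def)
  have 1: "(\<Sum>m\<le>Suc k. (case m of 0 \<Rightarrow> 0 | Suc m' \<Rightarrow> dickson_coeff k m' ^ CARD('k)) * Y ^ (CARD('k) ^ m)) = FF k Y ^ CARD('k)"
    using frob_sum[of "\<lambda>m. dickson_coeff k m * Y ^ (CARD('k) ^ m)" "{..k}" 1]
    unfolding sum.atMost_Suc_shift FF_def by (simp add: power_mult_distrib power_mult[symmetric] mult.commute)
  have 2: "(\<Sum>m\<le>Suc k. dickson_coeff k m * Y ^ (CARD('k) ^ m)) = FF k Y" by (simp add: FF_def dickson_coeff_zero)
  have "FF (Suc k) Y = (\<Sum>m\<le>Suc k. (case m of 0 \<Rightarrow> 0 | Suc m' \<Rightarrow> dickson_coeff k m' ^ CARD('k)) * Y ^ (CARD('k) ^ m)) - VV k ^ (CARD('k) - 1) * (\<Sum>m\<le>Suc k. dickson_coeff k m * Y ^ (CARD('k) ^ m))"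
    unfolding FF_def[of "Suc k"] e by (simp only: left_diff_distrib sum_subtractf sum_distrib_left mult.assoc)
  then show ?thesis by (simp only: 1 2)
qed

lemma FF_X_zero: "i < k \<Longrightarrow> FF k (X i) = (0 :: 'k mpol)"
proof (induction k)
  case (Suc k)
  have q: "CARD('k) > 1" by (rule card_field_gt_1)
  show ?case
  proof (cases "i = k")
    case True
    have "FF (Suc k) (X i) = (VV k ^ CARD('k) - VV k ^ (CARD('k) - 1) * VV k :: 'k mpol)" unfolding FF_Suc True by (simp add: VV_def)
    also have "\<dots> = 0" using q power_minus_mult[of "CARD('k)" "VV k :: 'k mpol"] by simp
    finally show ?thesis .
  next
    case False
    then show ?thesis using Suc q by (simp add: FF_Suc)
  qed
qed simp

text \<open>Split the span of the variables by the coefficient c of X_k. For fixed c the induction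
  hypothesis gives FF_k(Y + c X_k), which is additive in its argument, and \<open>prod_lines\<close>
  multiplies over c.\<close>

lemma FF_prod: "FF k Y = (\<Prod>u\<in>UU k. Y + lf k u)" for Y :: "'k mpol"
proof (induction k arbitrary: Y)
  case 0
  then show ?case by (simp add: FF_def UU_def lf_def)
next
  case (Suc k)
  have c: "FF k Y + C c * VV k = FF k (Y + C c * X k)" for c :: 'k
    by (simp only: VV_def FF_add FF_scale)
  have "FF (Suc k) Y = (\<Prod>c\<in>UNIV. FF k Y + C c * VV k)" by (simp add: FF_Suc prod_lines)
  also have "\<dots> = (\<Prod>c\<in>UNIV. \<Prod>u\<in>UU k. Y + C c * X k + lf k u)"
    unfolding c unfolding Suc.IH ..
  also have "\<dots> = (\<Prod>(c, u)\<in>UNIV \<times> UU k. Y + C c * X k + lf k u)" by (rule prod.cartesian_product)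
  also have "\<dots> = (\<Prod>u\<in>UU (Suc k). Y + lf (Suc k) u)"
  proof (rule prod.reindex_bij_witness[where i = "\<lambda>v. (v k, restrict v {..<k})" and j = "\<lambda>(c, u). u(k := c)"])
    fix cu :: "'k \<times> (nat \<Rightarrow> 'k)" assume cu: "cu \<in> UNIV \<times> UU k"
    obtain c u where e: "cu = (c, u)" by (cases cu)
    have u: "u \<in> UU k" using cu e by auto
    show "((case cu of (c, u) \<Rightarrow> u(k := c)) k, restrict (case cu of (c, u) \<Rightarrow> u(k := c)) {..<k}) = cu"
      using u by (auto simp: e UU_def PiE_def extensional_def fun_eq_iff)
    show "(case cu of (c, u) \<Rightarrow> u(k := c)) \<in> UU (Suc k)"
      using u by (auto simp: e UU_def PiE_def extensional_def)
    show "Y + lf (Suc k) (case cu of (c, u) \<Rightarrow> u(k := c)) = (case cu of (c, u) \<Rightarrow> Y + C c * X k + lf k u)"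
      by (simp add: e lf_def add_ac)
  next
    fix v :: "nat \<Rightarrow> 'k" assume v: "v \<in> UU (Suc k)"
    show "(v k, restrict v {..<k}) \<in> UNIV \<times> UU k" by (auto simp: UU_def)
    show "(case (v k, restrict v {..<k}) of (c, u) \<Rightarrow> u(k := c)) = v"
      using v by (auto simp: UU_def PiE_def extensional_def fun_eq_iff less_Suc_eq)
  qed
  finally show ?case .
qed

lemma VV_nonzero: "VV k \<noteq> (0 :: 'k mpol)"
  unfolding VV_def FF_prod by (simp add: prod_zero_iff finite_UU X_add_nonzero[OF lf_P])

lemma X_dvd_VV: "X k dvd (VV k :: 'k mpol)"
  unfolding VV_def FF_def by (intro dvd_sum dvd_mult dvd_power) (simp add: zero_less_card_finite)

lemma Lam_nonzero: "Lam n \<noteq> (0 :: 'k mpol)"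
  by (simp add: Lam_def VV_nonzero prod_zero_iff)

lemma Lam_P: "Lam n \<in> (P n :: 'k mpol set)"
  unfolding Lam_def by (intro P_prod P_mono[OF _ VV_P]) auto

lemma Lam_Hm: "Lam n \<in> (Hm (\<Sum>i<n. CARD('k) ^ i) :: 'k mpol set)"
  unfolding Lam_def by (intro Hm_prod VV_Hm)

lemma X_dvd_Lam: "i < n \<Longrightarrow> X i dvd (Lam n :: 'k mpol)"
  unfolding Lam_def using dvd_prodI[of "{..<n}" i VV] X_dvd_VV dvd_trans by blast

text \<open>Expanding each \<open>VV i\<close> by \<open>FF_prod\<close> makes \<open>Lam n\<close>
  a product of linear primes, no two of which divide each other.\<close>

lemma Lam_dvdI:
  assumes "\<And>i u. i < n \<Longrightarrow> u \<in> UU i \<Longrightarrow> X i + lf i u dvd f"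
  shows "(Lam n :: 'k mpol) dvd f"
proof -
  let ?S = "SIGMA i:{..<n}. (UU i :: (nat \<Rightarrow> 'k) set)"
  have e: "(Lam n :: 'k mpol) = (\<Prod>(i, u)\<in>?S. X i + lf i u)"
    unfolding Lam_def VV_def FF_prod by (subst prod.Sigma) (auto simp: finite_UU)
  show ?thesis unfolding e
  proof (rule prime_family_dvd)
    show "finite ?S" by (intro finite_SigmaI finite_UU) simp
    fix x :: "nat \<times> (nat \<Rightarrow> 'k)" assume x: "x \<in> ?S"
    then show "(case x of (i, u) \<Rightarrow> X i + lf i u) dvd f" using assms by auto
    show "primelike (case x of (i, u) \<Rightarrow> X i + lf i u)" using line_prime[OF lf_P] by (cases x) simp
    fix y :: "nat \<times> (nat \<Rightarrow> 'k)" assume y: "y \<in> ?S" and xy: "x \<noteq> y"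
    obtain i u where xe: "x = (i, u)" by (cases x)
    obtain j v where ye: "y = (j, v)" by (cases y)
    have "(i, lf i u) \<noteq> (j, lf j v)" using xy x y lf_inj[of u i v] by (auto simp: xe ye)
    then show "\<not> (case x of (i, u) \<Rightarrow> X i + lf i u) dvd (case y of (i, u) \<Rightarrow> X i + lf i u)"
      unfolding xe ye using line_not_dvd[OF lf_P lf_P] by simp
  qed
qed

lemma FF_relation: "X l ^ (CARD('k) ^ k) = FF k (X l) + (\<Sum>m<k. - dickson_coeff k m * X l ^ (CARD('k) ^ m) :: 'k mpol)" for l k
proof -
  have "FF k (X l) = (\<Sum>m<k. dickson_coeff k m * X l ^ (CARD('k) ^ m)) + (X l ^ (CARD('k) ^ k) :: 'k mpol)"
    by (simp add: FF_def lessThan_Suc_atMost[symmetric] dickson_coeff_top)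
  then show ?thesis by (simp add: sum_negf)
qed

text \<open>The additive polynomial FF_k vanishes at X_l for l < k and equals V_k at X_k. Its lower
  coefficients, negated, therefore express row k of the Moore matrix by the earlier rows as
  triangularity requires.\<close>

sublocale mo: moore n "\<lambda>m l. X l ^ (CARD('k) ^ m) :: 'k mpol" "\<lambda>k m. - dickson_coeff k m" VV for n
proof
  fix k l assume "k < n"
  show "X l ^ CARD('k) ^ k = (\<Sum>m<k. - dickson_coeff k m * X l ^ CARD('k) ^ m :: 'k mpol)" if "l < k"
    using FF_relation[of l k] unfolding FF_X_zero[OF that] by (simp only: add_0_left)
  show "X k ^ CARD('k) ^ k = (\<Sum>m<k. - dickson_coeff k m * X k ^ CARD('k) ^ m) + (VV k :: 'k mpol)"
    using FF_relation[of k k] unfolding VV_def[symmetric] by (simp only: add.commute)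
  show "VV k \<noteq> (0 :: 'k mpol)" by (rule VV_nonzero)
qed

end

lemma sym_act_sub: "sym_act g = sub (sym_col g)"
  by (simp add: sym_act_def sub_def mon_def[abs_def])

lemma sym_col_alt: "g \<in> carrier_mat n n \<Longrightarrow> sym_col g i = (\<Sum>l<n. C (g $$ (l, i)) * X l)"
  by (auto simp: sym_col_def C_def X_def mult_single)

lemma rhom_sym_act: "rhom (sym_act g)"
  by (simp add: sym_act_sub rhom_sub)

lemma sym_act_X: "sym_act g (X i) = sym_col g i"
  by (simp add: sym_act_sub sub_X)

lemma sym_act_C: "sym_act g (C c) = C c"
  by (simp add: sym_act_sub sub_C)

lemma sym_col_P: "g \<in> carrier_mat n n \<Longrightarrow> sym_col g i \<in> P n"
  unfolding sym_col_alt by (intro P_sum P_mult P_C P_X) auto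

lemma sym_act_P: "g \<in> carrier_mat n n \<Longrightarrow> f \<in> P n \<Longrightarrow> sym_act g f \<in> P n"
  unfolding sym_act_sub by (rule P_sub) (auto intro: sym_col_P)

lemma sym_col_Hm: "sym_col g i \<in> Hm 1"
proof -
  have "Poly_Mapping.single (Poly_Mapping.single l 1) a \<in> Hm 1" for l :: nat and a
    by (auto simp: Hm_def mdeg_def intro!: basis_space_single)
  then show ?thesis unfolding sym_col_def by (intro Hm_sum)
qed

lemma sym_act_Hm: "f \<in> Hm d \<Longrightarrow> sym_act g f \<in> Hm d"
  unfolding sym_act_sub by (erule Hm_sub) (rule sym_col_Hm)

section \<open>The spaces \<open>K\<close> for polynomials and for forms\<close>

definition form_coeff :: "'k::field mat \<Rightarrow> nat \<Rightarrow> nat \<Rightarrow> 'k mpol" where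
  "form_coeff g = (\<lambda>j l. C (g $$ (l, j)))"

definition gact :: "nat \<Rightarrow> 'k::field mat \<Rightarrow> (nat set \<Rightarrow> 'k mpol) \<Rightarrow> nat set \<Rightarrow> 'k mpol" where
  "gact n g \<omega> = fa n (form_coeff g) (sym_act g) \<omega>"

definition HP :: "nat \<Rightarrow> nat \<Rightarrow> 'k::field mpol set" where
  "HP n d = P n \<inter> Hm d"

lemma HP_mult: "f \<in> HP n d \<Longrightarrow> g \<in> HP n e \<Longrightarrow> f * g \<in> HP n (d + e)"
  and HP_add: "f \<in> HP n d \<Longrightarrow> g' \<in> HP n d \<Longrightarrow> f + g' \<in> HP n d"
  and HP_diff: "f \<in> HP n d \<Longrightarrow> g' \<in> HP n d \<Longrightarrow> f - g' \<in> HP n d"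
  and HP_neg: "f \<in> HP n d \<Longrightarrow> - f \<in> HP n d"
  and HP_0: "0 \<in> HP n d"
  and HP_sum: "(\<And>i. i \<in> I \<Longrightarrow> F i \<in> HP n d) \<Longrightarrow> sum F I \<in> HP n d"
  and HP_C: "C c \<in> HP n 0"
  by (auto simp: HP_def P_mult Hm_mult P_add Hm_add P_diff Hm_diff P_neg Hm_neg P_0 Hm_0 P_sum Hm_sum P_C Hm_C)

lemma HP_1: "1 \<in> HP n 0"
  by (simp add: HP_def P_1 Hm_1)

lemma HP_C_mult: "f \<in> HP n d \<Longrightarrow> C c * f \<in> HP n d"
  using HP_mult[OF HP_C, of f n d c] by simp

lemma HP_power: "f \<in> HP n d \<Longrightarrow> f ^ k \<in> HP n (d * k)"
  by (simp add: HP_def P_power Hm_power)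

lemma HP_cancel:
  assumes "l \<in> HP n e" "l \<noteq> 0" "l * f \<in> HP n d" "f \<noteq> 0"
  shows "e \<le> d" "f \<in> HP n (d - e)"
  using assms Hm_cancel[of l e f d] P_cancel[of l n f] by (auto simp: HP_def)

lemma sg_HP: "(sg l J :: 'k::field mpol) \<in> HP n 0"
  using sg_cases[where 'a = "'k mpol", of l J] by (auto simp: HP_1 HP_neg[OF HP_1])

lemma gact_sm: "gact n g (sm f \<omega>) = sm (sym_act g f) (gact n g \<omega>)"
  and gact_add: "gact n g (\<omega> + \<eta>) = gact n g \<omega> + gact n g \<eta>"
  and gact_neg: "gact n g (- \<omega>) = - gact n g \<omega>"
  and gact_zero: "gact n g 0 = 0"
  and gact_ev_empty: "gact n g (ev {}) = ev {}"
  by (simp_all add: gact_def fa_sm fa_add fa_neg fa_zero fa_ev EL_def rhom_sym_act)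

lemma gact_expand: "gact n g \<omega> J = (\<Sum>I\<in>Pow {..<n}. EE n (form_coeff g) I J * sym_act g (\<omega> I))"
  by (simp add: gact_def fa_def Ehat_def)

lemma gact_Fsup:
  assumes "\<omega> \<in> Fsup n j" shows "gact n g \<omega> \<in> Fsup n j"
  unfolding Fsup_def
proof (intro CollectI allI impI)
  fix J assume "gact n g \<omega> J \<noteq> 0"
  then obtain I where I: "I \<in> Pow {..<n}" "EE n (form_coeff g) I J * sym_act g (\<omega> I) \<noteq> 0"
    unfolding gact_expand by (meson sum.neutral)
  then have "\<omega> I \<noteq> 0" by (auto simp: rhom_0[OF rhom_sym_act])
  then have "card I = j" using assms by (auto simp: Fsup_def)
  moreover have "J \<subseteq> {..<n} \<and> card J = length (sorted_list_of_set I)"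
    using EL_support[of n "form_coeff g" "sorted_list_of_set I" J] I by auto
  ultimately show "J \<subseteq> {..<n} \<and> card J = j" by simp
qed

lemma cre_dvd_const:
  fixes v :: "nat \<Rightarrow> 'k::field mpol"
  assumes v: "\<And>l. v l \<in> HP n 0" and w: "\<And>J. \<omega> J \<in> HP n d"
  shows "cre n v \<omega> J \<in> HP n d"
proof -
  have m: "f * g \<in> HP n d" if "f \<in> HP n 0" "g \<in> HP n d" for f g :: "'k mpol"
    using HP_mult[OF that] by simp
  show ?thesis unfolding cre_def cr_def by (intro HP_sum) (auto intro: HP_0 m v w sg_HP)
qed

lemma EL_HP: "(\<And>j l. G j l \<in> HP n 0) \<Longrightarrow> EL n G xs J \<in> HP n 0"
  unfolding EL_def
  by (induction xs arbitrary: J) (auto simp: ev_def HP_0 HP_1 intro: cre_dvd_const)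

lemma gact_HP:
  assumes g: "g \<in> carrier_mat n n" and w: "\<And>J. \<omega> J \<in> HP n d"
  shows "gact n g \<omega> J \<in> HP n d"
  unfolding gact_expand
proof (rule HP_sum)
  fix I
  have "EE n (form_coeff g) I J \<in> HP n 0" by (rule EL_HP) (simp add: form_coeff_def HP_C)
  moreover have "sym_act g (\<omega> I) \<in> HP n d" using w[of I] g by (auto simp: HP_def sym_act_P sym_act_Hm)
  ultimately show "EE n (form_coeff g) I J * sym_act g (\<omega> I) \<in> HP n d" using HP_mult by fastforce
qed

lemma ann_HP:
  assumes "\<And>l. l < n \<Longrightarrow> a l \<in> HP n e" and "\<And>J. \<omega> J \<in> HP n d"
  shows "ann n a \<omega> J \<in> HP n (e + d)"
proof -
  have "an l \<omega> J \<in> HP n d" for l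
    unfolding an_def using HP_mult[OF sg_HP assms(2)] by (auto intro: HP_0)
  then show ?thesis unfolding ann_def using assms(1) by (intro HP_sum HP_mult) auto
qed

text \<open>Exactly the matrices occurring in the equations of \<open>K\<close>; equivariance has to
  be established only for these.\<close>

definition hecke_gens :: "nat \<Rightarrow> 'k::field mat set" where
  "hecke_gens n = Borel n \<union> {tm n i c | i c. Suc i < n}"

lemma hecke_gens_carrier: "g \<in> hecke_gens n \<Longrightarrow> g \<in> carrier_mat n n"
  by (auto simp: hecke_gens_def mem_Borel)

lemma hecke_gens_det: "g \<in> hecke_gens n \<Longrightarrow> det g \<noteq> 0"
  by (auto simp: hecke_gens_def det_tm mem_GL dest: Borel_GL)

lemma hecke_gens_Borel: "b \<in> Borel n \<Longrightarrow> b \<in> hecke_gens n" and hecke_gens_tm: "Suc i < n \<Longrightarrow> tm n i c \<in> hecke_gens n"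
  by (auto simp: hecke_gens_def)

lemma det_Borel:
  fixes b :: "'k::field mat"
  assumes "b \<in> Borel n" shows "det b = (\<Prod>i<n. b $$ (i, i))"
proof -
  have "upper_triangular b" "b \<in> carrier_mat n n" using assms by (auto simp: Borel_def GL_def)
  then have "det b = prod_list (diag_mat b)" by (rule det_upper_triangular)
  then show ?thesis using \<open>b \<in> carrier_mat n n\<close> by (simp add: prod_list_diag_prod lessThan_atLeast0)
qed

lemma gact_vol:
  assumes "g \<in> hecke_gens n" shows "gact n g (ev {..<n}) = sm (C (det g)) (ev {..<n})"
proof -
  have e: "gact n g (ev {..<n}) = EE n (form_coeff g) {..<n}" by (simp add: gact_def fa_ev rhom_sym_act)
  from assms consider "g \<in> Borel n" | i c where "Suc i < n" "g = tm n i c" by (auto simp: hecke_gens_def)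
  then show ?thesis
  proof cases
    case 1
    have "EE n (form_coeff g) {..<n} = sm (\<Prod>j<n. form_coeff g j j) (ev {..<n})"
      by (rule EE_top_triangular) (use 1 in \<open>auto simp: form_coeff_def mem_Borel C_0\<close>)
    then show ?thesis unfolding e det_Borel[OF 1] by (simp add: form_coeff_def rhom_prod[OF rhom_C])
  next
    case 2
    \<comment> \<open>\<open>EE_top_swap\<close> wants a matrix known at all indices, whereas
      entries of \<open>g\<close> outside its dimensions are unspecified; it is padded by the
      identity.\<close>
    have "EE n (\<lambda>j l. if l < n \<and> j < n then form_coeff g j l else if l = j then 1 else 0) {..<n} = - ev {..<n}"
      by (rule EE_top_swap[OF 2(1), where c = "C c"])
        (use 2 in \<open>auto simp: form_coeff_def tm_def C_0 C_1\<close>)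
    moreover have "EE n (\<lambda>j l. if l < n \<and> j < n then form_coeff g j l else if l = j then 1 else 0) {..<n} = EE n (form_coeff g) {..<n}"
    proof -
      have "foldr (\<lambda>j. cre n (\<lambda>l. if l < n \<and> j < n then form_coeff g j l else if l = j then 1 else 0)) xs w = foldr (\<lambda>j. cre n (form_coeff g j)) xs w"
        if "set xs \<subseteq> {..<n}" for xs w
        using that by (induction xs) (auto simp: cre_def)
      moreover have "set [0..<n] \<subseteq> {..<n}" by auto
      ultimately show ?thesis unfolding EL_def sorted_list_lessThan by blast
    qed
    ultimately have "EE n (form_coeff g) {..<n} = - ev {..<n}" by (metis (no_types))
    then have "gact n g (ev {..<n}) = - ev {..<n}" by (simp only: e)
    then show ?thesis unfolding 2(2) det_tm[OF 2(1)] C_neg C_1 sm_simps(5) sm_simps(2) .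
  qed
qed

context prime_power_field
begin

abbreviation "aq m \<equiv> (\<lambda>l. X l ^ (CARD('k) ^ m) :: 'k mpol)"
abbreviation "volf n \<equiv> (ev {..<n} :: nat set \<Rightarrow> 'k mpol)"

text \<open>Raising to the power q^m is additive and fixes the scalars, so the q^m-th powers of the
  variables transform by the same matrix as the variables.\<close>

lemma aq_equiv:
  assumes "g \<in> carrier_mat n n" shows "(\<Sum>l<n. form_coeff g i l * aq m l) = sym_act g (aq m i)"
proof -
  have "sym_act g (aq m i) = (\<Sum>l<n. C (g $$ (l, i)) * X l) ^ (CARD('k) ^ m)"
    by (simp add: rhom_power[OF rhom_sym_act] sym_act_X sym_col_alt[OF assms])
  also have "\<dots> = (\<Sum>l<n. form_coeff g i l * aq m l)"
    by (simp add: frob_sum power_mult_distrib C_power_card form_coeff_def)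
  finally show ?thesis ..
qed

lemma gact_A:
  assumes g: "g \<in> carrier_mat n n" and w: "\<omega> \<in> Fsup n (j + length ms)"
  shows "gact n g (mo.A n ms \<omega>) = mo.A n ms (gact n g \<omega>)"
  unfolding gact_def by (rule fa_foldr_ann[OF rhom_sym_act aq_equiv[OF g] w])

lemma gact_DD:
  assumes g: "g \<in> carrier_mat n n" and J: "J \<subseteq> {..<n}" and w: "\<omega> \<in> Fsup n (i + card J)"
  shows "gact n g (mo.DD n J \<omega>) = mo.DD n J (gact n g \<omega>)"
proof -
  have "finite J" using J finite_subset by blast
  then show ?thesis unfolding mo.DD_def using w by (intro gact_A[OF g, where j = i]) simp
qed

lemma Fsup_0: "\<omega> \<in> Fsup n 0 \<Longrightarrow> \<omega> = sm (\<omega> {}) (ev {})" for \<omega> :: "nat set \<Rightarrow> 'k mpol"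
proof
  fix J assume w: "\<omega> \<in> Fsup n 0"
  show "\<omega> J = sm (\<omega> {}) (ev {}) J"
  proof (cases "J = {}")
    case False
    then have "\<omega> J = 0" using w finite_subset[of J "{..<n}"] by (auto simp: Fsup_def)
    then show ?thesis using False by (simp add: sm_def ev_def)
  qed (simp add: sm_def ev_def)
qed

lemma DD_gact:
  assumes g: "g \<in> carrier_mat n n" and J: "J \<subseteq> {..<n}" and w: "\<omega> \<in> Fsup n (card J)"
  shows "mo.DD n J (gact n g \<omega>) {} = sym_act g (mo.DD n J \<omega> {})"
proof -
  have "mo.DD n J (gact n g \<omega>) = gact n g (mo.DD n J \<omega>)"
    using gact_DD[OF g J, of \<omega> 0] w by simp
  also have "\<dots> = gact n g (sm (mo.DD n J \<omega> {}) (ev {}))"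
    using Fsup_0[OF mo.DD_Fsup[OF J w]] by metis
  also have "\<dots> = sm (sym_act g (mo.DD n J \<omega> {})) (ev {})" by (simp add: gact_sm gact_ev_empty)
  finally show ?thesis by (simp add: sm_def ev_def)
qed

text \<open>Contract the volume form with all covectors: the contraction is equivariant and returns
  \<open>Lam n\<close> up to sign, while the volume form is multiplied by the determinant.\<close>

lemma sym_act_Lam:
  assumes g: "g \<in> hecke_gens n" shows "sym_act g (Lam n) = C (det g) * (Lam n :: 'k mpol)"
proof -
  obtain e :: "'k mpol" where e: "e \<in> {1,-1}" "mo.A n [0..<n] (volf n) = sm (e * Lam n) (ev {})"
    using mo.A_top[of n n] unfolding Lam_def by blast
  have gc: "g \<in> carrier_mat n n" by (rule hecke_gens_carrier[OF g])
  have es: "sym_act g e = e" using e(1) by (auto simp: rhom_1[OF rhom_sym_act] rhom_neg[OF rhom_sym_act])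
  have "gact n g (mo.A n [0..<n] (volf n)) = mo.A n [0..<n] (gact n g (volf n))"
    using Fsup_ev[of "{..<n}" n] by (intro gact_A[OF gc, where j = 0]) simp
  also have "\<dots> = sm (C (det g)) (mo.A n [0..<n] (volf n))" unfolding gact_vol[OF g] by (rule foldr_ann_sm)
  finally have "sm (sym_act g (e * Lam n)) (ev {}) = sm (C (det g) * (e * Lam n)) (ev {})"
    unfolding e(2) by (simp add: gact_sm gact_ev_empty sm_simps)
  then have "sm (sym_act g (e * Lam n)) (ev {}) {} = sm (C (det g) * (e * Lam n)) (ev {}) {}" by simp
  then have "e * sym_act g (Lam n) = C (det g) * (e * Lam n)"
    by (simp add: sm_def ev_def rhom_mult[OF rhom_sym_act] es)
  then show ?thesis using e(1) by auto
qed

text \<open>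
  The spaces \<open>K\<close> of \<open>S^d \<otimes> Det^k\<close> and of \<open>S^d \<otimes> \<Lambda>^j \<otimes> Det^k\<close>.
\<close>

definition Kp :: "nat \<Rightarrow> nat \<Rightarrow> nat \<Rightarrow> 'k mpol set" where
  "Kp n k d = {f \<in> HP n d. (\<forall>b\<in>Borel n. C (det b) ^ k * sym_act b f = f) \<and>
     (\<forall>i. Suc i < n \<longrightarrow> (\<Sum>c\<in>UNIV. C (det (tm n i c)) ^ k * sym_act (tm n i c) f) = - f)}"

definition Kf :: "nat \<Rightarrow> nat \<Rightarrow> nat \<Rightarrow> nat \<Rightarrow> (nat set \<Rightarrow> 'k mpol) set" where
  "Kf n k d j = {\<omega> \<in> Fsup n j. (\<forall>J. \<omega> J \<in> HP n d) \<and> (\<forall>b\<in>Borel n. sm (C (det b) ^ k) (gact n b \<omega>) = \<omega>) \<and>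
     (\<forall>i. Suc i < n \<longrightarrow> (\<lambda>J. \<Sum>c\<in>UNIV. sm (C (det (tm n i c)) ^ k) (gact n (tm n i c) \<omega>) J) = - \<omega>)}"

lemma Kp_add: "f \<in> Kp n k d \<Longrightarrow> g \<in> Kp n k d \<Longrightarrow> f + g \<in> Kp n k d"
  by (auto simp: Kp_def HP_add rhom_add[OF rhom_sym_act] algebra_simps sum.distrib)

lemma Kp_C_mult: "f \<in> Kp n k d \<Longrightarrow> C c * f \<in> Kp n k d"
proof -
  assume f: "f \<in> Kp n k d"
  have "(\<Sum>x\<in>UNIV. C (det (tm n i x)) ^ k * sym_act (tm n i x) (C c * f)) = C c * (\<Sum>x\<in>UNIV. C (det (tm n i x)) ^ k * sym_act (tm n i x) f)" for i
    by (simp add: rhom_mult[OF rhom_sym_act] sym_act_C sum_distrib_left mult_ac)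
  then show ?thesis using f
    by (auto simp: Kp_def HP_C_mult rhom_mult[OF rhom_sym_act] sym_act_C mult.left_commute[of _ "C c"])
qed

lemma Kp_neg: "f \<in> Kp n k d \<Longrightarrow> - f \<in> Kp n k d"
  using Kp_C_mult[of f n k d "- 1"] by (simp add: C_neg C_1)

lemma Kp_diff: "f \<in> Kp n k d \<Longrightarrow> g \<in> Kp n k d \<Longrightarrow> f - g \<in> Kp n k d"
  using Kp_add[of f n k d "- g"] Kp_neg[of g] by simp

lemma Kp_0: "0 \<in> Kp n k d"
  by (simp add: Kp_def HP_0 rhom_0[OF rhom_sym_act])

lemma Kp_unit_mult: "s \<in> {1,-1} \<Longrightarrow> f \<in> Kp n k d \<Longrightarrow> s * f \<in> Kp n k d"
  by (auto simp: Kp_neg)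

lemma Kp_cong_exponent:
  assumes "\<And>g. g \<in> hecke_gens n \<Longrightarrow> C (det g) ^ e = (C (det g) ^ k :: 'k mpol)"
  shows "Kp n e d = Kp n k d"
  by (auto simp: Kp_def assms hecke_gens_Borel hecke_gens_tm)

lemma Kp_periodic: "Kp n (k + (CARD('k) - 1)) d = Kp n k d"
proof (rule Kp_cong_exponent)
  fix g :: "'k mat" assume "g \<in> hecke_gens n"
  then have "C (det g) ^ (CARD('k) - 1) = (1 :: 'k mpol)"
    using field_power_card_minus_1[OF hecke_gens_det] by (metis C_1 C_power)
  then show "C (det g) ^ (k + (CARD('k) - 1)) = (C (det g) ^ k :: 'k mpol)"
    by (simp only: power_add mult_1_right)
qed

lemma Lam_HP: "Lam n \<in> (HP n (\<Sum>i<n. CARD('k) ^ i) :: 'k mpol set)"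
  by (simp add: HP_def Lam_P Lam_Hm)

text \<open>Since \<open>Lam n\<close> has character det, multiplying by it trades one determinant
  factor for its degree.\<close>

lemma Kp_Lam_mult:
  assumes "f \<in> Kp n (Suc k) d" shows "Lam n * f \<in> Kp n k (d + (\<Sum>i<n. CARD('k) ^ i))"
proof -
  have e: "C (det g) ^ k * sym_act g (Lam n * f) = Lam n * (C (det g) ^ Suc k * sym_act g f)" if "g \<in> hecke_gens n" for g
    by (simp add: rhom_mult[OF rhom_sym_act] sym_act_Lam[OF that])
  show ?thesis unfolding Kp_def
  proof (intro CollectI conjI ballI allI impI)
    show "Lam n * f \<in> HP n (d + (\<Sum>i<n. CARD('k) ^ i))"
      using HP_mult[OF Lam_HP] assms by (auto simp: Kp_def add.commute)
    show "C (det b) ^ k * sym_act b (Lam n * f) = Lam n * f" if "b \<in> Borel n" for b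
      unfolding e[OF hecke_gens_Borel[OF that]] using assms that by (simp add: Kp_def del: power_Suc)
    show "(\<Sum>c\<in>UNIV. C (det (tm n i c)) ^ k * sym_act (tm n i c) (Lam n * f)) = - (Lam n * f)" if "Suc i < n" for i
      by (simp only: e[OF hecke_gens_tm[OF that]] sum_distrib_left[symmetric])
        (use assms that in \<open>simp add: Kp_def del: power_Suc\<close>)
  qed
qed

lemma Kp_Lam_div:
  assumes f: "Lam n * f \<in> Kp n k d" and nz: "f \<noteq> 0"
  shows "(\<Sum>i<n. CARD('k) ^ i) \<le> d" "f \<in> Kp n (Suc k) (d - (\<Sum>i<n. CARD('k) ^ i))"
proof -
  have h: "Lam n * f \<in> HP n d" using f by (simp add: Kp_def)
  show "(\<Sum>i<n. CARD('k) ^ i) \<le> d" by (rule HP_cancel(1)[OF Lam_HP Lam_nonzero h nz])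
  have e: "C (det g) ^ k * sym_act g (Lam n * f) = Lam n * (C (det g) ^ Suc k * sym_act g f)" if "g \<in> hecke_gens n" for g
    by (simp add: rhom_mult[OF rhom_sym_act] sym_act_Lam[OF that])
  show "f \<in> Kp n (Suc k) (d - (\<Sum>i<n. CARD('k) ^ i))" unfolding Kp_def
  proof (intro CollectI conjI ballI allI impI)
    show "f \<in> HP n (d - (\<Sum>i<n. CARD('k) ^ i))" by (rule HP_cancel(2)[OF Lam_HP Lam_nonzero h nz])
    show "C (det b) ^ Suc k * sym_act b f = f" if "b \<in> Borel n" for b
    proof -
      have "Lam n * (C (det b) ^ Suc k * sym_act b f) = Lam n * f"
        unfolding e[OF hecke_gens_Borel[OF that], symmetric] using f that by (simp add: Kp_def)
      then show ?thesis using Lam_nonzero mult_left_cancel by blast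
    qed
    show "(\<Sum>c\<in>UNIV. C (det (tm n i c)) ^ Suc k * sym_act (tm n i c) f) = - f" if "Suc i < n" for i
    proof -
      have "Lam n * (\<Sum>c\<in>UNIV. C (det (tm n i c)) ^ Suc k * sym_act (tm n i c) f) = Lam n * - f"
        by (simp only: sum_distrib_left e[OF hecke_gens_tm[OF that], symmetric]) (use f that in \<open>simp add: Kp_def\<close>)
      then show ?thesis using Lam_nonzero mult_left_cancel by blast
    qed
  qed
qed

lemma Kf_poly: "sm f (ev {}) \<in> Kf n k d 0 \<longleftrightarrow> f \<in> Kp n k d"
proof -
  have inj: "sm x (ev {}) = (sm y (ev {}) :: nat set \<Rightarrow> 'k mpol) \<longleftrightarrow> x = y" for x y
    by (auto simp: sm_def ev_def fun_eq_iff)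
  have neg: "- sm x (ev {}) = (sm (- x) (ev {}) :: nat set \<Rightarrow> 'k mpol)" for x by (simp add: sm_simps)
  have sum: "(\<lambda>J. \<Sum>c\<in>UNIV. sm (F c) (ev {}) J) = sm (\<Sum>c\<in>UNIV. F c) (ev {})" for F :: "'k \<Rightarrow> 'k mpol"
    by (auto simp: sm_def ev_def fun_eq_iff)
  have "sm f (ev {}) \<in> Fsup n 0" by (rule Fsup_sm) (use Fsup_ev[of "{}" n] in simp)
  moreover have "(\<forall>J. sm f (ev {}) J \<in> HP n d) \<longleftrightarrow> f \<in> HP n d"
    by (auto simp: sm_def ev_def HP_0)
  moreover have "gact n g (sm f (ev {})) = sm (sym_act g f) (ev {})" for g
    by (simp add: gact_sm gact_ev_empty)
  ultimately show ?thesis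
    by (simp add: Kf_def Kp_def sm_simps(1) sum neg inj)
qed

text \<open>Downward from the last variable: each summand of the i-th Hecke operator substitutes X_i
  for X_(i+1), so divisibility by X_(i+1) turns into divisibility by X_i of the operator's value,
  which is minus the form.\<close>

lemma Kf_X_dvd:
  assumes w: "\<omega> \<in> Kf n k d j" and x: "\<And>J. X (n - 1) dvd \<omega> J"
  shows "i < n \<Longrightarrow> X i dvd \<omega> J"
proof -
  assume i: "i < n"
  have "\<forall>J. X i dvd \<omega> J" using i
  proof (induction "n - 1 - i" arbitrary: i)
    case 0
    then have "i = n - 1" by simp
    then show ?case using x by simp
  next
    case (Suc e)
    then have iS: "Suc i < n" by simp
    have X: "X (Suc i) dvd \<omega> J" for J using Suc.hyps(1)[of "Suc i"] Suc.hyps(2) iS by auto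
    have a: "X i dvd sym_act (tm n i c) (\<omega> I)" for c I
    proof -
      obtain h where h: "\<omega> I = X (Suc i) * h" using X[of I] by (elim dvdE)
      have "sym_col (tm n i c) (Suc i) = (\<Sum>l<n. if l = i then X l else 0)"
        unfolding sym_col_alt[OF tm_carrier] by (intro sum.cong) (use iS in \<open>auto simp: tm_def C_0 C_1\<close>)
      then have "sym_act (tm n i c) (X (Suc i)) = X i" using iS by (simp add: sym_act_X)
      then show ?thesis by (simp add: h rhom_mult[OF rhom_sym_act])
    qed
    have K: "(\<lambda>J. \<Sum>c\<in>UNIV. sm (C (det (tm n i c)) ^ k) (gact n (tm n i c) \<omega>) J) = - \<omega>"
      using w iS unfolding Kf_def by blast
    have "- \<omega> J = (\<Sum>c\<in>UNIV. sm (C (det (tm n i c)) ^ k) (gact n (tm n i c) \<omega>) J)" for J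
      using fun_cong[OF K, of J] by simp
    moreover have "X i dvd (\<Sum>c\<in>UNIV. sm (C (det (tm n i c)) ^ k) (gact n (tm n i c) \<omega>) J)" for J
      unfolding sm_def gact_expand using a by (intro dvd_sum dvd_mult) auto
    ultimately have "X i dvd - \<omega> J" for J by metis
    then show ?case by simp
  qed
  then show ?thesis by blast
qed

text \<open>All variables divide the form. By Borel invariance so does every image of X_i under a
  unipotent matrix, and these images are the linear factors of \<open>Lam n\<close>.\<close>

lemma Kf_Lam_dvd:
  assumes w: "\<omega> \<in> Kf n k d j" and x: "\<And>J. X (n - 1) dvd \<omega> J"
  shows "Lam n dvd \<omega> J"
proof (rule Lam_dvdI)
  fix i and u :: "nat \<Rightarrow> 'k" assume i: "i < n" and u: "u \<in> UU i"
  define b where "b = mat n n (\<lambda>(a, l). if a = l then 1 else if l = i \<and> a < i then u a else 0)"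
  have b: "b \<in> Borel n" by (auto simp: b_def mem_Borel)
  have bc: "b \<in> carrier_mat n n" by (simp add: b_def)
  have "sym_col b i = (\<Sum>l<n. (if l = i then X l else 0) + (if l < i then C (u l) * X l else 0))"
    unfolding sym_col_alt[OF bc] by (intro sum.cong) (use i in \<open>auto simp: b_def C_0 C_1\<close>)
  also have "\<dots> = X i + (\<Sum>l<n. if l < i then C (u l) * X l else 0)" using i by (simp add: sum.distrib)
  also have "(\<Sum>l<n. if l < i then C (u l) * X l else 0) = lf i u"
    unfolding lf_def using i by (intro sum.mono_neutral_cong_right) auto
  finally have col: "sym_act b (X i) = X i + lf i u" by (simp add: sym_act_X)
  have a: "X i + lf i u dvd sym_act b (\<omega> I)" for I
  proof -
    obtain h where h: "\<omega> I = X i * h" using Kf_X_dvd[OF w x i, of I] by (elim dvdE)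
    show ?thesis by (simp add: h rhom_mult[OF rhom_sym_act] col)
  qed
  have "\<omega> J = sm (C (det b) ^ k) (gact n b \<omega>) J" using w b by (simp add: Kf_def)
  also have "X i + lf i u dvd \<dots>" unfolding sm_def gact_expand using a by (intro dvd_mult dvd_sum) auto
  finally show "X i + lf i u dvd \<omega> J" .
qed

lemma Kp_X_dvd:
  assumes f: "f \<in> Kp n k d" and x: "X (n - 1) dvd f"
  shows "i < n \<Longrightarrow> X i dvd f" and Kp_Lam_dvd: "Lam n dvd f"
proof -
  have K: "sm f (ev {}) \<in> Kf n k d 0" using f by (simp add: Kf_poly)
  have d: "X (n - 1) dvd sm f (ev {}) J" for J using x by (simp add: sm_def)
  have e: "sm f (ev {}) {} = f" by (simp add: sm_def ev_def)
  show "X i dvd f" if "i < n" using Kf_X_dvd[OF K d that, of "{}"] by (simp only: e)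
  show "Lam n dvd f" using Kf_Lam_dvd[OF K d, of "{}"] by (simp only: e)
qed

text \<open>The case distinction guards the truncated subtraction: below the degree of
  \<open>Lam n\<close> only 0 is a multiple of it.\<close>

lemma Kp_X_dvd_image:
  assumes n: "0 < n"
  shows "{f \<in> Kp n k d. X (n - 1) dvd f} =
    (if (\<Sum>i<n. CARD('k) ^ i) \<le> d then (\<lambda>g. Lam n * g) ` Kp n (Suc k) (d - (\<Sum>i<n. CARD('k) ^ i)) else {0})"
    (is "?L = ?R")
proof (intro equalityI subsetI)
  fix f assume f: "f \<in> ?L"
  show "f \<in> ?R"
  proof (cases "f = 0")
    case True
    then show ?thesis using Kp_0 by (auto intro!: image_eqI[of _ _ 0])
  next
    case False
    obtain g where g: "f = Lam n * g" using Kp_Lam_dvd[of f n k d] f by (auto elim: dvdE)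
    have "g \<noteq> 0" using False g by auto
    then show ?thesis using Kp_Lam_div[of n g k d] f g by auto
  qed
next
  fix f assume f: "f \<in> ?R"
  show "f \<in> ?L"
  proof (cases "(\<Sum>i<n. CARD('k) ^ i) \<le> d")
    case True
    then obtain g where g: "g \<in> Kp n (Suc k) (d - (\<Sum>i<n. CARD('k) ^ i))" "f = Lam n * g" using f by auto
    then show ?thesis using Kp_Lam_mult[OF g(1)] True X_dvd_Lam[of "n - 1" n] n by (auto intro: dvd_mult2)
  next
    case False
    then show ?thesis using f Kp_0 by auto
  qed
qed

end

definition monomials :: "nat \<Rightarrow> nat \<Rightarrow> (nat \<Rightarrow>\<^sub>0 nat) set" where
  "monomials n d = {m. Poly_Mapping.keys m \<subseteq> {..<n} \<and> mdeg m = d}"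

lemma HP_basis_space: "HP n d = basis_space (monomials n d)"
  by (auto simp: HP_def P_def Hm_def monomials_def basis_space_def)

lemma sym_col_mult:
  assumes g: "g \<in> carrier_mat n n" and h: "h \<in> carrier_mat n n" and i: "i < n"
  shows "sym_col (g * h) i = sub (sym_col g) (sym_col h i)"
proof -
  have "sym_col (g * h) i = (\<Sum>l<n. \<Sum>k<n. C (g $$ (l, k)) * C (h $$ (k, i)) * X l)"
    using g h i unfolding sym_col_alt[OF mult_carrier_mat[OF g h]]
    by (intro sum.cong refl) (auto simp: mult_mat_entry[of _ n] rhom_sum[OF rhom_C] C_mult sum_distrib_right simp del: index_mult_mat)
  also have "\<dots> = (\<Sum>k<n. \<Sum>l<n. C (g $$ (l, k)) * C (h $$ (k, i)) * X l)" by (rule sum.swap)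
  also have "\<dots> = sub (sym_col g) (sym_col h i)"
    unfolding sym_col_alt[OF h] sub_simps sym_col_alt[OF g] sum_distrib_left
    by (intro sum.cong refl) (simp add: mult_ac)
  finally show ?thesis .
qed

lemma sym_act_mult:
  assumes g: "g \<in> carrier_mat n n" and h: "h \<in> carrier_mat n n" and f: "f \<in> P n"
  shows "sym_act (g * h) f = sym_act g (sym_act h f)"
  unfolding sym_act_sub sub_sub by (rule sub_cong[OF f]) (rule sym_col_mult[OF g h])

lemma sym_act_one:
  assumes f: "f \<in> P n" shows "sym_act (1\<^sub>m n) f = f"
  unfolding sym_act_sub
proof (rule sub_fix[OF f])
  fix i assume i: "i < n"
  have "sym_col (1\<^sub>m n) i = (\<Sum>l<n. if l = i then X l else 0)"
    unfolding sym_col_alt[OF one_carrier_mat] using i by (intro sum.cong) (auto simp: C_0 C_1)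
  then show "sym_col (1\<^sub>m n) i = X i" using i by simp
qed

interpretation sp: glrep n "monomials n d" "sym_act :: 'k::{field,finite} mat \<Rightarrow> _" for n d
proof
  show "pm_linear (sym_act g)" for g :: "'k mat" by (simp add: sym_act_sub pm_linear_sub)
  fix g h :: "'k mat" and x :: "'k mpol" assume x: "x \<in> basis_space (monomials n d)"
  have xP: "x \<in> P n" "x \<in> Hm d" using x by (auto simp: HP_basis_space[symmetric] HP_def)
  show "sym_act (1\<^sub>m n) x = x" by (rule sym_act_one[OF xP(1)])
  assume g: "g \<in> GL n"
  show "sym_act g x \<in> basis_space (monomials n d)"
    using sym_act_P[OF GL_carrier[OF g] xP(1)] sym_act_Hm[OF xP(2)] by (simp add: HP_basis_space[symmetric] HP_def)
  assume h: "h \<in> GL n"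
  show "sym_act (g * h) x = sym_act g (sym_act h x)"
    by (rule sym_act_mult[OF GL_carrier[OF g] GL_carrier[OF h] xP(1)])
qed

section \<open>Hecke operators and restriction to a hyperplane\<close>

text \<open>Here and in \<open>ts\<close> the substitutions are written without a matrix size, so
  that the same operators \<open>TT i\<close> act on polynomials in n and in n - 1
  variables.\<close>

definition utri :: "(nat \<Rightarrow> nat \<Rightarrow> 'k::field) \<Rightarrow> nat \<Rightarrow> 'k mpol" where
  "utri u i = (\<Sum>l\<le>i. C (u l i) * X l)"

definition ts :: "nat \<Rightarrow> 'k::field \<Rightarrow> nat \<Rightarrow> 'k mpol" where
  "ts i c j = (if j = i then C c * X i + X (Suc i) else if j = Suc i then X i else X j)"

definition TT :: "nat \<Rightarrow> 'k::{field,finite} mpol \<Rightarrow> 'k mpol" where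
  "TT i f = (\<Sum>c\<in>UNIV. sub (ts i c) f)"

definition Binv :: "nat \<Rightarrow> 'k::field mpol \<Rightarrow> bool" where
  "Binv n f \<longleftrightarrow> (\<forall>u. (\<forall>i<n. u i i \<noteq> 0) \<longrightarrow> sub (utri u) f = f)"

lemma sym_col_tm: "Suc i < n \<Longrightarrow> j < n \<Longrightarrow> sym_col (tm n i c) j = ts i c j"
proof -
  assume i: "Suc i < n" and j: "j < n"
  show ?thesis
  proof (cases "j = i")
    case True
    have "sym_col (tm n i c) j = (\<Sum>l<n. (if l = i then C c else if l = Suc i then 1 else 0) * X l)"
      unfolding sym_col_alt[OF tm_carrier] using i j True by (intro sum.cong) (auto simp: tm_def C_0 C_1)
    also have "\<dots> = C c * X i + 1 * X (Suc i)" using i by (intro sum_if_two) auto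
    finally show ?thesis using True by (simp add: ts_def)
  next
    case False
    have "sym_col (tm n i c) j = (\<Sum>l<n. if l = (if j = Suc i then i else j) then X l else 0)"
      unfolding sym_col_alt[OF tm_carrier] using i j False by (intro sum.cong) (auto simp: tm_def C_0 C_1)
    then show ?thesis using False i j by (auto simp: ts_def)
  qed
qed

lemma sym_act_tm: "Suc i < n \<Longrightarrow> f \<in> P n \<Longrightarrow> sym_act (tm n i c) f = sub (ts i c) f"
  unfolding sym_act_sub by (rule sub_cong[of f n]) (auto simp: sym_col_tm)

lemma tau_TT: "Suc i < n \<Longrightarrow> f \<in> P n \<Longrightarrow> sp.tau n i f = TT i f"
  by (simp add: sp.tau_def TT_def sym_act_tm)

lemma Borel_Binv:
  assumes f: "f \<in> P n"
  shows "(\<forall>b\<in>Borel n. sym_act b f = f) \<longleftrightarrow> Binv n f"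
proof
  assume b: "\<forall>b\<in>Borel n. sym_act b f = f"
  show "Binv n f" unfolding Binv_def
  proof (intro allI impI)
    fix u :: "nat \<Rightarrow> nat \<Rightarrow> 'a" assume u: "\<forall>i<n. u i i \<noteq> 0"
    define g where "g = mat n n (\<lambda>(l, i). if l \<le> i then u l i else 0)"
    have gB: "g \<in> Borel n" using u by (auto simp: g_def mem_Borel)
    have gc: "g \<in> carrier_mat n n" by (simp add: g_def)
    have "sub (utri u) f = sub (sym_col g) f"
    proof (rule sub_cong[OF f])
      fix i assume i: "i < n"
      show "utri u i = sym_col g i" unfolding sym_col_alt[OF gc] utri_def
        using i by (intro sum.mono_neutral_cong_left) (auto simp: g_def C_0)
    qed
    then show "sub (utri u) f = f" using b gB by (simp add: sym_act_sub)
  qed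
next
  assume B: "Binv n f"
  show "\<forall>b\<in>Borel n. sym_act b f = f"
  proof
    fix b :: "'a mat" assume b: "b \<in> Borel n"
    then have bc: "b \<in> carrier_mat n n" by (simp add: mem_Borel)
    have "sub (sym_col b) f = sub (utri (\<lambda>l i. b $$ (l, i))) f"
    proof (rule sub_cong[OF f])
      fix i assume i: "i < n"
      show "sym_col b i = utri (\<lambda>l i. b $$ (l, i)) i" unfolding sym_col_alt[OF bc] utri_def
        using i b by (intro sum.mono_neutral_cong_right) (auto simp: mem_Borel C_0)
    qed
    then show "sym_act b f = f" using B b by (simp add: sym_act_sub Binv_def mem_Borel)
  qed
qed

lemma binv_iff: "sp.binv n d f \<longleftrightarrow> f \<in> HP n d \<and> Binv n f"
  using Borel_Binv[of f n] by (auto simp: sp.binv_def HP_basis_space[symmetric] HP_def)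

lemma TT_HP: "Suc i < n \<Longrightarrow> f \<in> HP n d \<Longrightarrow> TT i f \<in> HP n d"
  using sp.closed_tau[of i n f d] by (simp add: HP_basis_space[symmetric] tau_TT HP_def)

lemma Binv_TT: "Suc i < n \<Longrightarrow> f \<in> HP n d \<Longrightarrow> Binv n f \<Longrightarrow> Binv n (TT i f)"
  using sp.binv_tau[of n d f i] by (simp add: binv_iff tau_TT HP_def)

lemma TT_add: "TT i (f + g) = TT i f + TT i g" and TT_neg: "TT i (- f) = - TT i f"
  by (simp_all add: TT_def sub_simps sum.distrib sum_negf)

lemma sub_eqI: "(\<And>j. \<theta> j = \<eta> j) \<Longrightarrow> sub \<theta> f = sub \<eta> f"
  by (metis ext)

lemma TT_comm:
  assumes "i + 2 \<le> j \<or> j + 2 \<le> i"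
  shows "TT i (TT j f) = TT j (TT i f)"
proof -
  have "sub (ts i c) (sub (ts j e) f) = sub (ts j e) (sub (ts i c) f)" for c e
    unfolding sub_sub by (rule sub_eqI) (use assms in \<open>auto simp: ts_def sub_simps\<close>)
  then have "TT i (TT j f) = (\<Sum>c\<in>UNIV. \<Sum>e\<in>UNIV. sub (ts j e) (sub (ts i c) f))"
    by (simp add: TT_def sub_simps)
  also have "\<dots> = TT j (TT i f)" unfolding TT_def sub_simps by (rule sum.swap)
  finally show ?thesis .
qed

text \<open>The braid relation holds termwise after the change of parameters (c, d, e) to (e, d +
  ec, c), which is a bijection.\<close>

lemma TT_braid: "TT i (TT (Suc i) (TT i f)) = TT (Suc i) (TT i (TT (Suc i) f))"
proof -
  have e: "sub (ts i c) (sub (ts (Suc i) d) (sub (ts i e) f)) =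
      sub (ts (Suc i) e) (sub (ts i (d + e * c)) (sub (ts (Suc i) c) f))" for c d e
    unfolding sub_sub by (rule sub_eqI) (auto simp: ts_def sub_simps C_add C_mult algebra_simps)
  have "TT i (TT (Suc i) (TT i f)) = (\<Sum>(c, d, e)\<in>UNIV. sub (ts i c) (sub (ts (Suc i) d) (sub (ts i e) f)))"
    by (simp add: TT_def sub_simps sum.cartesian_product case_prod_unfold)
  also have "\<dots> = (\<Sum>(a, b, g)\<in>UNIV. sub (ts (Suc i) a) (sub (ts i b) (sub (ts (Suc i) g) f)))"
    by (rule sum.reindex_bij_witness[of _ "\<lambda>(a, b, g). (g, b - a * g, a)" "\<lambda>(c, d, e). (e, d + e * c, c)"]) (auto simp: e)
  also have "\<dots> = TT (Suc i) (TT i (TT (Suc i) f))"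
    by (simp add: TT_def sub_simps sum.cartesian_product case_prod_unfold)
  finally show ?thesis .
qed

lemma mpol_sum_const: "(\<Sum>c\<in>I. f) = C (of_nat (card I)) * f" for f :: "'k::field mpol"
  using pm_sum_const[of f I] by (simp add: pm_scale_C)

text \<open>The Hecke relation with parameter q = 0. Inner parameter 0 gives q copies of
  \<open>f\<close>, which vanish; each of the q - 1 other inner parameters merely translates the
  outer one and gives \<open>TT i f\<close>, and q - 1 is -1.\<close>

lemma TT_quadratic:
  fixes f :: "'k::{field,finite} mpol"
  assumes i: "Suc i < n" and f: "f \<in> P n" and B: "Binv n f"
  shows "TT i (TT i f) = - TT i f"
proof -
  \<comment> \<open>The reflection cancels and leaves the unipotent substitution of parameter c,
    which fixes \<open>f\<close> by Borel invariance.\<close>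
  have 0: "sub (ts i c) (sub (ts i 0) f) = f" for c
  proof -
    let ?u = "\<lambda>a b. if a = b then 1 else if a = i \<and> b = Suc i then c else 0"
    have "sub (ts i c) (sub (ts i 0) f) = sub (utri ?u) f"
      unfolding sub_sub
    proof (rule sub_cong[OF f])
      fix j assume "j < n"
      have "utri ?u j = (\<Sum>l\<le>j. (if l = j then X l else 0) + (if l = i \<and> j = Suc i then C c * X l else 0))"
        unfolding utri_def by (intro sum.cong) (auto simp: C_0 C_1)
      also have "\<dots> = X j + (if j = Suc i then C c * X i else 0)" by (auto simp: sum.distrib)
      finally show "sub (ts i c) (ts i 0 j) = utri ?u j" by (auto simp: ts_def sub_simps C_0)
    qed
    also have "\<dots> = f" using B by (auto simp: Binv_def)
    finally show ?thesis .
  qed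
  \<comment> \<open>Two representatives in the big cell multiply to one with parameter c + 1/d, up
    to the triangular substitution \<open>?u\<close>.\<close>
  have nz: "sub (ts i c) (sub (ts i d) f) = sub (ts i (c + 1 / d)) f" if d: "d \<noteq> 0" for c d
  proof -
    let ?u = "\<lambda>a b. if b = i then (if a = i then d else 0) else if b = Suc i then (if a = i then 1 else if a = Suc i then - (1 / d) else 0)
       else if a = b then 1 else 0"
    have ui: "utri ?u j = (if j = i then C d * X i else if j = Suc i then X i - C (1 / d) * X (Suc i) else X j)" for j
    proof -
      have "utri ?u j = (\<Sum>l\<le>j. (if l = j then C (?u j j) * X j else 0) + (if l = i \<and> j = Suc i then X i else 0))"
        unfolding utri_def by (intro sum.cong) (auto simp: C_0 C_1)
      also have "\<dots> = C (?u j j) * X j + (if j = Suc i then X i else 0)" by (auto simp: sum.distrib)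
      finally show ?thesis by (auto simp: C_neg C_1)
    qed
    have "sub (utri ?u) f = f" using B d by (auto simp: Binv_def)
    then have "sub (ts i (c + 1 / d)) f = sub (ts i (c + 1 / d)) (sub (utri ?u) f)" by simp
    also have "\<dots> = sub (ts i c) (sub (ts i d) f)"
      unfolding sub_sub
    proof (rule sub_eqI)
      fix j
      have Cd: "C d * C (1 / d) = (1 :: 'k mpol)" using d by (simp add: C_mult[symmetric] C_1)
      have "C d * (C (1 / d) * x) = x" for x :: "'k mpol" using Cd by (simp add: mult.assoc[symmetric])
      then show "sub (ts i (c + 1 / d)) (utri ?u j) = sub (ts i c) (ts i d j)"
        unfolding ui by (auto simp: ts_def sub_simps C_add algebra_simps)
    qed
    finally show ?thesis ..
  qed
  have "TT i (TT i f) = (\<Sum>d\<in>UNIV. \<Sum>c\<in>UNIV. sub (ts i c) (sub (ts i d) f))"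
    unfolding TT_def sub_simps by (rule sum.swap)
  also have "\<dots> = (\<Sum>c\<in>UNIV. sub (ts i c) (sub (ts i 0) f)) + (\<Sum>d\<in>UNIV - {0}. \<Sum>c\<in>UNIV. sub (ts i c) (sub (ts i d) f))"
    by (rule sum.remove) auto
  also have "(\<Sum>c\<in>UNIV. sub (ts i c) (sub (ts i 0) f)) = 0"
    unfolding 0 mpol_sum_const of_nat_card_field C_0 by simp
  also have "(\<Sum>d\<in>UNIV - {0}. \<Sum>c\<in>UNIV. sub (ts i c) (sub (ts i d) f)) = (\<Sum>d\<in>UNIV - {0::'k}. TT i f)"
  proof (rule sum.cong)
    fix d :: 'k assume d: "d \<in> UNIV - {0}"
    have "(\<Sum>c\<in>UNIV. sub (ts i c) (sub (ts i d) f)) = (\<Sum>c\<in>UNIV. sub (ts i (c + 1 / d)) f)"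
      using d by (intro sum.cong refl) (simp add: nz)
    also have "\<dots> = TT i f" unfolding TT_def
      by (rule sum.reindex_bij_witness[of _ "\<lambda>c. c - 1 / d" "\<lambda>c. c + 1 / d"]) auto
    finally show "(\<Sum>c\<in>UNIV. sub (ts i c) (sub (ts i d) f)) = TT i f" .
  qed simp
  also have "\<dots> = C (of_nat (CARD('k) - 1)) * TT i f" unfolding mpol_sum_const by (simp only: card_Diff_subset finite.intros subset_UNIV card.empty card_insert_disjoint empty_iff not_False_eq_True One_nat_def)
  also have "\<dots> = - TT i f" unfolding of_nat_card_field_minus_1 by (simp add: C_neg C_1)
  finally show ?thesis by simp
qed

lemma TT_comm_list: "(\<And>j. j \<in> set xs \<Longrightarrow> j + 2 \<le> i \<or> i + 2 \<le> j) \<Longrightarrow> TT i (foldr TT xs f) = foldr TT xs (TT i f)"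
proof (induction xs)
  case (Cons j xs)
  have "TT i (TT j (foldr TT xs f)) = TT j (TT i (foldr TT xs f))" using Cons.prems[of j] by (intro TT_comm) auto
  also have "TT i (foldr TT xs f) = foldr TT xs (TT i f)" using Cons.prems by (intro Cons.IH) auto
  finally show ?case by simp
qed simp

lemma foldr_TT_neg: "foldr TT xs (- f) = - foldr TT xs f"
  by (induction xs) (auto simp: TT_neg)

lemma foldr_TT_Binv: "set xs \<subseteq> {i. Suc i < n} \<Longrightarrow> f \<in> HP n d \<Longrightarrow> Binv n f \<Longrightarrow> foldr TT xs f \<in> HP n d \<and> Binv n (foldr TT xs f)"
  by (induction xs) (auto intro: TT_HP Binv_TT)

text \<open>For i = 0 this is the quadratic relation. For i = k + 1 the operator commutes with the
  factors before k, the braid relation turns it into T_k on the inside, and T_k commutes past the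
  rest to act on \<open>w\<close> by -1.\<close>

lemma foldr_TT_eigen:
  assumes w: "w \<in> HP (Suc m) d" "Binv (Suc m) w" and eig: "\<And>i. Suc i < m \<Longrightarrow> TT i w = - w" and i: "i < m"
  shows "TT i (foldr TT [0..<m] w) = - foldr TT [0..<m] w"
proof (cases i)
  case 0
  have "[0..<m] = 0 # [1..<m]" using i by (simp add: upt_conv_Cons)
  moreover have "foldr TT [1..<m] w \<in> HP (Suc m) d \<and> Binv (Suc m) (foldr TT [1..<m] w)"
    using w by (intro foldr_TT_Binv) auto
  ultimately show ?thesis using TT_quadratic[of 0 "Suc m" "foldr TT [1..<m] w"] i 0 by (simp add: HP_def)
next
  case (Suc k)
  have "[0..<m] = [0..<k] @ [k..<m]" using i Suc upt_add_eq_append[of 0 k "m - k"] by simp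
  also have "[k..<m] = k # Suc k # [Suc (Suc k)..<m]" using i Suc by (simp add: upt_conv_Cons)
  finally have u: "[0..<m] = [0..<k] @ k # Suc k # [Suc (Suc k)..<m]" .
  let ?y = "foldr TT [Suc (Suc k)..<m] w"
  have "TT i (foldr TT [0..<m] w) = foldr TT [0..<k] (TT (Suc k) (TT k (TT (Suc k) ?y)))"
    unfolding u Suc using TT_comm_list[of "[0..<k]" "Suc k"] by simp
  also have "TT (Suc k) (TT k (TT (Suc k) ?y)) = TT k (TT (Suc k) (TT k ?y))" by (rule TT_braid[symmetric])
  also have "TT k ?y = foldr TT [Suc (Suc k)..<m] (TT k w)" by (rule TT_comm_list) auto
  also have "TT k w = - w" using eig[of k] i Suc by simp
  finally show ?thesis unfolding u by (simp add: foldr_TT_neg TT_neg)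
qed

lemma kill_sub: "kill m w (sub \<theta> f) = sub (\<lambda>j. kill m w (\<theta> j)) f"
  unfolding kill_def by (rule sub_sub)

lemma sub_kill: "sub \<theta> (kill m w f) = sub (\<lambda>j. if j = m then - sub \<theta> w else \<theta> j) f"
  unfolding kill_def sub_sub by (rule sub_eqI) (simp add: sub_simps)

lemma kill_X: "kill m w (X j) = (if j = m then - w else X j)"
  by (simp add: kill_def sub_X)

lemma kill_C: "kill m w (C a) = C a"
  by (simp add: kill_def sub_C)

lemma kill_TT:
  assumes "Suc i < m" shows "kill m 0 (TT i f) = TT i (kill m 0 f)"
proof -
  have "kill m 0 (sub (ts i c) f) = sub (ts i c) (kill m 0 f)" for c
    unfolding kill_sub sub_kill
    by (rule sub_eqI) (use assms in \<open>auto simp: ts_def rhom_add[OF rhom_kill] rhom_mult[OF rhom_kill] kill_X sub_simps kill_def sub_C\<close>)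
  then show ?thesis by (simp add: TT_def rhom_sum[OF rhom_kill])
qed

lemma kill_foldr_TT: "set xs \<subseteq> {i. Suc i < m} \<Longrightarrow> kill m 0 (foldr TT xs f) = foldr TT xs (kill m 0 f)"
  by (induction xs) (auto simp: kill_TT)

lemma foldr_TT_scalar: "(\<And>i. i \<in> set xs \<Longrightarrow> TT i w = - w) \<Longrightarrow> foldr TT xs w = w \<or> foldr TT xs w = - w"
  by (induction xs) (auto simp: TT_neg)

lemma kill_HP: "f \<in> HP (Suc m) d \<Longrightarrow> kill m 0 f \<in> HP m d"
proof -
  assume f: "f \<in> HP (Suc m) d"
  have "kill m 0 f \<in> P m" unfolding kill_def using f by (intro P_sub[of f "Suc m"]) (auto simp: HP_def P_0 P_X less_Suc_eq)
  moreover have "kill m 0 f \<in> Hm d" unfolding kill_def using f by (intro Hm_sub) (auto simp: HP_def Hm_0 Hm_X[simplified])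
  ultimately show ?thesis by (simp add: HP_def)
qed

lemma kill_Binv:
  assumes f: "f \<in> P (Suc m)" and B: "Binv (Suc m) f" shows "Binv m (kill m 0 f)"
  unfolding Binv_def
proof (intro allI impI)
  fix u :: "nat \<Rightarrow> nat \<Rightarrow> 'a" assume u: "\<forall>i<m. u i i \<noteq> 0"
  let ?u = "\<lambda>l i. if i = m then (if l = m then 1 else 0) else u l i"
  have "sub (utri u) (kill m 0 f) = kill m 0 (sub (utri ?u) f)"
    unfolding kill_sub sub_kill
  proof (rule sub_cong[OF f])
    fix j assume j: "j < Suc m"
    show "(if j = m then - sub (utri u) 0 else utri u j) = kill m 0 (utri ?u j)"
    proof (cases "j = m")
      case True
      have "utri ?u m = (\<Sum>l\<le>m. if l = m then X l else 0)"
        unfolding utri_def by (intro sum.cong) (auto simp: C_0 C_1)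
      then show ?thesis using True by (simp add: kill_X sub_simps)
    next
      case False
      then have "utri u j \<in> P m" unfolding utri_def using j by (intro P_sum P_mult P_C P_X) auto
      then have "kill m 0 (utri u j) = utri u j" by (rule kill_P)
      moreover have "utri ?u j = utri u j" using False by (simp add: utri_def)
      ultimately show ?thesis using False by simp
    qed
  qed
  also have "sub (utri ?u) f = f" using B u by (auto simp: Binv_def)
  finally show "sub (utri u) (kill m 0 f) = kill m 0 f" .
qed

lemma Binv_mono: "Binv m f \<Longrightarrow> Binv (Suc m) f"
  by (auto simp: Binv_def)

text \<open>If X_i and X_(i+1) are both set to 0, the q summands of \<open>TT i f\<close> become
  equal and cancel. So f vanishes on that codimension two subspace.\<close>

lemma kill_last_dvd:
  fixes f :: "'k::{field,finite} mpol"
  assumes T: "TT i f = - f"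
  shows "X i dvd kill (Suc i) 0 f"
proof -
  let ?z = "sub (\<lambda>j. if j = i \<or> j = Suc i then 0 else X j)"
  have "?z (sub (ts i c) f) = ?z f" for c unfolding sub_sub by (rule sub_eqI) (auto simp: ts_def sub_simps)
  then have "?z (TT i f) = (\<Sum>c\<in>(UNIV :: 'k set). ?z f)" by (simp add: TT_def sub_simps)
  also have "\<dots> = 0" unfolding mpol_sum_const of_nat_card_field C_0 by simp
  finally have z: "?z f = 0" using T by (simp add: sub_simps)
  have "kill i 0 (kill (Suc i) 0 f) = ?z f" unfolding kill_def sub_sub by (rule sub_eqI) (auto simp: sub_simps)
  then have "X i + 0 dvd kill (Suc i) 0 f" using z line_dvd_iff[OF P_0, of i "kill (Suc i) 0 f"] by simp
  then show ?thesis by simp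
qed

text \<open>Modulo X_(i+1) the summand of parameter c scales X_i by c in \<open>w\<close>. This
  fixes \<open>w\<close> for c nonzero by torus invariance and gives 0 for c = 0, because X_i
  divides \<open>w\<close>; the q - 1 equal terms add up to -w.\<close>

lemma kill_TT_last:
  fixes w :: "'k::{field,finite} mpol"
  assumes w: "w \<in> P (Suc i)" "Binv (Suc i) w" and x: "X i dvd w"
  shows "kill (Suc i) 0 (TT i w) = - w"
proof -
  have "kill (Suc i) 0 (sub (ts i c) w) = (if c = 0 then 0 else w)" for c
  proof -
    let ?u = "\<lambda>a b. if a = b then if b = i then c else 1 else 0"
    have "kill (Suc i) 0 (sub (ts i c) w) = sub (utri ?u) w"
      unfolding kill_sub
    proof (rule sub_cong[OF w(1)])
      fix j assume j: "j < Suc i"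
      have "utri ?u j = (\<Sum>l\<le>j. if l = j then C (if j = i then c else 1) * X j else 0)"
        unfolding utri_def by (intro sum.cong) (auto simp: C_0 C_1)
      then show "kill (Suc i) 0 (ts i c j) = utri ?u j" using j
        by (auto simp: ts_def rhom_add[OF rhom_kill] rhom_mult[OF rhom_kill] kill_X C_1 C_0 kill_C)
    qed
    moreover have "sub (utri ?u) w = w" if "c \<noteq> 0" using w(2) that by (auto simp: Binv_def)
    moreover have "sub (utri ?u) w = 0" if "c = 0"
    proof -
      obtain h where h: "w = X i * h" using x by (elim dvdE)
      have "utri ?u i = 0" unfolding utri_def using that by (intro sum.neutral) (auto simp: C_0)
      then show ?thesis by (simp add: h sub_simps)
    qed
    ultimately show ?thesis by auto
  qed
  then have "kill (Suc i) 0 (TT i w) = (\<Sum>c\<in>(UNIV :: 'k set). if c = 0 then 0 else w)"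
    by (simp add: TT_def rhom_sum[OF rhom_kill])
  also have "\<dots> = (\<Sum>c\<in>UNIV - {0::'k}. w)" by (intro sum.mono_neutral_cong_right) auto
  also have "\<dots> = C (of_nat (CARD('k) - 1)) * w" unfolding mpol_sum_const by (simp only: card_Diff_subset finite.intros subset_UNIV card.empty card_insert_disjoint empty_iff not_False_eq_True One_nat_def)
  also have "\<dots> = - w" unfolding of_nat_card_field_minus_1 by (simp add: C_neg C_1)
  finally show ?thesis .
qed

section \<open>Restriction to the last hyperplane, lifting back, and Dickson invariants\<close>

context prime_power_field
begin

lemma Kp_0_iff: "f \<in> Kp n 0 d \<longleftrightarrow> f \<in> HP n d \<and> Binv n f \<and> (\<forall>i. Suc i < n \<longrightarrow> TT i f = - f)"
proof -
  have "(\<forall>b\<in>Borel n. sym_act b f = f) \<longleftrightarrow> Binv n f" and "(\<Sum>c\<in>UNIV. sym_act (tm n i c) f) = TT i f"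
    if "f \<in> HP n d" "Suc i < n" for i
    using Borel_Binv[of f n] that by (auto simp: HP_def TT_def sym_act_tm)
  moreover have "(\<forall>b\<in>Borel n. sym_act b f = f) \<longleftrightarrow> Binv n f" if "f \<in> HP n d"
    using Borel_Binv[of f n] that by (auto simp: HP_def)
  ultimately show ?thesis by (auto simp: Kp_def)
qed

lemma Kp_restrict:
  assumes f: "f \<in> Kp (Suc m) 0 d"
  shows "kill m 0 f \<in> Kp m 0 d" and "0 < m \<Longrightarrow> X (m - 1) dvd kill m 0 f"
proof -
  have f': "f \<in> HP (Suc m) d" "Binv (Suc m) f" "\<And>i. Suc i < Suc m \<Longrightarrow> TT i f = - f"
    using f by (auto simp: Kp_0_iff)
  show "kill m 0 f \<in> Kp m 0 d"
    unfolding Kp_0_iff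
  proof (intro conjI allI impI)
    show "kill m 0 f \<in> HP m d" by (rule kill_HP[OF f'(1)])
    show "Binv m (kill m 0 f)" using f'(1,2) by (intro kill_Binv) (auto simp: HP_def)
    fix i assume "Suc i < m"
    then show "TT i (kill m 0 f) = - kill m 0 f"
      using f'(3)[of i] by (simp add: kill_TT[symmetric] rhom_neg[OF rhom_kill])
  qed
  show "X (m - 1) dvd kill m 0 f" if "0 < m"
    using kill_last_dvd[OF f'(3)[of "m - 1"]] that by simp
qed

text \<open>The lift is T_0 ... T_(m-1) applied to \<open>w\<close>, up to sign. On restriction the
  last operator gives -w by \<open>kill_TT_last\<close>, and the remaining ones act on
  \<open>w\<close> by -1.\<close>

lemma Kp_lift:
  assumes w: "w \<in> Kp m 0 d" and x: "0 < m \<Longrightarrow> X (m - 1) dvd w"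
  obtains v where "v \<in> Kp (Suc m) 0 d" "kill m 0 v = w"
proof -
  have w': "w \<in> HP m d" "Binv m w" "\<And>i. Suc i < m \<Longrightarrow> TT i w = - w" using w by (auto simp: Kp_0_iff)
  have wS: "w \<in> HP (Suc m) d" "Binv (Suc m) w"
    using w'(1) Binv_mono[OF w'(2)] P_mono[of m "Suc m" w] by (auto simp: HP_def)
  define v where "v = foldr TT [0..<m] w"
  have vB: "v \<in> HP (Suc m) d \<and> Binv (Suc m) v"
    unfolding v_def using wS by (intro foldr_TT_Binv) auto
  have vK: "v \<in> Kp (Suc m) 0 d"
    unfolding Kp_0_iff using vB foldr_TT_eigen[OF wS w'(3)] by (auto simp: v_def)
  have "kill m 0 v = w \<or> kill m 0 v = - w"
  proof (cases m)
    case 0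
    then show ?thesis using kill_P[of w m 0] w'(1) by (simp add: v_def HP_def)
  next
    case (Suc k)
    have "kill m 0 v = foldr TT [0..<k] (kill m 0 (TT k w))"
      unfolding v_def Suc using kill_foldr_TT[of "[0..<k]" "Suc k" "TT k w"] by (simp add: subset_iff)
    also have "kill m 0 (TT k w) = - w"
      using kill_TT_last[of w k] w' x Suc by (simp add: HP_def)
    finally have "kill m 0 v = - foldr TT [0..<k] w" by (simp add: foldr_TT_neg)
    moreover have "foldr TT [0..<k] w = w \<or> foldr TT [0..<k] w = - w"
      using w'(3) Suc by (intro foldr_TT_scalar) auto
    ultimately show ?thesis by auto
  qed
  then show thesis
  proof
    assume "kill m 0 v = - w"
    then have "kill m 0 (- v) = w" by (simp add: rhom_neg[OF rhom_kill])
    then show thesis using that[OF Kp_neg[OF vK]] by simp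
  qed (use that[OF vK] in simp)
qed

text \<open>
  The diagonal matrix with last entry \<open>c\<close>, \<open>c^k \<noteq> 1\<close>, acts trivially modulo the last variable.
\<close>

lemma Kp_torus_dvd:
  assumes k: "1 \<le> k" "k \<le> CARD('k) - 2" and f: "f \<in> Kp (Suc m) k d"
  shows "X m dvd f"
proof -
  obtain c :: 'k where c: "c \<noteq> 0" "c ^ k \<noteq> 1"
  proof (rule ccontr)
    assume "\<not> thesis"
    then have all: "c ^ k = 1" if "c \<noteq> 0" for c :: 'k using that \<open>\<And>c. c \<noteq> 0 \<Longrightarrow> c ^ k \<noteq> 1 \<Longrightarrow> thesis\<close> by blast
    \<comment> \<open>Otherwise x^k - 1 would have q - 1 roots, more than its degree, as k is at
      most q - 2.\<close>
    define g where "g = (monom 1 k - 1 :: 'k poly)"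
    have ev: "poly g x = x ^ k - 1" for x by (simp add: g_def poly_monom)
    have "poly g 0 \<noteq> 0" using k by (simp add: ev power_0_left)
    then have g0: "g \<noteq> 0" by auto
    have "degree g \<le> k" unfolding g_def by (intro degree_diff_le degree_monom_le) simp
    moreover have "card {x. poly g x = 0} \<le> degree g" by (rule card_poly_roots_bound[OF g0])
    moreover have "card (UNIV - {0::'k}) \<le> card {x. poly g x = 0}"
      using all by (intro card_mono) (auto simp: ev)
    moreover have "card (UNIV - {0::'k}) = CARD('k) - 1" by (simp add: card_Diff_subset)
    ultimately show False using k by linarith
  qed
  define b where "b = mat (Suc m) (Suc m) (\<lambda>(a, l). if a = l then if a = m then c else 1 else 0)"
  have b: "b \<in> Borel (Suc m)" using c by (auto simp: b_def mem_Borel)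
  have bc: "b \<in> carrier_mat (Suc m) (Suc m)" by (simp add: b_def)
  have "det b = c" unfolding det_Borel[OF b] by (simp add: b_def)
  moreover have "C (det b) ^ k * sym_act b f = f" using f b unfolding Kp_def by blast
  ultimately have e: "C (c ^ k) * sym_act b f = f" by (simp add: C_power)
  have fP: "f \<in> P (Suc m)" using f by (simp add: Kp_def HP_def)
  have kf: "kill m 0 f = sub (\<lambda>i. if i = m then - 0 else X i) f" by (simp add: kill_def)
  have "kill m 0 (sym_act b f) = kill m 0 f"
    unfolding sym_act_sub kill_sub kf
  proof (rule sub_cong[OF fP])
    fix i assume i: "i < Suc m"
    have "sym_col b i = (\<Sum>l<Suc m. if l = i then C (if i = m then c else 1) * X i else 0)"
      unfolding sym_col_alt[OF bc] using i by (intro sum.cong) (auto simp: b_def C_0 C_1)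
    then have "sym_col b i = C (if i = m then c else 1) * X i" using i by simp
    then show "kill m 0 (sym_col b i) = (if i = m then - 0 else X i)"
      by (simp add: rhom_mult[OF rhom_kill] rhom_1[OF rhom_kill] kill_X C_1)
  qed
  then have "C (c ^ k) * kill m 0 f = kill m 0 f"
    using arg_cong[OF e, of "kill m 0"] by (simp add: rhom_mult[OF rhom_kill]) (simp add: kill_def sub_C)
  then have "(C (c ^ k) - 1) * kill m 0 f = 0" by (simp add: algebra_simps)
  moreover have "C (c ^ k) - 1 \<noteq> (0 :: 'k mpol)" using c(2) by (metis C_1 C_eq_iff right_minus_eq)
  ultimately have "kill m 0 f = 0" by simp
  then have "X m + 0 dvd f" using line_dvd_iff[OF P_0, of m f] by simp
  then show ?thesis by simp
qed

text \<open>Cramer's rule: contracting the volume form with the covectors 0, ..., m, omitting j,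
  gives the Dickson coefficient times \<open>Lam m\<close> up to sign. Both this product and
  \<open>Lam m\<close> transform by the determinant.\<close>

lemma dickson_coeff_invariant:
  assumes g: "g \<in> hecke_gens m" and j: "j < m"
  shows "sym_act g (dickson_coeff m j) = (dickson_coeff m j :: 'k mpol)"
proof -
  have gc: "g \<in> carrier_mat m m" by (rule hecke_gens_carrier[OF g])
  let ?xs = "[0..<j] @ [Suc j..<m]"
  \<comment> \<open>Only the indices l < m enter the contraction, and there FF_m vanishes at
    X_l.\<close>
  have rel: "ann m (aq m) \<omega> J = (\<Sum>i<m. - dickson_coeff m i * ann m (aq i) \<omega> J)" for \<omega> J
  proof -
    have "ann m (aq m) \<omega> J = ann m (\<lambda>l. \<Sum>i<m. - dickson_coeff m i * aq i l) \<omega> J"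
      unfolding ann_def by (intro sum.cong refl) (use FF_relation[of _ m] FF_X_zero[of _ m] in auto)
    then show ?thesis by (simp only: ann_covector_sum)
  qed
  have zero: "mo.A m ?xs (ann m (aq i) (volf m)) = 0" if "i < m" "i \<noteq> j" for i
    using that by (intro ann.foldr_mem) auto
  have "ann m (aq m) (volf m) = (\<lambda>J. \<Sum>i<m. sm (- dickson_coeff m i) (ann m (aq i) (volf m)) J)"
    by (auto simp: rel sm_def)
  then have "mo.A m ?xs (ann m (aq m) (volf m)) = (\<lambda>J. \<Sum>i<m. mo.A m ?xs (sm (- dickson_coeff m i) (ann m (aq i) (volf m))) J)"
    by (simp only: foldr_ann_sum[abs_def])
  also have "\<dots> = sm (- dickson_coeff m j) (mo.A m ?xs (ann m (aq j) (volf m)))"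
  proof
    fix J
    have "(\<Sum>i<m. mo.A m ?xs (sm (- dickson_coeff m i) (ann m (aq i) (volf m))) J) =
      (\<Sum>i<m. if i = j then sm (- dickson_coeff m j) (mo.A m ?xs (ann m (aq j) (volf m))) J else 0)"
    proof (rule sum.cong)
      fix i assume "i \<in> {..<m}"
      then show "mo.A m ?xs (sm (- dickson_coeff m i) (ann m (aq i) (volf m))) J =
        (if i = j then sm (- dickson_coeff m j) (mo.A m ?xs (ann m (aq j) (volf m))) J else 0)"
        unfolding foldr_ann_sm by (cases "i = j") (auto simp: zero sm_def simp del: foldr_append)
    qed simp
    then show "(\<Sum>i<m. mo.A m ?xs (sm (- dickson_coeff m i) (ann m (aq i) (volf m))) J) = sm (- dickson_coeff m j) (mo.A m ?xs (ann m (aq j) (volf m))) J"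
      using j by simp
  qed
  finally have 1: "mo.A m (?xs @ [m]) (volf m) = sm (- dickson_coeff m j) (mo.A m (?xs @ [j]) (volf m))" by simp
  have "mset (?xs @ [j]) = mset [0..<m]"
  proof -
    have "[0..<m] = [0..<j] @ [j..<m]" using j upt_add_eq_append[of 0 j "m - j"] by simp
    then show ?thesis using j by (simp add: upt_conv_Cons)
  qed
  then have "(\<forall>\<omega>. mo.A m (?xs @ [j]) \<omega> = mo.A m [0..<m] \<omega>) \<or> (\<forall>\<omega>. mo.A m (?xs @ [j]) \<omega> = - mo.A m [0..<m] \<omega>)"
    by (rule ann.foldr_mset)
  then have "\<exists>e\<in>{1, -1 :: 'k mpol}. mo.A m (?xs @ [j]) (volf m) = sm e (mo.A m [0..<m] (volf m))"
  proof
    assume "\<forall>\<omega>. mo.A m (?xs @ [j]) \<omega> = mo.A m [0..<m] \<omega>"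
    then show ?thesis by (intro bexI[of _ 1]) (simp_all only: sm_simps(2) insertI1)
  next
    assume "\<forall>\<omega>. mo.A m (?xs @ [j]) \<omega> = - mo.A m [0..<m] \<omega>"
    then show ?thesis by (intro bexI[of _ "-1"]) (simp_all only: sm_simps(2,5) insert_iff simp_thms)
  qed
  then obtain e where e: "e \<in> {1, -1 :: 'k mpol}" "mo.A m (?xs @ [j]) (volf m) = sm e (mo.A m [0..<m] (volf m))" by blast
  obtain e' where e': "e' \<in> {1, -1 :: 'k mpol}" "mo.A m [0..<m] (volf m) = sm (e' * Lam m) (ev {})"
    using mo.A_top[of m m] unfolding Lam_def by blast
  have 2: "mo.A m (?xs @ [m]) (volf m) = sm (- (e * e') * (dickson_coeff m j * Lam m)) (ev {})"
    unfolding 1 e(2) e'(2) sm_simps(1) by (simp add: mult_ac)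
  have len: "length (?xs @ [m]) = m" using j by simp
  have "gact m g (mo.A m (?xs @ [m]) (volf m)) = mo.A m (?xs @ [m]) (gact m g (volf m))"
    using Fsup_ev[of "{..<m}" m] len by (intro gact_A[OF gc, where j = 0]) simp
  also have "\<dots> = sm (C (det g)) (mo.A m (?xs @ [m]) (volf m))" unfolding gact_vol[OF g] by (rule foldr_ann_sm)
  finally have "sm (sym_act g (- (e * e') * (dickson_coeff m j * Lam m))) (ev {}) {} = sm (C (det g) * (- (e * e') * (dickson_coeff m j * Lam m))) (ev {}) {}"
    unfolding 2 gact_sm gact_ev_empty sm_simps(1) by simp
  then have 3: "sym_act g (- (e * e') * (dickson_coeff m j * Lam m)) = C (det g) * (- (e * e') * (dickson_coeff m j * Lam m))"
    by (simp add: sm_def ev_def)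
  have s: "sym_act g (- (e * e')) = - (e * e')"
    using e(1) e'(1) by (auto simp: rhom_1[OF rhom_sym_act] rhom_neg[OF rhom_sym_act])
  have "- (e * e') * C (det g) * Lam m * sym_act g (dickson_coeff m j) = - (e * e') * C (det g) * Lam m * dickson_coeff m j"
    using 3 unfolding rhom_mult[OF rhom_sym_act, of g "- (e * e')"] s rhom_mult[OF rhom_sym_act, of g "dickson_coeff m j"] sym_act_Lam[OF g]
    by (simp only: mult_ac)
  moreover have "- (e * e') * C (det g) * Lam m \<noteq> 0"
    using e(1) e'(1) Lam_nonzero hecke_gens_det[OF g] C_eq_iff[of "det g" 0] by (auto simp: C_0)
  ultimately show ?thesis by (metis mult_left_cancel)
qed

lemma Kp_invariant_mult:
  assumes f: "f \<in> Kp n k d" and s: "s \<in> HP n e" and inv: "\<And>g. g \<in> hecke_gens n \<Longrightarrow> sym_act g s = s"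
  shows "s * f \<in> Kp n k (d + e)"
  unfolding Kp_def
proof (intro CollectI conjI ballI allI impI)
  show "s * f \<in> HP n (d + e)" using HP_mult[OF s, of f d] f by (simp add: Kp_def add.commute)
  show "C (det b) ^ k * sym_act b (s * f) = s * f" if "b \<in> Borel n" for b
    using f that by (simp add: rhom_mult[OF rhom_sym_act] inv[OF hecke_gens_Borel[OF that]] mult.left_commute Kp_def)
  show "(\<Sum>c\<in>UNIV. C (det (tm n i c)) ^ k * sym_act (tm n i c) (s * f)) = - (s * f)" if i: "Suc i < n" for i
  proof -
    have "(\<Sum>c\<in>UNIV. C (det (tm n i c)) ^ k * sym_act (tm n i c) (s * f)) = s * (\<Sum>c\<in>UNIV. C (det (tm n i c)) ^ k * sym_act (tm n i c) f)"
      by (simp add: rhom_mult[OF rhom_sym_act] inv[OF hecke_gens_tm[OF i]] mult.left_commute sum_distrib_left)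
    then show ?thesis using f i by (simp add: Kp_def)
  qed
qed

text \<open>The coefficient is invariant for m variables only, so the product with \<open>h\<close>
  need not lie in the space for m + 1 variables; a substitute with the same restriction is found.
  With a twist the restriction of \<open>h\<close> is 0 and 0 serves; otherwise \<open>h\<close> is
  restricted, multiplied there, and lifted by \<open>Kp_lift\<close>.\<close>

lemma Kp_dickson_coeff_lift:
  assumes k: "k = 0 \<or> 1 \<le> k \<and> k \<le> CARD('k) - 2" and h: "h \<in> Kp (Suc m) k d" and j: "j < m"
  shows "\<exists>h'\<in>Kp (Suc m) k (d + (CARD('k) ^ m - CARD('k) ^ j)). X m dvd h' - dickson_coeff m j * h"
  using k
proof
  assume "1 \<le> k \<and> k \<le> CARD('k) - 2"
  then have "X m dvd h" using Kp_torus_dvd[OF _ _ h] by blast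
  then show ?thesis using Kp_0 by (intro bexI[of _ 0]) auto
next
  assume k0: "k = 0"
  have hK: "kill m 0 h \<in> Kp m 0 d" and hx: "X (m - 1) dvd kill m 0 h"
    using Kp_restrict[of h m d] h j by (auto simp: k0)
  have cH: "(dickson_coeff m j :: 'k mpol) \<in> HP m (CARD('k) ^ m - CARD('k) ^ j)" using dickson_coeff_P[where 'k='k, of m j] dickson_coeff_Hm[where 'k='k, of j m] j by (simp add: HP_def)
  have "dickson_coeff m j * kill m 0 h \<in> Kp m 0 (d + (CARD('k) ^ m - CARD('k) ^ j))"
    by (rule Kp_invariant_mult[OF hK cH dickson_coeff_invariant[OF _ j]])
  moreover have "X (m - 1) dvd dickson_coeff m j * kill m 0 h" using hx by simp
  ultimately obtain v where v: "v \<in> Kp (Suc m) 0 (d + (CARD('k) ^ m - CARD('k) ^ j))" "kill m 0 v = dickson_coeff m j * kill m 0 h"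
    using Kp_lift by blast
  have kc: "kill m 0 (dickson_coeff m j) = (dickson_coeff m j :: 'k mpol)" by (rule kill_P[OF dickson_coeff_P])
  have "kill m 0 (v - dickson_coeff m j * h) = 0"
    by (simp add: kc rhom_diff[OF rhom_kill] rhom_mult[OF rhom_kill] v(2))
  then have "X m + 0 dvd v - dickson_coeff m j * h" using line_dvd_iff[OF P_0, of m "v - dickson_coeff m j * h"] by simp
  then show ?thesis using v(1) k0 by (intro bexI[of _ v]) auto
qed

end

section \<open>Contractions modulo the last diagonal entry\<close>

context moore
begin

text \<open>Row m of the Moore matrix is, apart from V_m times the last coordinate covector, the
  combination of earlier rows with coefficients \<open>c m i\<close>. Being the largest index, m is
  contracted first, where this can be substituted directly.\<close>

lemma DD_last:
  assumes n: "n = Suc m" and J0: "J0 \<subseteq> {..<m}"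
  shows "V m dvd DD (insert m J0) \<omega> I - (\<Sum>i<m. c m i * A (sorted_list_of_set J0 @ [i]) \<omega> I)"
proof -
  let ?xs = "sorted_list_of_set J0"
  have fJ: "finite J0" using J0 finite_subset by blast
  have "sorted_list_of_set (set (?xs @ [m])) = ?xs @ [m]"
    using J0 fJ by (intro sorted_list_of_set.idem_if_sorted_distinct) (auto simp: sorted_append)
  then have sl: "sorted_list_of_set (insert m J0) = ?xs @ [m]" using fJ by simp
  have "ann n (a m) \<omega> K = (sm (V m) (an m \<omega>) + (\<lambda>I. \<Sum>i<m. sm (c m i) (ann n (a i) \<omega>) I)) K" for K
  proof -
    have "ann n (\<delta> m) \<omega> K = (\<Sum>l<n. if l = m then V m * an m \<omega> K else 0)"
      unfolding ann_def using n by (intro sum.cong) (auto simp: delta)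
    then have "ann n (\<delta> m) \<omega> K = V m * an m \<omega> K" using n by simp
    then show ?thesis by (simp add: ann_delta[of m] sm_def)
  qed
  then have e: "ann n (a m) \<omega> = sm (V m) (an m \<omega>) + (\<lambda>I. \<Sum>i<m. sm (c m i) (ann n (a i) \<omega>) I)" by (rule ext)
  have "DD (insert m J0) \<omega> = A ?xs (ann n (a m) \<omega>)" by (simp add: DD_def sl)
  also have "\<dots> = A ?xs (sm (V m) (an m \<omega>) + (\<lambda>I. \<Sum>i<m. sm (c m i) (ann n (a i) \<omega>) I))" by (simp only: e)
  finally have "DD (insert m J0) \<omega> = A ?xs (sm (V m) (an m \<omega>) + (\<lambda>I. \<Sum>i<m. sm (c m i) (ann n (a i) \<omega>) I))" .
  then have "DD (insert m J0) \<omega> I = V m * A ?xs (an m \<omega>) I + (\<Sum>i<m. c m i * A (?xs @ [i]) \<omega> I)"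
    by (simp add: foldr_ann_add foldr_ann_sum foldr_ann_sm) (simp add: sm_def)
  then show ?thesis by simp
qed

lemma A_perm:
  assumes "distinct ms" shows "\<exists>e\<in>{1,-1}. \<forall>\<omega>. A ms \<omega> = sm e (DD (set ms) \<omega>)"
proof -
  have "mset ms = mset (sorted_list_of_set (set ms))"
    using assms by (metis mset_set_set mset_sorted_list_of_multiset sorted_list_of_mset_set)
  from ann.foldr_mset[OF this, of n a] show ?thesis
  proof
    assume "\<forall>x. A ms x = A (sorted_list_of_set (set ms)) x"
    then show ?thesis by (intro bexI[of _ 1]) (simp_all only: sm_simps(2) DD_def insertI1 simp_thms)
  next
    assume "\<forall>x. A ms x = - A (sorted_list_of_set (set ms)) x"
    then show ?thesis by (intro bexI[of _ "-1"]) (simp_all only: sm_simps(2,5) DD_def insert_iff simp_thms)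
  qed
qed

text \<open>In the congruence of \<open>DD_last\<close> the correction terms contract along sets
  avoiding m, up to order and repetition, and these vanish by assumption.\<close>

lemma DD_last_dvd:
  assumes n: "n = Suc m" and J0: "J0 \<subseteq> {..<m}"
    and 0: "\<And>J. J \<subseteq> {..<m} \<Longrightarrow> card J = Suc (card J0) \<Longrightarrow> DD J \<omega> {} = 0"
  shows "V m dvd DD (insert m J0) \<omega> {}"
proof -
  have fJ: "finite J0" using J0 finite_subset by blast
  have "A (sorted_list_of_set J0 @ [i]) \<omega> {} = 0" if i: "i < m" for i
  proof (cases "i \<in> J0")
    case True
    then have "\<not> distinct (sorted_list_of_set J0 @ [i])" using fJ by simp
    then show ?thesis using ann.foldr_not_distinct[of "sorted_list_of_set J0 @ [i]" n a \<omega>] by simp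
  next
    case False
    then have "distinct (sorted_list_of_set J0 @ [i])" using fJ by simp
    from A_perm[OF this] obtain e where "A (sorted_list_of_set J0 @ [i]) \<omega> = sm e (DD (set (sorted_list_of_set J0 @ [i])) \<omega>)" by blast
    moreover have "DD (insert i J0) \<omega> {} = 0" using False i J0 fJ by (intro 0) auto
    ultimately show ?thesis using fJ by (simp only: sm_def set_append set_sorted_list_of_set list.set Un_insert_right sup_bot.right_neutral mult_zero_right)
  qed
  then have "(\<Sum>i<m. c m i * A (sorted_list_of_set J0 @ [i]) \<omega> {}) = 0"
    by (intro sum.neutral) (simp del: foldr_append)
  then show ?thesis using DD_last[OF n J0, of \<omega> "{}"] by (simp only: diff_zero)
qed

text \<open>The dual counterpart of \<open>DD_last\<close>: the complement of J contains m, and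
  replacing m there by some i in J yields the complement of J with i exchanged for m. An i outside J
  repeats a covector and gives 0.\<close>

lemma beta_last:
  assumes n: "n = Suc m" and J: "J \<subseteq> {..<m}"
  shows "\<exists>s. (\<forall>i\<in>J. s i \<in> {1,-1}) \<and> (\<forall>I. V m dvd beta J I - (\<Sum>i\<in>J. s i * c m i * beta (insert m (J - {i})) I))"
proof -
  define J0 where "J0 = {..<m} - J"
  have J0: "J0 \<subseteq> {..<m}" "finite J0" by (auto simp: J0_def)
  have cJ: "{..<n} - J = insert m J0" using J n by (auto simp: J0_def)
  have Jn: "J \<subseteq> {..<n}" "finite J" using J n finite_subset by auto
  have ex: "\<exists>s\<in>{1,-1}. \<forall>I. dsign J * A (sorted_list_of_set J0 @ [i]) vol I = s * beta (insert m (J - {i})) I" if i: "i \<in> J" for i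
  proof -
    have "i \<notin> J0" using i by (simp add: J0_def)
    then have "distinct (sorted_list_of_set J0 @ [i])" using J0 by simp
    from A_perm[OF this] obtain e where e: "e \<in> {1,-1}"
      "A (sorted_list_of_set J0 @ [i]) vol = sm e (DD (set (sorted_list_of_set J0 @ [i])) vol)" by blast
    have "set (sorted_list_of_set J0 @ [i]) = {..<n} - insert m (J - {i})"
      using J0 J i n by (auto simp: J0_def)
    then have A: "A (sorted_list_of_set J0 @ [i]) vol I = e * DD ({..<n} - insert m (J - {i})) vol I" for I
      using e(2) by (simp only: sm_def)
    have "insert m (J - {i}) \<subseteq> {..<n}" using Jn n by auto
    then have d: "dsign (insert m (J - {i})) \<in> {1,-1}" "dsign J \<in> {1,-1}" using dsign(1) Jn by blast+
    show ?thesis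
    proof (intro bexI allI)
      show "dsign J * A (sorted_list_of_set J0 @ [i]) vol I =
        (dsign J * e * dsign (insert m (J - {i}))) * beta (insert m (J - {i})) I" for I
        unfolding A beta_def sm_def using d by auto
      show "dsign J * e * dsign (insert m (J - {i})) \<in> {1,-1}" using d e(1) by auto
    qed
  qed
  then have "\<exists>s. \<forall>i\<in>J. s i \<in> {1,-1} \<and> (\<forall>I. dsign J * A (sorted_list_of_set J0 @ [i]) vol I = s i * beta (insert m (J - {i})) I)"
    unfolding Bex_def by (intro bchoice ballI) blast
  then obtain s where s: "\<And>i. i \<in> J \<Longrightarrow> s i \<in> {1,-1}"
    "\<And>i I. i \<in> J \<Longrightarrow> dsign J * A (sorted_list_of_set J0 @ [i]) vol I = s i * beta (insert m (J - {i})) I" by blast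
  have "V m dvd beta J I - (\<Sum>i\<in>J. s i * c m i * beta (insert m (J - {i})) I)" for I
  proof -
    have z: "A (sorted_list_of_set J0 @ [i]) vol I = 0" if "i \<in> {..<m} - J" for i
    proof -
      have "i \<in> J0" using that by (simp add: J0_def)
      then have "\<not> distinct (sorted_list_of_set J0 @ [i])" using J0 by simp
      then show ?thesis using ann.foldr_not_distinct[of "sorted_list_of_set J0 @ [i]" n a vol] by simp
    qed
    have "dsign J * (\<Sum>i<m. c m i * A (sorted_list_of_set J0 @ [i]) vol I) = (\<Sum>i<m. c m i * (dsign J * A (sorted_list_of_set J0 @ [i]) vol I))"
      by (simp only: sum_distrib_left mult.left_commute)
    also have "\<dots> = (\<Sum>i\<in>J. c m i * (dsign J * A (sorted_list_of_set J0 @ [i]) vol I))"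
      using J by (intro sum.mono_neutral_right) (auto simp: z simp del: foldr_append)
    also have "\<dots> = (\<Sum>i\<in>J. s i * c m i * beta (insert m (J - {i})) I)"
      by (intro sum.cong refl) (simp only: s(2) mult_ac)
    finally have e: "dsign J * (\<Sum>i<m. c m i * A (sorted_list_of_set J0 @ [i]) vol I) = (\<Sum>i\<in>J. s i * c m i * beta (insert m (J - {i})) I)" .
    have b: "beta J I = dsign J * DD (insert m J0) vol I" by (simp only: beta_def sm_def cJ)
    have "beta J I - (\<Sum>i\<in>J. s i * c m i * beta (insert m (J - {i})) I) =
      dsign J * (DD (insert m J0) vol I - (\<Sum>i<m. c m i * A (sorted_list_of_set J0 @ [i]) vol I))"
      by (simp only: b e right_diff_distrib)
    then show ?thesis using dvd_mult[OF DD_last[OF n J0(1), of vol I], of "dsign J"] by (simp only:)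
  qed
  then show ?thesis using s(1) by blast
qed

lemma DD_diff: "DD J (\<omega> - \<eta>) = DD J \<omega> - DD J \<eta>"
  using foldr_ann_add[of n a "sorted_list_of_set J" \<omega> "- \<eta>"] ann.foldr_neg[of n a "sorted_list_of_set J" \<eta>]
  by (simp add: DD_def)

lemma DD_sum: "DD J (\<lambda>I. \<Sum>i\<in>S. w i I) K = (\<Sum>i\<in>S. DD J (w i) K)"
  by (simp add: DD_def foldr_ann_sum)

lemma DD_eqI:
  assumes "\<omega> \<in> Fsup n j" "\<eta> \<in> Fsup n j" and "\<And>J. J \<subseteq> {..<n} \<Longrightarrow> card J = j \<Longrightarrow> DD J \<omega> {} = DD J \<eta> {}"
  shows "\<omega> = \<eta>"
proof -
  have "\<omega> + sm (-1) \<eta> \<in> Fsup n j" using assms by (intro Fsup_add Fsup_sm)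
  then have "\<omega> - \<eta> \<in> Fsup n j" by (simp add: sm_simps)
  then have "\<omega> - \<eta> = 0" using assms(3) by (intro DD_inj) (auto simp: DD_diff)
  then show ?thesis by simp
qed

end

text \<open>With q the field size, this is the amount by which \<open>DD J\<close> raises the
  polynomial degree.\<close>

definition q_weight :: "nat \<Rightarrow> nat set \<Rightarrow> nat" where
  "q_weight q J = (\<Sum>m\<in>J. q ^ m)"

context prime_power_field
begin

lemma X_HP: "i < n \<Longrightarrow> X i \<in> (HP n 1 :: 'k mpol set)"
  by (simp add: HP_def P_X Hm_X[simplified])

lemma A_HP:
  assumes "\<And>I. \<omega> I \<in> HP n d" shows "mo.A n ms \<omega> I \<in> HP n (d + (\<Sum>m\<leftarrow>ms. CARD('k) ^ m))"
proof (induction ms arbitrary: I)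
  case (Cons m ms)
  have "aq m l \<in> HP n (CARD('k) ^ m)" if "l < n" for l
    using HP_power[OF X_HP[OF that], of "CARD('k) ^ m"] by simp
  then have "ann n (aq m) (mo.A n ms \<omega>) I \<in> HP n (CARD('k) ^ m + (d + (\<Sum>m\<leftarrow>ms. CARD('k) ^ m)))"
    using Cons.IH by (intro ann_HP)
  then show ?case by (simp add: add_ac)
qed (use assms in simp)

lemma DD_HP:
  assumes "\<And>I. \<omega> I \<in> HP n d" "finite J" shows "mo.DD n J \<omega> I \<in> HP n (d + q_weight CARD('k) J)"
proof -
  have "(\<Sum>m\<leftarrow>sorted_list_of_set J. CARD('k) ^ m) = q_weight CARD('k) J"
    using assms(2) by (simp add: q_weight_def sum_list_distinct_conv_sum_set)
  then show ?thesis using A_HP[of \<omega> n d "sorted_list_of_set J" I] assms(1) by (simp add: mo.DD_def)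
qed

lemma beta_HP:
  assumes "J \<subseteq> {..<n}" shows "mo.beta n J I \<in> HP n (q_weight CARD('k) {..<n} - q_weight CARD('k) J)"
proof -
  have "volf n K \<in> HP n 0" for K by (simp add: ev_def HP_1 HP_0)
  then have "mo.DD n ({..<n} - J) (volf n) I \<in> HP n (q_weight CARD('k) ({..<n} - J))"
    using DD_HP[of "volf n" n 0 "{..<n} - J" I] by simp
  moreover have "q_weight CARD('k) ({..<n} - J) = q_weight CARD('k) {..<n} - q_weight CARD('k) J"
    using assms finite_subset[of J "{..<n}"] by (simp add: q_weight_def sum_diff_nat)
  ultimately show ?thesis using mo.dsign(1)[OF assms] by (auto simp: mo.beta_def sm_def HP_neg)
qed

lemma q_weight_le: "J \<subseteq> {..<n} \<Longrightarrow> q_weight q J \<le> q_weight q {..<n}"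
  unfolding q_weight_def by (intro sum_mono2) auto

lemma DD_twist:
  assumes "g \<in> carrier_mat n n" "J \<subseteq> {..<n}" "\<omega> \<in> Fsup n (card J)"
  shows "mo.DD n J (sm c (gact n g \<omega>)) {} = c * sym_act g (mo.DD n J \<omega> {})"
  unfolding mo.DD_sm using DD_gact[OF assms] by (simp only: sm_def)

text \<open>The contractions commute with the action and are jointly injective, so each equation
  defining the space for forms can be tested on the polynomials \<open>DD J\<close>.\<close>

lemma Kf_iff_DD:
  assumes w: "\<omega> \<in> Fsup n j" and h: "\<And>I. \<omega> I \<in> HP n d"
  shows "\<omega> \<in> Kf n k d j \<longleftrightarrow> (\<forall>J. J \<subseteq> {..<n} \<and> card J = j \<longrightarrow> mo.DD n J \<omega> {} \<in> Kp n k (d + q_weight CARD('k) J))"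
proof -
  let ?S = "\<lambda>J. J \<subseteq> {..<n} \<and> card J = j"
  have gF: "sm c (gact n g \<omega>) \<in> Fsup n j" for c g by (intro Fsup_sm gact_Fsup w)
  have H: "mo.DD n J \<omega> {} \<in> HP n (d + q_weight CARD('k) J)" if "?S J" for J
    using that finite_subset[of J "{..<n}"] by (intro DD_HP h) auto
  have eq: "\<alpha> = \<beta> \<longleftrightarrow> (\<forall>J. ?S J \<longrightarrow> mo.DD n J \<alpha> {} = mo.DD n J \<beta> {})" if "\<alpha> \<in> Fsup n j" "\<beta> \<in> Fsup n j" for \<alpha> \<beta> :: "nat set \<Rightarrow> 'k mpol"
    using mo.DD_eqI[OF that] by blast
  have tw: "mo.DD n J (sm c (gact n g \<omega>)) {} = c * sym_act g (mo.DD n J \<omega> {})" if "?S J" "g \<in> carrier_mat n n" for J c g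
    using that w by (intro DD_twist) auto
  have B: "sm (C (det b) ^ k) (gact n b \<omega>) = \<omega> \<longleftrightarrow>
      (\<forall>J. ?S J \<longrightarrow> C (det b) ^ k * sym_act b (mo.DD n J \<omega> {}) = mo.DD n J \<omega> {})" if b: "b \<in> Borel n" for b
    using tw[OF _ hecke_gens_carrier[OF hecke_gens_Borel[OF b]]] unfolding eq[OF gF w] by simp
  have nF: "- \<omega> \<in> Fsup n j" using Fsup_sm[OF w, of "-1"] by (simp add: sm_simps)
  have T: "(\<lambda>J. \<Sum>c\<in>UNIV. sm (C (det (tm n i c)) ^ k) (gact n (tm n i c) \<omega>) J) = - \<omega> \<longleftrightarrow>
      (\<forall>J. ?S J \<longrightarrow> (\<Sum>c\<in>UNIV. C (det (tm n i c)) ^ k * sym_act (tm n i c) (mo.DD n J \<omega> {})) = - mo.DD n J \<omega> {})"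
    if i: "Suc i < n" for i
  proof -
    have "mo.DD n J (- \<omega>) {} = - mo.DD n J \<omega> {}" for J
      using mo.DD_sm[of n J "-1" \<omega>] by (simp add: sm_simps)
    then show ?thesis
      unfolding eq[OF Fsup_sum[OF gF] nF] mo.DD_sum using tw[OF _ tm_carrier] by simp
  qed
  have "\<omega> \<in> Kf n k d j \<longleftrightarrow>
    (\<forall>b\<in>Borel n. \<forall>J. ?S J \<longrightarrow> C (det b) ^ k * sym_act b (mo.DD n J \<omega> {}) = mo.DD n J \<omega> {}) \<and>
    (\<forall>i. Suc i < n \<longrightarrow> (\<forall>J. ?S J \<longrightarrow> (\<Sum>c\<in>UNIV. C (det (tm n i c)) ^ k * sym_act (tm n i c) (mo.DD n J \<omega> {})) = - mo.DD n J \<omega> {}))"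
    by (simp add: Kf_def w h B T)
  also have "\<dots> \<longleftrightarrow> (\<forall>J. ?S J \<longrightarrow> mo.DD n J \<omega> {} \<in> Kp n k (d + q_weight CARD('k) J))"
    using H by (auto simp: Kp_def)
  finally show ?thesis .
qed

lemma Kp_sum: "(\<And>i. i \<in> S \<Longrightarrow> f i \<in> Kp n k d) \<Longrightarrow> sum f S \<in> Kp n k d"
  by (induction S rule: infinite_finite_induct) (auto simp: Kp_0 Kp_add)

lemma KfD:
  assumes "\<omega> \<in> Kf n k d j"
  shows "\<omega> \<in> Fsup n j" "\<omega> I \<in> HP n d"
    "J \<subseteq> {..<n} \<Longrightarrow> card J = j \<Longrightarrow> mo.DD n J \<omega> {} \<in> Kp n k (d + q_weight CARD('k) J)"
proof -
  show a: "\<omega> \<in> Fsup n j" "\<omega> I \<in> HP n d" for I using assms by (auto simp: Kf_def)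
  show "mo.DD n J \<omega> {} \<in> Kp n k (d + q_weight CARD('k) J)" if "J \<subseteq> {..<n}" "card J = j"
    using assms that unfolding Kf_iff_DD[OF a] by blast
qed

lemma Kf_sum:
  assumes "\<And>i. i \<in> S \<Longrightarrow> w i \<in> Kf n k d j"
  shows "(\<lambda>I. \<Sum>i\<in>S. w i I) \<in> Kf n k d j"
proof -
  have "(\<lambda>I. \<Sum>i\<in>S. w i I) \<in> Fsup n j" using KfD(1)[OF assms] by (intro Fsup_sum)
  moreover have "(\<Sum>i\<in>S. w i I) \<in> HP n d" for I using KfD(2)[OF assms] by (intro HP_sum)
  ultimately show ?thesis using Kf_iff_DD KfD(3)[OF assms] by (simp add: mo.DD_sum Kp_sum)
qed

lemma ev_empty_eq: "sm x (ev {}) {} = x"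
  by (simp add: sm_def ev_def)

lemma zero_Kf: "0 \<in> Kf n k d j"
  using Kf_sum[of "{} :: nat set" "\<lambda>_. 0" n k d j] by (simp add: zero_fun_def)

lemma DD_beta_empty:
  assumes "J \<subseteq> {..<n}" "J' \<subseteq> {..<n}" "card J' = card J"
  shows "mo.DD n J' (mo.beta n J) {} = (if J' = J then Lam n else 0)"
  using mo.DD_beta[OF assms] by (simp add: ev_empty_eq Lam_def)

section \<open>Prescribing the contractions of a form\<close>

lemma Kf_lift_high:
  assumes J: "J \<subseteq> {..<Suc m}" and h: "h \<in> Kp (Suc m) k (d + q_weight CARD('k) J)" "X m dvd h"
  obtains \<omega> where "\<omega> \<in> Kf (Suc m) k d (card J)" "mo.DD (Suc m) J \<omega> {} = h"
    "\<And>J'. J' \<subseteq> {..<Suc m} \<Longrightarrow> card J' = card J \<Longrightarrow> J' \<noteq> J \<Longrightarrow> mo.DD (Suc m) J' \<omega> {} = 0"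
\<comment> \<open>The zero polynomial is split off because only a nonzero multiple of
  \<open>Lam\<close> yields the degree bound \<open>le\<close>, on which the natural subtractions
  rely.\<close>
proof (cases "h = 0")
  case True
  have "mo.DD (Suc m) J' 0 {} = 0" for J' by (simp add: mo.DD_def ann.foldr_zero)
  then show ?thesis using that[OF zero_Kf] True by auto
next
  case False
  let ?n = "Suc m" and ?q = "CARD('k)"
  have "Lam ?n dvd h" using Kp_Lam_dvd[OF h(1)] h(2) by simp
  then obtain h' where h': "h = Lam ?n * h'" by (elim dvdE)
  then have "h' \<noteq> 0" using False by auto
  then have le: "q_weight ?q {..<?n} \<le> d + q_weight ?q J" and hK: "h' \<in> Kp ?n (Suc k) (d + q_weight ?q J - q_weight ?q {..<?n})"
    using Kp_Lam_div[of ?n h' k] h(1) h' by (auto simp: q_weight_def)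
  define \<omega> where "\<omega> = sm h' (mo.beta ?n J)"
  have F: "\<omega> \<in> Fsup ?n (card J)" unfolding \<omega>_def by (intro Fsup_sm mo.beta_Fsup J)
  have H: "\<omega> I \<in> HP ?n d" for I
  proof -
    have "\<omega> I \<in> HP ?n (d + q_weight ?q J - q_weight ?q {..<?n} + (q_weight ?q {..<?n} - q_weight ?q J))"
      unfolding \<omega>_def sm_def using hK by (intro HP_mult beta_HP J) (simp add: Kp_def)
    also have "d + q_weight ?q J - q_weight ?q {..<?n} + (q_weight ?q {..<?n} - q_weight ?q J) = d" using le q_weight_le[OF J, of ?q] by simp
    finally show ?thesis .
  qed
  have D: "mo.DD ?n J' \<omega> {} = (if J' = J then h else 0)" if "J' \<subseteq> {..<?n}" "card J' = card J" for J'
    unfolding \<omega>_def mo.DD_sm h' using DD_beta_empty[OF J that] by (cases "J' = J") (simp_all add: sm_def)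
  have "\<omega> \<in> Kf ?n k d (card J)" unfolding Kf_iff_DD[OF F H] using D h(1) by (auto simp: Kp_0)
  then show ?thesis using that[of \<omega>] D J by auto
qed

text \<open>
  Modulo the last variable, \<open>beta J\<close> is a combination of the \<open>beta (J - {i} \<union> {m})\<close>. Correcting
  \<open>h * beta J\<close> accordingly makes it divisible by the last variable, hence by \<open>Lam\<close>; the quotient is the required form.
\<close>

lemma Kf_lift_low:
  assumes k: "k = 0 \<or> 1 \<le> k \<and> k \<le> CARD('k) - 2"
    and J: "J \<subseteq> {..<m}" and h: "h \<in> Kp (Suc m) k (d + q_weight CARD('k) J)"
  obtains \<omega> where "\<omega> \<in> Kf (Suc m) k d (card J)" "mo.DD (Suc m) J \<omega> {} = h"
    "\<And>J'. J' \<subseteq> {..<m} \<Longrightarrow> card J' = card J \<Longrightarrow> J' \<noteq> J \<Longrightarrow> mo.DD (Suc m) J' \<omega> {} = 0"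
proof -
  let ?n = "Suc m" and ?q = "CARD('k)"
  let ?J = "\<lambda>i. insert m (J - {i})"
  have fJ: "finite J" using J finite_subset by blast
  have Jn: "J \<subseteq> {..<?n}" using J by auto
  have Ji: "?J i \<subseteq> {..<?n}" "card (?J i) = card J" if "i \<in> J" for i
    using J that fJ by (auto simp: card_gt_0_iff) (metis card_Suc_Diff1 card_insert_disjoint finite_Diff insertCI lessThan_iff less_irrefl subsetD DiffD1)
  have wti: "d + q_weight ?q J + (?q ^ m - ?q ^ i) = d + q_weight ?q (?J i)" if i: "i \<in> J" for i
  proof -
    have mJ: "m \<notin> J" using J by auto
    have "q_weight ?q (?J i) = ?q ^ m + q_weight ?q (J - {i})" using mJ fJ by (simp add: q_weight_def)
    moreover have "q_weight ?q J = ?q ^ i + q_weight ?q (J - {i})" using i fJ by (simp add: q_weight_def sum.remove)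
    moreover have "?q ^ i \<le> ?q ^ m" using i J by (intro power_increasing) auto
    ultimately show ?thesis by linarith
  qed
  obtain s where s: "\<And>i. i \<in> J \<Longrightarrow> s i \<in> {1,-1 :: 'k mpol}"
    and b: "\<And>I. VV m dvd mo.beta ?n J I - (\<Sum>i\<in>J. s i * - dickson_coeff m i * mo.beta ?n (?J i) I)"
    using mo.beta_last[OF refl J] by blast
  have "\<exists>h'. h' \<in> Kp ?n k (d + q_weight ?q (?J i)) \<and> X m dvd h' - dickson_coeff m i * h" if i: "i \<in> J" for i
    using Kp_dickson_coeff_lift[OF k h, of i] i J unfolding wti[OF i] by blast
  then have "\<exists>h'. \<forall>i\<in>J. h' i \<in> Kp ?n k (d + q_weight ?q (?J i)) \<and> X m dvd h' i - dickson_coeff m i * h"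
    by (intro bchoice ballI) blast
  then obtain h' where h': "\<And>i. i \<in> J \<Longrightarrow> h' i \<in> Kp ?n k (d + q_weight ?q (?J i))"
    "\<And>i. i \<in> J \<Longrightarrow> X m dvd h' i - dickson_coeff m i * h" by blast
  \<comment> \<open>The Moore coefficients are minus the Dickson coefficients, so with these signs
    the terms combine to s_i (h'_i - dickson_coeff * h) modulo X_m, and these are divisible by X_m
    by the choice of h'.\<close>
  define \<Omega> where "\<Omega> = sm h (mo.beta ?n J) + (\<lambda>I. \<Sum>i\<in>J. sm (s i * h' i) (mo.beta ?n (?J i)) I)"
  have xO: "X m dvd \<Omega> I" for I
  proof -
    have "\<Omega> I = h * (mo.beta ?n J I - (\<Sum>i\<in>J. s i * - dickson_coeff m i * mo.beta ?n (?J i) I))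
      + (\<Sum>i\<in>J. s i * (h' i - dickson_coeff m i * h) * mo.beta ?n (?J i) I)"
      by (simp add: \<Omega>_def sm_def algebra_simps sum_distrib_left sum.distrib sum_subtractf sum_negf)
    moreover have "X m dvd mo.beta ?n J I - (\<Sum>i\<in>J. s i * - dickson_coeff m i * mo.beta ?n (?J i) I)"
      by (rule dvd_trans[OF X_dvd_VV b])
    moreover have "X m dvd (\<Sum>i\<in>J. s i * (h' i - dickson_coeff m i * h) * mo.beta ?n (?J i) I)"
      using h'(2) by (intro dvd_sum dvd_mult2 dvd_mult)
    ultimately show ?thesis by (simp only: dvd_add dvd_mult)
  qed
  define D where "D J' = (if J' = J then h else 0) + (\<Sum>i\<in>J. if J' = ?J i then s i * h' i else 0)" for J'
  have DO: "mo.DD ?n J' \<Omega> {} = Lam ?n * D J'" if J': "J' \<subseteq> {..<?n}" "card J' = card J" for J'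
  proof -
    have 1: "mo.DD ?n J' (sm h (mo.beta ?n J)) {} = Lam ?n * (if J' = J then h else 0)"
      unfolding mo.DD_sm using DD_beta_empty[OF Jn J'] by (auto simp: sm_def)
    have 2: "mo.DD ?n J' (sm (s i * h' i) (mo.beta ?n (?J i))) {} = Lam ?n * (if J' = ?J i then s i * h' i else 0)" if i: "i \<in> J" for i
      unfolding mo.DD_sm using DD_beta_empty[OF Ji(1)[OF i] J'(1)] J'(2) Ji(2)[OF i] by (auto simp: sm_def)
    have "mo.DD ?n J' \<Omega> {} = mo.DD ?n J' (sm h (mo.beta ?n J)) {} + mo.DD ?n J' (\<lambda>I. \<Sum>i\<in>J. sm (s i * h' i) (mo.beta ?n (?J i)) I) {}"
      unfolding \<Omega>_def mo.DD_def foldr_ann_add by simp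
    then show ?thesis unfolding mo.DD_sum 1 D_def using 2 by (simp add: sum_distrib_left distrib_left)
  qed
  have DK: "D J' \<in> Kp ?n k (d + q_weight ?q J')" for J'
    unfolding D_def using h h'(1) s by (intro Kp_add Kp_sum) (auto simp: Kp_0 Kp_unit_mult)
  have OF: "\<Omega> \<in> Fsup ?n (card J)"
    unfolding \<Omega>_def using mo.beta_Fsup[OF Ji(1)] Ji(2) by (intro Fsup_add Fsup_sum Fsup_sm mo.beta_Fsup Jn) auto
  have OH: "\<Omega> I \<in> HP ?n (d + q_weight ?q {..<?n})" for I
  proof -
    have t: "f * mo.beta ?n J' I \<in> HP ?n (d + q_weight ?q {..<?n})" if f: "f \<in> HP ?n (d + q_weight ?q J')" and J': "J' \<subseteq> {..<?n}" for f J'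
    proof -
      have "f * mo.beta ?n J' I \<in> HP ?n (d + q_weight ?q J' + (q_weight ?q {..<?n} - q_weight ?q J'))" by (intro HP_mult f beta_HP J')
      then show ?thesis using q_weight_le[OF J', of ?q] by simp
    qed
    have "s i * h' i * mo.beta ?n (?J i) I \<in> HP ?n (d + q_weight ?q {..<?n})" if i: "i \<in> J" for i
      using Kp_unit_mult[OF s[OF i] h'(1)[OF i]] by (intro t Ji(1) i) (simp add: Kp_def)
    moreover have "h * mo.beta ?n J I \<in> HP ?n (d + q_weight ?q {..<?n})" using h by (intro t Jn) (simp add: Kp_def)
    ultimately show ?thesis by (simp add: \<Omega>_def sm_def HP_add HP_sum)
  qed
  \<comment> \<open>Multiplication by \<open>Lam\<close> lowers the twist by one. Twists matter only
    modulo q - 1, so k - 1 is written as k + (q - 2) to stay in the natural numbers.\<close>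
  have q: "Suc (k + (?q - 2)) = k + (?q - 1)" using card_field_gt_1[where 'k='k] by simp
  have "\<Omega> \<in> Kf ?n (k + (?q - 2)) (d + q_weight ?q {..<?n}) (card J)"
    unfolding Kf_iff_DD[OF OF OH]
  proof (intro allI impI)
    fix J' assume J': "J' \<subseteq> {..<?n} \<and> card J' = card J"
    have "Lam ?n * D J' \<in> Kp ?n (k + (?q - 2)) (d + q_weight ?q J' + (\<Sum>i<?n. ?q ^ i))"
      using DK by (intro Kp_Lam_mult) (simp only: q Kp_periodic)
    then show "mo.DD ?n J' \<Omega> {} \<in> Kp ?n (k + (?q - 2)) (d + q_weight ?q {..<?n} + q_weight ?q J')"
      using J' by (simp add: DO q_weight_def add_ac)
  qed
  then have "Lam ?n dvd \<Omega> I" for I using xO by (intro Kf_Lam_dvd) auto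
  then have "\<exists>\<omega>. \<forall>I. \<Omega> I = Lam ?n * \<omega> I" unfolding dvd_def by (intro choice allI)
  then obtain \<omega> where w: "\<And>I. \<Omega> I = Lam ?n * \<omega> I" by blast
  have wO: "\<Omega> = sm (Lam ?n) \<omega>" by (simp add: sm_def w fun_eq_iff)
  have wF: "\<omega> \<in> Fsup ?n (card J)" using OF by (auto simp: Fsup_def w Lam_nonzero)
  have wH: "\<omega> I \<in> HP ?n d" for I
  proof (cases "\<omega> I = 0")
    case False
    have "Lam ?n * \<omega> I \<in> HP ?n (d + (\<Sum>i<?n. ?q ^ i))" using OH[of I] by (simp add: w q_weight_def)
    from HP_cancel(2)[OF Lam_HP Lam_nonzero this False] show ?thesis by simp
  qed (simp add: HP_0)
  have wD: "mo.DD ?n J' \<omega> {} = D J'" if J': "J' \<subseteq> {..<?n}" "card J' = card J" for J'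
  proof -
    have "Lam ?n * mo.DD ?n J' \<omega> {} = Lam ?n * D J'"
      using DO[OF J'] unfolding wO mo.DD_sm by (simp only: sm_def)
    then show ?thesis using Lam_nonzero mult_left_cancel by blast
  qed
  have "\<omega> \<in> Kf ?n k d (card J)" unfolding Kf_iff_DD[OF wF wH] using wD DK by auto
  moreover have "D J' = (if J' = J then h else 0)" if "J' \<subseteq> {..<m}" for J'
    using that unfolding D_def by (subst sum.neutral) auto
  moreover have "J' \<subseteq> {..<?n}" if "J' \<subseteq> {..<m}" for J' using that by auto
  ultimately show thesis using that[of \<omega>] wD J by auto
qed

definition Kp_dvd :: "nat \<Rightarrow> nat \<Rightarrow> nat \<Rightarrow> nat set \<Rightarrow> 'k mpol set" where
  "Kp_dvd m k d J = {h \<in> Kp (Suc m) k (d + q_weight CARD('k) J). m \<in> J \<longrightarrow> X m dvd h}"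

text \<open>Sums of lifts of the components parametrise the forms. The contractions at sets avoiding
  m return the components exactly; at sets containing m they return them up to a remainder that
  depends only on the components at sets avoiding m. The system is therefore block triangular and
  can be solved.\<close>

lemma card_Kf:
  assumes k: "k = 0 \<or> 1 \<le> k \<and> k \<le> CARD('k) - 2"
  shows "card (Kf (Suc m) k d j) = (\<Prod>J | J \<subseteq> {..<Suc m} \<and> card J = j. card (Kp_dvd m k d J))"
proof -
  let ?n = "Suc m" and ?q = "CARD('k)"
  let ?S = "{J. J \<subseteq> {..<Suc m} \<and> card J = j}"
  let ?D = "\<lambda>J \<omega>. mo.DD (Suc m) J \<omega> {}"
  have fS: "finite ?S" by (rule finite_subset[of _ "Pow {..<Suc m}"]) auto
  have ex: "\<exists>\<omega>. \<omega> \<in> Kf ?n k d j \<and> ?D J \<omega> = h \<and> (\<forall>J'\<in>?S. J' \<noteq> J \<and> (m \<notin> J' \<or> m \<in> J) \<longrightarrow> ?D J' \<omega> = 0)"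
    if J: "J \<in> ?S" and h: "h \<in> Kp_dvd m k d J" for J h
  proof (cases "m \<in> J")
    case True
    then show ?thesis using Kf_lift_high[of J m h k d] J h by (auto simp: Kp_dvd_def) metis
  next
    case False
    then have Jm: "J \<subseteq> {..<m}" using J by (auto simp: less_Suc_eq)
    have "J' \<subseteq> {..<m}" if "J' \<in> ?S" "m \<notin> J'" for J' using that by (auto simp: less_Suc_eq)
    moreover obtain \<omega> where "\<omega> \<in> Kf ?n k d (card J)" "?D J \<omega> = h"
      "\<And>J'. J' \<subseteq> {..<m} \<Longrightarrow> card J' = card J \<Longrightarrow> J' \<noteq> J \<Longrightarrow> ?D J' \<omega> = 0"
      using Kf_lift_low[OF k Jm, of h d] h by (auto simp: Kp_dvd_def)
    ultimately show ?thesis using False J by (intro exI[of _ \<omega>]) auto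
  qed
  \<comment> \<open>Preimages are merely chosen, not additive in h. The uncontrolled contractions
    are those with m in J' but not in J.\<close>
  define \<sigma> where "\<sigma> J h = (SOME \<omega>. \<omega> \<in> Kf ?n k d j \<and> ?D J \<omega> = h \<and> (\<forall>J'\<in>?S. J' \<noteq> J \<and> (m \<notin> J' \<or> m \<in> J) \<longrightarrow> ?D J' \<omega> = 0))" for J h
  have P: "\<sigma> J h \<in> Kf ?n k d j \<and> ?D J (\<sigma> J h) = h \<and> (\<forall>J'\<in>?S. J' \<noteq> J \<and> (m \<notin> J' \<or> m \<in> J) \<longrightarrow> ?D J' (\<sigma> J h) = 0)"
    if "J \<in> ?S" "h \<in> Kp_dvd m k d J" for J h
    unfolding \<sigma>_def by (rule someI_ex[OF ex[OF that]])
  have \<sigma>: "\<And>J h. J \<in> ?S \<Longrightarrow> h \<in> Kp_dvd m k d J \<Longrightarrow> \<sigma> J h \<in> Kf ?n k d j"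
    "\<And>J h. J \<in> ?S \<Longrightarrow> h \<in> Kp_dvd m k d J \<Longrightarrow> ?D J (\<sigma> J h) = h"
    "\<And>J h J'. J \<in> ?S \<Longrightarrow> h \<in> Kp_dvd m k d J \<Longrightarrow> J' \<in> ?S \<Longrightarrow> J' \<noteq> J \<Longrightarrow> m \<notin> J' \<or> m \<in> J \<Longrightarrow> ?D J' (\<sigma> J h) = 0"
    using P by blast+
  let ?T = "PiE ?S (Kp_dvd m k d)"
  define F where "F t = (\<lambda>I. \<Sum>J\<in>?S. \<sigma> J (t J) I)" for t
  \<comment> \<open>The remainder at sets containing m, caused by the lifts at sets avoiding
    m.\<close>
  define R where "R t J' = (\<Sum>J\<in>{J\<in>?S. m \<notin> J}. ?D J' (\<sigma> J (t J)))" for t J'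
  have tQ: "t J \<in> Kp_dvd m k d J" if "t \<in> ?T" "J \<in> ?S" for t J using that by (rule PiE_mem)
  have FK: "F t \<in> Kf ?n k d j" if "t \<in> ?T" for t unfolding F_def by (intro Kf_sum \<sigma>(1) tQ that)
  have D1: "?D J' (F t) = t J'" if t: "t \<in> ?T" and J': "J' \<in> ?S" "m \<notin> J'" for t J'
  proof -
    have "?D J' (F t) = (\<Sum>J\<in>?S. if J = J' then t J' else 0)"
      unfolding F_def mo.DD_sum
    proof (rule sum.cong[OF refl])
      fix J assume J: "J \<in> ?S"
      show "?D J' (\<sigma> J (t J)) = (if J = J' then t J' else 0)"
        using \<sigma>(2)[OF J tQ[OF t J]] \<sigma>(3)[OF J tQ[OF t J] J'(1)] J'(2) by (cases "J = J'") simp_all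
    qed
    then show ?thesis using J'(1) fS by simp
  qed
  have D2: "?D J' (F t) = t J' + R t J'" if t: "t \<in> ?T" and J': "J' \<in> ?S" "m \<in> J'" for t J'
  proof -
    have "?D J' (F t) = (\<Sum>J\<in>?S. if J = J' then t J' else if m \<notin> J then ?D J' (\<sigma> J (t J)) else 0)"
      unfolding F_def mo.DD_sum
    proof (rule sum.cong[OF refl])
      fix J assume J: "J \<in> ?S"
      show "?D J' (\<sigma> J (t J)) = (if J = J' then t J' else if m \<notin> J then ?D J' (\<sigma> J (t J)) else 0)"
        using \<sigma>(2)[OF J tQ[OF t J]] \<sigma>(3)[OF J tQ[OF t J] J'(1)] by auto
    qed
    also have "\<dots> = (\<Sum>J\<in>?S. if J = J' then t J' else 0) + (\<Sum>J\<in>?S. if m \<notin> J then ?D J' (\<sigma> J (t J)) else 0)"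
      unfolding sum.distrib[symmetric] using J' by (intro sum.cong) auto
    also have "(\<Sum>J\<in>?S. if m \<notin> J then ?D J' (\<sigma> J (t J)) else 0) = R t J'"
      unfolding R_def using sum.inter_filter[OF fS, of "\<lambda>J. ?D J' (\<sigma> J (t J))" "\<lambda>J. m \<notin> J"] by simp
    finally show ?thesis using J'(1) fS by simp
  qed
  have "inj_on F ?T"
  proof (rule inj_onI)
    fix t u assume t: "t \<in> ?T" and u: "u \<in> ?T" and e: "F t = F u"
    have low: "t J = u J" if "J \<in> ?S" "m \<notin> J" for J
      using D1[OF t that] D1[OF u that] by (simp only: e)
    have R: "R t J = R u J" for J unfolding R_def by (rule sum.cong[OF refl]) (simp add: low)
    have "t J = u J" if "J \<in> ?S" for J
    proof (cases "m \<in> J")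
      case True
      then show ?thesis using D2[OF t that True] D2[OF u that True] by (simp add: e R)
    qed (use low that in blast)
    then show "t = u" using t u by (intro PiE_ext) auto
  qed
  moreover have "F ` ?T = Kf ?n k d j"
  proof (intro equalityI subsetI)
    fix \<omega> assume w: "\<omega> \<in> Kf ?n k d j"
    have DK: "?D J \<omega> \<in> Kp ?n k (d + q_weight ?q J)" if "J \<in> ?S" for J using KfD(3)[OF w] that by blast
    \<comment> \<open>A first approximation matches the contractions at sets avoiding m. They vanish
      on the difference \<open>\<eta>\<close>, so by \<open>DD_last_dvd\<close> its other
      contractions are multiples of X_m and can serve as components.\<close>
    define t1 where "t1 = (\<lambda>J\<in>?S. if m \<in> J then 0 else ?D J \<omega>)"
    have t1: "t1 \<in> ?T" using DK by (auto simp: t1_def Kp_dvd_def Kp_0)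
    define \<eta> where "\<eta> = \<omega> - F t1"
    have \<eta>D: "?D J \<eta> = ?D J \<omega> - ?D J (F t1)" for J unfolding \<eta>_def mo.DD_diff by simp
    have \<eta>0: "?D J \<eta> = 0" if "J \<in> ?S" "m \<notin> J" for J
      unfolding \<eta>D D1[OF t1 that] using that by (simp add: t1_def)
    have \<eta>X: "X m dvd ?D J \<eta>" if J: "J \<in> ?S" "m \<in> J" for J
    proof -
      have fJ: "finite J" using J finite_subset[of J "{..<?n}"] by auto
      have "VV m dvd ?D (insert m (J - {m})) \<eta>"
      proof (rule mo.DD_last_dvd[OF refl])
        show "J - {m} \<subseteq> {..<m}" using J by (auto simp: less_Suc_eq)
        fix J' assume "J' \<subseteq> {..<m}" "card J' = Suc (card (J - {m}))"
        then have "J' \<in> ?S" "m \<notin> J'" using J fJ card_Suc_Diff1[OF fJ J(2)] by auto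
        then show "?D J' \<eta> = 0" by (rule \<eta>0)
      qed
      then show ?thesis using J(2) dvd_trans[OF X_dvd_VV] by (simp add: insert_absorb)
    qed
    define t where "t = (\<lambda>J\<in>?S. if m \<in> J then ?D J \<eta> else ?D J \<omega>)"
    have "?D J \<eta> \<in> Kp ?n k (d + q_weight ?q J)" if "J \<in> ?S" for J
      unfolding \<eta>D using KfD(3)[OF w] KfD(3)[OF FK[OF t1]] that by (intro Kp_diff) auto
    then have t: "t \<in> ?T" using DK \<eta>X by (auto simp: t_def Kp_dvd_def)
    have R: "R t J = R t1 J" for J unfolding R_def by (rule sum.cong[OF refl]) (simp add: t_def t1_def)
    have "\<omega> = F t"
    proof (rule mo.DD_eqI[OF KfD(1)[OF w] KfD(1)[OF FK[OF t]]])
      fix J assume "J \<subseteq> {..<?n}" "card J = j"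
      then have J: "J \<in> ?S" by simp
      show "?D J \<omega> = ?D J (F t)"
      proof (cases "m \<in> J")
        case True
        have "?D J (F t1) = R t1 J" using D2[OF t1 J True] J True by (simp add: t1_def)
        then show ?thesis using D2[OF t J True] J True \<eta>D[of J] R[of J] by (simp add: t_def)
      next
        case False
        then show ?thesis using D1[OF t J False] J by (simp add: t_def)
      qed
    qed
    then show "\<omega> \<in> F ` ?T" using t by blast
  qed (use FK in auto)
  ultimately have "bij_betw F ?T (Kf ?n k d j)" by (rule bij_betw_imageI)
  then have "card (Kf ?n k d j) = card ?T" by (rule bij_betw_same_card[symmetric])
  also have "\<dots> = (\<Prod>J\<in>?S. card (Kp_dvd m k d J))" by (rule card_PiE[OF fS])
  finally show ?thesis .
qed

end

lemma finite_monomials: "finite (monomials n d)"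
proof (rule inj_on_finite)
  show "inj_on (\<lambda>m. restrict (Poly_Mapping.lookup m) {..<n}) (monomials n d)"
  proof (rule inj_onI)
    fix x y assume x: "x \<in> monomials n d" and y: "y \<in> monomials n d"
      and e: "restrict (Poly_Mapping.lookup x) {..<n} = restrict (Poly_Mapping.lookup y) {..<n}"
    show "x = y"
    proof (rule poly_mapping_eqI)
      fix i show "Poly_Mapping.lookup x i = Poly_Mapping.lookup y i"
      proof (cases "i < n")
        case False
        then have "i \<notin> Poly_Mapping.keys x" "i \<notin> Poly_Mapping.keys y" using x y by (auto simp: monomials_def)
        then show ?thesis by (simp add: in_keys_iff)
      qed (use fun_cong[OF e, of i] in simp)
    qed
  qed
  show "(\<lambda>m. restrict (Poly_Mapping.lookup m) {..<n}) ` monomials n d \<subseteq> PiE {..<n} (\<lambda>_. {..d})"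
  proof
    fix f assume "f \<in> (\<lambda>m. restrict (Poly_Mapping.lookup m) {..<n}) ` monomials n d"
    then obtain m where m: "m \<in> monomials n d" and f: "f = restrict (Poly_Mapping.lookup m) {..<n}" by auto
    have "Poly_Mapping.lookup m i \<le> mdeg m" for i
      unfolding mdeg_def by (cases "i \<in> Poly_Mapping.keys m") (auto intro: member_le_sum simp: in_keys_iff)
    then show "f \<in> PiE {..<n} (\<lambda>_. {..d})" using m unfolding f by (auto simp: monomials_def)
  qed
  show "finite (PiE {..<n} (\<lambda>_. {..d}))" by (intro finite_PiE) auto
qed

lemma finite_HP: "finite (HP n d :: 'k::{field,finite} mpol set)"
  unfolding HP_basis_space by (rule finite_basis_space[OF finite_monomials])

text \<open>Each nonempty fibre is a translate of the kernel.\<close>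

lemma card_additive:
  fixes f :: "'a::ab_group_add \<Rightarrow> 'b::ab_group_add"
  assumes fin: "finite A" and add: "\<And>x y. x \<in> A \<Longrightarrow> y \<in> A \<Longrightarrow> x + y \<in> A \<and> f (x + y) = f x + f y"
    and neg: "\<And>x. x \<in> A \<Longrightarrow> - x \<in> A \<and> f (- x) = - f x"
  shows "card A = card {x \<in> A. f x = 0} * card (f ` A)"
proof -
  have fib: "card {x \<in> A. f x = y} = card {x \<in> A. f x = 0}" if y: "y \<in> f ` A" for y
  proof -
    obtain a where a: "a \<in> A" "y = f a" using y by auto
    have "bij_betw (\<lambda>x. x + a) {x \<in> A. f x = 0} {x \<in> A. f x = y}"
    proof (rule bij_betw_byWitness[where f' = "\<lambda>x. x + - a"])
      show "(\<lambda>x. x + a) ` {x \<in> A. f x = 0} \<subseteq> {x \<in> A. f x = y}" using add a by auto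
      have "x + - a \<in> A \<and> f (x + - a) = f x + f (- a)" if "x \<in> A" for x using add that neg[OF a(1)] by blast
      then show "(\<lambda>x. x + - a) ` {x \<in> A. f x = y} \<subseteq> {x \<in> A. f x = 0}" using neg[OF a(1)] a(2) by auto
    qed auto
    then show ?thesis by (rule bij_betw_same_card[symmetric])
  qed
  have "card A = (\<Sum>x\<in>A. 1)" by simp
  also have "\<dots> = (\<Sum>y\<in>f ` A. \<Sum>x\<in>{x \<in> A. f x = y}. 1)" by (rule sum.image_gen[OF fin])
  also have "\<dots> = (\<Sum>y\<in>f ` A. card {x \<in> A. f x = 0})" by (intro sum.cong refl) (simp add: fib)
  finally show ?thesis by (simp add: mult.commute)
qed

context prime_power_field
begin

section \<open>Hilbert series\<close>

definition dim_Kp :: "nat \<Rightarrow> nat \<Rightarrow> nat \<Rightarrow> nat" where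
  "dim_Kp n k d = pm.dim (Kp n k d)"

lemma finite_Kp: "finite (Kp n k d)"
  by (rule finite_subset[OF _ finite_HP[of n d]]) (auto simp: Kp_def)

lemma card_Kp: "card (Kp n k d) = CARD('k) ^ dim_Kp n k d"
  unfolding dim_Kp_def
proof (rule pm.card_subspace[OF _ finite_Kp])
  show "pm.subspace (Kp n k d)"
    unfolding pm.subspace_def by (auto simp: Kp_0 Kp_add Kp_C_mult pm_scale_C)
qed auto

lemma card_power_inject: "CARD('k) ^ a = CARD('k) ^ b \<longleftrightarrow> a = b"
  using card_field_gt_1[where 'k='k] by (simp add: power_inject_exp)

definition deg_Lam :: "nat \<Rightarrow> nat" where
  "deg_Lam n = q_weight CARD('k) {..<n}"

lemma deg_Lam_mult: "(CARD('k) - 1) * deg_Lam n = CARD('k) ^ n - 1"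
proof (induction n)
  case (Suc n)
  have "CARD('k) ^ n \<ge> 1" using card_field_gt_1[where 'k='k] by simp
  then show ?case using Suc card_field_gt_1[where 'k='k]
    by (simp add: deg_Lam_def q_weight_def distrib_left diff_mult_distrib)
qed (simp add: deg_Lam_def q_weight_def)

lemma card_Kp_X_dvd:
  "card {f \<in> Kp (Suc m) k d. X m dvd f} = CARD('k) ^ (if deg_Lam (Suc m) \<le> d then dim_Kp (Suc m) (Suc k) (d - deg_Lam (Suc m)) else 0)"
proof -
  have inj: "card ((\<lambda>g. Lam (Suc m) * g :: 'k mpol) ` S) = card S" for S
    using Lam_nonzero by (intro card_image) (simp add: inj_on_def)
  then show ?thesis using Kp_X_dvd_image[of "Suc m" k d]
    by (auto simp: deg_Lam_def q_weight_def inj card_Kp)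
qed

lemma dim_Kp_periodic: "dim_Kp n (k + (CARD('k) - 1)) d = dim_Kp n k d"
  by (simp only: dim_Kp_def Kp_periodic)

lemma dim_Kp_torus:
  assumes "1 \<le> k" "k \<le> CARD('k) - 2"
  shows "dim_Kp (Suc m) k d = (if deg_Lam (Suc m) \<le> d then dim_Kp (Suc m) (Suc k) (d - deg_Lam (Suc m)) else 0)"
proof -
  have "{f \<in> Kp (Suc m) k d. X m dvd f} = Kp (Suc m) k d" using Kp_torus_dvd[OF assms] by auto
  then have "CARD('k) ^ dim_Kp (Suc m) k d = card {f \<in> Kp (Suc m) k d. X m dvd f}" by (simp add: card_Kp)
  then show ?thesis by (simp only: card_Kp_X_dvd card_power_inject)
qed

lemma P_0_eq: "P 0 = range (C :: 'k \<Rightarrow> 'k mpol)"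
proof (intro equalityI subsetI)
  fix f :: "'k mpol" assume f: "f \<in> P 0"
  have "f = C (Poly_Mapping.lookup f 0)"
  proof (rule poly_mapping_eqI)
    fix m show "Poly_Mapping.lookup f m = Poly_Mapping.lookup (C (Poly_Mapping.lookup f 0)) m"
    proof (cases "m = 0")
      case False
      then have "m \<notin> Poly_Mapping.keys f" using f by (auto simp: P_def basis_space_def)
      then show ?thesis using False by (simp add: C_def lookup_single in_keys_iff)
    qed (simp add: C_def)
  qed
  then show "f \<in> range C" by blast
qed (auto simp: P_C)

lemma Kp_zero: "Kp 0 k d = HP 0 d"
proof (intro equalityI subsetI)
  fix f :: "'k mpol" assume f: "f \<in> HP 0 d"
  then have "f \<in> P 0" by (simp add: HP_def)
  then obtain c where c: "f = C c" unfolding P_0_eq by blast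
  have "det b = 1" if "b \<in> Borel 0" for b :: "'k mat" using det_Borel[OF that] by simp
  then show "f \<in> Kp 0 k d" using f by (simp add: Kp_def c sym_act_C C_1)
qed (simp add: Kp_def)

lemma dim_Kp_zero: "dim_Kp 0 k d = of_bool (d = 0)"
proof -
  have "card (HP 0 d :: 'k mpol set) = CARD('k) ^ of_bool (d = 0)"
  proof (cases "d = 0")
    case True
    have "HP 0 0 = range (C :: 'k \<Rightarrow> 'k mpol)" using HP_C_mult[OF HP_1] P_0_eq by (auto simp: HP_def)
    moreover have "inj (C :: 'k \<Rightarrow> 'k mpol)" by (simp add: inj_def C_eq_iff)
    ultimately show ?thesis using True by (simp add: card_image)
  next
    case False
    have "f = 0" if "f \<in> HP 0 d" for f :: "'k mpol"
    proof (rule ccontr)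
      assume nz: "f \<noteq> 0"
      have "f \<in> P 0" using that by (simp add: HP_def)
      then obtain c where c: "f = C c" unfolding P_0_eq by blast
      have "f * 1 \<in> HP 0 0" using HP_C_mult[OF HP_1, of c] by (simp add: c)
      from HP_cancel(1)[OF that nz this] show False using False by simp
    qed
    then have "HP 0 d = {0 :: 'k mpol}" using HP_0 by auto
    then show ?thesis using False by simp
  qed
  then show ?thesis using card_Kp[of 0 k d] by (simp add: Kp_zero card_power_inject del: of_bool_eq)
qed

text \<open>Kernel and image of setting X_m to 0. The kernel consists of the multiples of X_m; by
  \<open>Kp_restrict\<close> and \<open>Kp_lift\<close> the image consists of the multiples of
  X_(m-1) in m variables. Dividing by the respective \<open>Lam\<close> raises the twist to
  1.\<close>

lemma dim_Kp_recursion: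
  "dim_Kp (Suc m) 0 d = (if deg_Lam (Suc m) \<le> d then dim_Kp (Suc m) 1 (d - deg_Lam (Suc m)) else 0)
    + (if deg_Lam m \<le> d then dim_Kp m 1 (d - deg_Lam m) else 0)"
proof -
  let ?q = "CARD('k)"
  have "card (Kp (Suc m) 0 d) = card {f \<in> Kp (Suc m) 0 d. kill m 0 f = 0} * card (kill m 0 ` Kp (Suc m) 0 d)"
    by (rule card_additive[OF finite_Kp]) (auto simp: Kp_add Kp_neg rhom_add[OF rhom_kill] rhom_neg[OF rhom_kill])
  also have "{f \<in> Kp (Suc m) 0 d. kill m 0 f = 0} = {f \<in> Kp (Suc m) 0 d. X m dvd f}"
    using line_dvd_iff[OF P_0[where 'a='k], of m] by simp
  also have "card \<dots> = ?q ^ (if deg_Lam (Suc m) \<le> d then dim_Kp (Suc m) 1 (d - deg_Lam (Suc m)) else 0)"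
    by (simp only: card_Kp_X_dvd One_nat_def)
  also have "kill m 0 ` Kp (Suc m) 0 d = {w \<in> Kp m 0 d. 0 < m \<longrightarrow> X (m - 1) dvd w}"
  proof (intro equalityI subsetI)
    fix w assume w: "w \<in> {w \<in> Kp m 0 d. 0 < m \<longrightarrow> X (m - 1) dvd w}"
    then obtain v where "v \<in> Kp (Suc m) 0 d" "kill m 0 v = w" using Kp_lift[of w m d] by blast
    then show "w \<in> kill m 0 ` Kp (Suc m) 0 d" by blast
  qed (use Kp_restrict in blast)
  also have "card \<dots> = ?q ^ (if deg_Lam m \<le> d then dim_Kp m 1 (d - deg_Lam m) else 0)"
  proof (cases m)
    \<comment> \<open>Without variables the divisibility condition is empty; the twist has no effect
      and \<open>deg_Lam 0\<close> is 0.\<close>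
    case 0
    then show ?thesis by (simp add: card_Kp dim_Kp_zero deg_Lam_def q_weight_def)
  next
    case (Suc l)
    then show ?thesis using card_Kp_X_dvd[of l 0 d] by simp
  qed
  finally show ?thesis by (simp only: card_Kp power_add[symmetric] card_power_inject)
qed

definition series_Kp :: "nat \<Rightarrow> nat \<Rightarrow> rat fps" where
  "series_Kp n k = Abs_fps (\<lambda>d. of_nat (dim_Kp n k d))"

lemma series_Kp_torus:
  assumes "1 \<le> k" "k \<le> CARD('k) - 2"
  shows "series_Kp (Suc m) k = fps_X ^ deg_Lam (Suc m) * series_Kp (Suc m) (Suc k)"
  by (rule fps_ext) (auto simp: series_Kp_def fps_X_power_mult_nth dim_Kp_torus[OF assms])

text \<open>Each division by \<open>Lam\<close> raises the twist by one; after q - 1 - k divisions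
  it reaches q - 1, which is the trivial twist. Including k = q - 1 makes twist 1 available for q =
  2 as well.\<close>

lemma series_Kp_twist:
  assumes k: "1 \<le> k" "k \<le> CARD('k) - 1"
  shows "series_Kp (Suc m) k = fps_X ^ ((CARD('k) - 1 - k) * deg_Lam (Suc m)) * series_Kp (Suc m) 0"
  using k
proof (induction "CARD('k) - 1 - k" arbitrary: k)
  case 0
  then have "k = 0 + (CARD('k) - 1)" by simp
  then have "series_Kp (Suc m) k = series_Kp (Suc m) 0" unfolding series_Kp_def by (simp only: dim_Kp_periodic)
  then show ?case using 0 by simp
next
  case (Suc e)
  have "series_Kp (Suc m) k = fps_X ^ deg_Lam (Suc m) * series_Kp (Suc m) (Suc k)" using Suc by (intro series_Kp_torus) auto
  also have "series_Kp (Suc m) (Suc k) = fps_X ^ ((CARD('k) - 1 - Suc k) * deg_Lam (Suc m)) * series_Kp (Suc m) 0" using Suc by (intro Suc(1)) auto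
  finally have "series_Kp (Suc m) k = fps_X ^ (deg_Lam (Suc m) + (CARD('k) - 1 - Suc k) * deg_Lam (Suc m)) * series_Kp (Suc m) 0"
    by (simp add: power_add mult.assoc)
  moreover have "CARD('k) - 1 - k = Suc (CARD('k) - 1 - Suc k)" using Suc by simp
  ultimately show ?case by simp
qed

text \<open>For n >= 1 the left side counts multiples of the last variable in the untwisted space.
  They are Lam^(q-1) times that space, and Lam^(q-1) has degree q^n - 1.\<close>

lemma series_Kp_one: "fps_X ^ deg_Lam n * series_Kp n 1 = fps_X ^ (CARD('k) ^ n - 1) * series_Kp n 0"
proof (cases n)
  case 0
  then show ?thesis by (simp add: series_Kp_def dim_Kp_zero deg_Lam_def q_weight_def)
next
  case (Suc m)
  have "series_Kp n 1 = fps_X ^ ((CARD('k) - 1 - 1) * deg_Lam n) * series_Kp n 0"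
    unfolding Suc using card_field_gt_1[where 'k='k] by (intro series_Kp_twist) auto
  moreover have "deg_Lam n + (CARD('k) - 1 - 1) * deg_Lam n = (CARD('k) - 1) * deg_Lam n"
    using card_field_gt_1[where 'k='k] by (cases "CARD('k) - 1") auto
  ultimately show ?thesis by (simp only: deg_Lam_mult power_add[symmetric] mult.assoc[symmetric])
qed

lemma series_Kp_recursion:
  "(1 - fps_X ^ (CARD('k) ^ Suc m - 1)) * series_Kp (Suc m) 0 = fps_X ^ (CARD('k) ^ m - 1) * series_Kp m 0"
proof -
  have "series_Kp (Suc m) 0 = fps_X ^ deg_Lam (Suc m) * series_Kp (Suc m) 1 + fps_X ^ deg_Lam m * series_Kp m 1"
    by (rule fps_ext) (auto simp: series_Kp_def fps_X_power_mult_nth dim_Kp_recursion simp del: One_nat_def)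
  then show ?thesis unfolding series_Kp_one by (simp add: algebra_simps)
qed

lemma series_Kp_formula:
  "(\<Prod>i=1..n. 1 - fps_X ^ (CARD('k) ^ i - 1)) * series_Kp n 0 = fps_X ^ (\<Sum>i<n. CARD('k) ^ i - 1)"
proof (induction n)
  case 0
  then show ?case by (simp add: series_Kp_def dim_Kp_zero fps_eq_iff)
next
  case (Suc m)
  have "(\<Prod>i=1..Suc m. 1 - fps_X ^ (CARD('k) ^ i - 1)) * series_Kp (Suc m) 0
    = (\<Prod>i=1..m. 1 - fps_X ^ (CARD('k) ^ i - 1)) * ((1 - fps_X ^ (CARD('k) ^ Suc m - 1)) * series_Kp (Suc m) 0)"
    by (simp add: mult_ac)
  also have "\<dots> = fps_X ^ (CARD('k) ^ m - 1) * ((\<Prod>i=1..m. 1 - fps_X ^ (CARD('k) ^ i - 1)) * series_Kp m 0)"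
    unfolding series_Kp_recursion by (rule mult.left_commute)
  finally show ?case unfolding Suc power_add[symmetric] sum.lessThan_Suc by (simp only: add.commute)
qed

text \<open>The denominator has constant term 1, so the series starts at the exponent of its
  monomial numerator.\<close>

lemma dim_Kp_low:
  assumes d: "d < (\<Sum>i<n. CARD('k) ^ i - 1)" shows "dim_Kp n 0 d = 0"
proof -
  let ?p = "(\<Prod>i=1..n. 1 - fps_X ^ (CARD('k) ^ i - 1)) :: rat fps"
  have p0: "fps_nth (prod f S) 0 = (\<Prod>i\<in>S. fps_nth (f i) 0)" for f :: "nat \<Rightarrow> rat fps" and S
    by (induction S rule: infinite_finite_induct) auto
  have "\<not> CARD('k) ^ i \<le> Suc 0" if "Suc 0 \<le> i" for i
    using card_field_gt_1[where 'k='k] one_less_power[of "CARD('k)" i] that by simp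
  then have "fps_nth ?p 0 = 1"
    by (auto simp: p0 intro!: prod.neutral)
  then have "inverse ?p * ?p = 1" by (intro inverse_mult_eq_1) simp
  then have "series_Kp n 0 = inverse ?p * (?p * series_Kp n 0)" by (simp add: mult.assoc[symmetric])
  then have "series_Kp n 0 = fps_X ^ (\<Sum>i<n. CARD('k) ^ i - 1) * inverse ?p" unfolding series_Kp_formula by (simp only: mult.commute)
  from arg_cong[OF this, of "\<lambda>f. fps_nth f d"] show ?thesis
    using d by (simp add: series_Kp_def fps_X_power_mult_nth)
qed

text \<open>At sets containing m the summand counts multiples of X_m, by their quotients by
  \<open>Lam\<close>: twist k + 1, and degree lowered by \<open>deg_Lam\<close>.\<close>

definition mult_St :: "nat \<Rightarrow> nat \<Rightarrow> nat \<Rightarrow> nat \<Rightarrow> nat" where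
  "mult_St m k d j = (\<Sum>J | J \<subseteq> {..<Suc m} \<and> card J = j.
     if m \<in> J then if deg_Lam (Suc m) \<le> d + q_weight CARD('k) J then dim_Kp (Suc m) (Suc k) (d + q_weight CARD('k) J - deg_Lam (Suc m)) else 0
     else dim_Kp (Suc m) k (d + q_weight CARD('k) J))"

lemma card_Kf_mult_St:
  assumes "k = 0 \<or> 1 \<le> k \<and> k \<le> CARD('k) - 2"
  shows "card (Kf (Suc m) k d j) = CARD('k) ^ mult_St m k d j"
proof -
  have "card (Kp_dvd m k d J) = CARD('k) ^ (if m \<in> J then if deg_Lam (Suc m) \<le> d + q_weight CARD('k) J then dim_Kp (Suc m) (Suc k) (d + q_weight CARD('k) J - deg_Lam (Suc m)) else 0
     else dim_Kp (Suc m) k (d + q_weight CARD('k) J))" for J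
    using card_Kp_X_dvd[of m k "d + q_weight CARD('k) J"] by (cases "m \<in> J") (simp_all add: Kp_dvd_def card_Kp)
  then show ?thesis by (simp only: card_Kf[OF assms] mult_St_def power_sum)
qed

end

section \<open>Summing over index sets to obtain the bigraded series\<close>

lemma Pow_lessThan_Suc:
  "(\<Sum>J\<in>Pow {..<Suc m}. F J) = (\<Sum>J\<in>Pow {..<m}. F J + F (insert m J))" for F :: "nat set \<Rightarrow> 'a::comm_monoid_add"
proof -
  have "inj_on (insert m) (Pow {..<m})" by (rule inj_onI) (metis Diff_insert_absorb PowD lessThan_iff less_irrefl subsetD)
  moreover have "Pow {..<m} \<inter> insert m ` Pow {..<m} = {}" by auto
  ultimately show ?thesis
    unfolding lessThan_Suc Pow_insert by (subst sum.union_disjoint) (auto simp: sum.reindex sum.distrib)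
qed

lemma fps_const_prod: "fps_const (prod f S :: 'a::comm_ring_1) = (\<Prod>i\<in>S. fps_const (f i))"
  by (induction S rule: infinite_finite_induct) (simp_all add: fps_const_mult[symmetric] del: fps_const_mult)

lemma fps_card_sum:
  assumes "finite S"
  shows "Abs_fps (\<lambda>j. \<Sum>J | J \<in> S \<and> card J = j. T J) = (\<Sum>J\<in>S. fps_const (T J) * fps_X ^ card J)"
proof (rule fps_ext)
  fix j
  have "(\<Sum>J | J \<in> S \<and> card J = j. T J) = (\<Sum>J\<in>S. if card J = j then T J else 0)"
    using assms by (simp add: sum.inter_filter)
  then show "fps_nth (Abs_fps (\<lambda>j. \<Sum>J | J \<in> S \<and> card J = j. T J)) j = fps_nth (\<Sum>J\<in>S. fps_const (T J) * fps_X ^ card J) j"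
    by (simp add: fps_sum_nth fps_X_power_nth if_distrib eq_commute cong: if_cong)
qed

lemma fls_shift_low:
  fixes A :: "rat fps"
  assumes "\<And>d. d < w \<Longrightarrow> fps_nth A d = 0"
  shows "fls_X ^ w * fps_to_fls (Abs_fps (\<lambda>d. fps_nth A (d + w))) = fps_to_fls A"
proof -
  have "A = fps_X ^ w * Abs_fps (\<lambda>d. fps_nth A (d + w))"
    using assms by (intro fps_ext) (auto simp: fps_X_power_mult_nth)
  from arg_cong[OF this, of fps_to_fls] show ?thesis
    by (simp add: fls_times_fps_to_fls fps_to_fls_power)
qed

lemma tvar_powi: "tvar powi e = fps_const (fls_X powi e :: rat fls)"
  by (simp add: power_int_def fps_const_inverse)

text \<open>As a power series in s the denominator is a nonzero constant, hence a unit, and t is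
  invertible among the Laurent series.\<close>

lemma fps_final_form:
  fixes Z R :: "rat fls fps"
  assumes e: "tvar ^ n * fps_const D * Z = tvar ^ a * R" and D: "D \<noteq> 0"
  shows "Z = tvar powi (- int n + int a) * R / fps_const D"
proof -
  have t: "(fls_X :: rat fls) \<noteq> 0" by simp
  have "fls_X powi (- int n) * fls_X ^ n = (1 :: rat fls)"
    using power_int_add[OF disjI1[OF t], of "- int n" "int n"] by simp
  then have 1: "tvar powi (- int n) * tvar ^ n = 1" unfolding tvar_powi by simp
  have 2: "tvar powi (- int n + int a) = tvar powi (- int n) * tvar ^ a"
    unfolding tvar_powi using power_int_add[OF disjI1[OF t], of "- int n" "int a"] by simp
  have 3: "fps_const D * inverse (fps_const D) = 1" using D by (simp add: fps_const_inverse)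
  have "tvar powi (- int n + int a) * R / fps_const D = tvar powi (- int n + int a) * R * inverse (fps_const D)"
    using D by (intro fps_divide_unit) simp
  also have "\<dots> = tvar powi (- int n) * (tvar ^ a * R) * inverse (fps_const D)" unfolding 2 by (simp only: mult.assoc)
  also have "\<dots> = (tvar powi (- int n) * tvar ^ n) * (fps_const D * inverse (fps_const D)) * Z"
    unfolding e[symmetric] by (simp only: mult_ac)
  finally show ?thesis unfolding 1 3 by simp
qed

context prime_power_field
begin

lemma deg_Lam_Suc: "deg_Lam (Suc m) = deg_Lam m + CARD('k) ^ m"
  by (simp add: deg_Lam_def q_weight_def)

lemma deg_Lam_low: "deg_Lam n = (\<Sum>i<n. CARD('k) ^ i - 1) + n"
proof (induction n)
  case (Suc n)
  have "CARD('k) ^ n \<ge> 1" using card_field_gt_1[where 'k='k] by simp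
  then show ?case using Suc by (simp add: deg_Lam_Suc)
qed (simp add: deg_Lam_def q_weight_def)

lemma q_weight_Diff: "J \<subseteq> {..<m} \<Longrightarrow> q_weight CARD('k) ({..<m} - J) + q_weight CARD('k) J = deg_Lam m"
  unfolding deg_Lam_def q_weight_def by (rule sum.subset_diff[symmetric]) auto

lemma q_weight_insert: "J \<subseteq> {..<m} \<Longrightarrow> q_weight CARD('k) (insert m J) = CARD('k) ^ m + q_weight CARD('k) J"
  unfolding q_weight_def using finite_subset[of J "{..<m}"] by (subst sum.insert) auto

text \<open>Ensures that shifting a polynomial series down by the weight of J loses no coefficient.
  The weight is at most \<open>deg_Lam m\<close>, and without twist the lowest degree is at least
  this because m + 1 is at most q^m.\<close>

lemma dim_Kp_low_q_weight:
  assumes k: "k = 0 \<or> 1 \<le> k \<and> k \<le> CARD('k) - 2" and J: "J \<subseteq> {..<m}" and d: "d < q_weight CARD('k) J"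
  shows "dim_Kp (Suc m) k d = 0"
  using k
proof
  have "q_weight CARD('k) J \<le> deg_Lam m" using q_weight_le[OF J] by (simp add: deg_Lam_def)
  then have "d < deg_Lam m" using d by simp
  moreover have "Suc m \<le> CARD('k) ^ m"
  proof -
    have "2 \<le> CARD('k)" using card_field_gt_1[where 'k='k] by simp
    then have "2 ^ m \<le> CARD('k) ^ m" by (rule power_mono) simp
    then show ?thesis using less_exp[of m] by linarith
  qed
  ultimately have 1: "d < (\<Sum>i<Suc m. CARD('k) ^ i - 1)" using deg_Lam_low[of "Suc m"] deg_Lam_Suc[of m] by simp
  show "k = 0 \<Longrightarrow> ?thesis" using dim_Kp_low[OF 1] by simp
  show "1 \<le> k \<and> k \<le> CARD('k) - 2 \<Longrightarrow> ?thesis" using dim_Kp_torus[of k m d] \<open>d < deg_Lam m\<close> deg_Lam_Suc[of m] by simp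
qed

definition mult_series :: "nat \<Rightarrow> nat \<Rightarrow> rat fls fps" where
  "mult_series m k = Abs_fps (\<lambda>j. fps_to_fls (Abs_fps (\<lambda>d. of_nat (mult_St m k d j))))"

text \<open>Multiplication by t to the full weight turns the shift by minus the weight of J into the
  weight of its complement. The sets inside {..<m} and their complements expand the product, and
  whether m belongs to the set decides between the two terms of the first factor.\<close>

lemma mult_series_formula:
  assumes k: "k = 0 \<or> 1 \<le> k \<and> k \<le> CARD('k) - 2"
  shows "tvar ^ deg_Lam (Suc m) * mult_series m k =
    (tvar ^ (CARD('k) ^ m) * fps_const (fps_to_fls (series_Kp (Suc m) k)) +
      fps_const (fps_to_fls (fps_X ^ deg_Lam (Suc m) * series_Kp (Suc m) (Suc k))) * svar) *
    (\<Prod>i<m. svar + tvar ^ (CARD('k) ^ i))"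
proof -
  let ?q = "CARD('k)"
  define A where "A J = (if m \<in> J then fps_X ^ deg_Lam (Suc m) * series_Kp (Suc m) (Suc k) else series_Kp (Suc m) k)" for J
  define T where "T J = fps_to_fls (Abs_fps (\<lambda>d. fps_nth (A J) (d + q_weight ?q J)))" for J
  have tm: "of_nat (mult_St m k d j) = (\<Sum>J | J \<in> Pow {..<Suc m} \<and> card J = j. fps_nth (A J) (d + q_weight ?q J))" for d j
    unfolding mult_St_def of_nat_sum by (intro sum.cong) (auto simp: A_def series_Kp_def fps_X_power_mult_nth)
  have fsum: "Abs_fps (\<lambda>d. \<Sum>J\<in>S. f J d) = (\<Sum>J\<in>S. Abs_fps (f J))" for S and f :: "nat set \<Rightarrow> nat \<Rightarrow> rat"
    by (rule fps_ext) (simp add: fps_sum_nth)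
  have fls_sum: "fps_to_fls (sum f S) = (\<Sum>J\<in>S. fps_to_fls (f J))" for S and f :: "nat set \<Rightarrow> rat fps"
    by (induction S rule: infinite_finite_induct) auto
  have "mult_series m k = Abs_fps (\<lambda>j. \<Sum>J | J \<in> Pow {..<Suc m} \<and> card J = j. T J)"
    unfolding mult_series_def tm fsum fls_sum T_def ..
  also have "\<dots> = (\<Sum>J\<in>Pow {..<Suc m}. fps_const (T J) * fps_X ^ card J)" by (rule fps_card_sum) simp
  finally have Z: "mult_series m k = (\<Sum>J\<in>Pow {..<m}. fps_const (T J) * fps_X ^ card J + fps_const (T (insert m J)) * fps_X ^ card (insert m J))"
    by (simp only: Pow_lessThan_Suc)
  have low: "fls_X ^ q_weight ?q J * T J = fps_to_fls (A J)" if "J \<subseteq> {..<Suc m}" for J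
    unfolding T_def
  proof (rule fls_shift_low)
    fix d assume d: "d < q_weight ?q J"
    show "fps_nth (A J) d = 0"
    proof (cases "m \<in> J")
      case True
      then show ?thesis using d q_weight_le[OF that, of ?q] by (simp add: A_def deg_Lam_def fps_X_power_mult_nth)
    next
      case False
      then have "J \<subseteq> {..<m}" using that by (auto simp: less_Suc_eq)
      then show ?thesis using dim_Kp_low_q_weight[OF k _ d] False by (simp add: A_def series_Kp_def)
    qed
  qed
  have t1: "tvar ^ deg_Lam (Suc m) * fps_const (T J) = tvar ^ q_weight ?q ({..<m} - J) * (tvar ^ (?q ^ m) * fps_const (fps_to_fls (series_Kp (Suc m) k)))"
    if J: "J \<subseteq> {..<m}" for J
  proof -
    have "deg_Lam (Suc m) = q_weight ?q ({..<m} - J) + ?q ^ m + q_weight ?q J" using q_weight_Diff[OF J] deg_Lam_Suc[of m] by simp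
    then have "tvar ^ deg_Lam (Suc m) * fps_const (T J) = tvar ^ q_weight ?q ({..<m} - J) * (tvar ^ (?q ^ m) * fps_const (fls_X ^ q_weight ?q J * T J))"
      by (simp only: power_add fps_const_mult[symmetric] fps_const_power[symmetric] mult.assoc)
    moreover have "m \<notin> J" "J \<subseteq> {..<Suc m}" using J by auto
    ultimately show ?thesis using low[of J] by (simp only: A_def if_False)
  qed
  have t2: "tvar ^ deg_Lam (Suc m) * fps_const (T (insert m J)) = tvar ^ q_weight ?q ({..<m} - J) * fps_const (fps_to_fls (fps_X ^ deg_Lam (Suc m) * series_Kp (Suc m) (Suc k)))"
    if J: "J \<subseteq> {..<m}" for J
  proof -
    have "deg_Lam (Suc m) = q_weight ?q ({..<m} - J) + q_weight ?q (insert m J)" using q_weight_Diff[OF J] deg_Lam_Suc[of m] q_weight_insert[OF J] by simp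
    then have "tvar ^ deg_Lam (Suc m) * fps_const (T (insert m J)) = tvar ^ q_weight ?q ({..<m} - J) * fps_const (fls_X ^ q_weight ?q (insert m J) * T (insert m J))"
      by (simp only: power_add fps_const_mult[symmetric] fps_const_power[symmetric] mult.assoc)
    moreover have "insert m J \<subseteq> {..<Suc m}" using J by auto
    ultimately show ?thesis using low[of "insert m J"] by (simp only: A_def if_True insertI1)
  qed
  let ?a = "tvar ^ (?q ^ m) * fps_const (fps_to_fls (series_Kp (Suc m) k))"
  let ?b = "fps_const (fps_to_fls (fps_X ^ deg_Lam (Suc m) * series_Kp (Suc m) (Suc k)))"
  have pr: "(\<Prod>i<m. svar + tvar ^ (?q ^ i)) = (\<Sum>J\<in>Pow {..<m}. svar ^ card J * tvar ^ q_weight ?q ({..<m} - J))"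
    unfolding prod_add[OF finite_lessThan] by (simp add: q_weight_def power_sum)
  have "tvar ^ deg_Lam (Suc m) * mult_series m k = (\<Sum>J\<in>Pow {..<m}. (?a + ?b * svar) * (svar ^ card J * tvar ^ q_weight ?q ({..<m} - J)))"
    unfolding Z sum_distrib_left
  proof (rule sum.cong[OF refl])
    fix J assume "J \<in> Pow {..<m}"
    then have J: "J \<subseteq> {..<m}" by simp
    have c: "card (insert m J) = Suc (card J)" using J finite_subset[of J "{..<m}"] by (subst card_insert_disjoint) auto
    have "tvar ^ deg_Lam (Suc m) * (fps_const (T J) * svar ^ card J + fps_const (T (insert m J)) * svar ^ card (insert m J))
      = (tvar ^ deg_Lam (Suc m) * fps_const (T J)) * svar ^ card J + (tvar ^ deg_Lam (Suc m) * fps_const (T (insert m J))) * (svar * svar ^ card J)"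
      by (simp only: c power_Suc distrib_left mult.assoc)
    then show "tvar ^ deg_Lam (Suc m) * (fps_const (T J) * svar ^ card J + fps_const (T (insert m J)) * svar ^ card (insert m J))
      = (?a + ?b * svar) * (svar ^ card J * tvar ^ q_weight ?q ({..<m} - J))"
      unfolding t1[OF J] t2[OF J] by (simp only: distrib_left distrib_right mult_ac)
  qed
  then show ?thesis by (simp only: pr sum_distrib_left)
qed

definition denom :: "nat \<Rightarrow> rat fls" where
  "denom n = (\<Prod>i=1..n. 1 - fls_X ^ (CARD('k) ^ i - 1))"

lemma denom_series_Kp: "fls_X ^ n * denom n * fps_to_fls (series_Kp n 0) = fls_X ^ deg_Lam n"
proof -
  have pr: "fps_to_fls (prod f S) = (\<Prod>i\<in>S. fps_to_fls (f i))" for f :: "nat \<Rightarrow> rat fps" and S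
    by (induction S rule: infinite_finite_induct) (auto simp: fls_times_fps_to_fls)
  have "denom n * fps_to_fls (series_Kp n 0) = fls_X ^ (\<Sum>i<n. CARD('k) ^ i - 1)"
    using arg_cong[OF series_Kp_formula[of n], of fps_to_fls]
    by (simp add: denom_def fls_times_fps_to_fls fps_to_fls_power pr)
  then have "fls_X ^ n * denom n * fps_to_fls (series_Kp n 0) = fls_X ^ (n + (\<Sum>i<n. CARD('k) ^ i - 1))"
    by (simp only: power_add mult.assoc)
  then show ?thesis by (simp only: deg_Lam_low[of n] add.commute)
qed

lemma denom_nonzero: "denom n \<noteq> 0"
  using denom_series_Kp[of n] by auto

lemma denom_tvar: "fps_const (denom n) = (\<Prod>i=1..n. 1 - tvar ^ (CARD('k) ^ i - 1))"
  unfolding denom_def fps_const_prod by (intro prod.cong refl) (simp flip: fps_const_sub)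

lemma tvar_cancel: "tvar ^ a * x = tvar ^ a * y \<Longrightarrow> x = y" for x y :: "rat fls fps"
  by simp

text \<open>Without twist, sets containing m count only multiples of X_m, which costs t^(q^n - 1) by
  \<open>series_Kp_one\<close>. This is the origin of the exceptional factor.\<close>

lemma mult_series_0:
  "mult_series m 0 = tvar powi (- int (Suc m)) *
    ((svar * tvar ^ (CARD('k) ^ Suc m - 1) + tvar ^ (CARD('k) ^ m)) * (\<Prod>i<m. svar + tvar ^ (CARD('k) ^ i)))
    / (\<Prod>i=1..Suc m. 1 - tvar ^ (CARD('k) ^ i - 1))"
proof -
  let ?n = "Suc m" and ?q = "CARD('k)"
  let ?R = "(\<Prod>i<m. svar + tvar ^ (?q ^ i))"
  let ?g = "fps_const (fps_to_fls (series_Kp ?n 0))"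
  have g: "tvar ^ ?n * fps_const (denom ?n) * ?g = tvar ^ deg_Lam ?n"
    using arg_cong[OF denom_series_Kp[of ?n], of fps_const] by simp
  have "fps_X ^ deg_Lam ?n * series_Kp ?n (Suc 0) = fps_X ^ (?q ^ ?n - 1) * series_Kp ?n 0"
    using series_Kp_one[of ?n] by (simp only: One_nat_def)
  then have "fps_const (fps_to_fls (fps_X ^ deg_Lam ?n * series_Kp ?n (Suc 0))) = tvar ^ (?q ^ ?n - 1) * ?g"
    by (simp add: fls_times_fps_to_fls fps_to_fls_power del: power_Suc)
  then have "tvar ^ deg_Lam ?n * mult_series m 0 = (tvar ^ (?q ^ m) * ?g + tvar ^ (?q ^ ?n - 1) * ?g * svar) * ?R"
    using mult_series_formula[of 0 m] by (simp only: simp_thms)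
  then have "tvar ^ deg_Lam ?n * (tvar ^ ?n * fps_const (denom ?n) * mult_series m 0) =
    tvar ^ ?n * fps_const (denom ?n) * ((tvar ^ (?q ^ m) * ?g + tvar ^ (?q ^ ?n - 1) * ?g * svar) * ?R)"
    unfolding mult.left_commute[of "tvar ^ deg_Lam ?n"] by (rule arg_cong)
  also have "\<dots> = (tvar ^ ?n * fps_const (denom ?n) * ?g) * ((svar * tvar ^ (?q ^ ?n - 1) + tvar ^ (?q ^ m)) * ?R)"
    by (simp only: distrib_left distrib_right mult_ac add.commute)
  finally have "tvar ^ ?n * fps_const (denom ?n) * mult_series m 0 = (svar * tvar ^ (?q ^ ?n - 1) + tvar ^ (?q ^ m)) * ?R"
    unfolding g by (rule tvar_cancel)
  then have "tvar ^ ?n * fps_const (denom ?n) * mult_series m 0 = tvar ^ 0 * ((svar * tvar ^ (?q ^ ?n - 1) + tvar ^ (?q ^ m)) * ?R)"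
    by (simp only: power_0 mult_1_left)
  from fps_final_form[OF this denom_nonzero] show ?thesis unfolding denom_tvar by (simp only: of_nat_0 add_0_right)
qed

text \<open>With a nontrivial twist everything is already divisible by X_m, so both terms of the
  first factor carry the same series and that factor joins the product as its n-th member.\<close>

lemma mult_series_twist:
  assumes k: "1 \<le> k" "k \<le> CARD('k) - 2"
  shows "mult_series m k = tvar powi (- int (Suc m) + int ((CARD('k) - 1 - k) * deg_Lam (Suc m))) *
    (\<Prod>i<Suc m. svar + tvar ^ (CARD('k) ^ i)) / (\<Prod>i=1..Suc m. 1 - tvar ^ (CARD('k) ^ i - 1))"
proof -
  let ?n = "Suc m" and ?q = "CARD('k)"
  let ?e = "(?q - 1 - k) * deg_Lam ?n"
  let ?R = "(\<Prod>i<m. svar + tvar ^ (?q ^ i))"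
  let ?g = "fps_const (fps_to_fls (series_Kp ?n 0))"
  have g: "tvar ^ ?n * fps_const (denom ?n) * ?g = tvar ^ deg_Lam ?n"
    using arg_cong[OF denom_series_Kp[of ?n], of fps_const] by simp
  have "series_Kp ?n k = fps_X ^ ?e * series_Kp ?n 0" using k by (intro series_Kp_twist) auto
  then have G: "fps_const (fps_to_fls (series_Kp ?n k)) = tvar ^ ?e * ?g"
    by (simp add: fls_times_fps_to_fls fps_to_fls_power)
  have "tvar ^ deg_Lam ?n * mult_series m k = (tvar ^ (?q ^ m) * (tvar ^ ?e * ?g) + (tvar ^ ?e * ?g) * svar) * ?R"
    using mult_series_formula[of k m] k unfolding series_Kp_torus[OF k, symmetric] G by simp
  then have "tvar ^ deg_Lam ?n * (tvar ^ ?n * fps_const (denom ?n) * mult_series m k) =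
    tvar ^ ?n * fps_const (denom ?n) * ((tvar ^ (?q ^ m) * (tvar ^ ?e * ?g) + (tvar ^ ?e * ?g) * svar) * ?R)"
    unfolding mult.left_commute[of "tvar ^ deg_Lam ?n"] by (rule arg_cong)
  also have "\<dots> = (tvar ^ ?n * fps_const (denom ?n) * ?g) * (tvar ^ ?e * ((svar + tvar ^ (?q ^ m)) * ?R))"
    by (simp only: distrib_left distrib_right mult_ac add.commute)
  finally have "tvar ^ ?n * fps_const (denom ?n) * mult_series m k = tvar ^ ?e * ((svar + tvar ^ (?q ^ m)) * ?R)"
    unfolding g by (rule tvar_cancel)
  from fps_final_form[OF this denom_nonzero] show ?thesis
    unfolding denom_tvar prod.lessThan_Suc by (simp only: mult.commute)
qed

end

lemma lookup_sum_pm: "Poly_Mapping.lookup (sum f S) b = (\<Sum>i\<in>S. Poly_Mapping.lookup (f i) b)"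
  by (induction S rule: infinite_finite_induct) (auto simp: lookup_add)

lemma lookup_lin_ext: "Poly_Mapping.lookup (lin_ext f x) b = (\<Sum>a\<in>Poly_Mapping.keys x. Poly_Mapping.lookup x a * Poly_Mapping.lookup (f a) b)"
  by (simp add: lin_ext_def lookup_sum_pm lookup_pm_scale)

section \<open>The modules of the statement\<close>

definition ext_coeff :: "'k::field mat \<Rightarrow> nat \<Rightarrow> nat \<Rightarrow> 'k" where
  "ext_coeff g = (\<lambda>j l. g $$ (l, j))"

lemma wedge_sign_single: "l \<notin> J \<Longrightarrow> wedge_sign {l} J = sg l J"
proof -
  assume "l \<notin> J"
  have "{(i, j). i \<in> {l} \<and> j \<in> J \<and> j < i} = Pair l ` {i \<in> J. i < l}" by auto
  then have "card {(i, j). i \<in> {l} \<and> j \<in> J \<and> j < i} = card {i \<in> J. i < l}" by (simp add: card_image inj_on_def)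
  then show ?thesis using \<open>l \<notin> J\<close> by (simp add: wedge_sign_def sg_def)
qed

lemma lookup_wedge_ext_col:
  assumes "dim_row g = n"
  shows "Poly_Mapping.lookup (wedge (ext_col g j) y) = cre n (ext_coeff g j) (Poly_Mapping.lookup y)"
proof
  fix K
  let ?L = "\<lambda>I. lin_ext (\<lambda>J. Poly_Mapping.single (I \<union> J) (wedge_sign I J)) y"
  have "lin_ext ?L (Poly_Mapping.single {l} c) = pm_scale c (?L {l})" for l c by (rule lin_ext_single)
  then have "wedge (ext_col g j) y = (\<Sum>l<n. pm_scale (g $$ (l, j)) (?L {l}))"
    unfolding wedge_def ext_col_def assms pm_linear_sum[OF pm_linear_lin_ext] by simp
  moreover have "Poly_Mapping.lookup (?L {l}) K = cr l (Poly_Mapping.lookup y) K" for l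
  proof -
    have "Poly_Mapping.lookup (?L {l}) K = (\<Sum>J\<in>Poly_Mapping.keys y. if J = K - {l} then (if l \<in> K then sg l K * Poly_Mapping.lookup y (K - {l}) else 0) else 0)"
      unfolding lookup_lin_ext
    proof (rule sum.cong[OF refl])
      fix J
      show "Poly_Mapping.lookup y J * Poly_Mapping.lookup (Poly_Mapping.single ({l} \<union> J) (wedge_sign {l} J)) K
        = (if J = K - {l} then (if l \<in> K then sg l K * Poly_Mapping.lookup y (K - {l}) else 0) else 0)"
      proof (cases "l \<in> J")
        case True
        then show ?thesis by (auto simp: wedge_sign_def)
      next
        case False
        then have "{l} \<union> J = K \<longleftrightarrow> l \<in> K \<and> J = K - {l}" by auto
        moreover have "sg l (K - {l}) = (sg l K :: 'a)" by (cases "l \<in> K") (auto simp: sg_remove)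
        ultimately show ?thesis using False by (auto simp: lookup_single when_def wedge_sign_single)
      qed
    qed
    then show ?thesis by (simp add: cr_def in_keys_iff)
  qed
  ultimately show "Poly_Mapping.lookup (wedge (ext_col g j) y) K = cre n (ext_coeff g j) (Poly_Mapping.lookup y) K"
    by (simp add: lookup_sum_pm lookup_pm_scale cre_def ext_coeff_def)
qed

lemma lookup_ext_act_single:
  assumes "dim_row g = n"
  shows "Poly_Mapping.lookup (ext_act g (Poly_Mapping.single I 1)) = EE n (ext_coeff g) I"
proof -
  have "Poly_Mapping.lookup (foldr wedge (map (ext_col g) xs) (Poly_Mapping.single {} 1)) = EL n (ext_coeff g) xs" for xs
  proof (induction xs)
    case Nil
    then show ?case by (auto simp: EL_def ev_def fun_eq_iff lookup_single when_def)
  qed (simp add: lookup_wedge_ext_col[OF assms] EL_def)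
  then show ?thesis by (simp add: ext_act_def)
qed

lemma pm_linear_ext_act: "pm_linear (ext_act g)"
  unfolding ext_act_def by (rule pm_linear_lin_ext)

lemma lookup_ext_act:
  assumes "dim_row g = n" and x: "x \<in> basis_space (Pow {..<n})"
  shows "Poly_Mapping.lookup (ext_act g x) = Ehat n (ext_coeff g) (Poly_Mapping.lookup x)"
proof
  fix J
  have "ext_act g x = (\<Sum>I\<in>Pow {..<n}. pm_scale (Poly_Mapping.lookup x I) (ext_act g (Poly_Mapping.single I 1)))"
    using x unfolding ext_act_def lin_ext_basis by (intro lin_ext_superset) (auto simp: basis_space_def)
  then show "Poly_Mapping.lookup (ext_act g x) J = Ehat n (ext_coeff g) (Poly_Mapping.lookup x) J"
    by (simp add: lookup_sum_pm lookup_pm_scale lookup_ext_act_single[OF assms(1)] Ehat_def mult.commute)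
qed

lemma EL_cong: "(\<And>j l. j \<in> set xs \<Longrightarrow> l < n \<Longrightarrow> G j l = H j l) \<Longrightarrow> EL n G xs = EL n H xs"
  by (induction xs) (auto simp: EL_def cre_def intro!: ext sum.cong)

lemma EE_one:
  assumes "I \<subseteq> {..<n}" shows "EE n (ext_coeff (1\<^sub>m n)) I = (ev I :: nat set \<Rightarrow> 'a::field)"
proof -
  have "finite I" using assms finite_subset by blast
  then show ?thesis using assms
  proof (induction I)
    case empty
    show ?case by (rule EE_empty)
  next
    case (insert l I)
    have "cre n (ext_coeff (1\<^sub>m n) l) (ev I) = cr l (ev I :: nat set \<Rightarrow> 'a)"
      using insert.prems cre_unit[of l n] by (auto simp: cre_def ext_coeff_def fun_eq_iff intro!: sum.cong)
    also have "\<dots> = sm (sg l I) (ev (insert l I) :: nat set \<Rightarrow> 'a)" using insert.hyps by (simp add: cr_ev)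
    also have "cre n (ext_coeff (1\<^sub>m n) l) (ev I :: nat set \<Rightarrow> 'a) = sm (sg l I) (EE n (ext_coeff (1\<^sub>m n)) (insert l I))"
    proof -
      have "EE n (ext_coeff (1\<^sub>m n)) I = (ev I :: nat set \<Rightarrow> 'a)" using insert by simp
      then show ?thesis
        using EE_insert[OF insert.hyps(1), of n "ext_coeff (1\<^sub>m n) :: nat \<Rightarrow> nat \<Rightarrow> 'a" l] insert.hyps(2) by (simp only: if_False)
    qed
    finally have "sm (sg l I) (EE n (ext_coeff (1\<^sub>m n)) (insert l I)) = sm (sg l I) (ev (insert l I) :: nat set \<Rightarrow> 'a)" .
    from arg_cong[OF this, of "sm (sg l I)"] show ?case by (simp only: sm_simps(1,2) sg_sq)
  qed
qed

definition ext_basis :: "nat \<Rightarrow> nat \<Rightarrow> nat set set" where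
  "ext_basis n j = {J. J \<subseteq> {..<n} \<and> card J = j}"

lemma ext_power_basis: "ext_power n j = basis_space (ext_basis n j)"
  by (auto simp: ext_power_def basis_space_def ext_basis_def)

lemma finite_ext_basis: "finite (ext_basis n j)"
  by (rule finite_subset[of _ "Pow {..<n}"]) (auto simp: ext_basis_def)

text \<open>Multiplicativity is the composition law \<open>Ehat_EL\<close>; the transposition in
  \<open>ext_coeff\<close> puts the factors in the right order.\<close>

lemma glrep_ext: "glrep n (ext_basis n j) (ext_act :: 'k::{field,finite} mat \<Rightarrow> _)"
proof
  fix g h :: "'k mat" and x :: "nat set \<Rightarrow>\<^sub>0 'k"
  show "pm_linear (ext_act g)" by (rule pm_linear_ext_act)
  assume x: "x \<in> basis_space (ext_basis n j)"
  show "ext_act (1\<^sub>m n) x = x"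
  proof (rule pm_linear_eqI[OF pm_linear_ext_act _ _ x])
    fix I assume "I \<in> ext_basis n j"
    then have "Poly_Mapping.lookup (ext_act (1\<^sub>m n) (Poly_Mapping.single I (1::'k))) = ev I"
      by (simp add: lookup_ext_act_single[of _ n] EE_one ext_basis_def)
    then show "ext_act (1\<^sub>m n) (Poly_Mapping.single I (1::'k)) = Poly_Mapping.single I 1"
      by (intro poly_mapping_eqI) (auto simp: ev_def lookup_single when_def)
  qed (simp add: pm_linear_def)
  assume g: "g \<in> GL n"
  have dg: "dim_row g = n" using GL_carrier[OF g] by auto
  show "ext_act g x \<in> basis_space (ext_basis n j)"
  proof (rule pm_linear_closed[OF pm_linear_ext_act _ x])
    fix I assume I: "I \<in> ext_basis n j"
    have "J \<in> ext_basis n j" if "EE n (ext_coeff g) I J \<noteq> 0" for J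
      using EL_support[OF that] I finite_subset[of I "{..<n}"] by (auto simp: ext_basis_def)
    then show "ext_act g (Poly_Mapping.single I 1) \<in> basis_space (ext_basis n j)"
      by (auto simp: basis_space_iff lookup_ext_act_single[OF dg])
  qed
  assume h: "h \<in> GL n"
  have dh: "dim_row h = n" using GL_carrier[OF h] by auto
  show "ext_act (g * h) x = ext_act g (ext_act h x)"
  proof (rule pm_linear_eqI[OF pm_linear_ext_act pm_linear_comp[OF pm_linear_ext_act pm_linear_ext_act] _ x])
    fix I assume I: "I \<in> ext_basis n j"
    have fI: "finite I" using I finite_subset[of I "{..<n}"] by (auto simp: ext_basis_def)
    have "ext_act h (Poly_Mapping.single I 1) \<in> basis_space (Pow {..<n})"
      unfolding basis_space_iff lookup_ext_act_single[OF dh] using EL_support[of n "ext_coeff h" "sorted_list_of_set I"] by blast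
    then have "Poly_Mapping.lookup (ext_act g (ext_act h (Poly_Mapping.single I 1))) = Ehat n (ext_coeff g) (EE n (ext_coeff h) I)"
      by (simp add: lookup_ext_act[OF dg] lookup_ext_act_single[OF dh])
    also have "\<dots> = EE n (ext_coeff (g * h)) I"
      unfolding Ehat_EL
    proof (rule EL_cong)
      fix i l assume "i \<in> set (sorted_list_of_set I)" "l < n"
      then have "i < n" using I fI by (auto simp: ext_basis_def)
      then show "(\<Sum>k<n. ext_coeff h i k * ext_coeff g k l) = ext_coeff (g * h) i l"
        using mult_mat_entry[OF GL_carrier[OF g] GL_carrier[OF h], of l i] \<open>l < n\<close> by (simp only: ext_coeff_def mult.commute)
    qed
    also have "\<dots> = Poly_Mapping.lookup (ext_act (g * h) (Poly_Mapping.single I 1))"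
      by (rule lookup_ext_act_single[symmetric]) (simp add: dg)
    finally show "ext_act (g * h) (Poly_Mapping.single I 1) = ext_act g (ext_act h (Poly_Mapping.single I 1))"
      by (intro poly_mapping_eqI) simp
  qed
qed

lemma glrep_det: "glrep n UNIV (det_act k :: 'k::{field,finite} mat \<Rightarrow> _)"
  by standard (auto simp: det_act_def pm_linear_def pm.scale_right_distrib mult.commute basis_space_def
      det_mult[OF GL_carrier GL_carrier] power_mult_distrib)

lemma lookup_pm_tensor: "Poly_Mapping.lookup (pm_tensor x y) (b, c) = Poly_Mapping.lookup x b * Poly_Mapping.lookup y c"
proof -
  have 1: "Poly_Mapping.lookup (lin_ext (\<lambda>c'. Poly_Mapping.single (b', c') 1) y) (b, c) = (if b' = b then Poly_Mapping.lookup y c else 0)" for b'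
  proof -
    have "Poly_Mapping.lookup (lin_ext (\<lambda>c'. Poly_Mapping.single (b', c') 1) y) (b, c)
      = (\<Sum>c'\<in>Poly_Mapping.keys y. if c' = c then (if b' = b then Poly_Mapping.lookup y c else 0) else 0)"
      unfolding lookup_lin_ext by (intro sum.cong) (auto simp: lookup_single when_def)
    then show ?thesis by (simp add: in_keys_iff)
  qed
  have "Poly_Mapping.lookup (pm_tensor x y) (b, c) = (\<Sum>b'\<in>Poly_Mapping.keys x. if b' = b then Poly_Mapping.lookup x b * Poly_Mapping.lookup y c else 0)"
    unfolding pm_tensor_def lookup_lin_ext[where f = "\<lambda>b'. lin_ext (\<lambda>c'. Poly_Mapping.single (b', c') 1) y"] 1
    by (intro sum.cong) auto
  then show ?thesis by (simp add: in_keys_iff)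
qed

lemma pm_linear_tensor_left: "pm_linear (\<lambda>x. pm_tensor x y)"
  and pm_linear_tensor_right: "pm_linear (\<lambda>y. pm_tensor x y)"
  by (auto simp: pm_linear_def lookup_pm_tensor lookup_add lookup_pm_scale algebra_simps intro!: poly_mapping_eqI)

lemma pm_tensor_single: "pm_tensor (Poly_Mapping.single b 1) (Poly_Mapping.single c 1) = Poly_Mapping.single (b, c) 1"
  by (rule poly_mapping_eqI) (auto simp: lookup_pm_tensor lookup_single when_def split: if_splits)

lemma pm_tensor_basis_space: "x \<in> basis_space A \<Longrightarrow> y \<in> basis_space B \<Longrightarrow> pm_tensor x y \<in> basis_space (A \<times> B)"
  by (auto simp: basis_space_iff lookup_pm_tensor)

lemma pm_linear_eq_UNIV:
  assumes "pm_linear S" "pm_linear T" "\<And>b. S (Poly_Mapping.single b 1) = T (Poly_Mapping.single b 1)"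
  shows "S x = T x"
  by (rule pm_linear_eqI[OF assms(1,2), of UNIV]) (use assms(3) in \<open>auto simp: basis_space_def\<close>)

lemma tensor_act_tensor:
  assumes "pm_linear (\<rho> g)" "pm_linear (\<sigma> g)"
  shows "tensor_act \<rho> \<sigma> g (pm_tensor x y) = pm_tensor (\<rho> g x) (\<sigma> g y)"
proof -
  have l: "pm_linear (tensor_act \<rho> \<sigma> g)" unfolding tensor_act_def by (rule pm_linear_lin_ext)
  have "tensor_act \<rho> \<sigma> g (pm_tensor (Poly_Mapping.single b 1) y) = pm_tensor (\<rho> g (Poly_Mapping.single b 1)) (\<sigma> g y)" for b
    by (rule pm_linear_eq_UNIV[OF pm_linear_comp[OF l pm_linear_tensor_right] pm_linear_comp[OF pm_linear_tensor_right assms(2)]])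
      (simp add: pm_tensor_single tensor_act_def)
  then show ?thesis
    by (rule pm_linear_eq_UNIV[OF pm_linear_comp[OF l pm_linear_tensor_left] pm_linear_comp[OF pm_linear_tensor_left assms(1)]])
qed

lemma tensor_space_basis: "tensor_space (basis_space A) (basis_space B) = (basis_space (A \<times> B) :: ('a \<times> 'b \<Rightarrow>\<^sub>0 'k::field) set)"
proof
  have "pm.subspace (basis_space (A \<times> B) :: ('a \<times> 'b \<Rightarrow>\<^sub>0 'k) set)"
    unfolding pm.subspace_def by (auto intro: basis_space_add basis_space_scale)
  then show "tensor_space (basis_space A) (basis_space B) \<subseteq> (basis_space (A \<times> B) :: ('a \<times> 'b \<Rightarrow>\<^sub>0 'k) set)"
    unfolding tensor_space_def by (intro pm.span_minimal) (auto intro: pm_tensor_basis_space)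
  show "(basis_space (A \<times> B) :: ('a \<times> 'b \<Rightarrow>\<^sub>0 'k) set) \<subseteq> tensor_space (basis_space A) (basis_space B)"
  proof
    fix x :: "'a \<times> 'b \<Rightarrow>\<^sub>0 'k" assume x: "x \<in> basis_space (A \<times> B)"
    have "x = (\<Sum>b\<in>Poly_Mapping.keys x. pm_scale (Poly_Mapping.lookup x b) (Poly_Mapping.single b 1))"
      by (rule pm_expand) auto
    also have "\<dots> \<in> tensor_space (basis_space A) (basis_space B)"
      unfolding tensor_space_def
    proof (intro pm.span_sum pm.span_scale pm.span_base)
      fix b assume "b \<in> Poly_Mapping.keys x"
      then have "b \<in> A \<times> B" using x by (auto simp: basis_space_def)
      then obtain a c where "b = (a, c)" "a \<in> A" "c \<in> B" by auto
      then show "Poly_Mapping.single b 1 \<in> {pm_tensor x y |x y. x \<in> basis_space A \<and> y \<in> (basis_space B :: ('b \<Rightarrow>\<^sub>0 'k) set)}"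
        using pm_tensor_single[of a c] basis_space_single by (metis (mono_tags, lifting) mem_Collect_eq)
    qed
    finally show "x \<in> tensor_space (basis_space A) (basis_space B)" .
  qed
qed

lemma glrep_tensor:
  fixes \<rho> :: "'k::{field,finite} mat \<Rightarrow> ('b \<Rightarrow>\<^sub>0 'k) \<Rightarrow> _" and \<sigma> :: "'k mat \<Rightarrow> ('c \<Rightarrow>\<^sub>0 'k) \<Rightarrow> _"
  assumes "glrep n A \<rho>" "glrep n B \<sigma>"
  shows "glrep n (A \<times> B) (tensor_act \<rho> \<sigma>)"
proof -
  interpret r: glrep n A \<rho> by fact
  interpret s: glrep n B \<sigma> by fact
  have l: "pm_linear (tensor_act \<rho> \<sigma> g)" for g unfolding tensor_act_def by (rule pm_linear_lin_ext)
  have t: "tensor_act \<rho> \<sigma> g (Poly_Mapping.single (b, c) 1) = pm_tensor (\<rho> g (Poly_Mapping.single b 1)) (\<sigma> g (Poly_Mapping.single c 1))" for g b c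
    by (simp add: tensor_act_def)
  show ?thesis
  proof
    fix g h :: "'k mat" and x :: "'b \<times> 'c \<Rightarrow>\<^sub>0 'k" assume x: "x \<in> basis_space (A \<times> B)"
    show "tensor_act \<rho> \<sigma> (1\<^sub>m n) x = x"
    proof (rule pm_linear_eqI[OF l _ _ x])
      fix b assume "b \<in> A \<times> B"
      then show "tensor_act \<rho> \<sigma> (1\<^sub>m n) (Poly_Mapping.single b 1) = Poly_Mapping.single b 1"
        by (auto simp: t r.one s.one basis_space_single pm_tensor_single)
    qed (simp add: pm_linear_def)
    assume g: "g \<in> GL n"
    show "tensor_act \<rho> \<sigma> g x \<in> basis_space (A \<times> B)"
    proof (rule pm_linear_closed[OF l _ x])
      fix b assume "b \<in> A \<times> B"
      then show "tensor_act \<rho> \<sigma> g (Poly_Mapping.single b 1) \<in> basis_space (A \<times> B)"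
        using g by (auto simp: t intro!: pm_tensor_basis_space r.closed s.closed basis_space_single)
    qed
    assume h: "h \<in> GL n"
    show "tensor_act \<rho> \<sigma> (g * h) x = tensor_act \<rho> \<sigma> g (tensor_act \<rho> \<sigma> h x)"
    proof (rule pm_linear_eqI[OF l pm_linear_comp[OF l l] _ x])
      fix b assume "b \<in> A \<times> B"
      then obtain a c where b: "b = (a, c)" "a \<in> A" "c \<in> B" by auto
      then show "tensor_act \<rho> \<sigma> (g * h) (Poly_Mapping.single b 1) = tensor_act \<rho> \<sigma> g (tensor_act \<rho> \<sigma> h (Poly_Mapping.single b 1))"
        by (simp add: t tensor_act_tensor[OF r.lin s.lin] r.mult[OF g h] s.mult[OF g h] basis_space_single)
    qed
  qed (rule l)
qed

lemma glrep_sym_ext: "glrep n (monomials n d \<times> ext_basis n j) (sym_ext_act :: 'k::{field,finite} mat \<Rightarrow> _)"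
  unfolding sym_ext_act_def by (rule glrep_tensor[OF sp.glrep_axioms glrep_ext])

lemma glrep_sym_ext_det:
  "glrep n ((\<lambda>b. (b, ())) ` (monomials n d \<times> ext_basis n j)) (tensor_act sym_ext_act (det_act k) :: 'k::{field,finite} mat \<Rightarrow> _)"
proof -
  have "(\<lambda>b. (b, ())) ` (monomials n d \<times> ext_basis n j) = (monomials n d \<times> ext_basis n j) \<times> UNIV" by auto
  then show ?thesis using glrep_tensor[OF glrep_sym_ext glrep_det] by simp
qed

lemma sym_ext_space_basis: "sym_ext_space n d j = (basis_space (monomials n d \<times> ext_basis n j) :: (_ \<Rightarrow>\<^sub>0 'k::field) set)"
proof -
  have "sym_power n d = (basis_space (monomials n d) :: 'k mpol set)" by (simp add: sym_power_alt HP_basis_space[symmetric] HP_def)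
  then show ?thesis by (simp only: sym_ext_space_def ext_power_basis tensor_space_basis)
qed

lemma sym_ext_det_space_basis:
  "tensor_space (sym_ext_space n d j) det_space = (basis_space ((\<lambda>b. (b, ())) ` (monomials n d \<times> ext_basis n j)) :: (_ \<Rightarrow>\<^sub>0 'k::field) set)"
proof -
  have 1: "(\<lambda>b. (b, ())) ` (monomials n d \<times> ext_basis n j) = (monomials n d \<times> ext_basis n j) \<times> UNIV" by auto
  have 2: "det_space = (basis_space UNIV :: (unit \<Rightarrow>\<^sub>0 'k) set)" by (simp add: det_space_def basis_space_def)
  show ?thesis unfolding 1 2 sym_ext_space_basis tensor_space_basis ..
qed

text \<open>
  The injection \<open>e\<close> covers both modules: the identity without, and pairing with \<open>()\<close> with the factor \<open>Det^k\<close>.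
\<close>

definition form_of :: "((nat \<Rightarrow>\<^sub>0 nat) \<times> nat set \<Rightarrow> 'c) \<Rightarrow> nat \<Rightarrow> nat \<Rightarrow> ('c \<Rightarrow>\<^sub>0 'k::field) \<Rightarrow> nat set \<Rightarrow> 'k mpol" where
  "form_of e n d x J = (\<Sum>\<mu>\<in>monomials n d. Poly_Mapping.single \<mu> (Poly_Mapping.lookup x (e (\<mu>, J))))"

lemma lookup_form_of:
  "Poly_Mapping.lookup (form_of e n d x J) \<mu> = (if \<mu> \<in> monomials n d then Poly_Mapping.lookup x (e (\<mu>, J)) else 0)"
proof -
  have "Poly_Mapping.lookup (form_of e n d x J) \<mu> = (\<Sum>\<mu>'\<in>monomials n d. if \<mu>' = \<mu> then Poly_Mapping.lookup x (e (\<mu>, J)) else 0)"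
    unfolding form_of_def lookup_sum_pm by (intro sum.cong) (auto simp: lookup_single when_def)
  then show ?thesis by (simp add: finite_monomials)
qed

lemma pm_linear_form_of: "pm_linear (\<lambda>x. form_of e n d x J)"
  unfolding pm_linear_def
  by (intro conjI allI poly_mapping_eqI) (auto simp: lookup_form_of lookup_add lookup_pm_scale)

lemma bij_form_of:
  assumes e: "inj e"
  shows "bij_betw (form_of e n d) (basis_space (e ` (monomials n d \<times> ext_basis n j)))
    {\<omega> \<in> Fsup n j. \<forall>J. \<omega> J \<in> (HP n d :: 'k::field mpol set)}" (is "bij_betw _ ?B ?F")
proof (rule bij_betw_imageI)
  show "inj_on (form_of e n d) ?B"
  proof (rule inj_onI)
    fix x y :: "'a \<Rightarrow>\<^sub>0 'k" assume x: "x \<in> ?B" and y: "y \<in> ?B" and eq: "form_of e n d x = form_of e n d y"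
    show "x = y"
    proof (rule poly_mapping_eqI)
      fix b show "Poly_Mapping.lookup x b = Poly_Mapping.lookup y b"
      proof (cases "b \<in> e ` (monomials n d \<times> ext_basis n j)")
        case True
        then obtain \<mu> J where b: "b = e (\<mu>, J)" "\<mu> \<in> monomials n d" by auto
        then show ?thesis
          using arg_cong[OF fun_cong[OF eq, of J], of "\<lambda>f. Poly_Mapping.lookup f \<mu>"] by (simp add: lookup_form_of)
      qed (use x y in \<open>simp add: basis_space_iff\<close>)
    qed
  qed
  show "form_of e n d ` ?B = ?F"
  proof (intro equalityI subsetI)
    fix \<omega> assume "\<omega> \<in> form_of e n d ` ?B"
    then obtain x where x: "x \<in> ?B" and w: "\<omega> = form_of e n d x" by auto
    have "\<omega> J \<in> HP n d" for J
      unfolding HP_basis_space basis_space_iff w lookup_form_of by simp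
    moreover have "\<omega> \<in> Fsup n j"
    proof -
      have "\<omega> J = 0" if "J \<notin> ext_basis n j" for J
      proof (rule poly_mapping_eqI)
        fix \<mu>
        have "e (\<mu>, J) \<notin> e ` (monomials n d \<times> ext_basis n j)" using e that by (auto dest: injD)
        then show "Poly_Mapping.lookup (\<omega> J) \<mu> = Poly_Mapping.lookup 0 \<mu>"
          using x by (simp add: w lookup_form_of basis_space_iff)
      qed
      then show ?thesis by (auto simp: Fsup_def ext_basis_def)
    qed
    ultimately show "\<omega> \<in> ?F" by simp
  next
    fix \<omega> assume w: "\<omega> \<in> ?F"
    let ?S = "monomials n d \<times> ext_basis n j"
    define x where "x = (\<Sum>b\<in>?S. Poly_Mapping.single (e b) (Poly_Mapping.lookup (\<omega> (snd b)) (fst b)))"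
    have xB: "x \<in> ?B" unfolding x_def by (intro basis_space_sum basis_space_single) auto
    have lx: "Poly_Mapping.lookup x (e b) = (if b \<in> ?S then Poly_Mapping.lookup (\<omega> (snd b)) (fst b) else 0)" for b
    proof -
      have "Poly_Mapping.lookup x (e b) = (\<Sum>b'\<in>?S. if b' = b then Poly_Mapping.lookup (\<omega> (snd b)) (fst b) else 0)"
        unfolding x_def lookup_sum_pm using e by (intro sum.cong) (auto simp: lookup_single when_def dest: injD)
      then show ?thesis by (simp add: finite_monomials finite_ext_basis)
    qed
    have "\<omega> = form_of e n d x"
    proof (intro ext poly_mapping_eqI)
      fix J \<mu>
      have "\<omega> J \<in> basis_space (monomials n d)" using w by (auto simp: HP_basis_space)
      then have "Poly_Mapping.lookup (\<omega> J) \<mu> = 0" if "\<mu> \<notin> monomials n d" using that by (simp add: basis_space_iff)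
      moreover have "\<omega> J = 0" if "J \<notin> ext_basis n j" using w that by (auto simp: Fsup_def ext_basis_def)
      ultimately show "Poly_Mapping.lookup (\<omega> J) \<mu> = Poly_Mapping.lookup (form_of e n d x J) \<mu>"
        by (auto simp: lookup_form_of lx)
    qed
    then show "\<omega> \<in> form_of e n d ` ?B" using xB by blast
  qed
qed

context prime_power_field
begin

text \<open>Transport along \<open>form_of\<close>: once the action on basis tensors is that on
  forms times det^k, the equations of the abstract \<open>K\<close> become those of
  \<open>Kf\<close>.\<close>

lemma card_Kf_steinberg_mult:
  fixes \<rho> :: "'k mat \<Rightarrow> ('c \<Rightarrow>\<^sub>0 'k) \<Rightarrow> _"
  assumes e: "inj e" and rep: "glrep n (e ` (monomials n d \<times> ext_basis n j)) \<rho>"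
    and eq: "\<And>g \<mu> I J. g \<in> GL n \<Longrightarrow> \<mu> \<in> monomials n d \<Longrightarrow> I \<in> ext_basis n j \<Longrightarrow>
      form_of e n d (\<rho> g (Poly_Mapping.single (e (\<mu>, I)) 1)) J = C (det g) ^ k * (EE n (form_coeff g) I J * sym_act g (Poly_Mapping.single \<mu> 1))"
  shows "CARD('k) ^ steinberg_mult n (basis_space (e ` (monomials n d \<times> ext_basis n j))) \<rho> = card (Kf n k d j)"
proof -
  let ?A = "e ` (monomials n d \<times> ext_basis n j)"
  interpret g: glrep n ?A \<rho> by (rule rep)
  have fA: "finite ?A" by (simp add: finite_monomials finite_ext_basis)
  let ?f = "form_of e n d :: ('c \<Rightarrow>\<^sub>0 'k) \<Rightarrow> _"
  have bij: "bij_betw ?f (basis_space ?A) {\<omega> \<in> Fsup n j. \<forall>J. \<omega> J \<in> HP n d}" by (rule bij_form_of[OF e])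
  have inj: "?f x = ?f y \<longleftrightarrow> x = y" if "x \<in> basis_space ?A" "y \<in> basis_space ?A" for x y
    using bij_betw_imp_inj_on[OF bij] that by (auto dest: inj_onD)
  have act: "?f (\<rho> h x) = sm (C (det h) ^ k) (gact n h (?f x))" if h: "h \<in> GL n" and x: "x \<in> basis_space ?A" for h x
  proof
    fix J
    have l: "pm_linear (\<lambda>x. C (det h) ^ k * (\<Sum>I\<in>Pow {..<n}. EE n (form_coeff h) I J * sym_act h (?f x I)))"
    proof -
      have "sym_act h (?f (x + y) I) = sym_act h (?f x I) + sym_act h (?f y I)" for x y I
        by (simp add: pm_linear_add[OF pm_linear_form_of] rhom_add[OF rhom_sym_act])
      moreover have "sym_act h (?f (pm_scale c x) I) = C c * sym_act h (?f x I)" for x I c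
        by (simp add: pm_linear_scale[OF pm_linear_form_of] pm_scale_C rhom_mult[OF rhom_sym_act] sym_act_C)
      ultimately show ?thesis
        unfolding pm_linear_def pm_scale_C by (simp add: algebra_simps sum.distrib sum_distrib_left)
    qed
    have "?f (\<rho> h x) J = C (det h) ^ k * (\<Sum>I\<in>Pow {..<n}. EE n (form_coeff h) I J * sym_act h (?f x I))"
    proof (rule pm_linear_eqI[OF pm_linear_comp[OF pm_linear_form_of g.lin] l _ x])
      fix b assume "b \<in> ?A"
      then obtain \<mu> I where b: "b = e (\<mu>, I)" and mI: "\<mu> \<in> monomials n d" "I \<in> ext_basis n j" by auto
      have fb: "?f (Poly_Mapping.single b 1) I' = (if I' = I then Poly_Mapping.single \<mu> 1 else 0)" for I'
        unfolding b using e mI by (intro poly_mapping_eqI) (auto simp: lookup_form_of lookup_single when_def dest: injD)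
      have "(\<Sum>I'\<in>Pow {..<n}. EE n (form_coeff h) I' J * sym_act h (?f (Poly_Mapping.single b 1) I'))
        = (\<Sum>I'\<in>Pow {..<n}. if I' = I then EE n (form_coeff h) I J * sym_act h (Poly_Mapping.single \<mu> 1) else 0)"
        unfolding fb by (intro sum.cong) (auto simp: rhom_0[OF rhom_sym_act])
      also have "\<dots> = EE n (form_coeff h) I J * sym_act h (Poly_Mapping.single \<mu> 1)"
        using mI by (simp add: ext_basis_def)
      finally show "?f (\<rho> h (Poly_Mapping.single b 1)) J
        = C (det h) ^ k * (\<Sum>I'\<in>Pow {..<n}. EE n (form_coeff h) I' J * sym_act h (?f (Poly_Mapping.single b 1) I'))"
        unfolding b using eq[OF h mI] by simp
    qed
    then show "?f (\<rho> h x) J = sm (C (det h) ^ k) (gact n h (?f x)) J" by (simp only: sm_def gact_expand)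
  qed
  have K: "x \<in> g.K \<longleftrightarrow> ?f x \<in> Kf n k d j" if x: "x \<in> basis_space ?A" for x
  proof -
    have F: "?f x \<in> Fsup n j" "?f x J \<in> HP n d" for J
      using bij_betw_apply[OF bij x] by auto
    have b: "\<rho> b x = x \<longleftrightarrow> sm (C (det b) ^ k) (gact n b (?f x)) = ?f x" if "b \<in> Borel n" for b
      unfolding act[OF Borel_GL[OF that] x, symmetric] using inj[OF g.closed[OF Borel_GL[OF that] x] x] by simp
    have t: "g.tau i x = - x \<longleftrightarrow> (\<lambda>J. \<Sum>c\<in>UNIV. sm (C (det (tm n i c)) ^ k) (gact n (tm n i c) (?f x)) J) = - ?f x"
      if i: "Suc i < n" for i
    proof -
      have "?f (- x) = - ?f x" by (auto simp: pm_linear_uminus[OF pm_linear_form_of])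
      moreover have "?f (g.tau i x) = (\<lambda>J. \<Sum>c\<in>UNIV. ?f (\<rho> (tm n i c) x) J)"
        unfolding g.tau_def pm_linear_sum[OF pm_linear_form_of] by (rule ext) simp
      ultimately show ?thesis
        unfolding act[OF tm_GL[OF i] x, symmetric]
        using inj[OF g.closed_tau[OF i x] basis_space_uminus[OF x]] by simp
    qed
    show ?thesis using x F by (simp add: g.K_def g.binv_def Kf_def b t)
  qed
  have "g.K \<subseteq> basis_space ?A" by (auto simp: g.K_def g.binv_def)
  moreover have "Kf n k d j \<subseteq> {\<omega> \<in> Fsup n j. \<forall>J. \<omega> J \<in> HP n d}" by (auto simp: Kf_def)
  moreover have "?f ` g.K = Kf n k d j"
  proof (intro equalityI subsetI)
    fix \<omega> assume w: "\<omega> \<in> Kf n k d j"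
    then have "\<omega> \<in> ?f ` basis_space ?A" using bij_betw_imp_surj_on[OF bij] by (auto simp: Kf_def)
    then show "\<omega> \<in> ?f ` g.K" using K w by blast
  qed (use K \<open>g.K \<subseteq> basis_space ?A\<close> in blast)
  ultimately have "bij_betw ?f g.K (Kf n k d j)" using bij_betw_subset[OF bij] by blast
  then show ?thesis using g.card_K[OF fA] bij_betw_same_card by metis
qed

end

lemma EL_rhom:
  assumes s: "rhom s"
  shows "s (EL n G xs J) = EL n (\<lambda>j l. s (G j l)) xs J"
proof (induction xs arbitrary: J)
  case Nil
  show ?case by (simp add: EL_def ev_def rhom_1[OF s] rhom_0[OF s])
next
  case (Cons x xs)
  have "s (cr l \<omega> J) = cr l (\<lambda>J. s (\<omega> J)) J" for l \<omega>
    by (simp add: cr_def rhom_mult[OF s] rhom_sg[OF s] rhom_0[OF s])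
  then show ?case using Cons.IH by (simp add: EL_def cre_def rhom_sum[OF s] rhom_mult[OF s])
qed

lemma form_of_sym_ext_act:
  fixes g :: "'k::{field,finite} mat"
  assumes g: "g \<in> GL n" and mI: "\<mu> \<in> monomials n d"
  shows "form_of (\<lambda>b. b) n d (sym_ext_act g (Poly_Mapping.single (\<mu>, I) 1)) J = EE n (form_coeff g) I J * sym_act g (Poly_Mapping.single \<mu> 1)"
proof -
  have "EE n (form_coeff g) I J = C (EE n (ext_coeff g) I J)"
    unfolding EL_rhom[OF rhom_C] by (simp add: form_coeff_def ext_coeff_def)
  moreover have "sym_act g (Poly_Mapping.single \<mu> 1) \<in> basis_space (monomials n d)"
    by (rule sp.closed[OF g basis_space_single[OF mI]])
  moreover have "dim_row g = n" using GL_carrier[OF g] by auto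
  ultimately show ?thesis
    unfolding pm_scale_C[symmetric] sym_ext_act_def tensor_act_def
    by (intro poly_mapping_eqI)
      (auto simp: lookup_form_of lookup_pm_tensor lookup_pm_scale lookup_ext_act_single basis_space_iff pm_scale_C[symmetric])
qed

lemma form_of_sym_ext_det_act:
  fixes g :: "'k::{field,finite} mat"
  assumes "g \<in> GL n" and "\<mu> \<in> monomials n d"
  shows "form_of (\<lambda>b. (b, ())) n d (tensor_act sym_ext_act (det_act k) g (Poly_Mapping.single ((\<mu>, I), ()) 1)) J
    = C (det g) ^ k * (EE n (form_coeff g) I J * sym_act g (Poly_Mapping.single \<mu> 1))"
  unfolding form_of_sym_ext_act[OF assms, symmetric] C_power[symmetric] pm_scale_C[symmetric]
  by (intro poly_mapping_eqI)
    (auto simp: lookup_form_of lookup_pm_tensor lookup_pm_scale tensor_act_def[of sym_ext_act] det_act_def)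

context prime_power_field
begin

lemma steinberg_mult_sym_ext:
  "steinberg_mult (Suc m) (sym_ext_space (Suc m) d j) (sym_ext_act :: 'k mat \<Rightarrow> _) = mult_St m 0 d j"
proof -
  have "CARD('k) ^ steinberg_mult (Suc m) (basis_space ((\<lambda>b. b) ` (monomials (Suc m) d \<times> ext_basis (Suc m) j))) (sym_ext_act :: 'k mat \<Rightarrow> _)
    = card (Kf (Suc m) 0 d j)"
    by (rule card_Kf_steinberg_mult) (simp_all add: glrep_sym_ext form_of_sym_ext_act inj_def)
  then show ?thesis by (simp add: sym_ext_space_basis card_Kf_mult_St card_power_inject)
qed

lemma steinberg_mult_sym_ext_det:
  assumes "1 \<le> k" "k \<le> CARD('k) - 2"
  shows "steinberg_mult (Suc m) (tensor_space (sym_ext_space (Suc m) d j) det_space)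
    (tensor_act sym_ext_act (det_act k) :: 'k mat \<Rightarrow> _) = mult_St m k d j"
proof -
  have "CARD('k) ^ steinberg_mult (Suc m) (basis_space ((\<lambda>b. (b, ())) ` (monomials (Suc m) d \<times> ext_basis (Suc m) j)))
      (tensor_act sym_ext_act (det_act k) :: 'k mat \<Rightarrow> _) = card (Kf (Suc m) k d j)"
    by (rule card_Kf_steinberg_mult[OF _ glrep_sym_ext_det form_of_sym_ext_det_act]) (simp_all add: inj_def)
  then show ?thesis using assms by (simp add: sym_ext_det_space_basis card_Kf_mult_St card_power_inject)
qed

end

theorem theoremC:
  fixes p r q n :: nat
  assumes "prime p" and "r \<ge> 1" and "q = p ^ r" and "n \<ge> 1"
    and "CARD('k::{field,finite}) = q"
  shows
    "H_St n (sym_ext_space n) (sym_ext_act :: 'k mat \<Rightarrow> _) =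
       tvar powi (- int n) *
       ((svar * tvar ^ (q ^ n - 1) + tvar ^ (q ^ (n - 1))) *
        (\<Prod>i<n - 1. svar + tvar ^ (q ^ i)))
       / (\<Prod>i=1..n. 1 - tvar ^ (q ^ i - 1))
     \<and>
     (\<forall>k. 1 \<le> k \<and> k \<le> q - 2 \<longrightarrow>
       H_St n (\<lambda>i j. tensor_space (sym_ext_space n i j) det_space)
         (tensor_act sym_ext_act (det_act k) :: 'k mat \<Rightarrow> _) =
       tvar powi (- int n + int (q - 1 - k) * int ((q ^ n - 1) div (q - 1))) *
       (\<Prod>i<n. svar + tvar ^ (q ^ i))
       / (\<Prod>i=1..n. 1 - tvar ^ (q ^ i - 1)))"
proof -
  interpret prime_power_field "TYPE('k)" p r using assms by unfold_locales auto
  obtain m where n: "n = Suc m" using assms(4) by (cases n) auto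
  have q: "q = CARD('k)" using assms(5) by simp
  \<comment> \<open>The division is exact by \<open>deg_Lam_mult\<close>, and q - 1 is
    positive.\<close>
  have N: "(q ^ n - 1) div (q - 1) = deg_Lam n"
    using deg_Lam_mult[of n] card_field_gt_1[where 'k='k] unfolding q by (metis nonzero_mult_div_cancel_left zero_less_diff less_numeral_extra(3))
  show ?thesis
  proof (intro conjI allI impI)
    have "H_St n (sym_ext_space n) (sym_ext_act :: 'k mat \<Rightarrow> _) = mult_series m 0"
      unfolding H_St_def mult_series_def n steinberg_mult_sym_ext ..
    then show "H_St n (sym_ext_space n) (sym_ext_act :: 'k mat \<Rightarrow> _) =
       tvar powi (- int n) *
       ((svar * tvar ^ (q ^ n - 1) + tvar ^ (q ^ (n - 1))) *
        (\<Prod>i<n - 1. svar + tvar ^ (q ^ i)))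
       / (\<Prod>i=1..n. 1 - tvar ^ (q ^ i - 1))"
      by (simp only: mult_series_0 n q diff_Suc_1)
    fix k assume k: "1 \<le> k \<and> k \<le> q - 2"
    then have "H_St n (\<lambda>i j. tensor_space (sym_ext_space n i j) det_space)
         (tensor_act sym_ext_act (det_act k) :: 'k mat \<Rightarrow> _) = mult_series m k"
      unfolding H_St_def mult_series_def n q using steinberg_mult_sym_ext_det by simp
    then show "H_St n (\<lambda>i j. tensor_space (sym_ext_space n i j) det_space)
         (tensor_act sym_ext_act (det_act k) :: 'k mat \<Rightarrow> _) =
       tvar powi (- int n + int (q - 1 - k) * int ((q ^ n - 1) div (q - 1))) *
       (\<Prod>i<n. svar + tvar ^ (q ^ i))
       / (\<Prod>i=1..n. 1 - tvar ^ (q ^ i - 1))"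
      using mult_series_twist[of k m] k unfolding N unfolding n q by (simp only: of_nat_mult)
  qed
qed

end
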